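(* Let $(x,y)$ be a standard coordinate system on $\mathbb{R}^2$. Then any closed ideal in $\mathcal{P}_0^3(\mathbb{R}^2)$ is equivalent to one of the ideals in the following list (arranged by number of generators): - 1 generator: $\{0\},\ \langle x\rangle_3,\ \langle x^2\rangle_3,\ \langle x^3\rangle_3,\ \langle xy\rangle_3,\ \langle yx^2\rangle_3,\ \langle xy(x+y)\rangle_3,\ \langle x^2-y^3\rangle_3$; - 2 generators: $\langle x^2,xy\rangle_3,\ \langle x^2,xy^2\rangle_3,\ \langle x^2y,xy^2\rangle_3,\ \langle x^3,x^2y\rangle_3,\ \langle x^2-y^3,xy^2\rangle_3,\ \mathcal{P}_0^3(\mathbb{R}^2)$; - 3 generators: $\langle x^3,x^2y,xy^2\rangle_3$. Moreover, any ideal in this list arises as $I^3(E)$ for some semi-algebraic set $E\subset\mathbb{R}^2$ that contains the origin, and any two different ideals in this list are non-equivalent.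
   Context: Jets (used here with $m=3$, $n=2$). $\mathcal{P}^m(\mathbb{R}^n)$ is the ring of $m$-jets at the origin of $C^m$ real-valued functions on $\mathbb{R}^n$: its elements are identified with real polynomials in $n$ variables of degree at most $m$, and multiplication is polynomial multiplication followed by discarding all monomials of degree $>m$. $\mathcal{P}_0^m(\mathbb{R}^n)\subset\mathcal{P}^m(\mathbb{R}^n)$ is the set of jets vanishing at the origin. For $F\in C^m(\mathbb{R}^n)$, $J^m(F)$ is its $m$-th degree Taylor polynomial at $\vec 0$. An ideal in $\mathcal{P}_0^m(\mathbb{R}^n)$ means an ideal of the ring $\mathcal{P}^m(\mathbb{R}^n)$ contained in $\mathcal{P}_0^m(\mathbb{R}^n)$ (in particular a real linear subspace); $\langle p_1,\dots,p_t\rangle_m$ denotes the ideal of this kind generated by $p_1,\dots,p_t\in\mathcal{P}_0^m(\mathbb{R}^n)$. For $E\subset\mathbb{R}^n$ with $\vec 0\in E$, $$I^m(E):=\{J^m(F) : F\in C^m(\mathbb{R}^n),\ F=0\text{ on }E\}.$$ Equivalence. A $C^m$-diffeomorphism $\phi:\mathbb{R}^n\to\mathbb{R}^n$ fixing the origin induces an automorphism of $\mathcal{P}_0^m(\mathbb{R}^n)$ by $p\mapsto J^m(p\circ\phi)$. Two ideals $I,I'$ in $\mathcal{P}_0^m(\mathbb{R}^n)$ are equivalent if $I'$ is the image of $I$ under such an automorphism. Allowed directions. For $\omega\in S^{n-1}$ and $\delta,r>0$ let $\Gamma(\omega,\delta,r)=\{\vec x\in\mathbb{R}^n: 0<|\vec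 x|<r,\ |\vec x/|\vec x|-\omega|<\delta\}$. A direction $\omega\in S^{n-1}$ is a forbidden direction of an ideal $I\lhd\mathcal{P}_0^m(\mathbb{R}^n)$ if there exist finitely many $p_1,\dots,p_L\in I$ and $c,\delta,r>0$ such that $|p_1(\vec x)|+\dots+|p_L(\vec x)|>c|\vec x|^m$ for all $\vec x\in\Gamma(\omega,\delta,r)$; otherwise it is an allowed direction. $Allow(I)\subset S^{n-1}$ is the set of allowed directions of $I$. Closed ideals. For $K\ge1$, $\rho>0$ let $\mathrm{Ann}_K(\rho)=\{\vec x\in\mathbb{R}^n:\rho/K<|\vec x|<K\rho\}$. The distance from a point to the empty set is $+\infty$. Let $I\lhd\mathcal{P}_0^m(\mathbb{R}^n)$ be an ideal and $\Omega=Allow(I)$. A jet $p\in\mathcal{P}_0^m(\mathbb{R}^n)$ is implied by $I$ if there exist a constant $A>0$ and $Q_1,\dots,Q_L\in I$ such that: for every $\epsilon>0$ there exist $\delta,r>0$ such that for every $0<\rho\le r$ there exist $F,S_1,\dots,S_L\in C^m(\mathrm{Ann}_4(\rho))$ with (i) $|\partial^\alpha F(\vec x)|\le\epsilon\rho^{m-|\alpha|}$ for all $\vec x\in\mathrm{Ann}_4(\rho)$, $|\alpha|\le m$; (ii) $|\partial^\alpha S_l(\vec x)|\le A\rho^{-|\alpha|}$ for all $\vec x\in\mathrm{Ann}_4(\rho)$, $|\alpha|\le m$, $1\le l\le L$; (iii) $p(\vec x)=F(\vec x)+\sum_{l=1}^L S_l(\vec x)Q_l(\vec x)$ for all $\vec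 x\in\mathrm{Ann}_2(\rho)$ with $\mathrm{dist}(\vec x/|\vec x|,\Omega)<\delta$. $I$ is closed (implication-closed) if every jet implied by $I$ belongs to $I$. A set is semi-algebraic if it can be described by finitely many polynomial equations and inequalities and boolean operations. *)

theory Defs
  imports
    "HOL-Analysis.Analysis"
    "HOL-Library.Poly_Mapping"
    "HOL-Algebra.Ideal"
begin

section \<open>Functions of class \<open>C\<^sup>k\<close>\<close>

text \<open>
  For an open subset \<open>S\<close> of a finite-dimensional space this is the usual notion of a \<open>C\<^sup>k\<close> function
  on \<open>S\<close>; it does not depend on the values of \<open>f\<close> outside \<open>S\<close>.
\<close>

primrec Ck_on :: "nat \<Rightarrow> 'a::real_normed_vector set \<Rightarrow> ('a \<Rightarrow> 'b::real_normed_vector) \<Rightarrow> bool" where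
  "Ck_on 0 S f \<longleftrightarrow> continuous_on S f"
| "Ck_on (Suc k) S f \<longleftrightarrow>
     (\<forall>x\<in>S. f differentiable (at x)) \<and> (\<forall>v. Ck_on k S (\<lambda>x. frechet_derivative f (at x) v))"

definition dir_deriv :: "'a::real_normed_vector \<Rightarrow> ('a \<Rightarrow> real) \<Rightarrow> 'a \<Rightarrow> real" where
  "dir_deriv v f = (\<lambda>x. frechet_derivative f (at x) v)"

text \<open>
  The plane is \<^typ>\<open>real \<times> real\<close>, whose norm is the Euclidean one. A multi-index is a pair \<open>(i, j)\<close>
  of natural numbers, of length \<open>i + j\<close>.
\<close>

definition partial :: "nat \<times> nat \<Rightarrow> (real \<times> real \<Rightarrow> real) \<Rightarrow> real \<times> real \<Rightarrow> real" where
  "partial \<alpha> f = (dir_deriv (1, 0) ^^ fst \<alpha>) ((dir_deriv (0, 1) ^^ snd \<alpha>) f)"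

definition diffeo0 :: "nat \<Rightarrow> (real \<times> real \<Rightarrow> real \<times> real) \<Rightarrow> bool" where
  "diffeo0 m \<phi> \<longleftrightarrow>
     bij \<phi> \<and> Ck_on m UNIV \<phi> \<and> Ck_on m UNIV (inv_into UNIV \<phi>) \<and> \<phi> (0, 0) = (0, 0)"

section \<open>Polynomials in two variables and jets\<close>

text \<open>
  A real polynomial in \<open>x\<close> and \<open>y\<close> is a finitely supported function on exponent pairs; the library's
  multiplication on this type is convolution, that is, polynomial multiplication.
\<close>

type_synonym poly2 = "(nat \<times> nat) \<Rightarrow>\<^sub>0 real"

abbreviation X :: poly2 where "X \<equiv> Poly_Mapping.single (1, 0) 1"
abbreviation Y :: poly2 where "Y \<equiv> Poly_Mapping.single (0, 1) 1"

definition peval :: "poly2 \<Rightarrow> real \<times> real \<Rightarrow> real" where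
  "peval p = (\<lambda>(x, y). \<Sum>(i, j)\<in>Poly_Mapping.keys p. Poly_Mapping.lookup p (i, j) * x ^ i * y ^ j)"

definition trunc :: "nat \<Rightarrow> poly2 \<Rightarrow> poly2" where
  "trunc m p = (\<Sum>(i, j) | i + j \<le> m. Poly_Mapping.single (i, j) (Poly_Mapping.lookup p (i, j)))"

definition jets :: "nat \<Rightarrow> poly2 set" where
  "jets m = {p. \<forall>(i, j)\<in>Poly_Mapping.keys p. i + j \<le> m}"

definition jets0 :: "nat \<Rightarrow> poly2 set" where
  "jets0 m = {p \<in> jets m. peval p (0, 0) = 0}"

definition jet_ring :: "nat \<Rightarrow> poly2 ring" where
  "jet_ring m = \<lparr>carrier = jets m, mult = (\<lambda>p q. trunc m (p * q)), one = 1, zero = 0, add = (+)\<rparr>"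

definition taylor :: "nat \<Rightarrow> (real \<times> real \<Rightarrow> real) \<Rightarrow> poly2" where
  "taylor m F =
     (\<Sum>(i, j) | i + j \<le> m. Poly_Mapping.single (i, j) (partial (i, j) F (0, 0) / (fact i * fact j)))"

definition jet_ideal0 :: "nat \<Rightarrow> poly2 set \<Rightarrow> bool" where
  "jet_ideal0 m I \<longleftrightarrow> ideal I (jet_ring m) \<and> I \<subseteq> jets0 m"

definition gen_ideal :: "nat \<Rightarrow> poly2 set \<Rightarrow> poly2 set" where
  "gen_ideal m P = genideal (jet_ring m) P"

definition vanishing_ideal :: "nat \<Rightarrow> (real \<times> real) set \<Rightarrow> poly2 set" where
  "vanishing_ideal m E = {taylor m F | F. Ck_on m UNIV F \<and> (\<forall>z\<in>E. F z = 0)}"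

definition equivalent_ideals :: "nat \<Rightarrow> poly2 set \<Rightarrow> poly2 set \<Rightarrow> bool" where
  "equivalent_ideals m I I' \<longleftrightarrow>
     (\<exists>\<phi>. diffeo0 m \<phi> \<and> I' = (\<lambda>p. taylor m (peval p \<circ> \<phi>)) ` I)"

section \<open>Allowed directions and closed ideals\<close>

definition cone_nbhd :: "real \<times> real \<Rightarrow> real \<Rightarrow> real \<Rightarrow> (real \<times> real) set" where
  "cone_nbhd \<omega> \<delta> r = {z. 0 < norm z \<and> norm z < r \<and> norm (z /\<^sub>R norm z - \<omega>) < \<delta>}"

definition forbidden_direction :: "nat \<Rightarrow> poly2 set \<Rightarrow> real \<times> real \<Rightarrow> bool" where
  "forbidden_direction m I \<omega> \<longleftrightarrow>
     (\<exists>ps c \<delta> r. set ps \<subseteq> I \<and> c > 0 \<and> \<delta> > 0 \<and> r > 0 \<and>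
        (\<forall>z\<in>cone_nbhd \<omega> \<delta> r. (\<Sum>p\<leftarrow>ps. \<bar>peval p z\<bar>) > c * norm z ^ m))"

definition Allow :: "nat \<Rightarrow> poly2 set \<Rightarrow> (real \<times> real) set" where
  "Allow m I = {\<omega> \<in> sphere (0, 0) 1. \<not> forbidden_direction m I \<omega>}"

definition Ann :: "real \<Rightarrow> real \<Rightarrow> (real \<times> real) set" where
  "Ann K \<rho> = {z. \<rho> / K < norm z \<and> norm z < K * \<rho>}"

text \<open>
  The conjunct \<open>Allow m I \<noteq> {}\<close> encodes the convention that the distance to the empty set is infinite;
  the library defines \<^term>\<open>infdist z {} = 0\<close>.
\<close>

definition implied_jet :: "nat \<Rightarrow> poly2 set \<Rightarrow> poly2 \<Rightarrow> bool" where
  "implied_jet m I p \<longleftrightarrow>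
     (\<exists>A Qs. A > 0 \<and> set Qs \<subseteq> I \<and>
       (\<forall>\<epsilon>>0. \<exists>\<delta> r. \<delta> > 0 \<and> r > 0 \<and>
         (\<forall>\<rho>. 0 < \<rho> \<and> \<rho> \<le> r \<longrightarrow>
           (\<exists>F S.
              Ck_on m (Ann 4 \<rho>) F \<and> (\<forall>l<length Qs. Ck_on m (Ann 4 \<rho>) (S l)) \<and>
              (\<forall>z\<in>Ann 4 \<rho>. \<forall>i j. i + j \<le> m \<longrightarrow>
                 \<bar>partial (i, j) F z\<bar> \<le> \<epsilon> * \<rho> ^ (m - (i + j))) \<and>
              (\<forall>l<length Qs. \<forall>z\<in>Ann 4 \<rho>. \<forall>i j. i + j \<le> m \<longrightarrow>
                 \<bar>partial (i, j) (S l) z\<bar> \<le> A / \<rho> ^ (i + j)) \<and>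
              (\<forall>z\<in>Ann 2 \<rho>. Allow m I \<noteq> {} \<and> infdist (z /\<^sub>R norm z) (Allow m I) < \<delta> \<longrightarrow>
                 peval p z = F z + (\<Sum>l<length Qs. S l z * peval (Qs ! l) z))))))"

definition closed_ideal :: "nat \<Rightarrow> poly2 set \<Rightarrow> bool" where
  "closed_ideal m I \<longleftrightarrow> jet_ideal0 m I \<and> (\<forall>p\<in>jets0 m. implied_jet m I p \<longrightarrow> p \<in> I)"

section \<open>Semi-algebraic sets\<close>

inductive semialgebraic :: "(real \<times> real) set \<Rightarrow> bool" where
  zero_set: "semialgebraic {z. peval p z = 0}"
| pos_set: "semialgebraic {z. peval p z > 0}"
| Compl: "semialgebraic A \<Longrightarrow> semialgebraic (- A)"
| Un: "semialgebraic A \<Longrightarrow> semialgebraic B \<Longrightarrow> semialgebraic (A \<union> B)"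
| Int: "semialgebraic A \<Longrightarrow> semialgebraic B \<Longrightarrow> semialgebraic (A \<inter> B)"

section \<open>The list of ideals\<close>

definition ideal_list :: "poly2 set list" where
  "ideal_list =
    [{0},
     gen_ideal 3 {X},
     gen_ideal 3 {X^2},
     gen_ideal 3 {X^3},
     gen_ideal 3 {X * Y},
     gen_ideal 3 {Y * X^2},
     gen_ideal 3 {X * Y * (X + Y)},
     gen_ideal 3 {X^2 - Y^3},
     gen_ideal 3 {X^2, X * Y},
     gen_ideal 3 {X^2, X * Y^2},
     gen_ideal 3 {X^2 * Y, X * Y^2},
     gen_ideal 3 {X^3, X^2 * Y},
     gen_ideal 3 {X^2 - Y^3, X * Y^2},
     jets0 3,
     gen_ideal 3 {X^3, X^2 * Y, X * Y^2}]"

end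

theory Submission
  imports Defs
begin

text \<open>
  Two consequences of closedness drive the classification. A closed ideal without allowed directions
  contains every jet that vanishes at the origin. And if \<open>w u\<close> is in \<open>I\<close>, where \<open>w\<close> is homogeneous and
  nonzero in the allowed directions, then \<open>h u\<close> is in \<open>I\<close> for every \<open>h\<close> homogeneous of the same
  degree, because \<open>h / w\<close> is homogeneous of degree \<open>0\<close> and so is an admissible multiplier at all
  scales. The cases are distinguished by the lowest-degree parts of the jets in \<open>I\<close>, and linear maps
  and shears \<open>(x + a y\<^sup>2 + b y\<^sup>3, y)\<close> suffice as changes of coordinates.

  The ideals are realized on unions of branches of algebraic curves. A jet belongs to \<open>I\<^sup>3(E)\<close> only if
  its expansion along each branch is flat, which gives linear conditions on its coefficients; two
  branches with the same tangent give further conditions through Rolle's theorem. The ideals are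
  inequivalent because they differ in properties expressible in the ring of jets, such as containing
  the square of a jet with nonzero linear part.
\<close>

section \<open>Functions of class \<open>C\<^sup>k\<close>\<close>

text \<open>Closedness is a condition on \<open>I\<close> itself, and its consequences are carried
  to images of \<open>I\<close> in two different ways. The absence of allowed directions survives
  every diffeomorphism, because it amounts to a lower bound on a full punctured disc. The exchange
  of w for h is transported along linear maps only: they preserve homogeneity and substitute into a
  cubic jet without truncation. Hence linear changes (\<open>lin_eqv\<close>) come first and shears
  only after the last exchange. Jets are handled through the estimate o(|z|^m): a polynomial of
  degree at most m is the Taylor polynomial of a C^m function exactly when their difference is
  o(|z|^m). Products and compositions of jets then need neither a Leibniz formula nor a chain rule
  of higher order. The sets realizing the ideals are chosen so that the generators agree on them
  with C^3 functions that are o(|z|^3); the exponent 7/2 and the function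
  \<open>t ^ 3 * \<bar>t\<bar>\<close> arise in this way.\<close>

lemma Ck_on_cong:
  assumes "open S" "\<And>x. x \<in> S \<Longrightarrow> f x = g x" "Ck_on k S f"
  shows "Ck_on k S g"
  using assms(2,3)
proof (induction k arbitrary: f g)
  case 0
  then show ?case by (simp cong: continuous_on_cong)
next
  case (Suc k)
  have d: "(f has_derivative frechet_derivative f (at x)) (at x)" if "x \<in> S" for x
    using Suc.prems(2) that by (simp add: frechet_derivative_works)
  have dg: "(g has_derivative frechet_derivative f (at x)) (at x)" if "x \<in> S" for x
    using has_derivative_transform_within_open[OF d[OF that] assms(1) that] Suc.prems(1) by auto
  have e: "frechet_derivative f (at x) = frechet_derivative g (at x)" if "x \<in> S" for x
    using dg[OF that] frechet_derivative_at by blast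
  have "Ck_on k S (\<lambda>x. frechet_derivative g (at x) v)" for v
    by (rule Suc.IH[of "\<lambda>x. frechet_derivative f (at x) v"]) (use Suc.prems(2) e in auto)
  then show ?case using dg by (auto simp: differentiable_def)
qed

text \<open>The recursion in \<open>Ck_on\<close> speaks of the chosen
  \<open>frechet_derivative\<close>. By uniqueness of derivatives any explicit \<open>D\<close> may
  stand in for it, and the closure rules below rest on this form.\<close>

lemma Ck_on_SucI:
  assumes "open S" "\<And>x. x \<in> S \<Longrightarrow> (f has_derivative D x) (at x)" "\<And>v. Ck_on k S (\<lambda>x. D x v)"
  shows "Ck_on (Suc k) S f"
proof -
  have "Ck_on k S (\<lambda>x. frechet_derivative f (at x) v)" for v
  proof (rule Ck_on_cong[OF assms(1) _ assms(3)[of v]])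
    fix x assume "x \<in> S"
    then have "D x = frechet_derivative f (at x)" by (intro frechet_derivative_at assms)
    then show "D x v = frechet_derivative f (at x) v" by simp
  qed
  then show ?thesis using assms(2) by (auto simp: differentiable_def)
qed

lemma Ck_on_SucD:
  assumes "Ck_on (Suc k) S f" "x \<in> S"
  shows "(f has_derivative frechet_derivative f (at x)) (at x)"
  using assms by (simp add: frechet_derivative_works)

lemma Ck_on_Suc_differentiable: "Ck_on (Suc k) S f \<Longrightarrow> x \<in> S \<Longrightarrow> f differentiable (at x)"
  by simp

lemma Ck_on_Suc_imp: "Ck_on (Suc k) S f \<Longrightarrow> Ck_on k S f"
proof (induction k arbitrary: f)
  case 0
  then show ?case
    by (auto intro!: continuous_at_imp_continuous_on differentiable_imp_continuous_within)
next
  case (Suc k)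
  then show ?case using Ck_on.simps(2) by metis
qed

lemma Ck_on_le: "Ck_on k S f \<Longrightarrow> j \<le> k \<Longrightarrow> Ck_on j S f"
proof (induction k)
  case (Suc k)
  then show ?case using Ck_on_Suc_imp by (cases "j = Suc k") auto
qed simp

lemma Ck_on_imp_continuous: "Ck_on k S f \<Longrightarrow> continuous_on S f"
  using Ck_on_le[of k S f 0] by simp

lemma Ck_on_subset: "Ck_on k S f \<Longrightarrow> T \<subseteq> S \<Longrightarrow> Ck_on k T f"
  by (induction k arbitrary: f) (auto intro: continuous_on_subset)

lemma Ck_on_const [simp]: "Ck_on k S (\<lambda>x. c)"
  by (induction k arbitrary: c) simp_all

lemma Ck_on_bounded_linear:
  assumes "bounded_linear f" "open S"
  shows "Ck_on k S f"
proof (cases k)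
  case 0
  then show ?thesis using assms by (simp add: linear_continuous_on)
next
  case (Suc j)
  show ?thesis unfolding Suc
    by (rule Ck_on_SucI[where D="\<lambda>_. f"])
       (use assms bounded_linear_imp_has_derivative in auto)
qed

lemma Ck_on_add:
  assumes "open S" "Ck_on k S f" "Ck_on k S g"
  shows "Ck_on k S (\<lambda>x. f x + g x)"
  using assms(2,3)
proof (induction k arbitrary: f g)
  case 0
  then show ?case by (simp add: continuous_on_add)
next
  case (Suc k)
  show ?case
    by (rule Ck_on_SucI[OF assms(1) has_derivative_add[OF Ck_on_SucD Ck_on_SucD]])
       (use Suc in auto)
qed

lemma (in bounded_bilinear) Ck_on_prod:
  assumes "open S" "Ck_on k S f" "Ck_on k S g"
  shows "Ck_on k S (\<lambda>x. prod (f x) (g x))"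
  using assms(2,3)
proof (induction k arbitrary: f g)
  case 0
  then show ?case by (simp add: continuous_on)
next
  case (Suc k)
  show ?case
    by (rule Ck_on_SucI[OF assms(1) FDERIV[OF Ck_on_SucD Ck_on_SucD]])
       (use Suc Ck_on_Suc_imp[OF Suc.prems(1)] Ck_on_Suc_imp[OF Suc.prems(2)] in
         \<open>auto intro!: Ck_on_add assms(1)\<close>)
qed

lemmas Ck_on_mult = bounded_bilinear.Ck_on_prod[OF bounded_bilinear_mult]
lemmas Ck_on_scaleR = bounded_bilinear.Ck_on_prod[OF bounded_bilinear_scaleR]

lemma Ck_on_cmult:
  fixes f :: "'a::real_normed_vector \<Rightarrow> real"
  shows "open S \<Longrightarrow> Ck_on k S f \<Longrightarrow> Ck_on k S (\<lambda>x. c * f x)"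
  by (intro Ck_on_mult Ck_on_const)

lemma Ck_on_uminus:
  fixes f :: "'a::real_normed_vector \<Rightarrow> real"
  shows "open S \<Longrightarrow> Ck_on k S f \<Longrightarrow> Ck_on k S (\<lambda>x. - f x)"
  using Ck_on_cmult[of S k f "-1"] by simp

lemma Ck_on_diff:
  fixes f :: "'a::real_normed_vector \<Rightarrow> real"
  shows "open S \<Longrightarrow> Ck_on k S f \<Longrightarrow> Ck_on k S g \<Longrightarrow> Ck_on k S (\<lambda>x. f x - g x)"
  using Ck_on_add[OF _ _ Ck_on_uminus, of S k f g] by simp

lemma Ck_on_sum:
  assumes "open S" "\<And>i. i \<in> A \<Longrightarrow> Ck_on k S (f i)"
  shows "Ck_on k S (\<lambda>x. \<Sum>i\<in>A. f i x)"
  using assms(2) by (induction A rule: infinite_finite_induct) (auto intro!: Ck_on_add assms(1))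

lemma Ck_on_power:
  fixes f :: "'a::real_normed_vector \<Rightarrow> real"
  shows "open S \<Longrightarrow> Ck_on k S f \<Longrightarrow> Ck_on k S (\<lambda>x. f x ^ n)"
  by (induction n) (auto intro: Ck_on_mult)

lemma Ck_on_inverse:
  fixes f :: "'a::real_normed_vector \<Rightarrow> real"
  assumes "open S" "Ck_on k S f" "\<And>x. x \<in> S \<Longrightarrow> f x \<noteq> 0"
  shows "Ck_on k S (\<lambda>x. inverse (f x))"
  using assms(2)
proof (induction k)
  case 0
  then show ?case using assms(3) by (simp add: continuous_on_inverse)
next
  case (Suc k)
  have i: "Ck_on k S (\<lambda>x. inverse (f x))" using Suc Ck_on_Suc_imp by blast
  show ?case
  proof (rule Ck_on_SucI[OF assms(1)])
    show "((\<lambda>x. inverse (f x)) has_derivative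
        (\<lambda>v. - (inverse (f x) * frechet_derivative f (at x) v * inverse (f x)))) (at x)" if "x \<in> S" for x
      by (rule Deriv.has_derivative_inverse[OF assms(3)[OF that] Ck_on_SucD[OF Suc.prems that]])
    show "Ck_on k S (\<lambda>x. - (inverse (f x) * frechet_derivative f (at x) v * inverse (f x)))" for v
      using Suc.prems i by (intro Ck_on_mult Ck_on_uminus assms(1)) auto
  qed
qed

lemma Ck_on_divide:
  fixes f :: "'a::real_normed_vector \<Rightarrow> real"
  assumes "open S" "Ck_on k S f" "Ck_on k S g" "\<And>x. x \<in> S \<Longrightarrow> g x \<noteq> 0"
  shows "Ck_on k S (\<lambda>x. f x / g x)"
  using Ck_on_mult[OF assms(1,2) Ck_on_inverse[OF assms(1,3,4)]] by (simp add: divide_inverse)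

text \<open>The chain rule differentiates \<open>f\<close> in the direction
  \<open>frechet_derivative g (at x) v\<close>, which moves with \<open>x\<close>, while
  \<open>Ck_on\<close> knows fixed directions only. Expanding that vector in \<open>Basis\<close>
  leaves scalars times derivatives of \<open>f\<close> in fixed directions, to which the induction
  hypothesis applies.\<close>

lemma Ck_on_compose:
  fixes f :: "'c::euclidean_space \<Rightarrow> 'b::real_normed_vector"
    and g :: "'a::real_normed_vector \<Rightarrow> 'c"
  assumes "open S" "open T" "Ck_on k T f" "Ck_on k S g" "g ` S \<subseteq> T"
  shows "Ck_on k S (\<lambda>x. f (g x))"
  using assms(3,4)
proof (induction k arbitrary: f)
  case 0
  then show ?case using continuous_on_compose2 assms(5) by auto
next
  case (Suc k)
  let ?f = "\<lambda>b x. frechet_derivative f (at x) b" and ?g = "\<lambda>x. frechet_derivative g (at x)"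
  have g: "Ck_on k S g" using Suc.prems(2) Ck_on_Suc_imp by blast
  have f: "Ck_on k S (\<lambda>x. ?f b (g x))" for b by (rule Suc.IH) (use Suc.prems(1) g in auto)
  have D: "((\<lambda>x. f (g x)) has_derivative (\<lambda>v. \<Sum>b\<in>Basis. (?g x v \<bullet> b) *\<^sub>R ?f b (g x))) (at x)"
    if "x \<in> S" for x
  proof -
    have gx: "g x \<in> T" using that assms(5) by auto
    have df: "(f has_derivative frechet_derivative f (at (g x))) (at (g x))"
      using Ck_on_SucD[OF Suc.prems(1) gx] .
    have c: "((\<lambda>x. f (g x)) has_derivative (\<lambda>v. frechet_derivative f (at (g x)) (?g x v))) (at x)"
      using has_derivative_compose[OF Ck_on_SucD[OF Suc.prems(2) that] df] .
    have s: "frechet_derivative f (at (g x)) w = (\<Sum>b\<in>Basis. (w \<bullet> b) *\<^sub>R ?f b (g x))" for w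
    proof -
      have l: "linear (frechet_derivative f (at (g x)))"
        using df has_derivative_linear by blast
      have "frechet_derivative f (at (g x)) w =
          frechet_derivative f (at (g x)) (\<Sum>b\<in>Basis. (w \<bullet> b) *\<^sub>R b)"
        by (simp add: euclidean_representation)
      then show ?thesis by (simp add: linear_sum[OF l] linear_cmul[OF l])
    qed
    show ?thesis by (rule has_derivative_eq_rhs[OF c]) (rule ext, rule s)
  qed
  have gb: "Ck_on k S (\<lambda>x. ?g x v \<bullet> b)" for v b
    by (rule bounded_bilinear.Ck_on_prod[OF bounded_bilinear_inner assms(1)])
       (use Suc.prems(2) in auto)
  show ?case
    by (rule Ck_on_SucI[OF assms(1) D]) (assumption, rule Ck_on_sum[OF assms(1) Ck_on_scaleR[OF assms(1) gb f]])
qed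

lemma Ck_on_Pair:
  fixes f :: "'a::real_normed_vector \<Rightarrow> real" and g :: "'a \<Rightarrow> real"
  assumes "open S" "Ck_on k S f" "Ck_on k S g"
  shows "Ck_on k S (\<lambda>x. (f x, g x))"
proof -
  have "Ck_on k S (\<lambda>x. f x *\<^sub>R (1::real, 0::real) + g x *\<^sub>R (0::real, 1::real))"
    by (intro Ck_on_add Ck_on_scaleR Ck_on_const assms)
  then show ?thesis by simp
qed

lemma Ck_on_fst: "Ck_on k UNIV (fst :: real \<times> real \<Rightarrow> real)"
  by (rule Ck_on_bounded_linear) (simp_all add: bounded_linear_fst)

lemma Ck_on_snd: "Ck_on k UNIV (snd :: real \<times> real \<Rightarrow> real)"
  by (rule Ck_on_bounded_linear) (simp_all add: bounded_linear_snd)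

lemma Ck_on_ident: "open S \<Longrightarrow> Ck_on k S (\<lambda>x. x)"
  by (rule Ck_on_bounded_linear) simp_all

lemmas Ck_on_intros = Ck_on_const Ck_on_add Ck_on_mult Ck_on_diff Ck_on_uminus Ck_on_power
  Ck_on_fst Ck_on_snd

section \<open>Partial derivatives and Taylor polynomials\<close>

abbreviation Dx :: "(real \<times> real \<Rightarrow> real) \<Rightarrow> real \<times> real \<Rightarrow> real" where
  "Dx \<equiv> dir_deriv (1, 0)"
abbreviation Dy :: "(real \<times> real \<Rightarrow> real) \<Rightarrow> real \<times> real \<Rightarrow> real" where
  "Dy \<equiv> dir_deriv (0, 1)"

lemma Ck_on_dir_deriv: "Ck_on (Suc k) S f \<Longrightarrow> Ck_on k S (dir_deriv v f)"
  by (simp add: dir_deriv_def)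

lemma Ck_on_dir_deriv_funpow: "Ck_on (k + n) S f \<Longrightarrow> Ck_on k S ((dir_deriv v ^^ n) f)"
proof (induction n arbitrary: k)
  case (Suc n)
  then show ?case using Ck_on_dir_deriv[of k S "(dir_deriv v ^^ n) f" v] by (metis add_Suc_shift funpow.simps(2) comp_apply)
qed simp

lemma Ck_on_partial: "Ck_on (k + (i + j)) S f \<Longrightarrow> Ck_on k S (partial (i, j) f)"
  unfolding partial_def by (auto intro!: Ck_on_dir_deriv_funpow simp: ac_simps)

lemma dir_deriv_eqI: "(f has_derivative D) (at x) \<Longrightarrow> dir_deriv v f x = D v"
  using frechet_derivative_at unfolding dir_deriv_def by metis

text \<open>The form \<open>c * f + g\<close> covers sums, multiples and, with
  \<open>c = -1\<close>, differences at once.\<close>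

lemma dir_deriv_cmult_add:
  assumes "Ck_on (Suc k) UNIV f" "Ck_on (Suc k) UNIV g"
  shows "dir_deriv v (\<lambda>z. c * f z + g z) = (\<lambda>z. c * dir_deriv v f z + dir_deriv v g z)"
proof
  fix x
  have "((\<lambda>z. c * f z + g z) has_derivative
      (\<lambda>v. c * frechet_derivative f (at x) v + frechet_derivative g (at x) v)) (at x)"
    by (intro has_derivative_add has_derivative_mult_right Ck_on_SucD[OF assms(1)]
        Ck_on_SucD[OF assms(2)] UNIV_I)
  then show "dir_deriv v (\<lambda>z. c * f z + g z) x = c * dir_deriv v f x + dir_deriv v g x"
    by (auto dest!: dir_deriv_eqI simp: dir_deriv_def)
qed

lemma dir_deriv_funpow_cmult_add:
  fixes f g :: "'a::real_normed_vector \<Rightarrow> real"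
  assumes "Ck_on n UNIV f" "Ck_on n UNIV g"
  shows "(dir_deriv v ^^ n) (\<lambda>z. c * f z + g z) =
    (\<lambda>z. c * (dir_deriv v ^^ n) f z + (dir_deriv v ^^ n) g z)"
  using assms
proof (induction n)
  case (Suc n)
  have "Ck_on n UNIV f" "Ck_on n UNIV g" using Suc.prems Ck_on_Suc_imp by blast+
  then have "(dir_deriv v ^^ Suc n) (\<lambda>z. c * f z + g z) =
      dir_deriv v (\<lambda>z. c * (dir_deriv v ^^ n) f z + (dir_deriv v ^^ n) g z)"
    using Suc.IH by simp
  also have "\<dots> = (\<lambda>z. c * (dir_deriv v ^^ Suc n) f z + (dir_deriv v ^^ Suc n) g z)"
    using dir_deriv_cmult_add[of 0 "(dir_deriv v ^^ n) f" "(dir_deriv v ^^ n) g" v c]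
      Ck_on_dir_deriv_funpow[of "Suc 0" n UNIV f v] Ck_on_dir_deriv_funpow[of "Suc 0" n UNIV g v] Suc.prems
    by (simp del: Ck_on.simps)
  finally show ?case .
qed simp

lemma partial_cmult_add:
  assumes "Ck_on m UNIV f" "Ck_on m UNIV g" "i + j \<le> m"
  shows "partial (i, j) (\<lambda>z. c * f z + g z) = (\<lambda>z. c * partial (i, j) f z + partial (i, j) g z)"
proof -
  have c: "Ck_on (i + j) UNIV f" "Ck_on (i + j) UNIV g" "Ck_on j UNIV f" "Ck_on j UNIV g"
    using assms Ck_on_le[of m _ _ "i + j"] Ck_on_le[of m _ _ j] by auto
  show ?thesis
    using dir_deriv_funpow_cmult_add[OF Ck_on_dir_deriv_funpow[OF c(1)]
        Ck_on_dir_deriv_funpow[OF c(2)]] dir_deriv_funpow_cmult_add[OF c(3,4)]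
    by (simp add: partial_def)
qed

lemma partial_zero [simp]: "partial (i, j) (\<lambda>z. 0) = (\<lambda>z. 0)"
proof -
  have "(dir_deriv v ^^ n) (\<lambda>z. 0) = (\<lambda>z. 0)" for v :: "real \<times> real" and n
    by (induction n) (simp_all add: dir_deriv_def)
  then show ?thesis by (simp add: partial_def)
qed

lemma partial_sum:
  assumes "\<And>a. a \<in> A \<Longrightarrow> Ck_on m UNIV (f a)" "i + j \<le> m"
  shows "partial (i, j) (\<lambda>z. \<Sum>a\<in>A. c a * f a z) = (\<lambda>z. \<Sum>a\<in>A. c a * partial (i, j) (f a) z)"
  using assms(1)
proof (induction A rule: infinite_finite_induct)
  case (insert a A)
  have "Ck_on m UNIV (\<lambda>z. \<Sum>a\<in>A. c a * f a z)"
    using insert.prems by (intro Ck_on_sum Ck_on_cmult) auto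
  with insert show ?case using partial_cmult_add[OF _ _ assms(2), of "f a" _ "c a"] by simp
qed auto

section \<open>Mean value theorem along segments parallel to the axes\<close>

lemma mvt_dir:
  fixes F :: "'a::real_normed_vector \<Rightarrow> real"
  assumes "\<And>x. F differentiable (at x)"
  shows "\<exists>\<theta>\<in>{0<..<1}. F (z + v) - F z = dir_deriv v F (z + \<theta> *\<^sub>R v)"
proof -
  let ?g = "\<lambda>t. F (z + t *\<^sub>R v)"
  have d: "(?g has_real_derivative dir_deriv v F (z + t *\<^sub>R v)) (at t)" for t
  proof -
    have F: "(F has_derivative frechet_derivative F (at (z + t *\<^sub>R v))) (at (z + t *\<^sub>R v))"
      using assms by (simp add: frechet_derivative_works)
    have "((\<lambda>t. z + t *\<^sub>R v) has_derivative (\<lambda>s. s *\<^sub>R v)) (at t)"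
      by (auto intro!: derivative_eq_intros)
    from has_derivative_compose[OF this F]
    have "(?g has_derivative (\<lambda>s. frechet_derivative F (at (z + t *\<^sub>R v)) (s *\<^sub>R v))) (at t)" .
    moreover have "linear (frechet_derivative F (at (z + t *\<^sub>R v)))"
      using F has_derivative_linear by blast
    ultimately show ?thesis
      by (simp add: has_field_derivative_def linear_cmul dir_deriv_def mult_commute_abs)
  qed
  obtain \<theta> where "\<theta> > 0" "\<theta> < 1" "?g 1 - ?g 0 = (1 - 0) * dir_deriv v F (z + \<theta> *\<^sub>R v)"
    using MVT2[of 0 1 ?g "\<lambda>t. dir_deriv v F (z + t *\<^sub>R v)"] d by auto
  then show ?thesis by auto
qed

lemma dir_deriv_scaleR:
  "F differentiable (at x) \<Longrightarrow> dir_deriv (c *\<^sub>R v) F x = c * dir_deriv v F x"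
  unfolding dir_deriv_def by (simp add: linear_frechet_derivative linear_cmul)

lemma mvt_x:
  assumes "\<And>z. F differentiable (at z)"
  obtains \<theta> where "\<bar>\<theta>\<bar> \<le> \<bar>x\<bar>" "F (x, y) - F (0, y) = x * Dx F (\<theta>, y)"
proof -
  obtain t where t: "t \<in> {0<..<1}" "F ((0, y) + (x, 0)) - F (0, y) = dir_deriv (x, 0) F ((0, y) + t *\<^sub>R (x, 0))"
    using mvt_dir[of F "(0, y)" "(x, 0)"] assms by blast
  have "dir_deriv (x, 0) F z = x * Dx F z" for z
    using dir_deriv_scaleR[OF assms, of x "(1, 0)"] by simp
  moreover have "\<bar>t * x\<bar> \<le> \<bar>x\<bar>" using t(1) by (simp add: abs_mult mult_left_le_one_le)
  ultimately show ?thesis using that[of "t * x"] t by simp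
qed

lemma mvt_y:
  assumes "\<And>z. F differentiable (at z)"
  obtains \<theta> where "\<bar>\<theta>\<bar> \<le> \<bar>y\<bar>" "F (x, y) - F (x, 0) = y * Dy F (x, \<theta>)"
proof -
  obtain t where t: "t \<in> {0<..<1}" "F ((x, 0) + (0, y)) - F (x, 0) = dir_deriv (0, y) F ((x, 0) + t *\<^sub>R (0, y))"
    using mvt_dir[of F "(x, 0)" "(0, y)"] assms by blast
  have "dir_deriv (0, y) F z = y * Dy F z" for z
    using dir_deriv_scaleR[OF assms, of y "(0, 1)"] by simp
  moreover have "\<bar>t * y\<bar> \<le> \<bar>y\<bar>" using t(1) by (simp add: abs_mult mult_left_le_one_le)
  ultimately show ?thesis using that[of "t * y"] t by simp
qed

section \<open>Calculus of functions that are o(|z|^m) at the origin\<close>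

text \<open>The point z = 0 is included, so a flat function vanishes at the origin even for m =
  0.\<close>

definition flat :: "nat \<Rightarrow> (real \<times> real \<Rightarrow> real) \<Rightarrow> bool" where
  "flat m f \<longleftrightarrow> (\<forall>\<epsilon>>0. \<exists>d>0. \<forall>z. norm z < d \<longrightarrow> \<bar>f z\<bar> \<le> \<epsilon> * norm z ^ m)"

lemma norm_pair_mono:
  fixes x y a b :: real
  shows "\<bar>x\<bar> \<le> \<bar>a\<bar> \<Longrightarrow> \<bar>y\<bar> \<le> \<bar>b\<bar> \<Longrightarrow> norm (x, y) \<le> norm (a, b)"
  by (simp add: norm_Pair power2_eq_square[symmetric] abs_le_square_iff add_mono)

lemma abs_le_norm_pair: "\<bar>x\<bar> \<le> norm (x, y::real)" "\<bar>y\<bar> \<le> norm (x::real, y)"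
  using norm_fst_le[of x y] norm_snd_le[of y x] by auto

text \<open>Induction on m: by the mean value theorem a bound o(|x|^m) for \<open>Dx F\<close> on
  the axis gains one power of |x| for \<open>F\<close>.\<close>

lemma flat_x_axis:
  assumes "Ck_on m UNIV F" "\<And>i. i \<le> m \<Longrightarrow> (Dx ^^ i) F 0 = 0"
  shows "\<forall>\<epsilon>>0. \<exists>d>0. \<forall>x. \<bar>x\<bar> < d \<longrightarrow> \<bar>F (x, 0)\<bar> \<le> \<epsilon> * \<bar>x\<bar> ^ m"
  using assms
proof (induction m arbitrary: F)
  case 0
  have c: "continuous (at 0) F"
    using 0(1) continuous_on_eq_continuous_at[OF open_UNIV] by (metis Ck_on.simps(1) UNIV_I)
  show ?case
  proof (intro allI impI)
    fix e :: real assume "e > 0"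
    then obtain d where d: "d > 0" "\<And>z. dist z 0 < d \<Longrightarrow> dist (F z) (F 0) < e"
      using c unfolding continuous_at_eps_delta by blast
    have "F 0 = 0" using 0(2)[of 0] by simp
    then have "\<bar>F (x, 0)\<bar> \<le> e" if "\<bar>x\<bar> < d" for x
      using d(2)[of "(x, 0)"] that by (simp add: zero_prod_def dist_Pair_Pair)
    then show "\<exists>d>0. \<forall>x. \<bar>x\<bar> < d \<longrightarrow> \<bar>F (x, 0)\<bar> \<le> e * \<bar>x\<bar> ^ 0" using d(1) by auto
  qed
next
  case (Suc m)
  have ih: "\<forall>\<epsilon>>0. \<exists>d>0. \<forall>x. \<bar>x\<bar> < d \<longrightarrow> \<bar>Dx F (x, 0)\<bar> \<le> \<epsilon> * \<bar>x\<bar> ^ m"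
    using Suc.prems(2)[of "Suc i" for i]
    by (intro Suc.IH Ck_on_dir_deriv Suc.prems) (simp add: funpow_Suc_right del: funpow.simps)
  show ?case
  proof (intro allI impI)
    fix e :: real assume "e > 0"
    then obtain d where d: "d > 0" "\<And>x. \<bar>x\<bar> < d \<Longrightarrow> \<bar>Dx F (x, 0)\<bar> \<le> e * \<bar>x\<bar> ^ m"
      using ih by blast
    have "\<bar>F (x, 0)\<bar> \<le> e * \<bar>x\<bar> ^ Suc m" if x: "\<bar>x\<bar> < d" for x
    proof -
      have "\<And>z. F differentiable (at z)"
        using Ck_on_Suc_differentiable[OF Suc.prems(1)] by simp
      then obtain t where t: "\<bar>t\<bar> \<le> \<bar>x\<bar>" "F (x, 0) - F (0, 0) = x * Dx F (t, 0)"
        using mvt_x[of F x 0] by blast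
      have "F (0, 0) = 0" using Suc.prems(2)[of 0] by (simp add: zero_prod_def)
      then have "\<bar>F (x, 0)\<bar> = \<bar>x\<bar> * \<bar>Dx F (t, 0)\<bar>" using t by (simp add: abs_mult)
      also have "\<dots> \<le> \<bar>x\<bar> * (e * \<bar>t\<bar> ^ m)" using d(2)[of t] t x by (intro mult_left_mono) auto
      also have "\<dots> \<le> \<bar>x\<bar> * (e * \<bar>x\<bar> ^ m)"
        using t \<open>e > 0\<close> by (intro mult_left_mono power_mono) auto
      finally show ?thesis by (simp add: ac_simps)
    qed
    then show "\<exists>d>0. \<forall>x. \<bar>x\<bar> < d \<longrightarrow> \<bar>F (x, 0)\<bar> \<le> e * \<bar>x\<bar> ^ Suc m" using d(1) by blast
  qed
qed

lemma partial_Dy: "partial (i, j) (Dy F) = partial (i, Suc j) F"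
  by (simp add: partial_def funpow_Suc_right del: funpow.simps)

text \<open>In \<open>partial\<close> the y-derivatives are applied first, so the partials of
  \<open>Dy F\<close> are partials of \<open>F\<close> and the induction hypothesis applies to
  \<open>Dy F\<close>. The mean value theorem in y then compares a point with its projection to the
  x-axis, where the pure x-derivatives suffice. No exchange of derivatives is involved.\<close>

lemma flat_partials:
  assumes "Ck_on m UNIV F" "\<And>i j. i + j \<le> m \<Longrightarrow> partial (i, j) F 0 = 0"
  shows "flat m F"
  using assms
proof (induction m arbitrary: F)
  case 0
  have c: "continuous (at 0) F"
    using 0(1) continuous_on_eq_continuous_at[OF open_UNIV] by (metis Ck_on.simps(1) UNIV_I)
  have "F 0 = 0" using 0(2)[of 0 0] by (simp add: partial_def)
  then show ?case
    using c unfolding flat_def continuous_at_eps_delta by (auto simp: less_imp_le) (metis less_imp_le)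
next
  case (Suc m)
  have dy: "flat m (Dy F)"
    by (rule Suc.IH[OF Ck_on_dir_deriv[OF Suc.prems(1)]]) (use Suc.prems(2) partial_Dy in auto)
  have x: "\<forall>\<epsilon>>0. \<exists>d>0. \<forall>x. \<bar>x\<bar> < d \<longrightarrow> \<bar>F (x, 0)\<bar> \<le> \<epsilon> * \<bar>x\<bar> ^ Suc m"
    by (rule flat_x_axis[OF Suc.prems(1)]) (use Suc.prems(2)[of _ 0] in \<open>auto simp: partial_def\<close>)
  show ?case unfolding flat_def
  proof (intro allI impI)
    fix e :: real assume "e > 0"
    then have e2: "e / 2 > 0" by simp
    obtain d where d: "d > 0" "\<And>z. norm z < d \<Longrightarrow> \<bar>Dy F z\<bar> \<le> e / 2 * norm z ^ m"
      using dy e2 unfolding flat_def by blast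
    obtain d' where d': "d' > 0" "\<And>x. \<bar>x\<bar> < d' \<Longrightarrow> \<bar>F (x, 0)\<bar> \<le> e / 2 * \<bar>x\<bar> ^ Suc m"
      using x e2 by blast
    have "\<bar>F z\<bar> \<le> e * norm z ^ Suc m" if z: "norm z < min d d'" for z
    proof -
      obtain x y where xy: "z = (x, y)" by fastforce
      have "\<And>z. F differentiable (at z)"
        using Ck_on_Suc_differentiable[OF Suc.prems(1)] by simp
      then obtain t where t: "\<bar>t\<bar> \<le> \<bar>y\<bar>" "F (x, y) - F (x, 0) = y * Dy F (x, t)"
        using mvt_y[of F y x] by blast
      have n: "norm (x, t) \<le> norm z" using t xy norm_pair_mono by blast
      have ax: "\<bar>x\<bar> \<le> norm z" and ay: "\<bar>y\<bar> \<le> norm z" using xy abs_le_norm_pair by auto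
      have "\<bar>y * Dy F (x, t)\<bar> \<le> norm z * (e / 2 * norm (x, t) ^ m)"
        unfolding abs_mult using ay d(2)[of "(x, t)"] n z by (intro mult_mono) auto
      also have "\<dots> \<le> norm z * (e / 2 * norm z ^ m)"
        using n e2 by (intro mult_left_mono power_mono) auto
      finally have 1: "\<bar>y * Dy F (x, t)\<bar> \<le> e / 2 * norm z ^ Suc m" by (simp add: ac_simps)
      have "\<bar>F (x, 0)\<bar> \<le> e / 2 * \<bar>x\<bar> ^ Suc m" using d'(2) ax z by auto
      also have "\<dots> \<le> e / 2 * norm z ^ Suc m" using e2 ax by (intro mult_left_mono power_mono) auto
      finally have 2: "\<bar>F (x, 0)\<bar> \<le> e / 2 * norm z ^ Suc m" .
      have "F z = F (x, 0) + y * Dy F (x, t)" using t(2) xy by simp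
      then have "\<bar>F z\<bar> \<le> \<bar>F (x, 0)\<bar> + \<bar>y * Dy F (x, t)\<bar>" by linarith
      also have "\<dots> \<le> e / 2 * norm z ^ Suc m + e / 2 * norm z ^ Suc m" using 1 2 by (rule add_mono[rotated])
      finally show ?thesis by simp
    qed
    then show "\<exists>d>0. \<forall>z. norm z < d \<longrightarrow> \<bar>F z\<bar> \<le> e * norm z ^ Suc m"
      using d(1) d'(1) by (intro exI[of _ "min d d'"]) auto
  qed
qed

lemma flatD: "flat m f \<Longrightarrow> \<epsilon> > 0 \<Longrightarrow> \<exists>d>0. \<forall>z. norm z < d \<longrightarrow> \<bar>f z\<bar> \<le> \<epsilon> * norm z ^ m"
  unfolding flat_def by blast

lemma flat_add:
  assumes "flat m f" "flat m g"
  shows "flat m (\<lambda>z. f z + g z)"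
  unfolding flat_def
proof (intro allI impI)
  fix e :: real assume "e > 0"
  then have e: "e / 2 > 0" by simp
  obtain d where d: "d > 0" "\<And>z. norm z < d \<Longrightarrow> \<bar>f z\<bar> \<le> e / 2 * norm z ^ m"
    using flatD[OF assms(1) e] by blast
  obtain d' where d': "d' > 0" "\<And>z. norm z < d' \<Longrightarrow> \<bar>g z\<bar> \<le> e / 2 * norm z ^ m"
    using flatD[OF assms(2) e] by blast
  have "\<bar>f z + g z\<bar> \<le> e * norm z ^ m" if "norm z < min d d'" for z
    using d(2)[of z] d'(2)[of z] that by (simp add: field_simps)
  then show "\<exists>d>0. \<forall>z. norm z < d \<longrightarrow> \<bar>f z + g z\<bar> \<le> e * norm z ^ m"
    using d(1) d'(1) by (intro exI[of _ "min d d'"]) auto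
qed

lemma flat_zero [simp]: "flat m (\<lambda>z. 0)"
  unfolding flat_def by (auto intro!: exI[of _ 1])

lemma flat_bounded_mult:
  assumes "flat m f" "d > 0" "\<And>z. norm z < d \<Longrightarrow> \<bar>g z\<bar> \<le> C"
  shows "flat m (\<lambda>z. g z * f z)"
  unfolding flat_def
proof (intro allI impI)
  fix e :: real assume e: "e > 0"
  have C: "C \<ge> 0" using assms(3)[of 0] assms(2) by simp
  \<comment> \<open>Dividing by C + 1 covers the case C = 0 as well.\<close>
  obtain d' where d': "d' > 0" "\<And>z. norm z < d' \<Longrightarrow> \<bar>f z\<bar> \<le> e / (C + 1) * norm z ^ m"
    using flatD[OF assms(1), of "e / (C + 1)"] e C by auto
  have "\<bar>g z * f z\<bar> \<le> e * norm z ^ m" if z: "norm z < min d d'" for z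
  proof -
    have "\<bar>g z * f z\<bar> \<le> C * (e / (C + 1) * norm z ^ m)"
      unfolding abs_mult using assms(3)[of z] d'(2)[of z] z C by (intro mult_mono) auto
    also have "\<dots> \<le> (C + 1) * (e / (C + 1) * norm z ^ m)"
      using C e by (intro mult_right_mono) auto
    also have "\<dots> = e * norm z ^ m" using C by simp
    finally show ?thesis .
  qed
  then show "\<exists>d>0. \<forall>z. norm z < d \<longrightarrow> \<bar>g z * f z\<bar> \<le> e * norm z ^ m"
    using d'(1) assms(2) by (intro exI[of _ "min d d'"]) auto
qed

lemma flat_cmult: "flat m f \<Longrightarrow> flat m (\<lambda>z. c * f z)"
  using flat_bounded_mult[of m f 1 "\<lambda>_. c" "\<bar>c\<bar>"] by simp

lemma flat_uminus: "flat m f \<Longrightarrow> flat m (\<lambda>z. - f z)"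
  using flat_cmult[of m f "-1"] by simp

lemma flat_diff: "flat m f \<Longrightarrow> flat m g \<Longrightarrow> flat m (\<lambda>z. f z - g z)"
  using flat_add[OF _ flat_uminus, of m f g] by simp

lemma flat_sum: "(\<And>a. a \<in> A \<Longrightarrow> flat m (f a)) \<Longrightarrow> flat m (\<lambda>z. \<Sum>a\<in>A. f a z)"
  by (induction A rule: infinite_finite_induct) (auto intro: flat_add)

lemma flat_Suc_bound:
  assumes "d > 0" "\<And>z. norm z < d \<Longrightarrow> \<bar>f z\<bar> \<le> C * norm z ^ Suc m"
  shows "flat m f"
  unfolding flat_def
proof (intro allI impI)
  fix e :: real assume e: "e > 0"
  let ?C = "\<bar>C\<bar> + 1"
  have "\<bar>f z\<bar> \<le> e * norm z ^ m" if z: "norm z < min d (e / ?C)" for z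
  proof -
    have "\<bar>f z\<bar> \<le> C * norm z ^ Suc m" using assms(2) z by simp
    also have "\<dots> \<le> ?C * norm z * norm z ^ m"
      using mult_right_mono[of C ?C "norm z ^ Suc m"] by (simp add: ac_simps)
    also have "\<dots> \<le> e * norm z ^ m"
      using z by (intro mult_right_mono) (auto simp: field_simps)
    finally show ?thesis .
  qed
  then show "\<exists>d>0. \<forall>z. norm z < d \<longrightarrow> \<bar>f z\<bar> \<le> e * norm z ^ m"
    using assms(1) e by (intro exI[of _ "min d (e / ?C)"]) auto
qed

lemma flat_compose:
  assumes "flat m f" "r > 0" "\<And>z. norm z < r \<Longrightarrow> norm (\<phi> z) \<le> C * norm z"
  shows "flat m (\<lambda>z. f (\<phi> z))"
  unfolding flat_def
proof (intro allI impI)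
  fix e :: real assume e: "e > 0"
  let ?C = "\<bar>C\<bar> + 1"
  have C: "norm (\<phi> z) \<le> ?C * norm z" if "norm z < r" for z
    using assms(3)[OF that] mult_right_mono[of C ?C "norm z", OF _ norm_ge_zero] by linarith
  obtain d where d: "d > 0" "\<And>z. norm z < d \<Longrightarrow> \<bar>f z\<bar> \<le> e / ?C ^ m * norm z ^ m"
    using flatD[OF assms(1), of "e / ?C ^ m"] e by auto
  have "\<bar>f (\<phi> z)\<bar> \<le> e * norm z ^ m" if z: "norm z < min r (d / ?C)" for z
  proof -
    have n: "norm (\<phi> z) \<le> ?C * norm z" using C z by simp
    moreover have "?C * norm z < d" using z by (auto simp: field_simps)
    ultimately have "\<bar>f (\<phi> z)\<bar> \<le> e / ?C ^ m * norm (\<phi> z) ^ m" using d(2) by simp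
    also have "\<dots> \<le> e / ?C ^ m * (?C * norm z) ^ m"
      using n e by (intro mult_left_mono power_mono) auto
    also have "\<dots> = e * norm z ^ m"
    proof -
      have "?C \<noteq> 0" by linarith
      then show ?thesis by (simp add: power_mult_distrib)
    qed
    finally show ?thesis .
  qed
  then show "\<exists>d>0. \<forall>z. norm z < d \<longrightarrow> \<bar>f (\<phi> z)\<bar> \<le> e * norm z ^ m"
    using d(1) assms(2) by (intro exI[of _ "min r (d / ?C)"]) auto
qed

text \<open>The bound is one-sided in t so that it fits half-branches of curves. Once the constant
  term is known to vanish, division by t lowers the order by one.\<close>

lemma poly_little_o_imp_coeff_zero:
  fixes q :: "real poly"
  assumes "\<And>\<epsilon>. \<epsilon> > 0 \<Longrightarrow> \<exists>d>0. \<forall>t. 0 < t \<and> t < d \<longrightarrow> \<bar>poly q t\<bar> \<le> \<epsilon> * t ^ n" "k \<le> n"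
  shows "coeff q k = 0"
  using assms
proof (induction n arbitrary: q k)
  have lim: "(poly q \<longlongrightarrow> coeff q 0) (at_right 0)" for q :: "real poly"
    using poly_isCont[of 0 q] unfolding isCont_def poly_0_coeff_0
    by (rule tendsto_within_subset) simp
  have zero: "coeff q 0 = 0"
    if o: "\<And>\<epsilon>. \<epsilon> > 0 \<Longrightarrow> \<exists>d>0. \<forall>t. 0 < t \<and> t < d \<longrightarrow> \<bar>poly q t\<bar> \<le> \<epsilon>" for q :: "real poly"
  proof (rule tendsto_unique[OF _ lim])
    show "(poly q \<longlongrightarrow> 0) (at_right 0)"
      unfolding tendsto_iff
    proof (intro allI impI)
      fix e :: real assume "e > 0"
      then obtain d where "d > 0" "\<And>t. 0 < t \<Longrightarrow> t < d \<Longrightarrow> \<bar>poly q t\<bar> \<le> e / 2"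
        using o[of "e / 2"] by auto
      then show "\<forall>\<^sub>F t in at_right 0. dist (poly q t) 0 < e"
        unfolding eventually_at_right_field using \<open>e > 0\<close> by (intro exI[of _ d]) force
    qed
  qed simp
  {
    case 0
    then show ?case using zero[of q] by simp
  next
    case (Suc n)
    obtain a p where q: "q = pCons a p" by (cases q)
    have a: "a = 0"
    proof -
      have "coeff q 0 = 0"
      proof (rule zero)
        fix e :: real assume "e > 0"
        then obtain d where d: "d > 0" "\<And>t. 0 < t \<Longrightarrow> t < d \<Longrightarrow> \<bar>poly q t\<bar> \<le> e * t ^ Suc n"
          using Suc.prems(1) by blast
        have "\<bar>poly q t\<bar> \<le> e" if "0 < t" "t < min d 1" for t
        proof -
          have "e * t ^ Suc n \<le> e * 1"
            using that \<open>e > 0\<close> by (intro mult_left_mono power_le_one) auto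
          then show ?thesis using d(2)[of t] that by simp
        qed
        then show "\<exists>d>0. \<forall>t. 0 < t \<and> t < d \<longrightarrow> \<bar>poly q t\<bar> \<le> e"
          using d(1) by (intro exI[of _ "min d 1"]) auto
      qed
      then show ?thesis using q by simp
    qed
    have "coeff p k = 0" if "k \<le> n" for k
    proof (rule Suc.IH[OF _ that])
      fix e :: real assume "e > 0"
      then obtain d where d: "d > 0" "\<And>t. 0 < t \<Longrightarrow> t < d \<Longrightarrow> \<bar>poly q t\<bar> \<le> e * t ^ Suc n"
        using Suc.prems(1) by blast
      have "\<bar>poly p t\<bar> \<le> e * t ^ n" if "0 < t" "t < d" for t
        using d(2)[OF that] that a q by (simp add: abs_mult mult.left_commute)
      then show "\<exists>d>0. \<forall>t. 0 < t \<and> t < d \<longrightarrow> \<bar>poly p t\<bar> \<le> e * t ^ n" using d(1) by blast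
    qed
    then show ?case using Suc.prems(2) a q by (cases k) auto
  }
qed

section \<open>Evaluation of polynomials\<close>

abbreviation cf :: "poly2 \<Rightarrow> nat \<times> nat \<Rightarrow> real" where "cf \<equiv> Poly_Mapping.lookup"

abbreviation single2 :: "nat \<Rightarrow> nat \<Rightarrow> real \<Rightarrow> poly2" where
  "single2 i j \<equiv> Poly_Mapping.single (i, j)"

lemma peval_superset:
  assumes "finite A" "Poly_Mapping.keys p \<subseteq> A"
  shows "peval p z = (\<Sum>k\<in>A. cf p k * (fst z ^ fst k * snd z ^ snd k))"
proof -
  obtain x y where z: "z = (x, y)" by fastforce
  have "peval p z = (\<Sum>k\<in>Poly_Mapping.keys p. cf p k * (fst z ^ fst k * snd z ^ snd k))"
    unfolding peval_def z by (simp add: case_prod_beta mult.assoc)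
  also have "\<dots> = (\<Sum>k\<in>A. cf p k * (fst z ^ fst k * snd z ^ snd k))"
    using assms by (intro sum.mono_neutral_left) (auto simp: in_keys_iff)
  finally show ?thesis .
qed

lemma peval_zero [simp]: "peval 0 z = 0"
  by (simp add: peval_def case_prod_beta)

lemma peval_add: "peval (p + q) z = peval p z + peval q z"
proof -
  let ?A = "Poly_Mapping.keys p \<union> Poly_Mapping.keys q"
  have "Poly_Mapping.keys (p + q) \<subseteq> ?A" by (rule Poly_Mapping.keys_add)
  then show ?thesis
    by (simp add: peval_superset[of ?A] lookup_add distrib_right sum.distrib)
qed

lemma peval_single: "peval (single2 i j c) z = c * (fst z ^ i * snd z ^ j)"
  by (subst peval_superset[of "{(i, j)}"]) auto

lemma peval_sum: "peval (\<Sum>a\<in>A. f a) z = (\<Sum>a\<in>A. peval (f a) z)"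
  by (induction A rule: infinite_finite_induct) (auto simp: peval_add)

lemma peval_uminus: "peval (- p) z = - peval p z"
  using peval_add[of p "-p" z] by simp

lemma peval_diff: "peval (p - q) z = peval p z - peval q z"
  using peval_add[of p "-q" z] by (simp add: peval_uminus)

lemma poly2_sum_single: "p = (\<Sum>k\<in>Poly_Mapping.keys p. Poly_Mapping.single k (cf p k))"
  by (rule poly_mapping_eqI)
     (simp add: lookup_sum lookup_single when_def in_keys_iff)

lemma poly2_induct [case_names single add]:
  assumes "\<And>i j c. P (single2 i j c)" "\<And>p q. P p \<Longrightarrow> P q \<Longrightarrow> P (p + q)"
  shows "P p"
proof -
  have "P (\<Sum>k\<in>K. Poly_Mapping.single k (cf p k))" if "finite K" for K
    using that
  proof (induction K)
    case empty
    then show ?case using assms(1)[of 0 0 0] by simp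
  next
    case (insert k K)
    then show ?case using assms(1)[of "fst k" "snd k"] by (auto intro: assms(2))
  qed
  from this[of "Poly_Mapping.keys p"] show ?thesis using poly2_sum_single[of p] by simp
qed

lemma peval_mult: "peval (p * q) z = peval p z * peval q z"
proof (induction p rule: poly2_induct)
  case (single i j c)
  show ?case
    by (induction q rule: poly2_induct)
       (auto simp: mult_single peval_single peval_add power_add algebra_simps)
qed (simp_all add: distrib_right peval_add)

lemma peval_one [simp]: "peval 1 z = 1"
  using peval_single[of 0 0 1 z] by (simp add: zero_prod_def[symmetric])

lemma peval_power: "peval (p ^ n) z = peval p z ^ n"
  by (induction n) (simp_all add: peval_mult)

lemma Ck_on_peval: "Ck_on k UNIV (peval p)"
proof (induction p rule: poly2_induct)
  case (single i j c)
  have "Ck_on k UNIV (\<lambda>z. c * (fst z ^ i * snd z ^ j))" by (intro Ck_on_intros open_UNIV)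
  then show ?case by (simp add: peval_single)
next
  case (add p q)
  have "Ck_on k UNIV (\<lambda>z. peval p z + peval q z)" by (intro Ck_on_add add open_UNIV)
  then show ?case by (simp add: peval_add[abs_def])
qed

lemma finite_deg_le: "finite {(i, j). i + j \<le> (m::nat)}"
  by (rule finite_subset[of _ "{..m} \<times> {..m}"]) auto

lemma finite_deg_le': "finite {k. fst k + snd k \<le> (m::nat)}"
  by (rule finite_subset[OF _ finite_deg_le[of m]]) auto

lemma jets_iff: "p \<in> jets m \<longleftrightarrow> (\<forall>i j. i + j > m \<longrightarrow> cf p (i, j) = 0)"
  unfolding jets_def by (force simp: in_keys_iff)

lemma peval_jets:
  "p \<in> jets m \<Longrightarrow> peval p z = (\<Sum>k | fst k + snd k \<le> m. cf p k * (fst z ^ fst k * snd z ^ snd k))"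
  by (rule peval_superset[OF finite_deg_le']) (auto simp: jets_def)

lemma lookup_trunc: "cf (trunc m p) (i, j) = (if i + j \<le> m then cf p (i, j) else 0)"
proof -
  have "trunc m p = (\<Sum>k | fst k + snd k \<le> m. Poly_Mapping.single k (cf p k))"
    unfolding trunc_def by (rule sum.cong) auto
  then show ?thesis
    by (simp add: lookup_sum lookup_single when_def sum.delta[OF finite_deg_le'] eq_commute[of _ "(i, j)"]
        sum.delta'[OF finite_deg_le'])
qed

lemma trunc_in_jets: "trunc m p \<in> jets m"
  by (simp add: jets_iff lookup_trunc)

lemma lookup_taylor:
  "cf (taylor m F) (i, j) = (if i + j \<le> m then partial (i, j) F (0, 0) / (fact i * fact j) else 0)"
proof -
  have "taylor m F = (\<Sum>k | fst k + snd k \<le> m.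
      Poly_Mapping.single k (partial k F (0, 0) / (fact (fst k) * fact (snd k))))"
    unfolding taylor_def by (rule sum.cong) auto
  then show ?thesis
    by (simp add: lookup_sum lookup_single when_def sum.delta[OF finite_deg_le'] eq_commute[of _ "(i, j)"]
        sum.delta'[OF finite_deg_le'])
qed

lemma taylor_in_jets: "taylor m F \<in> jets m"
  by (simp add: jets_iff lookup_taylor)

text \<open>On the line (t, t y) the jet is a polynomial in t that is o(t^m), so its t-coefficients
  up to order m vanish. Each of these is a polynomial in the slope y that is zero for all y, and its
  coefficients are those of one homogeneous part of the jet.\<close>

lemma flat_jet_eq_zero:
  assumes "p \<in> jets m" "flat m (peval p)"
  shows "p = 0"
proof (rule poly_mapping_eqI)
  fix k :: "nat \<times> nat"
  obtain a b where k: "k = (a, b)" by fastforce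
  have z: "(\<Sum>k | fst k + snd k = n. cf p k * y ^ snd k) = 0" if n: "n \<le> m" for n and y :: real
  proof -
    let ?q = "\<Sum>k | fst k + snd k \<le> m. monom (cf p k * y ^ snd k) (fst k + snd k)"
    define N where "N = norm (1::real, y)"
    have n1: "N \<ge> 1" using abs_le_norm_pair(1)[of 1 y] by (simp only: N_def)
    have e: "poly ?q t = peval p (t, t * y)" for t
      unfolding peval_jets[OF assms(1)]
      by (simp add: poly_sum poly_monom power_add power_mult_distrib algebra_simps)
    have "coeff ?q n = 0"
    proof (rule poly_little_o_imp_coeff_zero[OF _ n])
      fix e :: real assume "e > 0"
      then have "e / N ^ m > 0" using n1 by (intro divide_pos_pos zero_less_power) linarith+
      from flatD[OF assms(2) this] obtain d where
        d: "d > 0" "\<And>z. norm z < d \<Longrightarrow> \<bar>peval p z\<bar> \<le> e / N ^ m * norm z ^ m" by blast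
      have "\<bar>poly ?q t\<bar> \<le> e * t ^ m" if t: "0 < t" "t < d / N" for t
      proof -
        have nt: "norm (t, t * y) = t * N"
          using t norm_scaleR[of t "(1::real, y)"] by (simp only: N_def scaleR_Pair real_scaleR_def abs_of_pos mult_1_right)
        have "t * N < d" using t n1 by (simp add: field_simps)
        then have "\<bar>poly ?q t\<bar> \<le> e / N ^ m * (t * N) ^ m" using d(2)[of "(t, t * y)"] nt e by simp
        then show ?thesis using n1 by (simp add: power_mult_distrib field_simps)
      qed
      then show "\<exists>d>0. \<forall>t. 0 < t \<and> t < d \<longrightarrow> \<bar>poly ?q t\<bar> \<le> e * t ^ m"
        using d(1) n1 by (intro exI[of _ "d / N"]) auto
    qed
    moreover have "coeff ?q n = (\<Sum>k | fst k + snd k = n. cf p k * y ^ snd k)"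
      unfolding coeff_sum coeff_monom
      by (subst sum.mono_neutral_right[OF finite_deg_le', where S = "{k. fst k + snd k = n}"])
         (use n in auto)
    ultimately show ?thesis by simp
  qed
  show "cf p k = cf 0 k"
  proof (cases "a + b \<le> m")
    case True
    let ?r = "\<Sum>k | fst k + snd k = a + b. monom (cf p k) (snd k)"
    have "poly ?r y = 0" for y
      using z[OF True, of y] by (simp add: poly_sum poly_monom)
    then have "?r = 0" using poly_all_0_iff_0 by blast
    moreover have "coeff ?r b = (\<Sum>k | fst k + snd k = a + b. if k = (a, b) then cf p k else 0)"
      unfolding coeff_sum coeff_monom by (rule sum.cong) auto
    moreover have "finite {k. fst k + snd k = a + b}"
      by (rule finite_subset[OF _ finite_deg_le'[of "a + b"]]) auto
    ultimately show ?thesis by (simp add: k sum.delta)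
  next
    case False
    then show ?thesis using assms(1) k by (simp add: jets_iff)
  qed
qed

section \<open>Taylor's theorem\<close>

lemma has_derivative_monomial:
  "((\<lambda>z::real \<times> real. fst z ^ k * snd z ^ l) has_derivative
    (\<lambda>v. fst v * (real k * (fst z ^ (k - 1) * snd z ^ l)) +
         snd v * (real l * (fst z ^ k * snd z ^ (l - 1))))) (at z)"
  by (auto intro!: derivative_eq_intros simp: algebra_simps)

lemma Dx_monomial:
  "Dx (\<lambda>z. c * (fst z ^ k * snd z ^ l)) = (\<lambda>z. c * real k * (fst z ^ (k - 1) * snd z ^ l))"
proof
  fix z
  show "Dx (\<lambda>z. c * (fst z ^ k * snd z ^ l)) z = c * real k * (fst z ^ (k - 1) * snd z ^ l)"
    by (subst dir_deriv_eqI[OF has_derivative_mult_right[OF has_derivative_monomial]]) simp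
qed

lemma Dy_monomial:
  "Dy (\<lambda>z. c * (fst z ^ k * snd z ^ l)) = (\<lambda>z. c * real l * (fst z ^ k * snd z ^ (l - 1)))"
proof
  fix z
  show "Dy (\<lambda>z. c * (fst z ^ k * snd z ^ l)) z = c * real l * (fst z ^ k * snd z ^ (l - 1))"
    by (subst dir_deriv_eqI[OF has_derivative_mult_right[OF has_derivative_monomial]]) simp
qed

text \<open>Truncated subtraction keeps the formula true for i > k: the factor with s = k is
  \<open>real (k - k)\<close>, so the product is 0.\<close>

lemma Dx_funpow_monomial:
  "(Dx ^^ i) (\<lambda>z. c * (fst z ^ k * snd z ^ l)) =
    (\<lambda>z. c * (\<Prod>s<i. real (k - s)) * (fst z ^ (k - i) * snd z ^ l))"
proof (induction i)
  case (Suc i)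
  have "(Dx ^^ Suc i) (\<lambda>z. c * (fst z ^ k * snd z ^ l)) =
      Dx (\<lambda>z. c * (\<Prod>s<i. real (k - s)) * (fst z ^ (k - i) * snd z ^ l))"
    using Suc by simp
  then show ?case unfolding Dx_monomial by (simp add: ac_simps)
qed simp

lemma Dy_funpow_monomial:
  "(Dy ^^ j) (\<lambda>z. c * (fst z ^ k * snd z ^ l)) =
    (\<lambda>z. c * (\<Prod>s<j. real (l - s)) * (fst z ^ k * snd z ^ (l - j)))"
proof (induction j)
  case (Suc j)
  have "(Dy ^^ Suc j) (\<lambda>z. c * (fst z ^ k * snd z ^ l)) =
      Dy (\<lambda>z. c * (\<Prod>s<j. real (l - s)) * (fst z ^ k * snd z ^ (l - j)))"
    using Suc by simp
  then show ?case unfolding Dy_monomial by (simp add: ac_simps)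
qed simp

lemma prod_diff_eq_fact: "(\<Prod>s<n. real (n - s)) = fact n"
  by (simp add: fact_prod_rev atLeast0LessThan)

text \<open>For i < k or j < l a positive power of 0 remains, for i > k or j > l the product of
  truncated differences vanishes; only the matching monomial survives.\<close>

lemma partial_monomial_0:
  "partial (i, j) (\<lambda>z. fst z ^ k * snd z ^ l) 0 = (if i = k \<and> j = l then fact i * fact j else 0)"
proof -
  have "partial (i, j) (\<lambda>z. fst z ^ k * snd z ^ l) 0 =
      (\<Prod>s<j. real (l - s)) * (\<Prod>s<i. real (k - s)) * (0 ^ (k - i) * 0 ^ (l - j))"
    using Dy_funpow_monomial[of j 1 k l]
      Dx_funpow_monomial[of i "\<Prod>s<j. real (l - s)" k "l - j"]
    by (simp add: partial_def)
  moreover have "(\<Prod>s<i. real (k - s)) = 0" if "i > k" for i k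
    using that by (intro prod_zero) (auto intro!: bexI[of _ k])
  ultimately show ?thesis
    by (cases i k rule: linorder_cases; cases j l rule: linorder_cases)
       (auto simp: prod_diff_eq_fact power_0_left simp del: of_nat_diff)
qed

text \<open>Subtracting the Taylor polynomial removes all partials at the origin up to order m, and
  \<open>flat_partials\<close> applies.\<close>

theorem taylor_flat:
  assumes "Ck_on m UNIV F"
  shows "flat m (\<lambda>z. F z - peval (taylor m F) z)"
proof (rule flat_partials)
  show "Ck_on m UNIV (\<lambda>z. F z - peval (taylor m F) z)"
    by (intro Ck_on_diff assms Ck_on_peval open_UNIV)
  fix i j assume ij: "i + j \<le> m"
  let ?A = "{k. fst k + snd k \<le> m}" and ?T = "cf (taylor m F)"
  have "partial (i, j) (peval (taylor m F)) 0 =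
      partial (i, j) (\<lambda>z. \<Sum>k\<in>?A. ?T k * (fst z ^ fst k * snd z ^ snd k)) 0"
    by (rule arg_cong[where f = "\<lambda>F. partial (i, j) F 0"]) (rule ext, rule peval_jets[OF taylor_in_jets])
  also have "\<dots> = (\<Sum>k\<in>?A. ?T k * partial (i, j) (\<lambda>z. fst z ^ fst k * snd z ^ snd k) 0)"
    by (subst partial_sum[OF _ ij]) (intro Ck_on_intros open_UNIV, rule refl)
  also have "\<dots> = (\<Sum>k\<in>?A. if k = (i, j) then ?T (i, j) * (fact i * fact j) else 0)"
    by (rule sum.cong) (auto simp: partial_monomial_0)
  also have "\<dots> = partial (i, j) F 0"
    using ij by (simp add: sum.delta[OF finite_deg_le'] lookup_taylor zero_prod_def)
  finally have "partial (i, j) (peval (taylor m F)) 0 = partial (i, j) F 0" .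
  then show "partial (i, j) (\<lambda>z. F z - peval (taylor m F) z) 0 = 0"
    using partial_cmult_add[OF Ck_on_peval assms ij, of "-1" "taylor m F"] by simp
qed

text \<open>Two jets with flat difference agree. Through this rule Taylor polynomials are found by
  estimates instead of by computing derivatives.\<close>

lemma taylor_eqI:
  assumes "Ck_on m UNIV F" "p \<in> jets m" "flat m (\<lambda>z. F z - peval p z)"
  shows "taylor m F = p"
proof -
  have "flat m (peval (taylor m F - p))"
    using flat_diff[OF assms(3) taylor_flat[OF assms(1)]] by (simp add: peval_diff[abs_def])
  moreover have "taylor m F - p \<in> jets m"
    using assms(2) taylor_in_jets[of m F] by (simp add: jets_iff lookup_minus)
  ultimately show ?thesis using flat_jet_eq_zero by fastforce
qed

lemma taylor_peval: "p \<in> jets m \<Longrightarrow> taylor m (peval p) = p"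
  by (rule taylor_eqI[OF Ck_on_peval]) simp_all

text \<open>Integrating the jet of \<open>Dx R\<close> in \<open>x\<close> gives a flat polynomial; this replaces the
  symmetry of mixed partial derivatives.\<close>

lemma flat_Dx:
  assumes "Ck_on (Suc m) UNIV R" "flat (Suc m) R"
  shows "flat m (Dx R)"
proof -
  define Q where "Q = taylor m (Dx R)"
  define H where "H = (\<Sum>k | fst k + snd k \<le> m. single2 (Suc (fst k)) (snd k) (cf Q k / real (Suc (fst k))))"
  have Dx: "flat m (\<lambda>z. Dx R z - peval Q z)"
    unfolding Q_def by (rule taylor_flat[OF Ck_on_dir_deriv[OF assms(1)]])
  have Qj: "Q \<in> jets m" unfolding Q_def by (rule taylor_in_jets)
  have pH: "peval H z = (\<Sum>k | fst k + snd k \<le> m. cf Q k / real (Suc (fst k)) * (fst z ^ Suc (fst k) * snd z ^ snd k))" for z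
    unfolding H_def peval_sum peval_single ..
  have "(peval H has_derivative (\<lambda>v. \<Sum>k | fst k + snd k \<le> m. cf Q k / real (Suc (fst k)) *
      (fst v * (real (Suc (fst k)) * (fst z ^ (Suc (fst k) - 1) * snd z ^ snd k)) +
         snd v * (real (snd k) * (fst z ^ Suc (fst k) * snd z ^ (snd k - 1)))))) (at z)" for z
    unfolding pH[abs_def]
    by (intro has_derivative_sum has_derivative_mult_right has_derivative_monomial)
  then have DH: "Dx (peval H) z = peval Q z" for z
    by (subst dir_deriv_eqI, assumption) (simp add: peval_jets[OF Qj] del: of_nat_Suc)
  have dD: "(\<lambda>z. R z - peval H z) differentiable (at z)" for z
    using Ck_on_diff[OF open_UNIV assms(1) Ck_on_peval[of "Suc m" H]] by (rule Ck_on_Suc_differentiable) simp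
  have DxK: "Dx (\<lambda>z. R z - peval H z) z = Dx R z - peval Q z" for z
    using dir_deriv_cmult_add[OF Ck_on_peval[of "Suc m" H] assms(1), of "(1, 0)" "-1"] DH by simp
  have H0: "peval H (0, y) = 0" for y unfolding pH by simp
  \<comment> \<open>The x-derivative of \<open>R - H\<close> is o(|z|^m), so a horizontal segment
    starting on the y-axis contributes o(|z|^(m+1)); \<open>H\<close> vanishes on that axis.\<close>
  have "flat (Suc m) (\<lambda>z. R z - peval H z - R (0, snd z))"
    unfolding flat_def
  proof (intro allI impI)
    fix e :: real assume "e > 0"
    then obtain d where d: "d > 0" "\<And>z. norm z < d \<Longrightarrow> \<bar>Dx R z - peval Q z\<bar> \<le> e * norm z ^ m"
      using flatD[OF Dx] by blast
    have "\<bar>R z - peval H z - R (0, snd z)\<bar> \<le> e * norm z ^ Suc m" if z: "norm z < d" for z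
    proof -
      obtain x y where xy: "z = (x, y)" by fastforce
      obtain t where t: "\<bar>t\<bar> \<le> \<bar>x\<bar>"
        "(R (x, y) - peval H (x, y)) - (R (0, y) - peval H (0, y)) = x * (Dx R (t, y) - peval Q (t, y))"
        by (rule mvt_x[of "\<lambda>z. R z - peval H z" x y, OF dD, unfolded DxK])
      have n: "norm (t, y) \<le> norm z" using t(1) xy norm_pair_mono by blast
      have "\<bar>R z - peval H z - R (0, snd z)\<bar> = \<bar>x\<bar> * \<bar>Dx R (t, y) - peval Q (t, y)\<bar>"
        using t(2) H0 xy by (simp add: abs_mult[symmetric])
      also have "\<dots> \<le> norm z * (e * norm (t, y) ^ m)"
        using d(2)[of "(t, y)"] n z xy abs_le_norm_pair(1)[of x y] by (intro mult_mono) auto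
      also have "\<dots> \<le> norm z * (e * norm z ^ m)"
        using n \<open>e > 0\<close> by (intro mult_left_mono power_mono) auto
      finally show ?thesis by (simp add: ac_simps)
    qed
    then show "\<exists>d>0. \<forall>z. norm z < d \<longrightarrow> \<bar>R z - peval H z - R (0, snd z)\<bar> \<le> e * norm z ^ Suc m"
      using d(1) by blast
  qed
  moreover have "flat (Suc m) (\<lambda>z. R (0, snd z))"
    by (rule flat_compose[OF assms(2), of 1 _ 1]) (auto intro: abs_le_norm_pair)
  ultimately have "flat (Suc m) (\<lambda>z. R z - ((R z - peval H z - R (0, snd z)) + R (0, snd z)))"
    by (rule flat_diff[OF assms(2) flat_add])
  \<comment> \<open>As \<open>R\<close> is flat, \<open>H\<close> is a flat jet and hence 0; its
    x-derivative \<open>Q\<close> is then 0 too.\<close>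
  then have "flat (Suc m) (peval H)" by simp
  moreover have "H \<in> jets (Suc m)"
    unfolding jets_iff H_def lookup_sum lookup_single when_def by (auto intro!: sum.neutral)
  ultimately have "H = 0" using flat_jet_eq_zero by blast
  then have "Dx (peval H) z = 0" for z
    by (simp add: peval_zero[abs_def] dir_deriv_def)
  then have "peval Q z = 0" for z using DH by simp
  then show ?thesis using Dx by simp
qed

section \<open>The ring of jets\<close>

abbreviation const2 :: "real \<Rightarrow> poly2" where "const2 \<equiv> Poly_Mapping.single (0, 0)"

definition jmult :: "nat \<Rightarrow> poly2 \<Rightarrow> poly2 \<Rightarrow> poly2" where
  "jmult m p q = trunc m (p * q)"

lemma trunc_add: "trunc m (p + q) = trunc m p + trunc m q"
  by (rule poly_mapping_eqI) (auto simp: lookup_trunc lookup_add split: prod.splits)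

lemma trunc_jets: "p \<in> jets m \<Longrightarrow> trunc m p = p"
  by (rule poly_mapping_eqI) (auto simp: lookup_trunc jets_iff not_le)

lemma trunc_single: "trunc m (single2 i j c) = (if i + j \<le> m then single2 i j c else 0)"
  by (rule poly_mapping_eqI) (auto simp: lookup_trunc lookup_single when_def split: if_splits)

lemma trunc_high: "(\<And>i j. i + j \<le> m \<Longrightarrow> cf p (i, j) = 0) \<Longrightarrow> trunc m p = 0"
  by (rule poly_mapping_eqI) (auto simp: lookup_trunc)

lemma lookup_mult_high:
  assumes "\<And>i j. i + j \<le> m \<Longrightarrow> cf p (i, j) = 0" "i + j \<le> m"
  shows "cf (p * q) (i, j) = 0"
proof (rule ccontr)
  assume "cf (p * q) (i, j) \<noteq> 0"
  then have "(i, j) \<in> Poly_Mapping.keys (p * q)" by (simp add: in_keys_iff)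
  then obtain a b where ab: "(i, j) = a + b" "a \<in> Poly_Mapping.keys p"
    using Poly_Mapping.keys_mult[of p q] by auto
  then have "fst a + snd a \<le> m" using assms(2) by (cases a; cases b) auto
  then show False using assms(1)[of "fst a" "snd a"] ab(2) by (simp add: in_keys_iff)
qed

text \<open>Terms of degree above m produce only terms of degree above m. This compatibility carries
  associativity over to \<open>jmult\<close>.\<close>

lemma trunc_mult_trunc: "trunc m (trunc m p * q) = trunc m (p * q)"
proof -
  have "trunc m ((p - trunc m p) * q) = 0"
    by (intro trunc_high lookup_mult_high) (auto simp: lookup_minus lookup_trunc)
  moreover have "p * q = trunc m p * q + (p - trunc m p) * q" by (simp add: algebra_simps)
  ultimately show ?thesis by (simp add: trunc_add)
qed

lemma trunc_mult_trunc2: "trunc m (p * trunc m q) = trunc m (p * q)"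
  using trunc_mult_trunc[of m q p] by (simp add: mult.commute)

lemma jmult_commute: "jmult m p q = jmult m q p"
  by (simp add: jmult_def mult.commute)

lemma jmult_assoc: "jmult m (jmult m p q) r = jmult m p (jmult m q r)"
  by (simp add: jmult_def trunc_mult_trunc trunc_mult_trunc2 mult.assoc)

lemma jmult_add: "jmult m p (q + r) = jmult m p q + jmult m p r"
  by (simp add: jmult_def distrib_left trunc_add)

lemma jmult_add2: "jmult m (p + q) r = jmult m p r + jmult m q r"
  by (simp add: jmult_def distrib_right trunc_add)

lemma jmult_in_jets: "jmult m p q \<in> jets m"
  by (simp add: jmult_def trunc_in_jets)

lemma jets_add: "p \<in> jets m \<Longrightarrow> q \<in> jets m \<Longrightarrow> p + q \<in> jets m"
  by (simp add: jets_iff lookup_add)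

lemma jets_uminus: "p \<in> jets m \<Longrightarrow> - p \<in> jets m"
  by (simp add: jets_iff)

lemma zero_in_jets [simp]: "0 \<in> jets m"
  by (simp add: jets_iff)

lemma single_in_jets: "i + j \<le> m \<Longrightarrow> single2 i j c \<in> jets m"
  by (auto simp: jets_iff lookup_single when_def)

lemma one_in_jets: "1 \<in> jets m"
  using single_in_jets[of 0 0 m 1] by (simp add: zero_prod_def[symmetric])

lemma jet_ring_simps [simp]:
  "carrier (jet_ring m) = jets m" "x \<otimes>\<^bsub>jet_ring m\<^esub> y = jmult m x y" "\<one>\<^bsub>jet_ring m\<^esub> = 1"
  "\<zero>\<^bsub>jet_ring m\<^esub> = 0" "x \<oplus>\<^bsub>jet_ring m\<^esub> y = x + y"
  by (simp_all add: jet_ring_def jmult_def)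

lemma ring_jet_ring: "ring (jet_ring m)"
proof (rule ringI)
  show "abelian_group (jet_ring m)"
  proof (rule abelian_groupI)
    fix p assume "p \<in> carrier (jet_ring m)"
    then show "\<exists>q\<in>carrier (jet_ring m). q \<oplus>\<^bsub>jet_ring m\<^esub> p = \<zero>\<^bsub>jet_ring m\<^esub>"
      by (auto intro!: bexI[of _ "- p"] jets_uminus)
  qed (auto intro: jets_add simp: algebra_simps)
  show "monoid (jet_ring m)"
    by (rule monoidI) (auto simp: jmult_in_jets one_in_jets jmult_assoc, auto simp: jmult_def trunc_jets)
qed (auto simp: jmult_add jmult_add2)

lemma ideal_jet_ringI:
  assumes "I \<subseteq> jets m" "0 \<in> I" "\<And>p q. p \<in> I \<Longrightarrow> q \<in> I \<Longrightarrow> p + q \<in> I"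
    "\<And>p r. p \<in> I \<Longrightarrow> r \<in> jets m \<Longrightarrow> jmult m r p \<in> I"
  shows "ideal I (jet_ring m)"
proof (rule idealI[OF ring_jet_ring])
  interpret R: ring "jet_ring m" by (rule ring_jet_ring)
  show "subgroup I (add_monoid (jet_ring m))"
  proof (rule R.add.subgroupI)
    fix p assume p: "p \<in> I"
    have "jmult m (- 1) p = - p"
    proof -
      have "- p \<in> jets m" using p assms(1) jets_uminus by blast
      then show ?thesis by (simp add: jmult_def trunc_jets)
    qed
    moreover have "\<ominus>\<^bsub>jet_ring m\<^esub> p = - p"
      using p assms(1) by (intro R.minus_equality) (auto intro: jets_uminus)
    moreover have "jmult m (- 1) p \<in> I" by (intro assms(4) p jets_uminus one_in_jets)
    ultimately show "\<ominus>\<^bsub>jet_ring m\<^esub> p \<in> I" by simp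
  qed (use assms in auto)
qed (use assms(4) jmult_commute in auto)

lemma
  assumes "ideal I (jet_ring m)"
  shows ideal_jet_zero: "0 \<in> I"
    and ideal_jet_add: "p \<in> I \<Longrightarrow> q \<in> I \<Longrightarrow> p + q \<in> I"
    and ideal_jet_mult: "p \<in> I \<Longrightarrow> r \<in> jets m \<Longrightarrow> jmult m r p \<in> I"
    and ideal_jet_subset: "I \<subseteq> jets m"
proof -
  interpret ideal I "jet_ring m" by fact
  show "0 \<in> I" using additive_subgroup.zero_closed[OF is_additive_subgroup] by simp
  show "p + q \<in> I" if "p \<in> I" "q \<in> I" using additive_subgroup.a_closed[OF is_additive_subgroup that] by simp
  show "jmult m r p \<in> I" if "p \<in> I" "r \<in> jets m" using I_l_closed[of p r] that by simp
  show "I \<subseteq> jets m" using a_subset by simp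
qed

lemma lookup_const2_mult: "cf (const2 c * p) k = c * cf p k"
proof (induction p rule: poly2_induct)
  case (single i j d)
  show ?case by (cases k) (simp add: mult_single lookup_single when_def)
qed (simp add: distrib_left lookup_add)

lemma jmult_const2: "p \<in> jets m \<Longrightarrow> jmult m (const2 c) p = const2 c * p"
  unfolding jmult_def by (rule trunc_jets) (simp add: jets_iff lookup_const2_mult)

lemma peval_const2_mult: "peval (const2 c * p) z = c * peval p z"
  by (simp add: peval_mult peval_single)

lemma ideal_jet_cmult: "ideal I (jet_ring m) \<Longrightarrow> p \<in> I \<Longrightarrow> const2 c * p \<in> I"
  using ideal_jet_mult[of I m p "const2 c"] jmult_const2[of p m c] ideal_jet_subset[of I m]
    single_in_jets[of 0 0 m c] by auto

lemma jets0_iff: "p \<in> jets0 m \<longleftrightarrow> p \<in> jets m \<and> cf p (0, 0) = 0"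
proof -
  have "peval p (0, 0) = cf p (0, 0)"
  proof (induction p rule: poly2_induct)
    case (single i j c)
    then show ?case by (auto simp: peval_single lookup_single when_def power_0_left)
  qed (simp add: peval_add lookup_add)
  then show ?thesis by (simp add: jets0_def)
qed

section \<open>Jets of order three in coordinates\<close>

text \<open>Nine explicit coefficients, ordered by degree and then by falling power of x, turn
  equations between jets into systems of real equations through \<open>J3_eq_iff\<close>. There is
  no constant term, because all ideals in question lie in \<open>jets0 3\<close>.\<close>

definition J3 :: "real \<Rightarrow> real \<Rightarrow> real \<Rightarrow> real \<Rightarrow> real \<Rightarrow> real \<Rightarrow> real \<Rightarrow> real \<Rightarrow> real \<Rightarrow> poly2" where
  "J3 a b c d e f g h i =
     single2 1 0 a + single2 0 1 b + single2 2 0 c + single2 1 1 d + single2 0 2 e +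
     single2 3 0 f + single2 2 1 g + single2 1 2 h + single2 0 3 i"

lemma lookup_J3:
  "cf (J3 a b c d e f g h i) (j, k) =
    (if (j, k) = (1, 0) then a else if (j, k) = (0, 1) then b else if (j, k) = (2, 0) then c
     else if (j, k) = (1, 1) then d else if (j, k) = (0, 2) then e else if (j, k) = (3, 0) then f
     else if (j, k) = (2, 1) then g else if (j, k) = (1, 2) then h else if (j, k) = (0, 3) then i else 0)"
  by (auto simp: J3_def lookup_add lookup_single when_def)

lemma J3_eq_iff [simp]:
  "J3 a b c d e f g h i = J3 a' b' c' d' e' f' g' h' i' \<longleftrightarrow>
    a = a' \<and> b = b' \<and> c = c' \<and> d = d' \<and> e = e' \<and> f = f' \<and> g = g' \<and> h = h' \<and> i = i'"
  (is "?l = ?r \<longleftrightarrow> ?R")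
proof
  assume eq: "?l = ?r"
  have "cf ?l (j, k) = cf ?r (j, k)" for j k by (simp add: eq)
  note * = this[of 1 0] this[of 0 1] this[of 2 0] this[of 1 1] this[of 0 2] this[of 3 0]
    this[of 2 1] this[of 1 2] this[of 0 3]
  show ?R using * by (simp add: lookup_J3)
qed simp

lemma J3_in_jets0 [simp]: "J3 a b c d e f g h i \<in> jets0 3"
  by (auto simp: jets0_iff jets_iff lookup_J3)

lemma J3_in_jets [simp]: "J3 a b c d e f g h i \<in> jets 3"
  using J3_in_jets0 jets0_iff by blast

lemma jets0_3_eq: "p \<in> jets0 3 \<longleftrightarrow> (\<exists>a b c d e f g h i. p = J3 a b c d e f g h i)"
proof
  assume p: "p \<in> jets0 3"
  have "p = J3 (cf p (1, 0)) (cf p (0, 1)) (cf p (2, 0)) (cf p (1, 1)) (cf p (0, 2))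
      (cf p (3, 0)) (cf p (2, 1)) (cf p (1, 2)) (cf p (0, 3))"
  proof (rule poly_mapping_eqI)
    fix k :: "nat \<times> nat"
    obtain i j where k: "k = (i, j)" by fastforce
    have ij: "i = 0 \<and> j = 0 \<or> i = 1 \<and> j = 0 \<or> i = 0 \<and> j = 1 \<or> i = 2 \<and> j = 0 \<or> i = 1 \<and> j = 1 \<or>
        i = 0 \<and> j = 2 \<or> i = 3 \<and> j = 0 \<or> i = 2 \<and> j = 1 \<or> i = 1 \<and> j = 2 \<or> i = 0 \<and> j = 3"
      if "i + j \<le> 3"
      using that by presburger
    show "cf p k = cf (J3 (cf p (1, 0)) (cf p (0, 1)) (cf p (2, 0)) (cf p (1, 1)) (cf p (0, 2))
      (cf p (3, 0)) (cf p (2, 1)) (cf p (1, 2)) (cf p (0, 3))) k"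
    proof (cases "i + j \<le> 3")
      case True
      then show ?thesis using ij[OF True] p
        by (elim disjE) (simp_all add: k lookup_J3 jets0_iff)
    next
      case False
      then have "cf p (i, j) = 0" using p by (simp add: jets0_iff jets_iff)
      then show ?thesis using False by (auto simp: k lookup_J3)
    qed
  qed
  then show "\<exists>a b c d e f g h i. p = J3 a b c d e f g h i" by blast
qed auto

lemma J3_add: "J3 a b c d e f g h i + J3 a' b' c' d' e' f' g' h' i' =
    J3 (a + a') (b + b') (c + c') (d + d') (e + e') (f + f') (g + g') (h + h') (i + i')"
  by (simp add: J3_def single_add algebra_simps)

lemma J3_cmult: "const2 s * J3 a b c d e f g h i =
    J3 (s * a) (s * b) (s * c) (s * d) (s * e) (s * f) (s * g) (s * h) (s * i)"
proof -
  have "const2 s * single2 i j c = single2 i j (s * c)" for i j c by (simp add: mult_single)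
  then show ?thesis by (simp only: J3_def distrib_left)
qed

lemma J3_zero: "J3 0 0 0 0 0 0 0 0 0 = 0"
  by (simp add: J3_def)

lemma jmult_single: "jmult m (single2 i j c) (single2 k l d) = 
    (if i + j + (k + l) \<le> m then single2 (i + k) (j + l) (c * d) else 0)"
  by (simp add: jmult_def mult_single trunc_single)

lemma jmult_J3: "jmult 3 (J3 a b c d e f g h i) (J3 a' b' c' d' e' f' g' h' i') =
    J3 0 0 (a * a') (a * b' + b * a') (b * b') (a * c' + c * a')
      (a * d' + d * a' + b * c' + c * b') (a * e' + e * a' + b * d' + d * b') (b * e' + e * b')"
  unfolding J3_def
  by (simp add: jmult_add jmult_add2 jmult_single single_add numeral_eq_Suc
      del: One_nat_def)

lemma peval_J3: "peval (J3 a b c d e f g h i) (x, y) =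
    a * x + b * y + c * x\<^sup>2 + d * x * y + e * y\<^sup>2 + f * x ^ 3 + g * x\<^sup>2 * y + h * x * y\<^sup>2 + i * y ^ 3"
  by (simp add: J3_def peval_add peval_single)

lemma X_J3: "X = J3 1 0 0 0 0 0 0 0 0" and Y_J3: "Y = J3 0 1 0 0 0 0 0 0 0"
  by (simp_all add: J3_def)

text \<open>Multiplication by x or y shifts the coefficients one degree up and drops the old cubic
  ones.\<close>

lemma ideal_J3:
  assumes "ideal I (jet_ring 3)"
  shows ideal_J3_X: "J3 a b c d e f g h i \<in> I \<Longrightarrow> J3 0 0 a b 0 c d e 0 \<in> I"
    and ideal_J3_Y: "J3 a b c d e f g h i \<in> I \<Longrightarrow> J3 0 0 0 a b 0 c d e \<in> I"
    and ideal_J3_cmult: "J3 a b c d e f g h i \<in> I \<Longrightarrow>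
      J3 (s * a) (s * b) (s * c) (s * d) (s * e) (s * f) (s * g) (s * h) (s * i) \<in> I"
    and ideal_J3_add: "J3 a b c d e f g h i \<in> I \<Longrightarrow> J3 a' b' c' d' e' f' g' h' i' \<in> I \<Longrightarrow>
      J3 (a + a') (b + b') (c + c') (d + d') (e + e') (f + f') (g + g') (h + h') (i + i') \<in> I"
  using ideal_jet_mult[OF assms, of "J3 a b c d e f g h i" "J3 1 0 0 0 0 0 0 0 0"]
    ideal_jet_mult[OF assms, of "J3 a b c d e f g h i" "J3 0 1 0 0 0 0 0 0 0"]
    ideal_jet_cmult[OF assms, of "J3 a b c d e f g h i" s]
    ideal_jet_add[OF assms, of "J3 a b c d e f g h i" "J3 a' b' c' d' e' f' g' h' i'"]
  by (simp_all add: jmult_J3 J3_cmult J3_add)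

text \<open>The jet ring is generated by x, y and the constants, so closure under these
  multiplications extends to monomials and then to all jets.\<close>

lemma jet_ideal0_3I:
  assumes "I \<subseteq> jets0 3" "0 \<in> I" "\<And>p q. p \<in> I \<Longrightarrow> q \<in> I \<Longrightarrow> p + q \<in> I"
    "\<And>s p. p \<in> I \<Longrightarrow> const2 s * p \<in> I"
    "\<And>p. p \<in> I \<Longrightarrow> jmult 3 X p \<in> I" "\<And>p. p \<in> I \<Longrightarrow> jmult 3 Y p \<in> I"
  shows "jet_ideal0 3 I"
proof -
  have sub: "I \<subseteq> jets 3" using assms(1) jets0_iff by blast
  have "jmult 3 (single2 i j c) p \<in> I" if "p \<in> I" for i j c p
  proof (induction i arbitrary: j)
    case 0
    show ?case
    proof (induction j)
      case 0
      show ?case using assms(4)[OF that] jmult_const2[of p 3] that sub by auto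
    next
      case (Suc j)
      have "single2 0 (Suc j) c = Y * single2 0 j c" by (simp add: mult_single)
      then have "jmult 3 (single2 0 (Suc j) c) p = jmult 3 Y (jmult 3 (single2 0 j c) p)"
        by (simp add: jmult_def trunc_mult_trunc2 mult.assoc)
      then show ?case using assms(6)[OF Suc] by simp
    qed
  next
    case (Suc i)
    have "single2 (Suc i) j c = X * single2 i j c" by (simp add: mult_single)
    then have "jmult 3 (single2 (Suc i) j c) p = jmult 3 X (jmult 3 (single2 i j c) p)"
      by (simp add: jmult_def trunc_mult_trunc2 mult.assoc)
    then show ?case using assms(5)[OF Suc] by simp
  qed
  then have "jmult 3 r p \<in> I" if "p \<in> I" for r p
    using that by (induction r rule: poly2_induct) (auto simp: jmult_add2 intro: assms(3))
  then show ?thesis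
    unfolding jet_ideal0_def using assms(1-3) sub by (auto intro: ideal_jet_ringI)
qed

lemma gen_ideal_eqI:
  assumes "jet_ideal0 m K" "S \<subseteq> K" "\<And>I. ideal I (jet_ring m) \<Longrightarrow> S \<subseteq> I \<Longrightarrow> K \<subseteq> I"
  shows "gen_ideal m S = K"
  unfolding gen_ideal_def genideal_def
  using assms unfolding jet_ideal0_def by (intro equalityI Inter_greatest Inter_lower) auto

section \<open>The action of maps fixing the origin on jets\<close>

lemma flat_peval_high:
  assumes "\<And>i j. i + j \<le> m \<Longrightarrow> cf p (i, j) = 0"
  shows "flat m (peval p)"
proof -
  have "flat m (\<lambda>z. cf p k * (fst z ^ fst k * snd z ^ snd k))" if "k \<in> Poly_Mapping.keys p" for k
  proof (rule flat_cmult, rule flat_Suc_bound[of 1 _ 1])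
    have k: "fst k + snd k \<ge> Suc m"
      using that assms[of "fst k" "snd k"] by (fastforce simp: in_keys_iff)
    fix z :: "real \<times> real" assume z: "norm z < 1"
    have a: "\<bar>fst z\<bar> \<le> norm z" "\<bar>snd z\<bar> \<le> norm z" using abs_le_norm_pair by (cases z, auto)+
    have "\<bar>fst z ^ fst k * snd z ^ snd k\<bar> \<le> norm z ^ fst k * norm z ^ snd k"
      unfolding abs_mult power_abs using a by (intro mult_mono power_mono) auto
    also have "\<dots> \<le> norm z ^ Suc m"
      unfolding power_add[symmetric] using k z by (intro power_decreasing) auto
    finally show "\<bar>fst z ^ fst k * snd z ^ snd k\<bar> \<le> 1 * norm z ^ Suc m" by simp
  qed simp
  then show ?thesis
    using flat_sum[of "Poly_Mapping.keys p" m "\<lambda>k z. cf p k * (fst z ^ fst k * snd z ^ snd k)"]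
    by (simp add: peval_superset[OF finite_keys order_refl, abs_def])
qed

lemma flat_trunc: "flat m (\<lambda>z. peval p z - peval (trunc m p) z)"
  using flat_peval_high[of m "p - trunc m p"]
  by (simp add: lookup_minus lookup_trunc peval_diff[abs_def])

lemma continuous_imp_locally_bounded:
  fixes f :: "real \<times> real \<Rightarrow> real"
  assumes "continuous_on UNIV f"
  obtains d where "d > 0" "\<And>z. norm z < d \<Longrightarrow> \<bar>f z\<bar> \<le> \<bar>f 0\<bar> + 1"
proof -
  have "continuous (at 0) f" using assms continuous_on_eq_continuous_at[OF open_UNIV] by (metis UNIV_I)
  then obtain d where "d > 0" "\<And>z. dist z 0 < d \<Longrightarrow> dist (f z) (f 0) < 1"
    unfolding continuous_at_eps_delta by (metis zero_less_one)
  then show ?thesis using that[of d] by (force simp: dist_norm)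
qed

definition pull :: "nat \<Rightarrow> (real \<times> real \<Rightarrow> real \<times> real) \<Rightarrow> poly2 \<Rightarrow> poly2" where
  "pull m \<phi> p = taylor m (peval p \<circ> \<phi>)"

text \<open>Working with C^m maps that fix the origin treats polynomial maps, diffeomorphisms and
  their inverses alike. By \<open>m_pos\<close> there is a derivative at 0 and with it a bound
  |\<phi>(z)| <= C |z|, which keeps o(|z|^m) stable under composition.\<close>

locale origin_map =
  fixes m :: nat and \<phi> :: "real \<times> real \<Rightarrow> real \<times> real"
  assumes m_pos: "m \<ge> 1" and smooth: "Ck_on m UNIV \<phi>" and fixes_origin: "\<phi> (0, 0) = (0, 0)"
begin

lemma linear_bound:
  obtains C r where "C > 0" "r > 0" "\<And>z. norm z < r \<Longrightarrow> norm (\<phi> z) \<le> C * norm z"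
proof -
  have "Ck_on (Suc 0) UNIV \<phi>" using Ck_on_le[OF smooth m_pos] by simp
  from Ck_on_SucD[OF this UNIV_I, of 0] obtain D where D: "(\<phi> has_derivative D) (at 0)" by blast
  then have "bounded_linear D" by (rule has_derivative_bounded_linear)
  then obtain K where K: "K > 0" "\<And>z. norm (D z) \<le> norm z * K"
    using bounded_linear.pos_bounded by blast
  obtain d where d: "d > 0" "\<And>z. norm (z - 0) < d \<Longrightarrow> norm (\<phi> z - \<phi> 0 - D (z - 0)) \<le> 1 * norm (z - 0)"
    using D[unfolded has_derivative_at_alt] zero_less_one by metis
  have "norm (\<phi> z) \<le> (K + 1) * norm z" if "norm z < d" for z
  proof -
    have "\<phi> 0 = 0" using fixes_origin by (simp only: zero_prod_def)
    then have "norm (\<phi> z - D z) \<le> norm z" using d(2)[of z] that by simp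
    then have "norm (\<phi> z) \<le> norm z + norm (D z)" by norm
    then show ?thesis using K(2)[of z] by (simp add: algebra_simps)
  qed
  then show ?thesis using that[of "K + 1" d] K d by simp
qed

lemma flat_comp: "flat m f \<Longrightarrow> flat m (\<lambda>z. f (\<phi> z))"
  using linear_bound flat_compose by metis

lemma Ck_on_peval_comp: "Ck_on m UNIV (peval p \<circ> \<phi>)"
  using Ck_on_compose[OF open_UNIV open_UNIV Ck_on_peval smooth] by (simp add: o_def)

lemma pull_flat: "flat m (\<lambda>z. peval p (\<phi> z) - peval (pull m \<phi> p) z)"
  using taylor_flat[OF Ck_on_peval_comp, of p] by (simp add: pull_def)

lemma pull_in_jets: "pull m \<phi> p \<in> jets m"
  by (simp add: pull_def taylor_in_jets)

lemma pull_eqI: "q \<in> jets m \<Longrightarrow> flat m (\<lambda>z. peval p (\<phi> z) - peval q z) \<Longrightarrow> pull m \<phi> p = q"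
  unfolding pull_def by (rule taylor_eqI[OF Ck_on_peval_comp]) simp_all

lemma pull_add: "pull m \<phi> (p + q) = pull m \<phi> p + pull m \<phi> q"
  using flat_add[OF pull_flat[of p] pull_flat[of q]]
  by (intro pull_eqI jets_add pull_in_jets) (simp add: peval_add algebra_simps)

lemma pull_cmult: "pull m \<phi> (const2 c * p) = const2 c * pull m \<phi> p"
proof (rule pull_eqI)
  show "const2 c * pull m \<phi> p \<in> jets m"
    using pull_in_jets[of p] by (simp add: jets_iff lookup_const2_mult)
  show "flat m (\<lambda>z. peval (const2 c * p) (\<phi> z) - peval (const2 c * pull m \<phi> p) z)"
    using flat_cmult[OF pull_flat[of p], of c] by (simp add: peval_const2_mult right_diff_distrib)
qed

text \<open>With P and Q the pulled jets, the difference of the products telescopes into (q o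
  \<phi>)(p o \<phi> - P) + P (q o \<phi> - Q), each summand being bounded times flat. The two
  truncations are accounted for by \<open>flat_trunc\<close>.\<close>

lemma pull_jmult: "pull m \<phi> (jmult m p q) = jmult m (pull m \<phi> p) (pull m \<phi> q)"
proof (rule pull_eqI[OF jmult_in_jets])
  let ?P = "pull m \<phi> p" and ?Q = "pull m \<phi> q"
  have "continuous_on UNIV (peval q \<circ> \<phi>)" "continuous_on UNIV (peval ?P)"
    using Ck_on_peval_comp Ck_on_peval Ck_on_imp_continuous by blast+
  then obtain d d' where d: "d > 0" "\<And>z. norm z < d \<Longrightarrow> \<bar>(peval q \<circ> \<phi>) z\<bar> \<le> \<bar>(peval q \<circ> \<phi>) 0\<bar> + 1"
    and d': "d' > 0" "\<And>z. norm z < d' \<Longrightarrow> \<bar>peval ?P z\<bar> \<le> \<bar>peval ?P 0\<bar> + 1"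
    by (metis continuous_imp_locally_bounded)
  have 1: "flat m (\<lambda>z. (peval q \<circ> \<phi>) z * (peval p (\<phi> z) - peval ?P z))"
    by (rule flat_bounded_mult[OF pull_flat d])
  have 2: "flat m (\<lambda>z. peval ?P z * (peval q (\<phi> z) - peval ?Q z))"
    by (rule flat_bounded_mult[OF pull_flat d'])
  have 3: "flat m (\<lambda>z. peval (p * q) (\<phi> z) - peval (trunc m (p * q)) (\<phi> z))"
    by (rule flat_comp[OF flat_trunc])
  have 4: "flat m (\<lambda>z. peval (?P * ?Q) z - peval (trunc m (?P * ?Q)) z)"
    by (rule flat_trunc)
  show "flat m (\<lambda>z. peval (jmult m p q) (\<phi> z) - peval (jmult m ?P ?Q) z)"
    using flat_diff[OF flat_add[OF flat_add[OF 1 2] 4] 3]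
    by (simp add: jmult_def peval_mult algebra_simps)
qed

lemma pull_jets0: "p \<in> jets0 m \<Longrightarrow> pull m \<phi> p \<in> jets0 m"
  unfolding jets0_iff[of "pull m \<phi> p"]
  using pull_in_jets fixes_origin
  by (simp add: pull_def lookup_taylor partial_def jets0_def)

lemma pull_pull:
  assumes "origin_map m \<psi>"
  shows "pull m \<psi> (pull m \<phi> p) = pull m (\<phi> \<circ> \<psi>) p"
proof -
  interpret psi: origin_map m \<psi> by fact
  have c: "Ck_on m UNIV (peval p \<circ> (\<phi> \<circ> \<psi>))"
    using Ck_on_compose[OF open_UNIV open_UNIV Ck_on_peval_comp psi.smooth] by (simp add: o_def)
  have "flat m (\<lambda>z. peval p (\<phi> (\<psi> z)) - peval (pull m \<psi> (pull m \<phi> p)) z)"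
    using flat_add[OF psi.flat_comp[OF pull_flat[of p]] psi.pull_flat[of "pull m \<phi> p"]] by simp
  then have "pull m (\<phi> \<circ> \<psi>) p = pull m \<psi> (pull m \<phi> p)"
    unfolding pull_def[of m "\<phi> \<circ> \<psi>"] by (intro taylor_eqI[OF c] psi.pull_in_jets) simp
  then show ?thesis by simp
qed

end

lemma pull_id: "p \<in> jets m \<Longrightarrow> pull m (\<lambda>z. z) p = p"
  by (simp add: pull_def o_def taylor_peval)

lemma diffeo0_origin_map: "diffeo0 m \<phi> \<Longrightarrow> m \<ge> 1 \<Longrightarrow> origin_map m \<phi>"
  by (simp add: diffeo0_def origin_map_def)

lemma diffeo0_id: "diffeo0 m (\<lambda>z. z)"
proof -
  have "inv_into UNIV (\<lambda>z::real\<times>real. z) = (\<lambda>z. z)" by (rule ext) simp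
  then show ?thesis by (simp add: diffeo0_def Ck_on_ident bij_def)
qed

lemma diffeo0_inv: "diffeo0 m \<phi> \<Longrightarrow> diffeo0 m (inv_into UNIV \<phi>)"
  by (auto simp: diffeo0_def bij_imp_bij_inv inv_inv_eq inv_f_eq bij_is_inj)

lemma diffeo0_compose:
  assumes "diffeo0 m \<phi>" "diffeo0 m \<psi>"
  shows "diffeo0 m (\<phi> \<circ> \<psi>)"
proof -
  have b: "bij \<phi>" "bij \<psi>"
    and c: "Ck_on m UNIV \<phi>" "Ck_on m UNIV \<psi>" "Ck_on m UNIV (inv_into UNIV \<phi>)"
      "Ck_on m UNIV (inv_into UNIV \<psi>)" "\<phi> (0, 0) = (0, 0)" "\<psi> (0, 0) = (0, 0)"
    using assms unfolding diffeo0_def by blast+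
  have "inv_into UNIV (\<phi> \<circ> \<psi>) = inv_into UNIV \<psi> \<circ> inv_into UNIV \<phi>" by (rule o_inv_distrib[OF b])
  moreover have "Ck_on m UNIV (\<phi> \<circ> \<psi>)" "Ck_on m UNIV (inv_into UNIV \<psi> \<circ> inv_into UNIV \<phi>)"
    unfolding o_def by (rule Ck_on_compose[OF open_UNIV open_UNIV], fact c, fact c, simp)+
  moreover have "bij (\<phi> \<circ> \<psi>)" using b by (simp add: bij_comp)
  ultimately show ?thesis using c by (simp add: diffeo0_def)
qed

lemma equivalent_ideals_pull:
  "equivalent_ideals m I I' \<longleftrightarrow> (\<exists>\<phi>. diffeo0 m \<phi> \<and> I' = pull m \<phi> ` I)"
  by (simp add: equivalent_ideals_def pull_def[abs_def])

lemma pull_inv_pull: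
  assumes "diffeo0 m \<phi>" "m \<ge> 1" "p \<in> jets m"
  shows "pull m (inv_into UNIV \<phi>) (pull m \<phi> p) = p" "pull m \<phi> (pull m (inv_into UNIV \<phi>) p) = p"
proof -
  note o = diffeo0_origin_map[OF assms(1,2)] diffeo0_origin_map[OF diffeo0_inv[OF assms(1)] assms(2)]
  have "bij \<phi>" using assms(1) by (simp add: diffeo0_def)
  then have "\<phi> \<circ> inv_into UNIV \<phi> = (\<lambda>z. z)" "inv_into UNIV \<phi> \<circ> \<phi> = (\<lambda>z. z)"
    by (auto simp: fun_eq_iff bij_is_surj surj_f_inv_f bij_is_inj)
  then show "pull m (inv_into UNIV \<phi>) (pull m \<phi> p) = p" "pull m \<phi> (pull m (inv_into UNIV \<phi>) p) = p"
    using origin_map.pull_pull[OF o] origin_map.pull_pull[OF o(2,1)] pull_id[OF assms(3)] by simp_all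
qed

lemma equivalent_ideals_refl: "I \<subseteq> jets m \<Longrightarrow> equivalent_ideals m I I"
  unfolding equivalent_ideals_pull
  by (rule exI[of _ "\<lambda>z. z"]) (auto simp: diffeo0_id image_iff subset_iff pull_id)

lemma equivalent_ideals_trans:
  assumes "equivalent_ideals m I J" "equivalent_ideals m J K" "m \<ge> 1"
  shows "equivalent_ideals m I K"
proof -
  obtain \<phi> \<psi> where p: "diffeo0 m \<phi>" "J = pull m \<phi> ` I" "diffeo0 m \<psi>" "K = pull m \<psi> ` J"
    using assms unfolding equivalent_ideals_pull by blast
  have "K = pull m (\<phi> \<circ> \<psi>) ` I"
    unfolding p(2,4) image_image
    using origin_map.pull_pull[OF diffeo0_origin_map[OF p(1) assms(3)] diffeo0_origin_map[OF p(3) assms(3)]]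
    by simp
  then show ?thesis using diffeo0_compose[OF p(1,3)] unfolding equivalent_ideals_pull by blast
qed

lemma equivalent_ideals_sym:
  assumes "equivalent_ideals m I J" "I \<subseteq> jets m" "m \<ge> 1"
  shows "equivalent_ideals m J I"
proof -
  obtain \<phi> where p: "diffeo0 m \<phi>" "J = pull m \<phi> ` I" using assms unfolding equivalent_ideals_pull by blast
  have "I = pull m (inv_into UNIV \<phi>) ` J"
    unfolding p(2) image_image using assms(2) pull_inv_pull(1)[OF p(1) assms(3)] by (force simp: image_iff)
  then show ?thesis using diffeo0_inv[OF p(1)] unfolding equivalent_ideals_pull by blast
qed

text \<open>For closure under multiplication the multiplier \<open>r\<close> has to be a pulled jet;
  it is the pullback of its own pullback along the inverse map.\<close>

lemma pull_ideal:
  assumes "diffeo0 m \<phi>" "m \<ge> 1" "jet_ideal0 m I"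
  shows "jet_ideal0 m (pull m \<phi> ` I)"
proof -
  interpret origin_map m \<phi> by (rule diffeo0_origin_map[OF assms(1,2)])
  have I: "ideal I (jet_ring m)" "I \<subseteq> jets0 m" using assms(3) by (simp_all add: jet_ideal0_def)
  have "ideal (pull m \<phi> ` I) (jet_ring m)"
  proof (rule ideal_jet_ringI)
    have "pull m \<phi> 0 = 0" using pull_add[of 0 0] by simp
    then show "0 \<in> pull m \<phi> ` I" using ideal_jet_zero[OF I(1)] image_eqI[of 0 "pull m \<phi>" 0] by simp
    show "p + q \<in> pull m \<phi> ` I" if "p \<in> pull m \<phi> ` I" "q \<in> pull m \<phi> ` I" for p q
      using that by (auto simp: pull_add[symmetric] intro!: imageI ideal_jet_add[OF I(1)])
    show "jmult m r p \<in> pull m \<phi> ` I" if pI: "p \<in> pull m \<phi> ` I" and r: "r \<in> jets m" for p r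
    proof -
      obtain p' where p': "p = pull m \<phi> p'" "p' \<in> I" using pI by (elim imageE)
      let ?r = "pull m (inv_into UNIV \<phi>) r"
      have "?r \<in> jets m" by (simp add: pull_def taylor_in_jets)
      then have "jmult m ?r p' \<in> I" by (intro ideal_jet_mult[OF I(1)] p')
      moreover have "jmult m r p = pull m \<phi> (jmult m ?r p')"
        using pull_inv_pull(2)[OF assms(1,2) r] p' by (simp add: pull_jmult)
      ultimately show ?thesis by blast
    qed
  qed (use pull_in_jets in auto)
  then show ?thesis using I(2) pull_jets0 by (auto simp: jet_ideal0_def)
qed

text \<open>A homomorphism is determined by the images of x and y, which here are the component
  polynomials p and q themselves. The jet is written as a polynomial in x and y inside the jet ring,
  and \<open>pull\<close> is pushed through.\<close>

lemma pull_J3: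
  assumes "origin_map 3 \<phi>" "\<And>z. \<phi> z = (peval p z, peval q z)" "p \<in> jets0 3" "q \<in> jets0 3"
  shows "pull 3 \<phi> (J3 a b c d e f g h i) =
    const2 a * p + const2 b * q + const2 c * jmult 3 p p + const2 d * jmult 3 p q +
    const2 e * jmult 3 q q + const2 f * jmult 3 p (jmult 3 p p) + const2 g * jmult 3 p (jmult 3 p q) +
    const2 h * jmult 3 p (jmult 3 q q) + const2 i * jmult 3 q (jmult 3 q q)"
proof -
  interpret origin_map 3 \<phi> by fact
  have j: "p \<in> jets 3" "q \<in> jets 3" using assms(3,4) by (simp_all add: jets0_iff)
  have X: "pull 3 \<phi> (J3 1 0 0 0 0 0 0 0 0) = p" and Y: "pull 3 \<phi> (J3 0 1 0 0 0 0 0 0 0) = q"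
    by (rule pull_eqI, fact j, simp add: assms(2) peval_J3)+
  have "J3 a b c d e f g h i = const2 a * J3 1 0 0 0 0 0 0 0 0 + const2 b * J3 0 1 0 0 0 0 0 0 0
     + const2 c * jmult 3 (J3 1 0 0 0 0 0 0 0 0) (J3 1 0 0 0 0 0 0 0 0)
     + const2 d * jmult 3 (J3 1 0 0 0 0 0 0 0 0) (J3 0 1 0 0 0 0 0 0 0)
     + const2 e * jmult 3 (J3 0 1 0 0 0 0 0 0 0) (J3 0 1 0 0 0 0 0 0 0)
     + const2 f * jmult 3 (J3 1 0 0 0 0 0 0 0 0) (jmult 3 (J3 1 0 0 0 0 0 0 0 0) (J3 1 0 0 0 0 0 0 0 0))
     + const2 g * jmult 3 (J3 1 0 0 0 0 0 0 0 0) (jmult 3 (J3 1 0 0 0 0 0 0 0 0) (J3 0 1 0 0 0 0 0 0 0))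
     + const2 h * jmult 3 (J3 1 0 0 0 0 0 0 0 0) (jmult 3 (J3 0 1 0 0 0 0 0 0 0) (J3 0 1 0 0 0 0 0 0 0))
     + const2 i * jmult 3 (J3 0 1 0 0 0 0 0 0 0) (jmult 3 (J3 0 1 0 0 0 0 0 0 0) (J3 0 1 0 0 0 0 0 0 0))"
    by (simp add: jmult_J3 J3_cmult J3_add)
  then show ?thesis by (simp only: pull_add pull_cmult pull_jmult X Y)
qed

section \<open>Linear maps and shears as coordinate changes\<close>

definition linmap :: "real \<Rightarrow> real \<Rightarrow> real \<Rightarrow> real \<Rightarrow> real \<times> real \<Rightarrow> real \<times> real" where
  "linmap a b c d = (\<lambda>z. (a * fst z + b * snd z, c * fst z + d * snd z))"

text \<open>The linear part is the identity. With x as linear part of a jet, \<alpha> and \<beta>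
  can remove y^2 and y^3; with x^2 or xy as quadratic part, \<alpha> can remove x y^2 or y^3,
  respectively.\<close>

definition shear :: "real \<Rightarrow> real \<Rightarrow> real \<times> real \<Rightarrow> real \<times> real" where
  "shear \<alpha> \<beta> = (\<lambda>z. (fst z + \<alpha> * snd z ^ 2 + \<beta> * snd z ^ 3, snd z))"

lemma Ck_on_linmap: "Ck_on m UNIV (linmap a b c d)"
  unfolding linmap_def by (intro Ck_on_Pair Ck_on_intros open_UNIV)

lemma Ck_on_shear: "Ck_on m UNIV (shear \<alpha> \<beta>)"
  unfolding shear_def by (intro Ck_on_Pair Ck_on_intros open_UNIV)

lemma linmap_inverse:
  assumes "a * d - b * c \<noteq> 0"
  defines "D \<equiv> a * d - b * c"
  shows "linmap a b c d (linmap (d / D) (- b / D) (- c / D) (a / D) z) = z"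
    "linmap (d / D) (- b / D) (- c / D) (a / D) (linmap a b c d z) = z"
proof -
  obtain x y where z: "z = (x, y)" by fastforce
  have D: "D \<noteq> 0" using assms by simp
  have "a * (d / D * x + - b / D * y) + b * (- c / D * x + a / D * y) = (a * d - b * c) / D * x"
    "c * (d / D * x + - b / D * y) + d * (- c / D * x + a / D * y) = (a * d - b * c) / D * y"
    "d / D * (a * x + b * y) + - b / D * (c * x + d * y) = (a * d - b * c) / D * x"
    "- c / D * (a * x + b * y) + a / D * (c * x + d * y) = (a * d - b * c) / D * y"
    by (simp_all add: diff_divide_distrib algebra_simps)
  moreover have "(a * d - b * c) / D = 1" using D D_def by simp
  ultimately show "linmap a b c d (linmap (d / D) (- b / D) (- c / D) (a / D) z) = z"
    "linmap (d / D) (- b / D) (- c / D) (a / D) (linmap a b c d z) = z"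
    by (simp_all add: z linmap_def)
qed

lemma inv_linmap:
  assumes "a * d - b * c \<noteq> 0"
  defines "D \<equiv> a * d - b * c"
  shows "inv_into UNIV (linmap a b c d) = linmap (d / D) (- b / D) (- c / D) (a / D)" "bij (linmap a b c d)"
proof -
  let ?g = "linmap (d / D) (- b / D) (- c / D) (a / D)"
  have 1: "linmap a b c d \<circ> ?g = id" "?g \<circ> linmap a b c d = id"
    using linmap_inverse[OF assms(1)] by (auto simp: fun_eq_iff D_def)
  show "inv_into UNIV (linmap a b c d) = ?g" using inv_unique_comp[OF 1] .
  show "bij (linmap a b c d)" using o_bij[OF 1(2,1)] .
qed

lemma diffeo0_linmap: "a * d - b * c \<noteq> 0 \<Longrightarrow> diffeo0 m (linmap a b c d)"
  unfolding diffeo0_def by (auto simp: inv_linmap Ck_on_linmap) (simp add: linmap_def)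

lemma diffeo0_shear: "diffeo0 m (shear \<alpha> \<beta>)"
proof -
  have 1: "shear \<alpha> \<beta> \<circ> shear (- \<alpha>) (- \<beta>) = id" "shear (- \<alpha>) (- \<beta>) \<circ> shear \<alpha> \<beta> = id"
    by (auto simp: shear_def fun_eq_iff)
  show ?thesis
    unfolding diffeo0_def inv_unique_comp[OF 1] using o_bij[OF 1(2,1)]
    by (auto simp: Ck_on_shear) (simp add: shear_def)
qed

lemma pull_linmap_J3:
  "pull 3 (linmap \<alpha> \<beta> \<gamma> \<delta>) (J3 a b c d e f g h i) =
    J3 (a * \<alpha> + b * \<gamma>) (a * \<beta> + b * \<delta>)
      (c * \<alpha>\<^sup>2 + d * \<alpha> * \<gamma> + e * \<gamma>\<^sup>2) (2 * c * \<alpha> * \<beta> + d * (\<alpha> * \<delta> + \<beta> * \<gamma>) + 2 * e * \<gamma> * \<delta>)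
      (c * \<beta>\<^sup>2 + d * \<beta> * \<delta> + e * \<delta>\<^sup>2)
      (f * \<alpha> ^ 3 + g * \<alpha>\<^sup>2 * \<gamma> + h * \<alpha> * \<gamma>\<^sup>2 + i * \<gamma> ^ 3)
      (3 * f * \<alpha>\<^sup>2 * \<beta> + g * (\<alpha>\<^sup>2 * \<delta> + 2 * \<alpha> * \<beta> * \<gamma>) + h * (2 * \<alpha> * \<gamma> * \<delta> + \<beta> * \<gamma>\<^sup>2) + 3 * i * \<gamma>\<^sup>2 * \<delta>)
      (3 * f * \<alpha> * \<beta>\<^sup>2 + g * (2 * \<alpha> * \<beta> * \<delta> + \<beta>\<^sup>2 * \<gamma>) + h * (\<alpha> * \<delta>\<^sup>2 + 2 * \<beta> * \<gamma> * \<delta>) + 3 * i * \<gamma> * \<delta>\<^sup>2)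
      (f * \<beta> ^ 3 + g * \<beta>\<^sup>2 * \<delta> + h * \<beta> * \<delta>\<^sup>2 + i * \<delta> ^ 3)"
proof -
  have eq: "linmap \<alpha> \<beta> \<gamma> \<delta> z = (peval (J3 \<alpha> \<beta> 0 0 0 0 0 0 0) z, peval (J3 \<gamma> \<delta> 0 0 0 0 0 0 0) z)" for z
    by (cases z) (simp add: linmap_def peval_J3)
  have o: "origin_map 3 (linmap \<alpha> \<beta> \<gamma> \<delta>)"
    by (simp add: origin_map_def Ck_on_linmap) (simp add: linmap_def)
  show ?thesis
    unfolding pull_J3[OF o eq J3_in_jets0 J3_in_jets0] jmult_J3 J3_add J3_cmult J3_eq_iff
    by (simp add: power2_eq_square power3_eq_cube algebra_simps)
qed

lemma pull_shear_J3:
  "pull 3 (shear \<alpha> \<beta>) (J3 a b c d e f g h i) =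
    J3 a b c d (e + a * \<alpha>) f g (h + 2 * c * \<alpha>) (i + a * \<beta> + d * \<alpha>)"
proof -
  have eq: "shear \<alpha> \<beta> z = (peval (J3 1 0 0 0 \<alpha> 0 0 0 \<beta>) z, peval (J3 0 1 0 0 0 0 0 0 0) z)" for z
    by (cases z) (simp add: shear_def peval_J3)
  have o: "origin_map 3 (shear \<alpha> \<beta>)"
    by (simp add: origin_map_def Ck_on_shear) (simp add: shear_def)
  show ?thesis
    unfolding pull_J3[OF o eq J3_in_jets0 J3_in_jets0] jmult_J3 J3_add J3_cmult J3_eq_iff
    by (simp add: algebra_simps)
qed

section \<open>Allowed directions\<close>

text \<open>Half the aperture serves for nearby directions. This openness makes \<open>Allow\<close>
  compact.\<close>

lemma forbidden_direction_open:
  assumes "forbidden_direction m I \<omega>"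
  shows "\<exists>\<delta>>0. \<forall>\<omega>'. norm (\<omega>' - \<omega>) < \<delta> \<longrightarrow> forbidden_direction m I \<omega>'"
proof -
  obtain ps c \<delta> r where *: "set ps \<subseteq> I" "c > 0" "\<delta> > 0" "r > 0"
    "\<forall>z\<in>cone_nbhd \<omega> \<delta> r. (\<Sum>p\<leftarrow>ps. \<bar>peval p z\<bar>) > c * norm z ^ m"
    using assms unfolding forbidden_direction_def by blast
  have "forbidden_direction m I \<omega>'" if "norm (\<omega>' - \<omega>) < \<delta> / 2" for \<omega>'
  proof -
    have "cone_nbhd \<omega>' (\<delta> / 2) r \<subseteq> cone_nbhd \<omega> \<delta> r"
    proof
      fix z assume z: "z \<in> cone_nbhd \<omega>' (\<delta> / 2) r"
      have "norm (z /\<^sub>R norm z - \<omega>) \<le> norm (z /\<^sub>R norm z - \<omega>') + norm (\<omega>' - \<omega>)"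
        using norm_triangle_ineq[of "z /\<^sub>R norm z - \<omega>'" "\<omega>' - \<omega>"] by simp
      then show "z \<in> cone_nbhd \<omega> \<delta> r" using z that by (simp add: cone_nbhd_def)
    qed
    then show ?thesis
      unfolding forbidden_direction_def using *
      by (intro exI[of _ ps] exI[of _ c] exI[of _ "\<delta> / 2"] exI[of _ r]) auto
  qed
  then show ?thesis using *(3) by (intro exI[of _ "\<delta> / 2"]) auto
qed

lemma compact_Allow: "compact (Allow m I)"
proof -
  have "open {\<omega>. forbidden_direction m I \<omega>}"
    unfolding open_dist using forbidden_direction_open by (auto simp: dist_norm)
  moreover have "Allow m I = sphere (0, 0) 1 - {\<omega>. forbidden_direction m I \<omega>}"
    by (auto simp: Allow_def)
  ultimately show ?thesis by (simp add: compact_diff)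
qed

lemma sum_list_append_ge:
  fixes f :: "'a \<Rightarrow> real"
  shows "max (\<Sum>p\<leftarrow>ps. \<bar>f p\<bar>) (\<Sum>p\<leftarrow>qs. \<bar>f p\<bar>) \<le> (\<Sum>p\<leftarrow>ps @ qs. \<bar>f p\<bar>)"
  by (auto intro!: sum_list_nonneg)

text \<open>Compactness of the unit circle: finitely many cones cover all directions. Their lists of
  jets are concatenated, which can only enlarge the sum, and the smallest constant and radius are
  taken.\<close>

lemma all_directions_forbidden_imp_uniform:
  assumes "\<And>\<omega>. norm \<omega> = 1 \<Longrightarrow> forbidden_direction m I \<omega>"
  shows "\<exists>ps c r. set ps \<subseteq> I \<and> c > 0 \<and> r > 0 \<and>
    (\<forall>z. 0 < norm z \<and> norm z < r \<longrightarrow> (\<Sum>p\<leftarrow>ps. \<bar>peval p z\<bar>) > c * norm z ^ m)"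
proof -
  define good where "good T \<longleftrightarrow> (\<exists>ps c r. set ps \<subseteq> I \<and> c > 0 \<and> r > 0 \<and>
    (\<forall>z. 0 < norm z \<and> norm z < r \<and> z /\<^sub>R norm z \<in> T \<longrightarrow> (\<Sum>p\<leftarrow>ps. \<bar>peval p z\<bar>) > c * norm z ^ m))" for T
  have good_Un: "good (S \<union> T)" if ST: "good S" "good T" for S T
  proof -
    obtain ps c r where 1: "set ps \<subseteq> I" "c > 0" "r > 0"
      "\<And>z. 0 < norm z \<Longrightarrow> norm z < r \<Longrightarrow> z /\<^sub>R norm z \<in> S \<Longrightarrow> (\<Sum>p\<leftarrow>ps. \<bar>peval p z\<bar>) > c * norm z ^ m"
      using ST(1) unfolding good_def by blast
    obtain qs c' r' where 2: "set qs \<subseteq> I" "c' > 0" "r' > 0"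
      "\<And>z. 0 < norm z \<Longrightarrow> norm z < r' \<Longrightarrow> z /\<^sub>R norm z \<in> T \<Longrightarrow> (\<Sum>p\<leftarrow>qs. \<bar>peval p z\<bar>) > c' * norm z ^ m"
      using ST(2) unfolding good_def by blast
    have "(\<Sum>p\<leftarrow>ps @ qs. \<bar>peval p z\<bar>) > min c c' * norm z ^ m"
      if z: "0 < norm z" "norm z < min r r'" "z /\<^sub>R norm z \<in> S \<union> T" for z
    proof -
      have m: "min c c' * norm z ^ m \<le> c * norm z ^ m" "min c c' * norm z ^ m \<le> c' * norm z ^ m"
        by (intro mult_right_mono; simp)+
      have s: "(\<Sum>p\<leftarrow>ps. \<bar>peval p z\<bar>) \<le> (\<Sum>p\<leftarrow>ps @ qs. \<bar>peval p z\<bar>)"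
        "(\<Sum>p\<leftarrow>qs. \<bar>peval p z\<bar>) \<le> (\<Sum>p\<leftarrow>ps @ qs. \<bar>peval p z\<bar>)"
        using sum_list_append_ge[where f = "\<lambda>p. peval p z" and ps = ps and qs = qs]
        by (simp_all only: max.bounded_iff)
      have r: "norm z < r" "norm z < r'" using z(2) by simp_all
      show ?thesis using z(3)
      proof (elim UnE)
        assume "z /\<^sub>R norm z \<in> S"
        from 1(4)[OF z(1) r(1) this] show ?thesis using m(1) s(1) by linarith
      next
        assume "z /\<^sub>R norm z \<in> T"
        from 2(4)[OF z(1) r(2) this] show ?thesis using m(2) s(2) by linarith
      qed
    qed
    then show ?thesis unfolding good_def using 1 2
      by (intro exI[of _ "ps @ qs"] exI[of _ "min c c'"] exI[of _ "min r r'"]) auto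
  qed
  have "\<exists>\<delta>>0. good (ball \<omega> \<delta>)" if n: "norm \<omega> = 1" for \<omega>
  proof -
    obtain ps c \<delta> r where *: "set ps \<subseteq> I" "c > 0" "\<delta> > 0" "r > 0"
      "\<forall>z\<in>cone_nbhd \<omega> \<delta> r. (\<Sum>p\<leftarrow>ps. \<bar>peval p z\<bar>) > c * norm z ^ m"
      using assms[OF n] unfolding forbidden_direction_def by blast
    have "good (ball \<omega> \<delta>)" unfolding good_def
      using * by (intro exI[of _ ps] exI[of _ c] exI[of _ r])
        (auto simp: cone_nbhd_def dist_norm norm_minus_commute)
    then show ?thesis using *(3) by blast
  qed
  then obtain \<delta> where \<delta>: "\<And>\<omega>. norm \<omega> = 1 \<Longrightarrow> \<delta> \<omega> > 0 \<and> good (ball \<omega> (\<delta> \<omega>))" by metis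
  have cpt: "compact (sphere (0::real \<times> real) 1)" by simp
  have cov: "sphere (0::real \<times> real) 1 \<subseteq> (\<Union>\<omega>\<in>sphere 0 1. ball \<omega> (\<delta> \<omega>))" using \<delta> by fastforce
  obtain C where C: "C \<subseteq> sphere 0 1" "finite C" "sphere 0 1 \<subseteq> (\<Union>\<omega>\<in>C. ball \<omega> (\<delta> \<omega>))"
    by (rule compactE_image[OF cpt _ cov, of thesis]) auto
  have "good (\<Union>\<omega>\<in>C. ball \<omega> (\<delta> \<omega>))"
    using C(2,1)
  proof (induction C)
    case empty
    show ?case unfolding good_def by (auto intro!: exI[of _ "[]"] exI[of _ 1])
  next
    case (insert \<omega> C)
    then show ?case using good_Un[of "ball \<omega> (\<delta> \<omega>)"] \<delta>[of \<omega>] by simp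
  qed
  then obtain ps c r where 1: "set ps \<subseteq> I" "c > 0" "r > 0"
    "\<And>z. 0 < norm z \<Longrightarrow> norm z < r \<Longrightarrow> z /\<^sub>R norm z \<in> (\<Union>\<omega>\<in>C. ball \<omega> (\<delta> \<omega>)) \<Longrightarrow>
      (\<Sum>p\<leftarrow>ps. \<bar>peval p z\<bar>) > c * norm z ^ m"
    unfolding good_def by blast
  have "z /\<^sub>R norm z \<in> (\<Union>\<omega>\<in>C. ball \<omega> (\<delta> \<omega>))" if "0 < norm z" for z :: "real \<times> real"
    by (rule subsetD[OF C(3)]) (use that in simp)
  then show ?thesis using 1 by blast
qed

lemma uniform_imp_Allow_empty:
  assumes "set ps \<subseteq> I" "c > 0" "r > 0"
    "\<And>z. 0 < norm z \<Longrightarrow> norm z < r \<Longrightarrow> (\<Sum>p\<leftarrow>ps. \<bar>peval p z\<bar>) > c * norm z ^ m"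
  shows "Allow m I = {}"
proof -
  have "forbidden_direction m I \<omega>" for \<omega>
    unfolding forbidden_direction_def
    by (intro exI[of _ ps] exI[of _ c] exI[of _ 1] exI[of _ r]) (use assms in \<open>auto simp: cone_nbhd_def\<close>)
  then show ?thesis by (simp add: Allow_def)
qed

lemma sum_list_abs_diff:
  fixes f g :: "'a \<Rightarrow> real"
  assumes "\<And>p. p \<in> set ps \<Longrightarrow> \<bar>f p - g p\<bar> \<le> e"
  shows "(\<Sum>p\<leftarrow>ps. \<bar>g p\<bar>) \<le> (\<Sum>p\<leftarrow>ps. \<bar>f p\<bar>) + real (length ps) * e"
  using assms
proof (induction ps)
  case (Cons p ps)
  have "\<bar>f p - g p\<bar> \<le> e" using Cons.prems by simp
  then have "\<bar>g p\<bar> \<le> \<bar>f p\<bar> + e" by linarith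
  moreover have "(\<Sum>p\<leftarrow>ps. \<bar>g p\<bar>) \<le> (\<Sum>p\<leftarrow>ps. \<bar>f p\<bar>) + real (length ps) * e" using Cons by simp
  ultimately show ?case by (simp add: algebra_simps)
qed simp

text \<open>Following single directions through the differential of \<phi> is avoided. If all
  directions are forbidden, a lower bound c |z|^m holds on a full punctured disc; it survives a
  change of variables with linear bounds in both senses, since pulled jets differ from compositions
  only by o(|z|^m).\<close>

lemma Allow_empty_pull:
  assumes "diffeo0 m \<phi>" "m \<ge> 1" "\<And>\<omega>. norm \<omega> = 1 \<Longrightarrow> forbidden_direction m (pull m \<phi> ` I) \<omega>"
  shows "Allow m I = {}"
proof -
  interpret origin_map m \<phi> by (rule diffeo0_origin_map[OF assms(1,2)])
  interpret psi: origin_map m "inv_into UNIV \<phi>"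
    by (rule diffeo0_origin_map[OF diffeo0_inv[OF assms(1)] assms(2)])
  let ?\<psi> = "inv_into UNIV \<phi>"
  have inv: "\<phi> (?\<psi> w) = w" for w
    using assms(1) by (simp add: diffeo0_def bij_is_surj surj_f_inv_f)
  have "\<exists>qs c r. set qs \<subseteq> pull m \<phi> ` I \<and> c > 0 \<and> r > 0 \<and>
      (\<forall>z. 0 < norm z \<and> norm z < r \<longrightarrow> (\<Sum>p\<leftarrow>qs. \<bar>peval p z\<bar>) > c * norm z ^ m)"
    by (rule all_directions_forbidden_imp_uniform, rule assms(3))
  then obtain qs c r where q0: "set qs \<subseteq> pull m \<phi> ` I \<and> c > 0 \<and> r > 0 \<and>
      (\<forall>z. 0 < norm z \<and> norm z < r \<longrightarrow> (\<Sum>p\<leftarrow>qs. \<bar>peval p z\<bar>) > c * norm z ^ m)"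
    by (elim exE)
  have q: "set qs \<subseteq> pull m \<phi> ` I" "c > 0" "r > 0" using q0 by (simp_all only: simp_thms)
  have q4: "(\<Sum>p\<leftarrow>qs. \<bar>peval p z\<bar>) > c * norm z ^ m" if "0 < norm z" "norm z < r" for z
    using q0[THEN conjunct2, THEN conjunct2, THEN conjunct2, THEN spec, of z] that by simp
  define ps where "ps = map (inv_into I (pull m \<phi>)) qs"
  have "map (\<lambda>x. pull m \<phi> (inv_into I (pull m \<phi>) x)) qs = qs"
    by (rule map_idI, rule f_inv_into_f, erule subsetD[OF q(1)])
  then have ps1: "qs = map (pull m \<phi>) ps" by (simp add: ps_def o_def)
  have ps2: "set ps \<subseteq> I"
  proof
    fix p assume "p \<in> set ps"
    then obtain q where "q \<in> set qs" "p = inv_into I (pull m \<phi>) q" by (auto simp: ps_def)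
    then show "p \<in> I" using inv_into_into[OF subsetD[OF q(1)]] by simp
  qed
  note ps = ps1 ps2
  \<comment> \<open>With this \<open>e\<close> the errors of all jets in \<open>ps\<close> together
    consume at most half of c.\<close>
  define e where "e = c / (2 * (real (length ps) + 1))"
  have e: "e > 0" "real (length ps) * e \<le> c / 2" using q(2) by (auto simp: e_def field_simps)
  have "\<exists>d>0. \<forall>p\<in>set ps. \<forall>z. norm z < d \<longrightarrow> \<bar>peval p (\<phi> z) - peval (pull m \<phi> p) z\<bar> \<le> e * norm z ^ m"
  proof (induction ps)
    case (Cons p ps)
    then obtain d d' where "d > 0" "\<forall>p\<in>set ps. \<forall>z. norm z < d \<longrightarrow> \<bar>peval p (\<phi> z) - peval (pull m \<phi> p) z\<bar> \<le> e * norm z ^ m"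
      "d' > 0" "\<forall>z. norm z < d' \<longrightarrow> \<bar>peval p (\<phi> z) - peval (pull m \<phi> p) z\<bar> \<le> e * norm z ^ m"
      using flatD[OF pull_flat e(1)] by metis
    then show ?case by (intro exI[of _ "min d d'"]) auto
  qed (auto intro: exI[of _ 1])
  then obtain d where d: "d > 0"
    "\<And>p z. p \<in> set ps \<Longrightarrow> norm z < d \<Longrightarrow> \<bar>peval p (\<phi> z) - peval (pull m \<phi> p) z\<bar> \<le> e * norm z ^ m"
    by blast
  obtain C s where C: "C > 0" "s > 0" "\<And>z. norm z < s \<Longrightarrow> norm (\<phi> z) \<le> C * norm z"
    using linear_bound by blast
  obtain C' s' where C': "C' > 0" "s' > 0" "\<And>z. norm z < s' \<Longrightarrow> norm (?\<psi> z) \<le> C' * norm z"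
    using psi.linear_bound by blast
  define t where "t = min d (min r s)"
  have t: "t > 0" using d(1) q(3) C(2) by (simp add: t_def)
  show ?thesis
  proof (rule uniform_imp_Allow_empty[OF ps(2)])
    \<comment> \<open>The factor (C + 1)^m converts |z| into |w|; it is applied to the half of c
      that the errors leave.\<close>
    show "c / (2 * (C + 1) ^ m) / 2 > 0" using q(2) C by simp
    show "min s' (t / C') > 0" using t C' by simp
    fix w :: "real \<times> real" assume w: "0 < norm w" "norm w < min s' (t / C')"
    define z where "z = ?\<psi> w"
    have wz: "w = \<phi> z" using inv z_def by simp
    have "norm z \<le> C' * norm w" using C'(3)[of w] w z_def by simp
    also have "\<dots> < t" using w C' by (simp add: field_simps)
    finally have zt: "norm z < t" .
    have wC: "norm w \<le> C * norm z" using C(3)[of z] zt wz by (simp add: t_def)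
    then have z0: "norm z > 0" using w(1) C(1) by (metis less_le_trans zero_less_mult_pos)
    have "c * norm z ^ m < (\<Sum>p\<leftarrow>qs. \<bar>peval p z\<bar>)" using q4[OF z0] zt by (simp add: t_def)
    also have "\<dots> = (\<Sum>p\<leftarrow>ps. \<bar>peval (pull m \<phi> p) z\<bar>)" by (simp add: ps(1) o_def)
    also have "\<dots> \<le> (\<Sum>p\<leftarrow>ps. \<bar>peval p w\<bar>) + real (length ps) * (e * norm z ^ m)"
      unfolding wz by (rule sum_list_abs_diff) (use d(2) zt in \<open>auto simp: t_def\<close>)
    also have "\<dots> \<le> (\<Sum>p\<leftarrow>ps. \<bar>peval p w\<bar>) + c / 2 * norm z ^ m"
      using mult_right_mono[OF e(2), of "norm z ^ m"] by simp
    finally have 1: "c / 2 * norm z ^ m < (\<Sum>p\<leftarrow>ps. \<bar>peval p w\<bar>)" by (simp add: field_simps)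
    have "norm w ^ m \<le> ((C + 1) * norm z) ^ m"
      using wC norm_ge_zero[of z] unfolding distrib_right by (intro power_mono) (linarith, simp)
    then have "c / (2 * (C + 1) ^ m) / 2 * norm w ^ m \<le> c / (2 * (C + 1) ^ m) / 2 * ((C + 1) * norm z) ^ m"
      using q(2) C by (intro mult_left_mono) auto
    also have "\<dots> = c / 4 * norm z ^ m"
      using C(1) by (simp add: power_mult_distrib)
    also have "\<dots> \<le> c / 2 * norm z ^ m" using q(2) by (intro mult_right_mono) auto
    finally show "(\<Sum>p\<leftarrow>ps. \<bar>peval p w\<bar>) > c / (2 * (C + 1) ^ m) / 2 * norm w ^ m" using 1 by simp
  qed
qed

text \<open>Without allowed directions the decomposition is required at no point, so the empty list
  of jets together with F = 0 implies every jet.\<close>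

lemma closed_Allow_empty:
  assumes "closed_ideal m I" "Allow m I = {}"
  shows "I = jets0 m"
proof -
  have "implied_jet m I p" for p
    unfolding implied_jet_def
    by (rule exI[of _ 1], rule exI[of _ "[]"]) (use assms(2) in \<open>auto intro!: exI[of _ 1] exI[of _ "\<lambda>_. 0"]\<close>)
  then show ?thesis using assms(1) by (auto simp: closed_ideal_def jet_ideal0_def)
qed

lemma closed_all_directions_forbidden:
  assumes "closed_ideal m I" "m \<ge> 1" "diffeo0 m \<phi>"
    "\<And>\<omega>. norm \<omega> = 1 \<Longrightarrow> forbidden_direction m (pull m \<phi> ` I) \<omega>"
  shows "I = jets0 m"
  using closed_Allow_empty[OF assms(1) Allow_empty_pull[OF assms(3,2,4)]] .

text \<open>Positive factors are the right notion here, as points are compared only with their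
  rescalings by 1 / \<rho> and by the norm.\<close>

definition homogeneous :: "nat \<Rightarrow> (real \<times> real \<Rightarrow> real) \<Rightarrow> bool" where
  "homogeneous d f \<longleftrightarrow> (\<forall>s>0. \<forall>z. f (s *\<^sub>R z) = s ^ d * f z)"

text \<open>Near \<omega> the leading form is at least a constant times |z|^d, the rest is o(|z|^d),
  and |z|^d >= |z|^m for |z| < 1.\<close>

lemma forbidden_leading_part:
  assumes "p \<in> I" "d \<le> m" "homogeneous d Q" "continuous_on UNIV Q" "flat d (\<lambda>z. peval p z - Q z)"
    "Q \<omega> \<noteq> 0"
  shows "forbidden_direction m I \<omega>"
proof -
  define k where "k = \<bar>Q \<omega>\<bar>"
  have k: "k > 0" using assms(6) by (simp add: k_def)
  have "continuous (at \<omega>) Q" using assms(4) continuous_on_eq_continuous_at[OF open_UNIV] by (metis UNIV_I)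
  then obtain \<delta> where \<delta>: "\<delta> > 0" "\<And>z. dist z \<omega> < \<delta> \<Longrightarrow> dist (Q z) (Q \<omega>) < k / 2"
    unfolding continuous_at_eps_delta using k by (metis half_gt_zero)
  obtain r where r: "r > 0" "\<And>z. norm z < r \<Longrightarrow> \<bar>peval p z - Q z\<bar> \<le> k / 4 * norm z ^ d"
    using flatD[OF assms(5), of "k / 4"] k by auto
  \<comment> \<open>Continuity leaves k/2 for the leading form, the remainder costs k/4, and k/8
    makes the final inequality strict.\<close>
  have "\<bar>peval p z\<bar> > k / 8 * norm z ^ m" if z: "z \<in> cone_nbhd \<omega> \<delta> (min r 1)" for z
  proof -
    have n: "0 < norm z" "norm z < r" "norm z < 1" "dist (z /\<^sub>R norm z) \<omega> < \<delta>"
      using z by (auto simp: cone_nbhd_def dist_norm)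
    have "Q z = norm z ^ d * Q (z /\<^sub>R norm z)"
      using assms(3) n(1) unfolding homogeneous_def by (metis n(1) right_inverse scaleR_one scaleR_scaleR less_irrefl)
    moreover have "\<bar>Q (z /\<^sub>R norm z)\<bar> \<ge> k / 2"
      using \<delta>(2)[OF n(4)] unfolding dist_real_def k_def by linarith
    ultimately have "\<bar>Q z\<bar> \<ge> norm z ^ d * (k / 2)"
      using mult_left_mono[of "k / 2" "\<bar>Q (z /\<^sub>R norm z)\<bar>" "norm z ^ d"] by (simp add: abs_mult)
    moreover have "\<bar>Q z\<bar> \<le> \<bar>peval p z\<bar> + \<bar>peval p z - Q z\<bar>" by linarith
    ultimately have "\<bar>peval p z\<bar> \<ge> k / 4 * norm z ^ d" using r(2)[OF n(2)] by (simp add: algebra_simps)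
    moreover have "k / 8 * norm z ^ m \<le> k / 8 * norm z ^ d"
      using n k assms(2) by (intro mult_left_mono power_decreasing) auto
    moreover have "k / 8 * norm z ^ d < k / 4 * norm z ^ d" using k n(1) by simp
    ultimately show ?thesis by linarith
  qed
  then show ?thesis
    unfolding forbidden_direction_def using assms(1) k \<delta>(1) r(1)
    by (intro exI[of _ "[p]"] exI[of _ "k / 8"] exI[of _ \<delta>] exI[of _ "min r 1"]) auto
qed

lemma
  shows homogeneous_J3_1: "homogeneous 1 (peval (J3 a b 0 0 0 0 0 0 0))"
    and homogeneous_J3_2: "homogeneous 2 (peval (J3 0 0 c d e 0 0 0 0))"
    and homogeneous_J3_3: "homogeneous 3 (peval (J3 0 0 0 0 0 f g h i))"
  by (auto simp: homogeneous_def peval_J3 algebra_simps power2_eq_square power3_eq_cube)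

lemma continuous_peval: "continuous_on UNIV (peval p)"
  using Ck_on_peval[of 0 p] by simp

lemma
  shows flat_J3_1: "flat 1 (\<lambda>z. peval (J3 a b c d e f g h i) z - peval (J3 a b 0 0 0 0 0 0 0) z)"
    and flat_J3_2: "flat 2 (\<lambda>z. peval (J3 0 0 c d e f g h i) z - peval (J3 0 0 c d e 0 0 0 0) z)"
  unfolding peval_diff[symmetric] by (rule flat_peval_high, auto simp: lookup_minus lookup_J3)+

lemma
  shows forbidden_J3_1: "J3 a b c d e f g h i \<in> J \<Longrightarrow> a * u + b * v \<noteq> 0 \<Longrightarrow> forbidden_direction 3 J (u, v)"
    and forbidden_J3_2: "J3 0 0 c d e f g h i \<in> J \<Longrightarrow> c * u\<^sup>2 + d * u * v + e * v\<^sup>2 \<noteq> 0 \<Longrightarrow>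
      forbidden_direction 3 J (u, v)"
    and forbidden_J3_3: "J3 0 0 0 0 0 f g h i \<in> J \<Longrightarrow>
      f * u ^ 3 + g * u\<^sup>2 * v + h * u * v\<^sup>2 + i * v ^ 3 \<noteq> 0 \<Longrightarrow> forbidden_direction 3 J (u, v)"
proof -
  show "J3 a b c d e f g h i \<in> J \<Longrightarrow> a * u + b * v \<noteq> 0 \<Longrightarrow> forbidden_direction 3 J (u, v)"
    by (rule forbidden_leading_part[OF _ _ homogeneous_J3_1 continuous_peval flat_J3_1])
       (assumption, simp, simp add: peval_J3)
  show "J3 0 0 c d e f g h i \<in> J \<Longrightarrow> c * u\<^sup>2 + d * u * v + e * v\<^sup>2 \<noteq> 0 \<Longrightarrow> forbidden_direction 3 J (u, v)"
    by (rule forbidden_leading_part[OF _ _ homogeneous_J3_2 continuous_peval flat_J3_2])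
       (assumption, simp, simp add: peval_J3)
  show "J3 0 0 0 0 0 f g h i \<in> J \<Longrightarrow> f * u ^ 3 + g * u\<^sup>2 * v + h * u * v\<^sup>2 + i * v ^ 3 \<noteq> 0 \<Longrightarrow>
      forbidden_direction 3 J (u, v)"
    by (rule forbidden_leading_part[OF _ order_refl homogeneous_J3_3 continuous_peval,
          of "J3 0 0 0 0 0 f g h i" _ f g h i]) (assumption, simp, simp add: peval_J3)
qed

section \<open>Implied jets\<close>

text \<open>The positive part raised to a real power, of class C^k for every exponent above k. The
  exponent m + 1 gives the cutoff in the quotient argument; half-integers describe monomials on
  cusps.\<close>

definition pos_powr :: "real \<Rightarrow> real \<Rightarrow> real" where
  "pos_powr a t = max 0 t powr a"

lemma pos_powr_nonneg: "pos_powr a t \<ge> 0"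
  by (simp add: pos_powr_def)

lemma pos_powr_eq_0_iff: "pos_powr a t = 0 \<longleftrightarrow> t \<le> 0"
  by (auto simp: pos_powr_def max_def)

lemma has_derivative_pos_powr:
  assumes "a > 1"
  shows "(pos_powr a has_real_derivative a * pos_powr (a - 1) t) (at t)"
proof (cases t "0::real" rule: linorder_cases)
  case less
  have "((\<lambda>_. 0) has_real_derivative 0) (at t)" by simp
  then have "(pos_powr a has_real_derivative 0) (at t)"
    by (rule has_field_derivative_transform_within_open[of _ _ _ "{..<0}"])
       (use less in \<open>auto simp: pos_powr_def\<close>)
  then show ?thesis using less by (simp add: pos_powr_def)
next
  case greater
  have "((\<lambda>t. t powr a) has_real_derivative a * t powr (a - 1)) (at t)"
    using greater by (rule has_real_derivative_powr)
  then have "(pos_powr a has_real_derivative a * t powr (a - 1)) (at t)"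
    by (rule has_field_derivative_transform_within_open[of _ _ _ "{0<..}"])
       (use greater in \<open>auto simp: pos_powr_def\<close>)
  then show ?thesis using greater by (simp add: pos_powr_def)
next
  case equal
  have "((\<lambda>h. pos_powr a h / h) \<longlongrightarrow> 0) (at 0)"
  proof (rule Lim_null_comparison)
    have "\<bar>pos_powr a h / h\<bar> \<le> \<bar>h\<bar> powr (a - 1)" if "h \<noteq> 0" for h
    proof (cases "h > 0")
      case True
      then show ?thesis by (simp add: pos_powr_def powr_diff)
    next
      case False
      then have "pos_powr a h = 0" by (simp add: pos_powr_eq_0_iff)
      then show ?thesis by simp
    qed
    then show "\<forall>\<^sub>F h in at 0. norm (pos_powr a h / h) \<le> \<bar>h\<bar> powr (a - 1)"
      by (auto simp: eventually_at_filter)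
    have "((\<lambda>h::real. \<bar>h\<bar> powr (a - 1)) \<longlongrightarrow> \<bar>0\<bar> powr (a - 1)) (at 0)"
      using assms by (intro tendsto_intros) auto
    then show "((\<lambda>h::real. \<bar>h\<bar> powr (a - 1)) \<longlongrightarrow> 0) (at 0)" by simp
  qed
  then show ?thesis using equal by (simp add: has_field_derivative_iff pos_powr_def)
qed

lemma Ck_on_pos_powr: "a > real k \<Longrightarrow> Ck_on k UNIV (pos_powr a)"
proof (induction k arbitrary: a)
  case 0
  then show ?case unfolding pos_powr_def[abs_def] Ck_on.simps
    by (intro continuous_on_powr' continuous_intros) auto
next
  case (Suc k)
  have "Ck_on k UNIV (pos_powr (a - 1))" using Suc by simp
  then have "Ck_on k UNIV (\<lambda>t. a * pos_powr (a - 1) t * v)" for v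
    by (intro Ck_on_mult Ck_on_const open_UNIV)
  moreover have "(pos_powr a has_derivative (\<lambda>v. a * pos_powr (a - 1) t * v)) (at t)" for t
    using has_derivative_pos_powr[of a t] Suc.prems by (simp add: has_field_derivative_def)
  ultimately show ?case by (intro Ck_on_SucI[OF open_UNIV, of _ "\<lambda>t v. a * pos_powr (a - 1) t * v"])
qed

lemma Ck_on_pos_powr_comp:
  fixes f :: "'a::real_normed_vector \<Rightarrow> real"
  shows "a > real k \<Longrightarrow> Ck_on k UNIV f \<Longrightarrow> Ck_on k UNIV (\<lambda>z. pos_powr a (f z))"
  by (rule Ck_on_compose[OF open_UNIV open_UNIV Ck_on_pos_powr]) auto

lemma dir_deriv_scaled:
  assumes "Ck_on (Suc 0) UNIV G"
  shows "dir_deriv v (\<lambda>z. k * G (c *\<^sub>R z)) = (\<lambda>z. k * c * dir_deriv v G (c *\<^sub>R z))"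
proof
  fix z
  have D: "(G has_derivative frechet_derivative G (at (c *\<^sub>R z))) (at (c *\<^sub>R z))"
    using Ck_on_SucD[OF assms] by simp
  have "((\<lambda>z. c *\<^sub>R z) has_derivative (\<lambda>v. c *\<^sub>R v)) (at z)" by (auto intro!: derivative_eq_intros)
  from has_derivative_mult_right[OF has_derivative_compose[OF this D], of k]
  have "((\<lambda>z. k * G (c *\<^sub>R z)) has_derivative (\<lambda>v. k * frechet_derivative G (at (c *\<^sub>R z)) (c *\<^sub>R v))) (at z)" .
  moreover have "linear (frechet_derivative G (at (c *\<^sub>R z)))" using D has_derivative_linear by blast
  ultimately show "dir_deriv v (\<lambda>z. k * G (c *\<^sub>R z)) z = k * c * dir_deriv v G (c *\<^sub>R z)"
    by (simp add: dir_deriv_eqI[of _ _ z v] linear_cmul) (simp add: dir_deriv_def)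
qed

lemma dir_deriv_funpow_scaled:
  "Ck_on n UNIV G \<Longrightarrow>
    (dir_deriv v ^^ n) (\<lambda>z. k * G (c *\<^sub>R z)) = (\<lambda>z. k * c ^ n * (dir_deriv v ^^ n) G (c *\<^sub>R z))"
proof (induction n)
  case (Suc n)
  have "Ck_on (Suc 0) UNIV ((dir_deriv v ^^ n) G)" using Suc.prems by (intro Ck_on_dir_deriv_funpow) simp
  from dir_deriv_scaled[OF this, of v "k * c ^ n" c] show ?case
    using Suc.IH[OF Ck_on_Suc_imp[OF Suc.prems]] by (simp add: mult_ac)
qed simp

text \<open>With c = 1 / \<rho> this is the factor \<open>1 / \<rho> ^ (i + j)\<close> in the bounds
  on the multipliers: one function rescaled to each annulus satisfies all of them with a single
  constant.\<close>

lemma partial_scaled: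
  assumes "Ck_on (i + j) UNIV G"
  shows "partial (i, j) (\<lambda>z. G (c *\<^sub>R z)) z = c ^ (i + j) * partial (i, j) G (c *\<^sub>R z)"
proof -
  have "(Dy ^^ j) (\<lambda>z. G (c *\<^sub>R z)) = (\<lambda>z. c ^ j * (Dy ^^ j) G (c *\<^sub>R z))"
    using dir_deriv_funpow_scaled[of j G "(0, 1)" 1 c] Ck_on_le[OF assms, of j] by simp
  then show ?thesis
    using dir_deriv_funpow_scaled[OF Ck_on_dir_deriv_funpow[OF assms], where v = "(1, 0)" and k = "c ^ j" and c = c]
    by (simp add: partial_def power_add ac_simps)
qed

text \<open>The multiplier at scale \<open>\<rho>\<close> is \<open>h / w\<close>, made smooth away from the allowed directions by
  adding to the denominator of \<open>h w / w\<^sup>2\<close> a cutoff that is nonzero only where \<open>w\<close> is small.\<close>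

lemma implied_jet_quotient:
  assumes "P \<in> I" and smooth: "Ck_on m UNIV w" "Ck_on m UNIV h"
    and hom: "homogeneous d w" "homogeneous d h"
    and P: "\<And>z. peval P z = w z * u z" and T: "\<And>z. peval T z = h z * u z"
    and nz: "\<And>\<omega>. \<omega> \<in> Allow m I \<Longrightarrow> w \<omega> \<noteq> 0"
  shows "implied_jet m I T"
proof -
  let ?K = "Allow m I"
  have cw: "continuous_on UNIV w" using smooth(1) Ck_on_imp_continuous by blast
  \<comment> \<open>Compactness of \<open>Allow\<close> keeps w^2 away from 0 on it, and also on the
    unit vectors close to it: the unit vectors with w^2 at most half the minimum form a compact set
    disjoint from \<open>Allow\<close>.\<close>
  obtain \<kappa> \<delta> where \<kappa>: "\<kappa> > 0" "\<delta> > 0"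
    "\<And>\<omega>. norm \<omega> = 1 \<Longrightarrow> ?K \<noteq> {} \<Longrightarrow> infdist \<omega> ?K < \<delta> \<Longrightarrow> (w \<omega>)\<^sup>2 \<ge> \<kappa>"
  proof (cases "?K = {}")
    case True
    then show ?thesis using that[of 1 1] by simp
  next
    case False
    have "continuous_on ?K (\<lambda>\<omega>. (w \<omega>)\<^sup>2)" using cw by (intro continuous_intros) (auto intro: continuous_on_subset)
    then obtain \<omega>0 where o: "\<omega>0 \<in> ?K" "\<And>\<omega>. \<omega> \<in> ?K \<Longrightarrow> (w \<omega>0)\<^sup>2 \<le> (w \<omega>)\<^sup>2"
      using continuous_attains_inf[OF compact_Allow False] by blast
    define k where "k = (w \<omega>0)\<^sup>2"
    have k: "k > 0" using nz[OF o(1)] by (simp add: k_def)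
    let ?C = "sphere 0 1 \<inter> {\<omega>. (w \<omega>)\<^sup>2 \<le> k / 2}"
    have "closed {\<omega>. (w \<omega>)\<^sup>2 \<le> k / 2}" using cw by (intro closed_Collect_le continuous_intros)
    then have "compact ?C" by (intro compact_Int_closed) simp_all
    moreover have "closed ?K" by (rule compact_imp_closed[OF compact_Allow])
    moreover have "?C \<inter> ?K = {}"
    proof (rule equals0I)
      fix x assume "x \<in> ?C \<inter> ?K"
      then have "(w x)\<^sup>2 \<le> k / 2" "k \<le> (w x)\<^sup>2" using o(2) by (auto simp: k_def)
      then show False using k by linarith
    qed
    ultimately obtain e where e: "e > 0" "\<And>x y. x \<in> ?C \<Longrightarrow> y \<in> ?K \<Longrightarrow> e \<le> dist x y"
      using separate_compact_closed by metis
    have "(w \<omega>)\<^sup>2 \<ge> k / 2" if "norm \<omega> = 1" "infdist \<omega> ?K < e" for \<omega>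
    proof (rule ccontr)
      assume "\<not> ?thesis"
      then have "\<omega> \<in> ?C" using that by simp
      moreover obtain y where "y \<in> ?K" "infdist \<omega> ?K = dist \<omega> y"
        using infdist_attains_inf[OF compact_imp_closed[OF compact_Allow] False] by blast
      ultimately show False using e(2) that(2) by fastforce
    qed
    then show ?thesis using that[of "k / 2" e] k e(1) by simp
  qed
  \<comment> \<open>On \<open>Ann 2 \<rho>\<close> the rescaled point z / \<rho> has norm above 1/2,
    so compared with the unit vector w^2 loses at most the factor (1/2)^(2d) = 1 / 4^d.\<close>
  define \<kappa>' where "\<kappa>' = \<kappa> / 4 ^ d"
  have k': "\<kappa>' > 0" using \<kappa> by (simp add: \<kappa>'_def)
  \<comment> \<open>The exponent m + 1 makes the cutoff C^m; where w^2 >= \<kappa>' it is 0 and G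
    equals h / w.\<close>
  define G where "G z = h z * w z / ((w z)\<^sup>2 + pos_powr (m + 1) (\<kappa>' - (w z)\<^sup>2))" for z
  have den: "(w z)\<^sup>2 + pos_powr (m + 1) (\<kappa>' - (w z)\<^sup>2) \<noteq> 0" for z
  proof (cases "w z = 0")
    case True
    then show ?thesis using k' by (simp add: pos_powr_eq_0_iff)
  next
    case False
    then have "(w z)\<^sup>2 > 0" by simp
    then show ?thesis using pos_powr_nonneg[of "m + 1" "\<kappa>' - (w z)\<^sup>2"] by linarith
  qed
  have G: "Ck_on m UNIV G" unfolding G_def[abs_def]
    by (intro Ck_on_divide Ck_on_mult Ck_on_add Ck_on_power Ck_on_pos_powr_comp Ck_on_diff Ck_on_const
        smooth den open_UNIV) simp_all
  have GP: "peval T z = G (z /\<^sub>R \<rho>) * peval P z"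
    if \<rho>: "\<rho> > 0" and z: "z \<in> Ann 2 \<rho>" "?K \<noteq> {}" "infdist (z /\<^sub>R norm z) ?K < \<delta>" for z \<rho>
  proof -
    have "norm z > \<rho> / 2" using z by (simp add: Ann_def)
    then have n: "norm z > \<rho> / 2" "norm z > 0" using \<rho> by linarith+
    let ?s = "norm z / \<rho>"
    have wk: "(w (z /\<^sub>R norm z))\<^sup>2 \<ge> \<kappa>" using n z by (intro \<kappa>(3)) auto
    have "?s * inverse (norm z) = inverse \<rho>" using n(2) by (simp add: divide_inverse)
    then have "z /\<^sub>R \<rho> = ?s *\<^sub>R (z /\<^sub>R norm z)" by (simp only: scaleR_scaleR)
    moreover have "?s > 0" using n(2) \<rho> by simp
    ultimately have w: "w (z /\<^sub>R \<rho>) = ?s ^ d * w (z /\<^sub>R norm z)"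
      using hom(1) unfolding homogeneous_def by presburger
    have "(1 / 2) ^ d \<le> ?s ^ d" using n \<rho> by (intro power_mono) (auto simp: field_simps)
    then have "((1 / 2) ^ d)\<^sup>2 \<le> (?s ^ d)\<^sup>2" by (rule power_mono) simp
    then have "(w (z /\<^sub>R \<rho>))\<^sup>2 \<ge> ((1 / 2) ^ d)\<^sup>2 * \<kappa>"
      unfolding w power_mult_distrib using \<kappa>(1) wk by (intro mult_mono) auto
    also have "((1 / 2 :: real) ^ d)\<^sup>2 = (1 / 4) ^ d"
      unfolding power2_eq_square power_mult_distrib[symmetric] by simp
    also have "(1 / 4) ^ d * \<kappa> = \<kappa>'" by (simp add: \<kappa>'_def power_divide)
    finally have ge: "(w (z /\<^sub>R \<rho>))\<^sup>2 \<ge> \<kappa>'" .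
    then have w0: "w (z /\<^sub>R \<rho>) \<noteq> 0" using k' by auto
    have "pos_powr (m + 1) (\<kappa>' - (w (z /\<^sub>R \<rho>))\<^sup>2) = 0" using ge by (simp add: pos_powr_eq_0_iff)
    then have "G (z /\<^sub>R \<rho>) = h (z /\<^sub>R \<rho>) / w (z /\<^sub>R \<rho>)" using w0 by (simp add: G_def power2_eq_square)
    moreover have i: "inverse \<rho> > 0" using \<rho> by simp
    have "w (z /\<^sub>R \<rho>) = inverse \<rho> ^ d * w z" "h (z /\<^sub>R \<rho>) = inverse \<rho> ^ d * h z"
      using hom i unfolding homogeneous_def by blast+
    ultimately have "G (z /\<^sub>R \<rho>) = h z / w z" "w z \<noteq> 0"
      using w0 i by auto
    then show ?thesis by (simp add: P T)
  qed
  \<comment> \<open>G does not depend on \<rho>, and z / \<rho> stays in the ball of radius 4 for z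
    in \<open>Ann 4 \<rho>\<close>; a bound for the derivatives on this ball therefore serves all
    scales.\<close>
  let ?D = "\<lambda>z. \<Sum>(i, j) | i + j \<le> m. \<bar>partial (i, j) G z\<bar>"
  have cont: "continuous_on UNIV (partial (i, j) G)" if "i + j \<le> m" for i j
    using Ck_on_partial[of 0 i j UNIV G] Ck_on_le[OF G that] by simp
  have "continuous_on (cball 0 4) ?D"
    unfolding case_prod_beta by (intro continuous_on_sum continuous_on_rabs continuous_on_subset[OF cont]) auto
  then have "bounded (?D ` cball 0 4)" by (intro compact_imp_bounded compact_continuous_image) auto
  then obtain A0 where A0: "\<And>z. norm z \<le> 4 \<Longrightarrow> \<bar>?D z\<bar> \<le> A0" by (force simp: bounded_iff)
  define A where "A = \<bar>A0\<bar> + 1"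
  have A: "\<bar>partial (i, j) G z\<bar> \<le> A" if "i + j \<le> m" "norm z \<le> 4" for i j z
  proof -
    have "\<bar>partial (i, j) G z\<bar> \<le> ?D z"
      using member_le_sum[of "(i, j)" "{(i, j). i + j \<le> m}" "\<lambda>(i, j). \<bar>partial (i, j) G z\<bar>"]
        finite_deg_le[of m] that(1) by auto
    then show ?thesis using A0[OF that(2)] by (simp add: A_def)
  qed
  show ?thesis
    unfolding implied_jet_def
  proof (intro exI conjI allI impI)
    show "A > 0" by (simp add: A_def)
    show "set [P] \<subseteq> I" using assms(1) by simp
    show "\<delta> > 0" "(1::real) > 0" by (simp_all add: \<kappa>)
    fix \<epsilon> \<rho> :: real assume \<epsilon>: "\<epsilon> > 0" and \<rho>: "0 < \<rho> \<and> \<rho> \<le> 1"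
    let ?S = "\<lambda>(l::nat) z. G (inverse \<rho> *\<^sub>R z)"
    show "Ck_on m (Ann 4 \<rho>) (\<lambda>_. 0)" by simp
    have "Ck_on m UNIV (\<lambda>z. G (inverse \<rho> *\<^sub>R z))"
      by (rule Ck_on_compose[OF open_UNIV open_UNIV G])
         (auto intro!: Ck_on_scaleR Ck_on_ident)
    then show "Ck_on m (Ann 4 \<rho>) (?S l)" for l :: nat by (rule Ck_on_subset) simp
    show "\<forall>z\<in>Ann 4 \<rho>. \<forall>i j. i + j \<le> m \<longrightarrow> \<bar>partial (i, j) (\<lambda>_. 0) z\<bar> \<le> \<epsilon> * \<rho> ^ (m - (i + j))"
      using \<epsilon> \<rho> by simp
    show "\<forall>z\<in>Ann 4 \<rho>. \<forall>i j. i + j \<le> m \<longrightarrow> \<bar>partial (i, j) (?S l) z\<bar> \<le> A / \<rho> ^ (i + j)" for l :: nat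
    proof (intro ballI allI impI)
      fix z i j assume z: "z \<in> Ann 4 \<rho>" and ij: "i + j \<le> m"
      have "norm (inverse \<rho> *\<^sub>R z) \<le> 4" using z \<rho> by (simp add: Ann_def field_simps)
      then have "\<bar>partial (i, j) G (inverse \<rho> *\<^sub>R z)\<bar> \<le> A" by (intro A ij)
      then have "inverse \<rho> ^ (i + j) * \<bar>partial (i, j) G (inverse \<rho> *\<^sub>R z)\<bar> \<le> inverse \<rho> ^ (i + j) * A"
        using \<rho> by (intro mult_left_mono) auto
      then show "\<bar>partial (i, j) (?S l) z\<bar> \<le> A / \<rho> ^ (i + j)"
        using \<rho> by (simp add: partial_scaled[OF Ck_on_le[OF G ij]] abs_mult power_abs divide_inverse
            power_inverse mult.commute)
    qed
    show "\<forall>z\<in>Ann 2 \<rho>. ?K \<noteq> {} \<and> infdist (z /\<^sub>R norm z) ?K < \<delta> \<longrightarrow>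
        peval T z = 0 + (\<Sum>l<length [P]. ?S l z * peval ([P] ! l) z)"
      using GP \<rho> by auto
  qed
qed

text \<open>Linear substitution does not raise degrees, so nothing is truncated and equality holds
  pointwise, not only up to o(|z|^3). The quotient argument needs such exact identities to keep the
  factorization P = w u.\<close>

lemma peval_pull_linmap:
  assumes "p \<in> jets0 3"
  shows "peval (pull 3 (linmap a b c d) p) z = peval p (linmap a b c d z)"
proof -
  obtain a' b' c' d' e f g h i where p: "p = J3 a' b' c' d' e f g h i" using assms jets0_3_eq by blast
  obtain x y where z: "z = (x, y)" by fastforce
  show ?thesis unfolding p z pull_linmap_J3
    by (simp add: linmap_def peval_J3 power2_eq_square power3_eq_cube algebra_simps)
qed

lemma linmap_scaleR: "linmap a b c d (s *\<^sub>R z) = s *\<^sub>R linmap a b c d z"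
  by (simp add: linmap_def algebra_simps)

text \<open>Closedness is available for \<open>I\<close>, while factorizations are found in its
  linear image \<open>J\<close>; they are pulled back along the inverse map. By \<open>nz\<close>
  each zero direction of w is forbidden by a cubic form of \<open>J\<close>, so w has no zero in an
  allowed direction.\<close>

lemma closed_ideal_quotient:
  assumes cl: "closed_ideal 3 I" and D: "a * d - b * c \<noteq> 0"
    and J: "J = pull 3 (linmap a b c d) ` I" and P: "P \<in> J" and T: "T \<in> jets0 3"
    and smooth: "Ck_on 3 UNIV w" "Ck_on 3 UNIV h"
    and hom: "homogeneous k w" "homogeneous k h"
    and Pw: "\<And>z. peval P z = w z * u z" and Th: "\<And>z. peval T z = h z * u z"
    and nz: "\<And>x y. (x, y) \<noteq> 0 \<Longrightarrow> w (x, y) = 0 \<Longrightarrow> \<exists>e f g i. J3 0 0 0 0 0 e f g i \<in> J \<and>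
      e * x ^ 3 + f * x\<^sup>2 * y + g * x * y\<^sup>2 + i * y ^ 3 \<noteq> 0"
  shows "T \<in> J"
proof -
  let ?L = "linmap a b c d"
  obtain a' b' c' d' where M: "inv_into UNIV ?L = linmap a' b' c' d'" by (rule that[OF inv_linmap(1)[OF D]])
  let ?M = "linmap a' b' c' d'"
  have dL: "diffeo0 3 ?L" by (rule diffeo0_linmap[OF D])
  have dM: "diffeo0 3 ?M" using diffeo0_inv[OF dL] by (simp only: M)
  have LM: "?L (?M z) = z" for z
    using bij_is_surj[OF inv_linmap(2)[OF D]] unfolding M[symmetric] by (rule surj_f_inv_f)
  have I0: "I \<subseteq> jets0 3" using cl by (simp add: closed_ideal_def jet_ideal0_def)
  have inI: "pull 3 ?M q \<in> I \<and> (\<forall>z. peval (pull 3 ?M q) z = peval q (?M z))" if "q \<in> J" for q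
  proof -
    obtain q' where q': "q' \<in> I" "q = pull 3 ?L q'" using \<open>q \<in> J\<close> J by blast
    have "q' \<in> jets 3" "q' \<in> jets0 3" using q'(1) I0 by (auto simp: jets0_iff)
    then have "pull 3 ?M q = q'" using pull_inv_pull(1)[OF dL _, of q'] M q'(2) by simp
    moreover have "q \<in> jets0 3"
      unfolding q'(2) by (rule origin_map.pull_jets0[OF diffeo0_origin_map[OF dL]]) (simp, fact)
    ultimately show ?thesis using q'(1) peval_pull_linmap[of q] by metis
  qed
  let ?T = "pull 3 ?M T"
  have "implied_jet 3 I ?T"
  proof (rule implied_jet_quotient)
    show "pull 3 ?M P \<in> I" using inI[OF P] by blast
    show "Ck_on 3 UNIV (\<lambda>z. w (?M z))" "Ck_on 3 UNIV (\<lambda>z. h (?M z))"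
      by (rule Ck_on_compose[OF open_UNIV open_UNIV]; use smooth Ck_on_linmap in simp)+
    show "homogeneous k (\<lambda>z. w (?M z))" "homogeneous k (\<lambda>z. h (?M z))"
      using hom unfolding homogeneous_def linmap_scaleR by blast+
    show "peval (pull 3 ?M P) z = w (?M z) * u (?M z)" for z using inI[OF P] Pw by metis
    show "peval ?T z = h (?M z) * u (?M z)" for z using peval_pull_linmap[OF T] Th by simp
    fix \<omega> assume \<omega>: "\<omega> \<in> Allow 3 I"
    show "w (?M \<omega>) \<noteq> 0"
    proof
      assume w0: "w (?M \<omega>) = 0"
      obtain x y where xy: "?M \<omega> = (x, y)" by fastforce
      have "(x, y) \<noteq> 0"
      proof
        assume "(x, y) = 0"
        then have "\<omega> = ?L 0" using LM[of \<omega>] xy by simp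
        then have "\<omega> = (0, 0)" by (simp add: linmap_def)
        then show False using \<omega> by (simp add: Allow_def)
      qed
      then obtain e f g i where q: "J3 0 0 0 0 0 e f g i \<in> J"
        "e * x ^ 3 + f * x\<^sup>2 * y + g * x * y\<^sup>2 + i * y ^ 3 \<noteq> 0"
        using nz w0 xy by metis
      let ?q = "pull 3 ?M (J3 0 0 0 0 0 e f g i)"
      obtain e' f' g' h' where q': "?q = J3 0 0 0 0 0 e' f' g' h'" unfolding pull_linmap_J3 by simp
      have "peval ?q \<omega> = peval (J3 0 0 0 0 0 e f g i) (?M \<omega>)" using inI[OF q(1)] by blast
      then have "peval ?q \<omega> \<noteq> 0" using q(2) unfolding xy by (simp add: peval_J3)
      moreover obtain u v where uv: "\<omega> = (u, v)" by fastforce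
      ultimately have "forbidden_direction 3 I \<omega>"
        unfolding uv by (intro forbidden_J3_3[of e' f' g' h']) (use inI[OF q(1)] q' in \<open>auto simp: peval_J3\<close>)
      then show False using \<omega> by (simp add: Allow_def)
    qed
  qed
  moreover have "?T \<in> jets0 3" by (rule origin_map.pull_jets0[OF diffeo0_origin_map[OF dM] T]) simp
  ultimately have "?T \<in> I" using cl by (simp add: closed_ideal_def)
  moreover have "pull 3 ?L ?T = T"
    using pull_inv_pull(2)[OF dL _, of T] T by (simp add: M jets0_iff)
  ultimately show ?thesis using J by (metis image_eqI)
qed

section \<open>The listed ideals in coordinates\<close>

type_synonym coeff_pred =
  "real \<Rightarrow> real \<Rightarrow> real \<Rightarrow> real \<Rightarrow> real \<Rightarrow> real \<Rightarrow> real \<Rightarrow> real \<Rightarrow> real \<Rightarrow> bool"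

text \<open>Describing an ideal by conditions on coefficients instead of by generators reduces
  comparisons of ideals to real arithmetic.\<close>

definition jset :: "coeff_pred \<Rightarrow> poly2 set" where
  "jset V = {J3 a b c d e f g h i | a b c d e f g h i. V a b c d e f g h i}"

lemma J3_in_jset [simp]: "J3 a b c d e f g h i \<in> jset V \<longleftrightarrow> V a b c d e f g h i"
  by (auto simp: jset_def)

text \<open>The last two hypotheses are multiplication by x and by y, seen as shifts of
  coefficients.\<close>

lemma jet_ideal0_jset:
  assumes "V 0 0 0 0 0 0 0 0 0"
    and "\<And>a b c d e f g h i a' b' c' d' e' f' g' h' i'. V a b c d e f g h i \<Longrightarrow> V a' b' c' d' e' f' g' h' i' \<Longrightarrow>
      V (a + a') (b + b') (c + c') (d + d') (e + e') (f + f') (g + g') (h + h') (i + i')"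
    and "\<And>s a b c d e f g h i. V a b c d e f g h i \<Longrightarrow>
      V (s * a) (s * b) (s * c) (s * d) (s * e) (s * f) (s * g) (s * h) (s * i)"
    and "\<And>a b c d e f g h i. V a b c d e f g h i \<Longrightarrow> V 0 0 a b 0 c d e 0"
    and "\<And>a b c d e f g h i. V a b c d e f g h i \<Longrightarrow> V 0 0 0 a b 0 c d e"
  shows "jet_ideal0 3 (jset V)"
proof (rule jet_ideal0_3I)
  show "jset V \<subseteq> jets0 3" by (auto simp: jset_def)
  show "0 \<in> jset V" using assms(1) by (subst J3_zero[symmetric]) simp
  show "p + q \<in> jset V" if "p \<in> jset V" "q \<in> jset V" for p q
  proof -
    obtain a b c d e f g h i where "p = J3 a b c d e f g h i" "V a b c d e f g h i"
      using \<open>p \<in> jset V\<close> unfolding jset_def by blast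
    moreover obtain a' b' c' d' e' f' g' h' i' where "q = J3 a' b' c' d' e' f' g' h' i'" "V a' b' c' d' e' f' g' h' i'"
      using \<open>q \<in> jset V\<close> unfolding jset_def by blast
    ultimately show ?thesis using assms(2) by (simp add: J3_add)
  qed
  show "const2 s * p \<in> jset V" if "p \<in> jset V" for s p
  proof -
    obtain a b c d e f g h i where "p = J3 a b c d e f g h i" "V a b c d e f g h i"
      using \<open>p \<in> jset V\<close> unfolding jset_def by blast
    then show ?thesis using assms(3) by (simp add: J3_cmult)
  qed
  show "jmult 3 X p \<in> jset V" "jmult 3 Y p \<in> jset V" if "p \<in> jset V" for p
  proof -
    obtain a b c d e f g h i where p: "p = J3 a b c d e f g h i" "V a b c d e f g h i"
      using \<open>p \<in> jset V\<close> unfolding jset_def by blast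
    show "jmult 3 X p \<in> jset V" "jmult 3 Y p \<in> jset V"
      unfolding X_J3 Y_J3 p(1) jmult_J3 J3_in_jset using assms(4)[OF p(2)] assms(5)[OF p(2)] by simp_all
  qed
qed

lemma jet_ideal0_eq_jset:
  assumes "jet_ideal0 3 J" "\<And>a b c d e f g h i. J3 a b c d e f g h i \<in> J \<longleftrightarrow> V a b c d e f g h i"
  shows "J = jset V"
proof -
  have "p \<in> J \<longleftrightarrow> p \<in> jset V" for p
  proof (cases "p \<in> jets0 3")
    case True
    then obtain a b c d e f g h i where "p = J3 a b c d e f g h i" using jets0_3_eq by blast
    then show ?thesis using assms(2) by simp
  next
    case False
    then show ?thesis using assms(1) by (auto simp: jet_ideal0_def jset_def)
  qed
  then show ?thesis by blast
qed

text \<open>The coefficients of the combination enter as equations, so that the target can be stated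
  in simplified form and arithmetic remains.\<close>

lemma ideal_comb:
  assumes "ideal J (jet_ring 3)" "J3 a b c d e f g h i \<in> J" "J3 a' b' c' d' e' f' g' h' i' \<in> J"
    "A = s * a + t * a'" "B = s * b + t * b'" "C = s * c + t * c'" "D = s * d + t * d'" "E = s * e + t * e'"
    "F = s * f + t * f'" "G = s * g + t * g'" "H = s * h + t * h'" "K = s * i + t * i'"
  shows "J3 A B C D E F G H K \<in> J"
  unfolding assms(4-12) by (intro ideal_J3_add[OF assms(1)] ideal_J3_cmult[OF assms(1)] assms(2,3))

lemma gen_ideal_eq_jset:
  assumes "jet_ideal0 3 (jset V)" "S \<subseteq> jset V"
    "\<And>I a b c d e f g h i. ideal I (jet_ring 3) \<Longrightarrow> S \<subseteq> I \<Longrightarrow> V a b c d e f g h i \<Longrightarrow> J3 a b c d e f g h i \<in> I"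
  shows "gen_ideal 3 S = jset V"
  by (rule gen_ideal_eqI[OF assms(1,2)]) (use assms(3) in \<open>auto simp: jset_def\<close>)

lemma monomials_J3:
  "X ^ 2 = J3 0 0 1 0 0 0 0 0 0" "X ^ 3 = J3 0 0 0 0 0 1 0 0 0" "X * Y = J3 0 0 0 1 0 0 0 0 0"
  "Y * X ^ 2 = J3 0 0 0 0 0 0 1 0 0" "X ^ 2 * Y = J3 0 0 0 0 0 0 1 0 0" "X * Y ^ 2 = J3 0 0 0 0 0 0 0 1 0"
  "X * Y * (X + Y) = J3 0 0 0 0 0 0 1 1 0" "X ^ 2 - Y ^ 3 = J3 0 0 1 0 0 0 0 0 (-1)"
proof -
  have p: "X ^ 2 = single2 2 0 1" "X ^ 3 = single2 3 0 1" "Y ^ 2 = single2 0 2 1" "Y ^ 3 = single2 0 3 1"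
    by (simp_all add: power2_eq_square power3_eq_cube mult_single numeral_eq_Suc)
  show "X ^ 2 = J3 0 0 1 0 0 0 0 0 0" "X ^ 3 = J3 0 0 0 0 0 1 0 0 0" "X * Y = J3 0 0 0 1 0 0 0 0 0"
    "Y * X ^ 2 = J3 0 0 0 0 0 0 1 0 0" "X ^ 2 * Y = J3 0 0 0 0 0 0 1 0 0" "X * Y ^ 2 = J3 0 0 0 0 0 0 0 1 0"
    "X * Y * (X + Y) = J3 0 0 0 0 0 0 1 1 0" "X ^ 2 - Y ^ 3 = J3 0 0 1 0 0 0 0 0 (-1)"
    unfolding p J3_def by (simp_all add: mult_single distrib_left single_uminus numeral_eq_Suc)
qed

lemma jset_zero: "jset (\<lambda>a b c d e f g h i. a = 0 \<and> b = 0 \<and> c = 0 \<and> d = 0 \<and> e = 0 \<and> f = 0 \<and> g = 0 \<and> h = 0 \<and> i = 0) = {0}"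
  by (auto simp: jset_def J3_zero)

lemma jset_all: "jset (\<lambda>a b c d e f g h i. True) = jets0 3"
  by (auto simp: jset_def jets0_3_eq)

text \<open>The products of x with the monomials of degree at most 2 span the ideal. The generated
  ideals that follow are computed in the same manner.\<close>

lemma gen_x: "gen_ideal 3 {X} = jset (\<lambda>a b c d e f g h i. b = 0 \<and> e = 0 \<and> i = 0)"
proof (rule gen_ideal_eq_jset)
  fix I and a b c d e f g h i :: real
  assume I: "ideal I (jet_ring 3)" "{X} \<subseteq> I" and V: "b = 0 \<and> e = 0 \<and> i = 0"
  have 1: "J3 1 0 0 0 0 0 0 0 0 \<in> I" using I(2) unfolding X_J3 by blast
  note 2 = ideal_J3_X[OF I(1) 1] ideal_J3_Y[OF I(1) 1]
  note 3 = ideal_J3_X[OF I(1) 2(1)] ideal_J3_Y[OF I(1) 2(1)] ideal_J3_Y[OF I(1) 2(2)]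
  have "J3 a 0 c 0 0 0 0 0 0 \<in> I" by (rule ideal_comb[OF I(1) 1 2(1), of _ a c]) simp_all
  moreover have "J3 0 0 0 d 0 f 0 0 0 \<in> I" by (rule ideal_comb[OF I(1) 2(2) 3(1), of _ d f]) simp_all
  moreover have "J3 0 0 0 0 0 0 g h 0 \<in> I" by (rule ideal_comb[OF I(1) 3(2,3), of _ g h]) simp_all
  ultimately have "J3 a 0 c 0 0 0 0 0 0 + J3 0 0 0 d 0 f 0 0 0 + J3 0 0 0 0 0 0 g h 0 \<in> I"
    by (intro ideal_jet_add[OF I(1)])
  then show "J3 a b c d e f g h i \<in> I" using V by (simp add: J3_add)
qed ((rule jet_ideal0_jset; simp), unfold X_J3, simp)

lemma gen_x2: "gen_ideal 3 {X ^ 2} = jset (\<lambda>a b c d e f g h i. a = 0 \<and> b = 0 \<and> d = 0 \<and> e = 0 \<and> h = 0 \<and> i = 0)"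
proof (rule gen_ideal_eq_jset)
  fix I and a b c d e f g h i :: real
  assume I: "ideal I (jet_ring 3)" "{X ^ 2} \<subseteq> I" and V: "a = 0 \<and> b = 0 \<and> d = 0 \<and> e = 0 \<and> h = 0 \<and> i = 0"
  have 1: "J3 0 0 1 0 0 0 0 0 0 \<in> I" using I(2) unfolding monomials_J3(1) by blast
  note 2 = ideal_J3_X[OF I(1) 1] ideal_J3_Y[OF I(1) 1]
  have "J3 0 0 c 0 0 f 0 0 0 \<in> I" by (rule ideal_comb[OF I(1) 1 2(1), of _ c f]) simp_all
  from ideal_comb[OF I(1) this 2(2), of _ 1 g] show "J3 a b c d e f g h i \<in> I" using V by simp
qed ((rule jet_ideal0_jset; simp), unfold monomials_J3(1), simp)

lemma gen_x3: "gen_ideal 3 {X ^ 3} = jset (\<lambda>a b c d e f g h i. a = 0 \<and> b = 0 \<and> c = 0 \<and> d = 0 \<and> e = 0 \<and> g = 0 \<and> h = 0 \<and> i = 0)"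
proof (rule gen_ideal_eq_jset)
  fix I and a b c d e f g h i :: real
  assume I: "ideal I (jet_ring 3)" "{X ^ 3} \<subseteq> I"
    and V: "a = 0 \<and> b = 0 \<and> c = 0 \<and> d = 0 \<and> e = 0 \<and> g = 0 \<and> h = 0 \<and> i = 0"
  have 1: "J3 0 0 0 0 0 1 0 0 0 \<in> I" using I(2) unfolding monomials_J3(2) by blast
  from ideal_J3_cmult[OF I(1) 1, of f] show "J3 a b c d e f g h i \<in> I" using V by simp
qed ((rule jet_ideal0_jset; simp), unfold monomials_J3(2), simp)

lemma gen_xy: "gen_ideal 3 {X * Y} = jset (\<lambda>a b c d e f g h i. a = 0 \<and> b = 0 \<and> c = 0 \<and> e = 0 \<and> f = 0 \<and> i = 0)"
proof (rule gen_ideal_eq_jset)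
  fix I and a b c d e f g h i :: real
  assume I: "ideal I (jet_ring 3)" "{X * Y} \<subseteq> I" and V: "a = 0 \<and> b = 0 \<and> c = 0 \<and> e = 0 \<and> f = 0 \<and> i = 0"
  have 1: "J3 0 0 0 1 0 0 0 0 0 \<in> I" using I(2) unfolding monomials_J3(3) by blast
  note 2 = ideal_J3_X[OF I(1) 1] ideal_J3_Y[OF I(1) 1]
  have "J3 0 0 0 d 0 0 g 0 0 \<in> I" by (rule ideal_comb[OF I(1) 1 2(1), of _ d g]) simp_all
  from ideal_comb[OF I(1) this 2(2), of _ 1 h] show "J3 a b c d e f g h i \<in> I" using V by simp
qed ((rule jet_ideal0_jset; simp), unfold monomials_J3(3), simp)

lemma gen_yx2: "gen_ideal 3 {Y * X ^ 2} = jset (\<lambda>a b c d e f g h i. a = 0 \<and> b = 0 \<and> c = 0 \<and> d = 0 \<and> e = 0 \<and> f = 0 \<and> h = 0 \<and> i = 0)"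
proof (rule gen_ideal_eq_jset)
  fix I and a b c d e f g h i :: real
  assume I: "ideal I (jet_ring 3)" "{Y * X ^ 2} \<subseteq> I"
    and V: "a = 0 \<and> b = 0 \<and> c = 0 \<and> d = 0 \<and> e = 0 \<and> f = 0 \<and> h = 0 \<and> i = 0"
  have 1: "J3 0 0 0 0 0 0 1 0 0 \<in> I" using I(2) unfolding monomials_J3(4) by blast
  from ideal_J3_cmult[OF I(1) 1, of g] show "J3 a b c d e f g h i \<in> I" using V by simp
qed ((rule jet_ideal0_jset; simp), unfold monomials_J3(4), simp)

lemma gen_xyxy: "gen_ideal 3 {X * Y * (X + Y)} = jset (\<lambda>a b c d e f g h i. a = 0 \<and> b = 0 \<and> c = 0 \<and> d = 0 \<and> e = 0 \<and> f = 0 \<and> g = h \<and> i = 0)"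
proof (rule gen_ideal_eq_jset)
  fix I and a b c d e f g h i :: real
  assume I: "ideal I (jet_ring 3)" "{X * Y * (X + Y)} \<subseteq> I"
    and V: "a = 0 \<and> b = 0 \<and> c = 0 \<and> d = 0 \<and> e = 0 \<and> f = 0 \<and> g = h \<and> i = 0"
  have 1: "J3 0 0 0 0 0 0 1 1 0 \<in> I" using I(2) unfolding monomials_J3(7) by blast
  from ideal_J3_cmult[OF I(1) 1, of g] show "J3 a b c d e f g h i \<in> I" using V by simp
qed ((rule jet_ideal0_jset; simp), unfold monomials_J3(7), simp)

lemma gen_cusp: "gen_ideal 3 {X ^ 2 - Y ^ 3} = jset (\<lambda>a b c d e f g h i. a = 0 \<and> b = 0 \<and> d = 0 \<and> e = 0 \<and> h = 0 \<and> i = - c)"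
proof (rule gen_ideal_eq_jset)
  fix I and a b c d e f g h i :: real
  assume I: "ideal I (jet_ring 3)" "{X ^ 2 - Y ^ 3} \<subseteq> I"
    and V: "a = 0 \<and> b = 0 \<and> d = 0 \<and> e = 0 \<and> h = 0 \<and> i = - c"
  have 1: "J3 0 0 1 0 0 0 0 0 (-1) \<in> I" using I(2) unfolding monomials_J3(8) by blast
  note 2 = ideal_J3_X[OF I(1) 1] ideal_J3_Y[OF I(1) 1]
  have "J3 0 0 c 0 0 f 0 0 (-c) \<in> I" by (rule ideal_comb[OF I(1) 1 2(1), of _ c f]) simp_all
  from ideal_comb[OF I(1) this 2(2), of _ 1 g] show "J3 a b c d e f g h i \<in> I" using V by simp
qed ((rule jet_ideal0_jset; simp), unfold monomials_J3(8), simp)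

lemma gen_x2_xy: "gen_ideal 3 {X ^ 2, X * Y} = jset (\<lambda>a b c d e f g h i. a = 0 \<and> b = 0 \<and> e = 0 \<and> i = 0)"
proof (rule gen_ideal_eq_jset)
  fix I and a b c d e f g h i :: real
  assume I: "ideal I (jet_ring 3)" "{X ^ 2, X * Y} \<subseteq> I" and V: "a = 0 \<and> b = 0 \<and> e = 0 \<and> i = 0"
  have 1: "J3 0 0 1 0 0 0 0 0 0 \<in> I" "J3 0 0 0 1 0 0 0 0 0 \<in> I" using I(2) unfolding monomials_J3(1,3) by blast+
  note 2 = ideal_J3_X[OF I(1) 1(1)] ideal_J3_X[OF I(1) 1(2)] ideal_J3_Y[OF I(1) 1(2)]
  have "J3 0 0 c d 0 0 0 0 0 \<in> I" by (rule ideal_comb[OF I(1) 1, of _ c d]) simp_all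
  moreover have "J3 0 0 0 0 0 f g 0 0 \<in> I" by (rule ideal_comb[OF I(1) 2(1,2), of _ f g]) simp_all
  ultimately have "J3 0 0 c d 0 f g 0 0 \<in> I" by (rule ideal_comb[OF I(1), where s = 1 and t = 1]) simp_all
  from ideal_comb[OF I(1) this 2(3), of _ 1 h] show "J3 a b c d e f g h i \<in> I" using V by simp
qed ((rule jet_ideal0_jset; simp), unfold monomials_J3(1,3), simp)

lemma gen_x2_xy2: "gen_ideal 3 {X ^ 2, X * Y ^ 2} = jset (\<lambda>a b c d e f g h i. a = 0 \<and> b = 0 \<and> d = 0 \<and> e = 0 \<and> i = 0)"
proof (rule gen_ideal_eq_jset)
  fix I and a b c d e f g h i :: real
  assume I: "ideal I (jet_ring 3)" "{X ^ 2, X * Y ^ 2} \<subseteq> I" and V: "a = 0 \<and> b = 0 \<and> d = 0 \<and> e = 0 \<and> i = 0"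
  have 1: "J3 0 0 1 0 0 0 0 0 0 \<in> I" "J3 0 0 0 0 0 0 0 1 0 \<in> I" using I(2) unfolding monomials_J3(1,6) by blast+
  note 2 = ideal_J3_X[OF I(1) 1(1)] ideal_J3_Y[OF I(1) 1(1)]
  have "J3 0 0 c 0 0 0 0 h 0 \<in> I" by (rule ideal_comb[OF I(1) 1, of _ c h]) simp_all
  moreover have "J3 0 0 0 0 0 f g 0 0 \<in> I" by (rule ideal_comb[OF I(1) 2(1,2), of _ f g]) simp_all
  ultimately have "J3 0 0 c 0 0 f g h 0 \<in> I" by (rule ideal_comb[OF I(1), where s = 1 and t = 1]) simp_all
  then show "J3 a b c d e f g h i \<in> I" using V by simp
qed ((rule jet_ideal0_jset; simp), unfold monomials_J3(1,6), simp)

lemma gen_x2y_xy2: "gen_ideal 3 {X ^ 2 * Y, X * Y ^ 2} = jset (\<lambda>a b c d e f g h i. a = 0 \<and> b = 0 \<and> c = 0 \<and> d = 0 \<and> e = 0 \<and> f = 0 \<and> i = 0)"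
proof (rule gen_ideal_eq_jset)
  fix I and a b c d e f g h i :: real
  assume I: "ideal I (jet_ring 3)" "{X ^ 2 * Y, X * Y ^ 2} \<subseteq> I"
    and V: "a = 0 \<and> b = 0 \<and> c = 0 \<and> d = 0 \<and> e = 0 \<and> f = 0 \<and> i = 0"
  have 1: "J3 0 0 0 0 0 0 1 0 0 \<in> I" "J3 0 0 0 0 0 0 0 1 0 \<in> I" using I(2) unfolding monomials_J3(5,6) by blast+
  from ideal_comb[OF I(1) 1, of _ g h] show "J3 a b c d e f g h i \<in> I" using V by simp
qed ((rule jet_ideal0_jset; simp), unfold monomials_J3(5,6), simp)

lemma gen_x3_x2y: "gen_ideal 3 {X ^ 3, X ^ 2 * Y} = jset (\<lambda>a b c d e f g h i. a = 0 \<and> b = 0 \<and> c = 0 \<and> d = 0 \<and> e = 0 \<and> h = 0 \<and> i = 0)"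
proof (rule gen_ideal_eq_jset)
  fix I and a b c d e f g h i :: real
  assume I: "ideal I (jet_ring 3)" "{X ^ 3, X ^ 2 * Y} \<subseteq> I"
    and V: "a = 0 \<and> b = 0 \<and> c = 0 \<and> d = 0 \<and> e = 0 \<and> h = 0 \<and> i = 0"
  have 1: "J3 0 0 0 0 0 1 0 0 0 \<in> I" "J3 0 0 0 0 0 0 1 0 0 \<in> I" using I(2) unfolding monomials_J3(2,5) by blast+
  from ideal_comb[OF I(1) 1, of _ f g] show "J3 a b c d e f g h i \<in> I" using V by simp
qed ((rule jet_ideal0_jset; simp), unfold monomials_J3(2,5), simp)

lemma gen_cusp_xy2: "gen_ideal 3 {X ^ 2 - Y ^ 3, X * Y ^ 2} = jset (\<lambda>a b c d e f g h i. a = 0 \<and> b = 0 \<and> d = 0 \<and> e = 0 \<and> i = - c)"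
proof (rule gen_ideal_eq_jset)
  fix I and a b c d e f g h i :: real
  assume I: "ideal I (jet_ring 3)" "{X ^ 2 - Y ^ 3, X * Y ^ 2} \<subseteq> I"
    and V: "a = 0 \<and> b = 0 \<and> d = 0 \<and> e = 0 \<and> i = - c"
  have 1: "J3 0 0 1 0 0 0 0 0 (-1) \<in> I" "J3 0 0 0 0 0 0 0 1 0 \<in> I" using I(2) unfolding monomials_J3(8,6) by blast+
  note 2 = ideal_J3_X[OF I(1) 1(1)] ideal_J3_Y[OF I(1) 1(1)]
  have "J3 0 0 c 0 0 0 0 h (-c) \<in> I" by (rule ideal_comb[OF I(1) 1, of _ c h]) simp_all
  moreover have "J3 0 0 0 0 0 f g 0 0 \<in> I" by (rule ideal_comb[OF I(1) 2(1,2), of _ f g]) simp_all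
  ultimately have "J3 0 0 c 0 0 f g h (-c) \<in> I" by (rule ideal_comb[OF I(1), where s = 1 and t = 1]) simp_all
  then show "J3 a b c d e f g h i \<in> I" using V by simp
qed ((rule jet_ideal0_jset; simp), unfold monomials_J3(8,6), simp)

lemma gen_x3_x2y_xy2: "gen_ideal 3 {X ^ 3, X ^ 2 * Y, X * Y ^ 2} = jset (\<lambda>a b c d e f g h i. a = 0 \<and> b = 0 \<and> c = 0 \<and> d = 0 \<and> e = 0 \<and> i = 0)"
proof (rule gen_ideal_eq_jset)
  fix I and a b c d e f g h i :: real
  assume I: "ideal I (jet_ring 3)" "{X ^ 3, X ^ 2 * Y, X * Y ^ 2} \<subseteq> I"
    and V: "a = 0 \<and> b = 0 \<and> c = 0 \<and> d = 0 \<and> e = 0 \<and> i = 0"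
  have 1: "J3 0 0 0 0 0 1 0 0 0 \<in> I" "J3 0 0 0 0 0 0 1 0 0 \<in> I" "J3 0 0 0 0 0 0 0 1 0 \<in> I"
    using I(2) unfolding monomials_J3(2,5,6) by blast+
  have "J3 0 0 0 0 0 f g 0 0 \<in> I" by (rule ideal_comb[OF I(1) 1(1,2), of _ f g]) simp_all
  from ideal_comb[OF I(1) this 1(3), of _ 1 h] show "J3 a b c d e f g h i \<in> I" using V by simp
qed ((rule jet_ideal0_jset; simp), unfold monomials_J3(2,5,6), simp)

lemma ideal_list_jset:
  "ideal_list =
    [jset (\<lambda>a b c d e f g h i. a = 0 \<and> b = 0 \<and> c = 0 \<and> d = 0 \<and> e = 0 \<and> f = 0 \<and> g = 0 \<and> h = 0 \<and> i = 0),
     jset (\<lambda>a b c d e f g h i. b = 0 \<and> e = 0 \<and> i = 0),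
     jset (\<lambda>a b c d e f g h i. a = 0 \<and> b = 0 \<and> d = 0 \<and> e = 0 \<and> h = 0 \<and> i = 0),
     jset (\<lambda>a b c d e f g h i. a = 0 \<and> b = 0 \<and> c = 0 \<and> d = 0 \<and> e = 0 \<and> g = 0 \<and> h = 0 \<and> i = 0),
     jset (\<lambda>a b c d e f g h i. a = 0 \<and> b = 0 \<and> c = 0 \<and> e = 0 \<and> f = 0 \<and> i = 0),
     jset (\<lambda>a b c d e f g h i. a = 0 \<and> b = 0 \<and> c = 0 \<and> d = 0 \<and> e = 0 \<and> f = 0 \<and> h = 0 \<and> i = 0),
     jset (\<lambda>a b c d e f g h i. a = 0 \<and> b = 0 \<and> c = 0 \<and> d = 0 \<and> e = 0 \<and> f = 0 \<and> g = h \<and> i = 0),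
     jset (\<lambda>a b c d e f g h i. a = 0 \<and> b = 0 \<and> d = 0 \<and> e = 0 \<and> h = 0 \<and> i = - c),
     jset (\<lambda>a b c d e f g h i. a = 0 \<and> b = 0 \<and> e = 0 \<and> i = 0),
     jset (\<lambda>a b c d e f g h i. a = 0 \<and> b = 0 \<and> d = 0 \<and> e = 0 \<and> i = 0),
     jset (\<lambda>a b c d e f g h i. a = 0 \<and> b = 0 \<and> c = 0 \<and> d = 0 \<and> e = 0 \<and> f = 0 \<and> i = 0),
     jset (\<lambda>a b c d e f g h i. a = 0 \<and> b = 0 \<and> c = 0 \<and> d = 0 \<and> e = 0 \<and> h = 0 \<and> i = 0),
     jset (\<lambda>a b c d e f g h i. a = 0 \<and> b = 0 \<and> d = 0 \<and> e = 0 \<and> i = - c),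
     jset (\<lambda>a b c d e f g h i. True),
     jset (\<lambda>a b c d e f g h i. a = 0 \<and> b = 0 \<and> c = 0 \<and> d = 0 \<and> e = 0 \<and> i = 0)]"
  unfolding ideal_list_def gen_x gen_x2 gen_x3 gen_xy gen_yx2 gen_xyxy gen_cusp gen_x2_xy gen_x2_xy2
    gen_x2y_xy2 gen_x3_x2y gen_cusp_xy2 gen_x3_x2y_xy2 jset_zero jset_all ..

section \<open>Classification of closed ideals\<close>

lemma linmap_compose:
  "linmap a b c d \<circ> linmap a' b' c' d' =
    linmap (a * a' + b * c') (a * b' + b * d') (c * a' + d * c') (c * b' + d * d')"
  by (auto simp: linmap_def fun_eq_iff algebra_simps)

text \<open>Completing the square: 4c times the form is (2cu + dv)^2 + (4ce - d^2) v^2.\<close>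

lemma definite_quadratic_nonzero:
  fixes c d e u v :: real
  assumes "d\<^sup>2 - 4 * c * e < 0" "(u, v) \<noteq> (0, 0)"
  shows "c * u\<^sup>2 + d * u * v + e * v\<^sup>2 \<noteq> 0"
proof
  assume z: "c * u\<^sup>2 + d * u * v + e * v\<^sup>2 = 0"
  have "4 * c * (c * u\<^sup>2 + d * u * v + e * v\<^sup>2) = (2 * c * u + d * v)\<^sup>2 + (4 * c * e - d\<^sup>2) * v\<^sup>2"
    by (simp add: power2_eq_square algebra_simps)
  then have s: "(2 * c * u + d * v)\<^sup>2 + (4 * c * e - d\<^sup>2) * v\<^sup>2 = 0" using z by simp
  have "(4 * c * e - d\<^sup>2) * v\<^sup>2 \<ge> 0" using assms(1) by (intro mult_nonneg_nonneg) auto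
  then have "(4 * c * e - d\<^sup>2) * v\<^sup>2 = 0" and 2: "(2 * c * u + d * v)\<^sup>2 = 0"
    using s zero_le_power2[of "2 * c * u + d * v"] by linarith+
  then have v: "v = 0" using assms(1) by auto
  have "c \<noteq> 0"
  proof
    assume "c = 0"
    then have "d\<^sup>2 < 0" using assms(1) by simp
    then show False using zero_le_power2[of d] by linarith
  qed
  then show False using 2 v assms(2) by simp
qed

text \<open>Subspaces of the plane, sorted by dimension; from two independent vectors Cramer's rule
  reaches every point. It will be applied to the linear cofactors of cubic forms with two known
  linear factors.\<close>

lemma plane_subspace_cases:
  fixes U :: "real \<Rightarrow> real \<Rightarrow> bool"
  assumes "\<And>s t a b a' b'. U a b \<Longrightarrow> U a' b' \<Longrightarrow> U (s * a + t * a') (s * b + t * b')"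
  obtains "\<And>a b. U a b \<Longrightarrow> a = 0 \<and> b = 0"
  | a b where "U a b" "(a, b) \<noteq> (0, 0)" "\<And>x y. U x y \<Longrightarrow> \<exists>s. x = s * a \<and> y = s * b"
  | "\<And>a b. U a b"
proof (cases "\<exists>a b a' b'. U a b \<and> U a' b' \<and> a * b' - b * a' \<noteq> 0")
  case True
  then obtain a b a' b' where U: "U a b" "U a' b'" and D: "a * b' - b * a' \<noteq> 0" by blast
  have "U x y" for x y
  proof -
    let ?D = "a * b' - b * a'"
    have 1: "(x * b' - y * a') * a + (a * y - b * x) * a' = ?D * x" "(x * b' - y * a') * b + (a * y - b * x) * b' = ?D * y"
      by (simp_all add: algebra_simps)
    have "(x * b' - y * a') / ?D * a + (a * y - b * x) / ?D * a' = ((x * b' - y * a') * a + (a * y - b * x) * a') / ?D"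
      "(x * b' - y * a') / ?D * b + (a * y - b * x) / ?D * b' = ((x * b' - y * a') * b + (a * y - b * x) * b') / ?D"
      by (simp_all add: add_divide_distrib)
    then have "(x * b' - y * a') / ?D * a + (a * y - b * x) / ?D * a' = x"
      "(x * b' - y * a') / ?D * b + (a * y - b * x) / ?D * b' = y"
      unfolding 1 using D by simp_all
    then show ?thesis using assms[OF U, of "(x * b' - y * a') / ?D" "(a * y - b * x) / ?D"] by simp
  qed
  then show ?thesis using that(3) by blast
next
  case False
  show ?thesis
  proof (cases "\<exists>a b. U a b \<and> (a, b) \<noteq> (0, 0)")
    case True
    then obtain a b where ab: "U a b" "(a, b) \<noteq> (0, 0)" by blast
    have "\<exists>s. x = s * a \<and> y = s * b" if "U x y" for x y
    proof -
      have e: "a * y = b * x" using False ab(1) that by auto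
      show ?thesis
      proof (cases "a = 0")
        case True
        then have "b \<noteq> 0" using ab(2) by simp
        then show ?thesis using e True by (intro exI[of _ "y / b"]) auto
      next
        case False
        then show ?thesis using e by (intro exI[of _ "x / a"]) (auto simp: field_simps)
      qed
    qed
    then show ?thesis using that(2) ab by blast
  next
    case False
    then show ?thesis using that(1) by blast
  qed
qed

text \<open>Excluding \<open>jets0 3\<close> leaves an allowed direction in every equivalent ideal;
  most contradictions below consist in forbidding all of them.\<close>

locale nontrivial_closed_ideal =
  fixes I :: "poly2 set"
  assumes closed: "closed_ideal 3 I" and proper: "I \<noteq> jets0 3"
begin

definition eqv :: "poly2 set \<Rightarrow> bool" where
  "eqv J \<longleftrightarrow> equivalent_ideals 3 I J"

text \<open>Linear equivalence is kept apart because the quotient argument is available for linear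
  images of \<open>I\<close>.\<close>

definition lin_eqv :: "poly2 set \<Rightarrow> bool" where
  "lin_eqv J \<longleftrightarrow> (\<exists>a b c d. a * d - b * c \<noteq> 0 \<and> J = pull 3 (linmap a b c d) ` I)"

lemma ideal_I: "jet_ideal0 3 I" "I \<subseteq> jets0 3"
  using closed by (simp_all add: closed_ideal_def jet_ideal0_def)

lemma lin_eqv_eqv: "lin_eqv J \<Longrightarrow> eqv J"
  unfolding lin_eqv_def eqv_def equivalent_ideals_pull using diffeo0_linmap by blast

lemma eqv_jet_ideal0: "eqv J \<Longrightarrow> jet_ideal0 3 J"
  unfolding eqv_def equivalent_ideals_pull using pull_ideal[OF _ _ ideal_I(1)] by auto

lemma eqv_ideal: "eqv J \<Longrightarrow> ideal J (jet_ring 3)"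
  using eqv_jet_ideal0 by (simp add: jet_ideal0_def)

lemma eqv_cases:
  assumes "eqv J" "p \<in> J"
  obtains a b c d e f g h i where "p = J3 a b c d e f g h i" "J3 a b c d e f g h i \<in> J"
  using assms eqv_jet_ideal0[OF assms(1)] jets0_3_eq[of p] by (auto simp: jet_ideal0_def subset_iff)

lemma eqv_shear: "eqv J \<Longrightarrow> eqv (pull 3 (shear \<alpha> \<beta>) ` J)"
  unfolding eqv_def
  by (rule equivalent_ideals_trans) (auto simp: equivalent_ideals_pull intro: diffeo0_shear)

lemma eqv_linmap:
  assumes "eqv J" "a * d - b * c \<noteq> 0"
  shows "eqv (pull 3 (linmap a b c d) ` J)"
proof -
  have "equivalent_ideals 3 J (pull 3 (linmap a b c d) ` J)"
    unfolding equivalent_ideals_pull using diffeo0_linmap[OF assms(2)] by blast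
  then show ?thesis using assms(1) unfolding eqv_def by (metis equivalent_ideals_trans one_le_numeral)
qed

lemma lin_eqv_linmap:
  assumes "lin_eqv J" "a * d - b * c \<noteq> 0"
  shows "lin_eqv (pull 3 (linmap a b c d) ` J)"
proof -
  obtain a' b' c' d' where J: "a' * d' - b' * c' \<noteq> 0" "J = pull 3 (linmap a' b' c' d') ` I"
    using assms(1) unfolding lin_eqv_def by blast
  have o: "origin_map 3 (linmap x y z w)" for x y z w
    by (simp add: origin_map_def Ck_on_linmap) (simp add: linmap_def)
  have "(a' * a + b' * c) * (c' * b + d' * d) - (a' * b + b' * d) * (c' * a + d' * c) =
      (a' * d' - b' * c') * (a * d - b * c)" by (simp add: algebra_simps)
  then have "(a' * a + b' * c) * (c' * b + d' * d) - (a' * b + b' * d) * (c' * a + d' * c) \<noteq> 0"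
    using J(1) assms(2) by simp
  moreover have "pull 3 (linmap a b c d) ` J = pull 3 (linmap (a' * a + b' * c) (a' * b + b' * d) (c' * a + d' * c) (c' * b + d' * d)) ` I"
    unfolding J(2) image_image origin_map.pull_pull[OF o o] linmap_compose ..
  ultimately show ?thesis unfolding lin_eqv_def by blast
qed

lemma lin_eqv_I: "lin_eqv I"
proof -
  have "linmap 1 0 0 1 = (\<lambda>z. z)" by (auto simp: linmap_def)
  moreover have "I = pull 3 (\<lambda>z. z) ` I"
    using ideal_I(2) by (auto simp: image_iff pull_id jets0_iff subset_iff)
  ultimately show ?thesis unfolding lin_eqv_def by (intro exI[of _ 1] exI[of _ 0]) auto
qed

lemma not_all_forbidden:
  assumes "eqv J" "\<And>u v. (u, v) \<noteq> (0, 0) \<Longrightarrow> forbidden_direction 3 J (u, v)"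
  shows False
proof -
  obtain \<phi> where \<phi>: "diffeo0 3 \<phi>" "J = pull 3 \<phi> ` I" using assms(1) unfolding eqv_def equivalent_ideals_pull by blast
  have "forbidden_direction 3 (pull 3 \<phi> ` I) \<omega>" if "norm \<omega> = 1" for \<omega>
  proof -
    obtain u v where uv: "\<omega> = (u, v)" by fastforce
    then have "(u, v) \<noteq> (0, 0)" using that by auto
    then show ?thesis using assms(2) uv \<phi>(2) by simp
  qed
  from closed_all_directions_forbidden[OF closed _ \<phi>(1) this] show False using proper by simp
qed

lemma quotient:
  assumes "lin_eqv J" "P \<in> J" "T \<in> jets0 3" "Ck_on 3 UNIV w" "Ck_on 3 UNIV h"
    "homogeneous k w" "homogeneous k h" "\<And>z. peval P z = w z * u z" "\<And>z. peval T z = h z * u z"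
    "\<And>x y. (x, y) \<noteq> 0 \<Longrightarrow> w (x, y) = 0 \<Longrightarrow> \<exists>e f g i. J3 0 0 0 0 0 e f g i \<in> J \<and>
      e * x ^ 3 + f * x\<^sup>2 * y + g * x * y\<^sup>2 + i * y ^ 3 \<noteq> 0"
  shows "T \<in> J"
proof -
  obtain a b c d where "a * d - b * c \<noteq> 0" "J = pull 3 (linmap a b c d) ` I"
    using assms(1) unfolding lin_eqv_def by blast
  from closed_ideal_quotient[OF closed this assms(2-)] show ?thesis by blast
qed

lemma eqv_eq_jset:
  "eqv J \<Longrightarrow> (\<And>a b c d e f g h i. J3 a b c d e f g h i \<in> J \<longleftrightarrow> V a b c d e f g h i) \<Longrightarrow> J = jset V"
  using jet_ideal0_eq_jset[OF eqv_jet_ideal0] .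

definition listed :: bool where
  "listed \<longleftrightarrow> (\<exists>J\<in>set ideal_list. eqv J)"

lemma listedI: "eqv J \<Longrightarrow> J = jset V \<Longrightarrow> jset V \<in> set ideal_list \<Longrightarrow> listed"
  unfolding listed_def by blast

lemma comb:
  assumes "eqv J" "J3 a b c d e f g h i \<in> J" "J3 a' b' c' d' e' f' g' h' i' \<in> J"
    "A = s * a + t * a'" "B = s * b + t * b'" "C = s * c + t * c'" "D = s * d + t * d'" "E = s * e + t * e'"
    "F = s * f + t * f'" "G = s * g + t * g'" "H = s * h + t * h'" "K = s * i + t * i'"
  shows "J3 A B C D E F G H K \<in> J"
  by (rule ideal_comb[OF eqv_ideal[OF assms(1)] assms(2-)])

lemmas mulX = ideal_J3_X[OF eqv_ideal] and mulY = ideal_J3_Y[OF eqv_ideal]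
  and scl = ideal_J3_cmult[OF eqv_ideal]

section \<open>Ideals with a jet of nonzero linear part\<close>

text \<open>y^3 forbids every direction off the x-axis, and x or x^2 leads every direction off the
  y-axis to be forbidden, so none is allowed.\<close>

lemma y3_imp_False:
  assumes "eqv J" "J3 0 0 0 0 0 0 0 0 i \<in> J" "i \<noteq> 0" "J3 a 0 c 0 0 0 0 0 0 \<in> J" "a \<noteq> 0 \<or> c \<noteq> 0"
  shows False
proof (rule not_all_forbidden[OF assms(1)])
  fix u v :: real assume uv: "(u, v) \<noteq> (0, 0)"
  show "forbidden_direction 3 J (u, v)"
  proof (cases "u = 0")
    case True
    then show ?thesis using uv assms(3) by (intro forbidden_J3_3[OF assms(2)]) auto
  next
    case False
    show ?thesis
    proof (cases "a = 0")
      case True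
      then have m: "J3 0 0 c 0 0 0 0 0 0 \<in> J" using assms(4) by simp
      show ?thesis using True False assms(5) by (intro forbidden_J3_2[OF m]) auto
    next
      case a: False
      show ?thesis using a False by (intro forbidden_J3_1[OF assms(4)]) auto
    qed
  qed
qed

text \<open>After a linear map and a shear the jet is x plus higher terms divisible by x, and then x
  itself lies in the ideal. Any element outside the ideal generated by x would put a multiple of y^3
  into it and forbid all directions.\<close>

lemma listed_linear_part:
  assumes I: "J3 a b c d e f g h i \<in> I" and ab: "(a, b) \<noteq> (0, 0)"
  shows listed
proof -
  define n where "n = a\<^sup>2 + b\<^sup>2"
  have n: "n \<noteq> 0" using ab by (simp add: n_def sum_power2_eq_zero_iff)
  \<comment> \<open>The columns are (a, b) / n and (-b, a), on which the form a x + b y takes the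
    values 1 and 0.\<close>
  let ?L = "linmap (a / n) (- b) (b / n) a"
  have det: "a / n * a - (- b) * (b / n) \<noteq> 0"
  proof -
    have "a / n * a - (- b) * (b / n) = (a\<^sup>2 + b\<^sup>2) / n" by (simp add: add_divide_distrib power2_eq_square)
    then show ?thesis using n by (simp add: n_def)
  qed
  have s: "a * (a / n) + b * (b / n) = 1" "a * - b + b * a = 0"
    using n by (simp_all add: n_def add_divide_distrib[symmetric] power2_eq_square)
  have e1: "eqv (pull 3 ?L ` I)" by (rule eqv_linmap[OF lin_eqv_eqv[OF lin_eqv_I] det])
  have "pull 3 ?L (J3 a b c d e f g h i) \<in> pull 3 ?L ` I" using I by (rule imageI)
  then obtain c d e f g h i where 1: "J3 1 0 c d e f g h i \<in> pull 3 ?L ` I" unfolding pull_linmap_J3 s by blast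
  \<comment> \<open>The parameters solve e + \<alpha> = 0 and i + \<beta> + d \<alpha> = 0, whose
    left sides are the new coefficients of y^2 and y^3.\<close>
  define J where "J = pull 3 (shear (- e) (- (i - d * e))) ` pull 3 ?L ` I"
  have J: "eqv J" unfolding J_def by (rule eqv_shear[OF e1])
  have "pull 3 (shear (- e) (- (i - d * e))) (J3 1 0 c d e f g h i) \<in> J" unfolding J_def using 1 by (rule imageI)
  then obtain h where p: "J3 1 0 c d 0 f g h 0 \<in> J" unfolding pull_shear_J3 by simp
  \<comment> \<open>Multiplied by x^2, xy and y^2, the jet leaves exactly x^3, x^2 y and x
    y^2.\<close>
  note q = mulX[OF J mulX[OF J p]] mulX[OF J mulY[OF J p]] mulY[OF J mulY[OF J p]]
  have x2: "J3 0 0 1 0 0 0 0 0 0 \<in> J"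
  proof -
    have "J3 0 0 1 0 0 0 d 0 0 \<in> J" by (rule comb[OF J mulX[OF J p] q(1), of _ 1 "- c"]) simp_all
    from comb[OF J this q(2), of _ 1 "- d"] show ?thesis by simp
  qed
  have xy: "J3 0 0 0 1 0 0 0 0 0 \<in> J"
  proof -
    have "J3 0 0 0 1 0 0 0 d 0 \<in> J" by (rule comb[OF J mulY[OF J p] q(2), of _ 1 "- c"]) simp_all
    from comb[OF J this q(3), of _ 1 "- d"] show ?thesis by simp
  qed
  have x: "J3 1 0 0 0 0 0 0 0 0 \<in> J"
  proof -
    have "J3 1 0 0 d 0 f g h 0 \<in> J" by (rule comb[OF J p x2, of _ 1 "- c"]) simp_all
    from comb[OF J this xy, of _ 1 "- d"] have "J3 1 0 0 0 0 f g h 0 \<in> J" by simp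
    from comb[OF J this q(1), of _ 1 "- f"] have "J3 1 0 0 0 0 0 g h 0 \<in> J" by simp
    from comb[OF J this q(2), of _ 1 "- g"] have "J3 1 0 0 0 0 0 0 h 0 \<in> J" by simp
    from comb[OF J this q(3), of _ 1 "- h"] show ?thesis by simp
  qed
  have rest: "J3 a 0 c d 0 f g h 0 \<in> J" for a c d f g h
  proof -
    have "gen_ideal 3 {X} \<subseteq> J"
      unfolding gen_ideal_def genideal_def using x eqv_ideal[OF J] unfolding X_J3 by blast
    then show ?thesis unfolding gen_x by (auto simp: subset_iff)
  qed
  have "b = 0 \<and> e = 0 \<and> i = 0" if r: "J3 a b c d e f g h i \<in> J" for a b c d e f g h i
  proof (rule ccontr)
    assume nz: "\<not> (b = 0 \<and> e = 0 \<and> i = 0)"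
    have t: "J3 0 b 0 0 e 0 0 0 i \<in> J" by (rule comb[OF J r rest[of a c d f g h], of _ 1 "-1"]) simp_all
    have "\<exists>i. i \<noteq> 0 \<and> J3 0 0 0 0 0 0 0 0 i \<in> J"
    proof (cases "b = 0")
      case b: True
      show ?thesis
      proof (cases "e = 0")
        case True
        then show ?thesis using t b nz by auto
      next
        case False
        then show ?thesis using mulY[OF J t] b by auto
      qed
    next
      case False
      then show ?thesis using mulY[OF J mulY[OF J t]] by auto
    qed
    then show False using y3_imp_False[OF J _ _ x] by auto
  qed
  then have "J3 a b c d e f g h i \<in> J \<longleftrightarrow> b = 0 \<and> e = 0 \<and> i = 0" for a b c d e f g h i
    using rest by auto
  from eqv_eq_jset[OF J this] show ?thesis by (rule listedI[OF J]) (simp add: ideal_list_jset)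
qed

section \<open>Ideals with an indefinite quadratic part\<close>

definition no_linear_part :: "poly2 set \<Rightarrow> bool" where
  "no_linear_part J \<longleftrightarrow> (\<forall>a b c d e f g h i. J3 a b c d e f g h i \<in> J \<longrightarrow> a = 0 \<and> b = 0)"

lemma no_linear_partD: "no_linear_part J \<Longrightarrow> J3 a b c d e f g h i \<in> J \<Longrightarrow> a = 0 \<and> b = 0"
  unfolding no_linear_part_def by blast

lemma image_J3_cases:
  assumes "eqv J" "J3 a b c d e f g h i \<in> pull 3 \<phi> ` J"
  obtains a' b' c' d' e' f' g' h' i' where "J3 a' b' c' d' e' f' g' h' i' \<in> J"
    "J3 a b c d e f g h i = pull 3 \<phi> (J3 a' b' c' d' e' f' g' h' i')"
proof -
  obtain q where "q \<in> J" "J3 a b c d e f g h i = pull 3 \<phi> q" using assms(2) by (rule imageE) blast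
  then show ?thesis using that eqv_cases[OF assms(1), of q] by metis
qed

lemma no_linear_part_shear:
  assumes "eqv J" "no_linear_part J"
  shows "no_linear_part (pull 3 (shear \<alpha> \<beta>) ` J)"
  unfolding no_linear_part_def
proof (intro allI impI)
  fix a b c d e f g h i assume "J3 a b c d e f g h i \<in> pull 3 (shear \<alpha> \<beta>) ` J"
  then show "a = 0 \<and> b = 0"
    by (rule image_J3_cases[OF assms(1)]) (use no_linear_partD[OF assms(2)] in \<open>auto simp: pull_shear_J3\<close>)
qed

lemma no_linear_part_linmap:
  assumes "eqv J" "no_linear_part J"
  shows "no_linear_part (pull 3 (linmap \<alpha> \<beta> \<gamma> \<delta>) ` J)"
  unfolding no_linear_part_def
proof (intro allI impI)
  fix a b c d e f g h i assume "J3 a b c d e f g h i \<in> pull 3 (linmap \<alpha> \<beta> \<gamma> \<delta>) ` J"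
  then show "a = 0 \<and> b = 0"
  proof (rule image_J3_cases[OF assms(1)])
    fix a' b' c' d' e' f' g' h' i'
    assume "J3 a' b' c' d' e' f' g' h' i' \<in> J"
    then have "a' = 0" "b' = 0" using no_linear_partD[OF assms(2)] by blast+
    then show "J3 a b c d e f g h i = pull 3 (linmap \<alpha> \<beta> \<gamma> \<delta>) (J3 a' b' c' d' e' f' g' h' i') \<Longrightarrow> a = 0 \<and> b = 0"
      unfolding pull_linmap_J3 J3_eq_iff by simp
  qed
qed

text \<open>The ideal \<open>\<langle>x\<^sup>2 + i y\<^sup>3, xy\<rangle>\<close> has no allowed direction if \<open>i \<noteq> 0\<close>, since
  \<open>x\<^sup>2 \<le> \<bar>xy\<bar>\<close> near the \<open>y\<close>-axis.\<close>

lemma forbidden_x2_y3_xy: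
  assumes "J3 0 0 1 0 0 0 0 0 i \<in> J" "J3 0 0 0 1 0 0 0 0 0 \<in> J" "i \<noteq> 0" "v \<noteq> 0"
  shows "forbidden_direction 3 J (0, v)"
proof -
  \<comment> \<open>Since \<delta> <= |v| / 2, the cone satisfies |x| < (\<delta>/2) |z| < |y|,
    which gives both x^2 <= |xy| and a lower bound for |y|^3.\<close>
  define \<delta> where "\<delta> = min 1 (\<bar>v\<bar> / 2)"
  have \<delta>: "\<delta> > 0" using assms(4) by (simp add: \<delta>_def)
  have dv: "\<delta> \<le> \<bar>v\<bar> / 2" by (simp add: \<delta>_def)
  have "\<bar>peval (J3 0 0 1 0 0 0 0 0 i) z\<bar> + \<bar>peval (J3 0 0 0 1 0 0 0 0 0) z\<bar> > \<bar>i\<bar> * \<delta> ^ 3 / 16 * norm z ^ 3"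
    if z: "z \<in> cone_nbhd (0, v) (\<delta> / 2) 1" for z
  proof -
    obtain x y where xy: "z = (x, y)" by fastforce
    have n: "norm z > 0" "norm (z /\<^sub>R norm z - (0, v)) < \<delta> / 2" using z by (auto simp: cone_nbhd_def)
    have "\<bar>x / norm z\<bar> \<le> norm (z /\<^sub>R norm z - (0, v))" "\<bar>y / norm z - v\<bar> \<le> norm (z /\<^sub>R norm z - (0, v))"
      using abs_le_norm_pair(1)[of "x / norm z" "y / norm z - v"] abs_le_norm_pair(2)[of "y / norm z - v" "x / norm z"] xy
      by (simp_all add: divide_inverse_commute)
    then have "\<bar>x / norm z\<bar> < \<delta> / 2" "\<bar>y / norm z\<bar> > \<delta> / 2"
      using n(2) \<delta> dv by linarith+
    then have x: "\<bar>x\<bar> < \<delta> / 2 * norm z" and y: "\<bar>y\<bar> > \<delta> / 2 * norm z"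
      using n(1) by (simp_all add: abs_divide pos_divide_less_eq pos_less_divide_eq)
    have "x\<^sup>2 \<le> \<bar>x * y\<bar>"
      using x y mult_left_mono[of "\<bar>x\<bar>" "\<bar>y\<bar>" "\<bar>x\<bar>"] by (simp add: power2_eq_square abs_mult)
    then have "\<bar>x\<^sup>2 + i * y ^ 3\<bar> + \<bar>x * y\<bar> \<ge> \<bar>i * y ^ 3\<bar>"
      using zero_le_power2[of x] by linarith
    moreover have "(\<delta> / 2 * norm z) ^ 3 < \<bar>y\<bar> ^ 3" using y \<delta> n(1) by (intro power_strict_mono) auto
    then have "\<bar>i\<bar> * (\<delta> / 2 * norm z) ^ 3 < \<bar>i\<bar> * \<bar>y\<bar> ^ 3" using assms(3) by simp
    moreover have "\<bar>i\<bar> * \<delta> ^ 3 / 16 * norm z ^ 3 \<le> \<bar>i\<bar> * (\<delta> / 2 * norm z) ^ 3"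
      using n(1) \<delta> assms(3) by (simp add: power_mult_distrib power_divide)
    ultimately show ?thesis unfolding xy peval_J3 by (simp add: abs_mult power_abs)
  qed
  then show ?thesis
    unfolding forbidden_direction_def using assms \<delta>
    by (intro exI[of _ "[J3 0 0 1 0 0 0 0 0 i, J3 0 0 0 1 0 0 0 0 0]"] exI[of _ "\<bar>i\<bar> * \<delta> ^ 3 / 16"]
        exI[of _ "\<delta> / 2"] exI[of _ 1]) auto
qed

text \<open>Multiples of the two jets give x^3, x^2 y and x y^2, so x^2 + k y^3 and xy + i y^3
  remain. A shear clears y^3 from the latter and changes x^2 only by a multiple of x y^2. If k were
  nonzero, no direction would be allowed.\<close>

lemma listed_x2_xy:
  assumes J: "eqv J" "no_linear_part J" and p: "J3 0 0 0 1 0 f g h i \<in> J"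
    and q: "J3 0 0 c d 0 f' g' h' i' \<in> J" and c: "c \<noteq> 0"
  shows listed
proof -
  note x2y = mulX[OF J(1) p] and xy2 = mulY[OF J(1) p]
  have x3: "J3 0 0 0 0 0 1 0 0 0 \<in> J"
  proof -
    have "J3 0 0 0 0 0 c 0 0 0 \<in> J"
      by (rule comb[OF J(1) mulX[OF J(1) q] x2y, of _ 1 "- d"]) simp_all
    from scl[OF J(1) this, of "1 / c"] show ?thesis using c by simp
  qed
  have red: "J3 0 0 c d e 0 0 0 i \<in> J" if "J3 0 0 c d e f g h i \<in> J" for c d e f g h i
  proof -
    from comb[OF J(1) that x3, of _ 1 "- f"] have "J3 0 0 c d e 0 g h i \<in> J" by simp
    from comb[OF J(1) this x2y, of _ 1 "- g"] have "J3 0 0 c d e 0 0 h i \<in> J" by simp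
    from comb[OF J(1) this xy2, of _ 1 "- h"] show ?thesis by simp
  qed
  have q': "J3 0 0 1 (d / c) 0 0 0 0 (i' / c) \<in> J" using scl[OF J(1) red[OF q], of "1 / c"] c by simp
  define k where "k = i' / c - d / c * i"
  have x2: "J3 0 0 1 0 0 0 0 0 k \<in> J"
    by (rule comb[OF J(1) q' red[OF p], of _ 1 "- (d / c)"]) (simp_all add: k_def)
  define J' where "J' = pull 3 (shear (- i) 0) ` J"
  have J': "eqv J'" "no_linear_part J'"
    unfolding J'_def using eqv_shear[OF J(1)] no_linear_part_shear[OF J] by blast+
  have xy: "J3 0 0 0 1 0 0 0 0 0 \<in> J'"
    using imageI[OF red[OF p], of "pull 3 (shear (- i) 0)"] unfolding J'_def[symmetric] by (simp add: pull_shear_J3)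
  note xy2' = mulY[OF J'(1) xy]
  have "J3 0 0 1 0 0 0 0 (2 * - i) k \<in> J'"
    using imageI[OF x2, of "pull 3 (shear (- i) 0)"] unfolding J'_def[symmetric] by (simp add: pull_shear_J3)
  from comb[OF J'(1) this xy2', of _ 1 "2 * i"] have x2k: "J3 0 0 1 0 0 0 0 0 k \<in> J'" by simp
  have "k = 0"
  proof (rule ccontr)
    assume k: "k \<noteq> 0"
    show False
    proof (rule not_all_forbidden[OF J'(1)])
      fix u v :: real assume uv: "(u, v) \<noteq> (0, 0)"
      show "forbidden_direction 3 J' (u, v)"
      proof (cases "u = 0")
        case True
        then show ?thesis using forbidden_x2_y3_xy[OF x2k xy k, of v] uv by simp
      next
        case False
        then show ?thesis by (intro forbidden_J3_2[OF x2k]) simp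
      qed
    qed
  qed
  then have x2': "J3 0 0 1 0 0 0 0 0 0 \<in> J'" using x2k by simp
  have rest: "J3 0 0 c d 0 f g h 0 \<in> J'" for c d f g h
  proof -
    have "gen_ideal 3 {X ^ 2, X * Y} \<subseteq> J'"
      unfolding gen_ideal_def genideal_def using x2' xy eqv_ideal[OF J'(1)] unfolding monomials_J3(1,3) by blast
    then show ?thesis unfolding gen_x2_xy by (auto simp: subset_iff)
  qed
  have "a = 0 \<and> b = 0 \<and> e = 0 \<and> i = 0" if r: "J3 a b c d e f g h i \<in> J'" for a b c d e f g h i
  proof (rule ccontr)
    assume nz: "\<not> (a = 0 \<and> b = 0 \<and> e = 0 \<and> i = 0)"
    have ab: "a = 0" "b = 0" using no_linear_partD[OF J'(2) r] by simp_all
    have t: "J3 0 0 0 0 e 0 0 0 i \<in> J'"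
      by (rule comb[OF J'(1) r rest[of c d f g h], of _ 1 "-1"]) (simp_all add: ab)
    have "\<exists>i. i \<noteq> 0 \<and> J3 0 0 0 0 0 0 0 0 i \<in> J'"
    proof (cases "e = 0")
      case True
      then show ?thesis using t ab nz by auto
    next
      case False
      then show ?thesis using mulY[OF J'(1) t] by auto
    qed
    then show False using y3_imp_False[OF J'(1) _ _ x2'] by auto
  qed
  then have "J3 a b c d e f g h i \<in> J' \<longleftrightarrow> a = 0 \<and> b = 0 \<and> e = 0 \<and> i = 0" for a b c d e f g h i
    using rest by auto
  from eqv_eq_jset[OF J'(1) this] show ?thesis by (rule listedI[OF J'(1)]) (simp add: ideal_list_jset)
qed

lemma pull_swap_J3: "pull 3 (linmap 0 1 1 0) (J3 a b c d e f g h i) = J3 b a e d c i h g f"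
  by (simp add: pull_linmap_J3)

text \<open>Since x^2 y and x y^2 are available, only the quadratic part and the coefficients of x^3
  and y^3 matter. A quadratic part that is no multiple of xy forbids all directions or leads to x^2
  and xy. Otherwise closedness rules out additional cubics, and xy generates the ideal up to
  equivalence.\<close>

lemma listed_xy:
  assumes J: "lin_eqv J" "no_linear_part J" and p: "J3 0 0 0 1 0 f g h i \<in> J"
  shows listed
proof -
  have E: "eqv J" by (rule lin_eqv_eqv[OF J(1)])
  note x2y = mulX[OF E p] and xy2 = mulY[OF E p]
  have red: "J3 0 0 c d e f 0 0 i \<in> J" if "J3 0 0 c d e f g h i \<in> J" for c d e f g h i
  proof -
    from comb[OF E that x2y, of _ 1 "- g"] have "J3 0 0 c d e f 0 h i \<in> J" by simp
    from comb[OF E this xy2, of _ 1 "- h"] show ?thesis by simp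
  qed
  note p0 = red[OF p]
  have red2: "J3 0 0 c 0 e (f' - d * f) 0 0 (i' - d * i) \<in> J" if "J3 0 0 c d e f' g' h' i' \<in> J" for c d e f' g' h' i'
    by (rule comb[OF E red[OF that] p0, of _ 1 "- d"]) simp_all
  show ?thesis
  proof (cases "\<exists>c d e f g h i. J3 0 0 c d e f g h i \<in> J \<and> (c, e) \<noteq> (0, 0)")
    case True
    then obtain c d e f' g' h' i' where "J3 0 0 c d e f' g' h' i' \<in> J" and ce: "(c, e) \<noteq> (0, 0)" by blast
    then obtain f'' i'' where q: "J3 0 0 c 0 e f'' 0 0 i'' \<in> J" using red2 by blast
    consider "c \<noteq> 0" "e \<noteq> 0" | "c \<noteq> 0" "e = 0" | "c = 0" "e \<noteq> 0" using ce by auto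
    then show ?thesis
    proof cases
      case 1
      have False
      proof (rule not_all_forbidden[OF E])
        fix u v :: real assume uv: "(u, v) \<noteq> (0, 0)"
        show "forbidden_direction 3 J (u, v)"
        proof (cases "u = 0 \<or> v = 0")
          case True
          then show ?thesis using uv 1 by (intro forbidden_J3_2[OF q]) auto
        next
          case False
          then show ?thesis by (intro forbidden_J3_2[OF p]) auto
        qed
      qed
      then show ?thesis ..
    next
      case 2
      then show ?thesis using listed_x2_xy[OF E J(2) p, of c 0] q by simp
    next
      case 3
      let ?J = "pull 3 (linmap 0 1 1 0) ` J"
      have "eqv ?J" by (rule eqv_linmap[OF E]) simp
      moreover have "no_linear_part ?J" by (rule no_linear_part_linmap[OF E J(2)])
      moreover have "J3 0 0 0 1 0 i h g f \<in> ?J" using imageI[OF p, of "pull 3 (linmap 0 1 1 0)"] unfolding pull_swap_J3 .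
      moreover have "J3 0 0 e 0 0 i'' 0 0 f'' \<in> ?J"
        using imageI[OF q, of "pull 3 (linmap 0 1 1 0)"] unfolding pull_swap_J3 using 3 by simp
      ultimately show ?thesis using listed_x2_xy 3(2) by blast
    qed
  next
    case False
    then have ce: "c = 0" "e = 0" if "J3 0 0 c d e f g h i \<in> J" for c d e f g h i using that by blast+
    have ext: "f' = 0 \<and> i' = 0" if r: "J3 0 0 0 0 0 f' 0 0 i' \<in> J" for f' i'
    proof (rule ccontr)
      assume "\<not> (f' = 0 \<and> i' = 0)"
      then consider "f' \<noteq> 0" "i' \<noteq> 0" | "f' \<noteq> 0" "i' = 0" | "f' = 0" "i' \<noteq> 0" by blast
      then show False
      proof cases
        case 1
        show False
        proof (rule not_all_forbidden[OF E])
          fix u v :: real assume uv: "(u, v) \<noteq> (0, 0)"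
          show "forbidden_direction 3 J (u, v)"
          proof (cases "u = 0 \<or> v = 0")
            case True
            then show ?thesis using uv 1 by (intro forbidden_J3_3[OF r]) auto
          next
            case False
            then show ?thesis by (intro forbidden_J3_2[OF p]) auto
          qed
        qed
      next
        case 2
        have x3: "J3 0 0 0 0 0 1 0 0 0 \<in> J" using scl[OF E r, of "1 / f'"] 2 by simp
        have P: "J3 0 0 0 1 0 0 0 0 i \<in> J" by (rule comb[OF E p0 x3, of _ 1 "- f"]) simp_all
        \<comment> \<open>\<open>J\<close> contains y (x + i y^2), and x^3 forbids the zero
          directions of y. Closedness exchanges the factor y for x and gives x (x + i y^2), whose
          x^2-term is excluded in this case.\<close>
        have "J3 0 0 1 0 0 0 0 i 0 \<in> J"
        proof (rule quotient[OF J(1) P, where w = snd and h = fst and k = 1 and u = "\<lambda>z. fst z + i * snd z ^ 2"])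
          show "\<And>x y. (x, y) \<noteq> 0 \<Longrightarrow> snd (x, y) = 0 \<Longrightarrow> \<exists>e f g i. J3 0 0 0 0 0 e f g i \<in> J \<and>
              e * x ^ 3 + f * x\<^sup>2 * y + g * x * y\<^sup>2 + i * y ^ 3 \<noteq> (0::real)"
            using x3 by (intro exI[of _ 1] exI[of _ 0]) (auto simp: zero_prod_def)
          show "peval (J3 0 0 0 1 0 0 0 0 i) z = snd z * (fst z + i * snd z ^ 2)"
            "peval (J3 0 0 1 0 0 0 0 i 0) z = fst z * (fst z + i * snd z ^ 2)" for z
            by (cases z, simp add: peval_J3 power2_eq_square power3_eq_cube algebra_simps)+
        qed (simp_all add: Ck_on_fst Ck_on_snd homogeneous_def)
        then show False using ce(1) by fastforce
      next
        case 3
        have y3: "J3 0 0 0 0 0 0 0 0 1 \<in> J" using scl[OF E r, of "1 / i'"] 3 by simp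
        have P: "J3 0 0 0 1 0 f 0 0 0 \<in> J" by (rule comb[OF E p0 y3, of _ 1 "- i"]) simp_all
        have "J3 0 0 0 0 1 0 f 0 0 \<in> J"
        proof (rule quotient[OF J(1) P, where w = fst and h = snd and k = 1 and u = "\<lambda>z. snd z + f * fst z ^ 2"])
          show "\<And>x y. (x, y) \<noteq> 0 \<Longrightarrow> fst (x, y) = 0 \<Longrightarrow> \<exists>e f g i. J3 0 0 0 0 0 e f g i \<in> J \<and>
              e * x ^ 3 + f * x\<^sup>2 * y + g * x * y\<^sup>2 + i * y ^ 3 \<noteq> (0::real)"
            by (intro exI[of _ 0] exI[of _ 1]) (use y3 in \<open>auto simp: zero_prod_def intro!: exI[of _ 1]\<close>)
          show "peval (J3 0 0 0 1 0 f 0 0 0) z = fst z * (snd z + f * fst z ^ 2)"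
            "peval (J3 0 0 0 0 1 0 f 0 0) z = snd z * (snd z + f * fst z ^ 2)" for z
            by (cases z, simp add: peval_J3 power2_eq_square power3_eq_cube algebra_simps)+
        qed (simp_all add: Ck_on_fst Ck_on_snd homogeneous_def)
        then show False using ce(2) by fastforce
      qed
    qed
    have str: "a = 0 \<and> b = 0 \<and> c = 0 \<and> e = 0 \<and> f' = d * f \<and> i' = d * i"
      if r: "J3 a b c d e f' g' h' i' \<in> J" for a b c d e f' g' h' i'
    proof -
      have ab: "a = 0" "b = 0" using no_linear_partD[OF J(2) r] by simp_all
      then have ce': "c = 0" "e = 0" using ce r by blast+
      have "J3 0 0 0 0 0 (f' - d * f) 0 0 (i' - d * i) \<in> J" using red2[of c d e f' g' h' i'] r ab ce' by simp
      from ext[OF this] show ?thesis using ab ce' by simp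
    qed
    \<comment> \<open>The first shear removes y^3 from xy + f x^3 + i y^3; after the swap the second
      removes the former x^3.\<close>
    let ?s1 = "shear (- i) 0" and ?sw = "linmap 0 1 1 0" and ?s2 = "shear (- f) 0"
    define J' where "J' = pull 3 ?s2 ` pull 3 ?sw ` pull 3 ?s1 ` J"
    have E1: "eqv (pull 3 ?s1 ` J)" by (rule eqv_shear[OF E])
    have E2: "eqv (pull 3 ?sw ` pull 3 ?s1 ` J)" by (rule eqv_linmap[OF E1]) simp
    have E': "eqv J'" unfolding J'_def by (rule eqv_shear[OF E2])
    have "pull 3 ?s2 (pull 3 ?sw (pull 3 ?s1 (J3 0 0 0 1 0 f 0 0 i))) \<in> J'"
      unfolding J'_def using p0 by (intro imageI)
    then have xy: "J3 0 0 0 1 0 0 0 0 0 \<in> J'" by (simp add: pull_shear_J3 pull_swap_J3)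
    have rest: "J3 0 0 0 d 0 0 g h 0 \<in> J'" for d g h
    proof -
      have "gen_ideal 3 {X * Y} \<subseteq> J'"
        unfolding gen_ideal_def genideal_def using xy eqv_ideal[OF E'] unfolding monomials_J3(3) by blast
      then show ?thesis unfolding gen_xy by (auto simp: subset_iff)
    qed
    have "a = 0 \<and> b = 0 \<and> c = 0 \<and> e = 0 \<and> f' = 0 \<and> i' = 0" if r: "J3 a b c d e f' g' h' i' \<in> J'" for a b c d e f' g' h' i'
    proof -
      from r[unfolded J'_def] show ?thesis
      proof (rule image_J3_cases[OF E2])
        fix a1 b1 c1 d1 e1 f1 g1 h1 i1
        assume *: "J3 a1 b1 c1 d1 e1 f1 g1 h1 i1 \<in> pull 3 ?sw ` pull 3 ?s1 ` J"
          and 1: "J3 a b c d e f' g' h' i' = pull 3 ?s2 (J3 a1 b1 c1 d1 e1 f1 g1 h1 i1)"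
        show ?thesis
        proof (rule image_J3_cases[OF E1 *])
          fix a2 b2 c2 d2 e2 f2 g2 h2 i2
          assume *: "J3 a2 b2 c2 d2 e2 f2 g2 h2 i2 \<in> pull 3 ?s1 ` J"
            and 2: "J3 a1 b1 c1 d1 e1 f1 g1 h1 i1 = pull 3 ?sw (J3 a2 b2 c2 d2 e2 f2 g2 h2 i2)"
          show ?thesis
          proof (rule image_J3_cases[OF E *])
            fix a3 b3 c3 d3 e3 f3 g3 h3 i3
            assume "J3 a3 b3 c3 d3 e3 f3 g3 h3 i3 \<in> J"
              and 3: "J3 a2 b2 c2 d2 e2 f2 g2 h2 i2 = pull 3 ?s1 (J3 a3 b3 c3 d3 e3 f3 g3 h3 i3)"
            from str[OF this(1)] 1 2 3 show ?thesis
              unfolding pull_shear_J3 pull_swap_J3 J3_eq_iff by simp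
          qed
        qed
      qed
    qed
    then have "J3 a b c d e f g h i \<in> J' \<longleftrightarrow> a = 0 \<and> b = 0 \<and> c = 0 \<and> e = 0 \<and> f = 0 \<and> i = 0" for a b c d e f g h i
      using rest by auto
    from eqv_eq_jset[OF E' this] show ?thesis by (rule listedI[OF E']) (simp add: ideal_list_jset)
  qed
qed

end

text \<open>For c = 0 the form is y (d x + e y); otherwise the quadratic formula splits it.\<close>

lemma indefinite_quadratic_factors:
  fixes c d e :: real
  assumes "d\<^sup>2 - 4 * c * e > 0"
  obtains a1 b1 a2 b2 where "c = a1 * a2" "d = a1 * b2 + b1 * a2" "e = b1 * b2" "a1 * b2 - b1 * a2 \<noteq> 0"
proof (cases "c = 0")
  case True
  \<comment> \<open>The positional arguments of \<open>that\<close> stand for \<open>a1\<close>,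
    \<open>a2\<close>, \<open>b2\<close>, \<open>b1\<close>, in the order of first
    occurrence.\<close>
  show ?thesis
    by (rule that[of 0 d e 1]) (use assms True in auto)
next
  case False
  define s where "s = sqrt (d\<^sup>2 - 4 * c * e)"
  have s: "s\<^sup>2 = d\<^sup>2 - 4 * c * e" "s > 0" using assms by (simp_all add: s_def)
  show ?thesis
  proof (rule that[of c 1 "(d + s) / (2 * c)" "(d - s) / 2"])
    show "d = c * ((d + s) / (2 * c)) + (d - s) / 2 * 1" using False by (simp add: field_simps)
    have "(d - s) / 2 * ((d + s) / (2 * c)) = (d\<^sup>2 - s\<^sup>2) / (4 * c)"
      by (simp add: power2_eq_square algebra_simps)
    then show "e = (d - s) / 2 * ((d + s) / (2 * c))" using False s(1) by simp
    show "c * ((d + s) / (2 * c)) - (d - s) / 2 * 1 \<noteq> 0" using False s(2) by (simp add: field_simps)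
  qed simp
qed

context nontrivial_closed_ideal
begin

text \<open>The two linear factors become the new coordinates, which turns the quadratic part into
  xy by a linear map, as \<open>listed_xy\<close> demands.\<close>

lemma listed_positive_discriminant:
  assumes L: "no_linear_part I" and p: "J3 0 0 c d e f g h i \<in> I" and disc: "d\<^sup>2 - 4 * c * e > 0"
  shows listed
proof -
  obtain a1 b1 a2 b2 where F: "c = a1 * a2" "d = a1 * b2 + b1 * a2" "e = b1 * b2"
    and D: "a1 * b2 - b1 * a2 \<noteq> 0"
    by (rule indefinite_quadratic_factors[OF disc])
  define D where "D = a1 * b2 - b1 * a2"
  have D0: "D \<noteq> 0" using D by (simp add: D_def)
  \<comment> \<open>These are the entries of the inverse of the matrix with rows (a1, b1) and (a2,
    b2).\<close>
  define \<alpha> \<beta> \<gamma> \<delta> where "\<alpha> = b2 / D" and "\<beta> = - b1 / D" and "\<gamma> = - a2 / D" and "\<delta> = a1 / D"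
  have 1: "a1 * \<alpha> + b1 * \<gamma> = 1" "a1 * \<beta> + b1 * \<delta> = 0" "a2 * \<alpha> + b2 * \<gamma> = 0" "a2 * \<beta> + b2 * \<delta> = 1"
  proof -
    have "a1 * \<alpha> + b1 * \<gamma> = (a1 * b2 - b1 * a2) / D" "a2 * \<beta> + b2 * \<delta> = (a1 * b2 - b1 * a2) / D"
      by (simp_all add: \<alpha>_def \<beta>_def \<gamma>_def \<delta>_def diff_divide_distrib mult.commute)
    then show "a1 * \<alpha> + b1 * \<gamma> = 1" "a2 * \<beta> + b2 * \<delta> = 1"
      unfolding D_def[symmetric] using D0 by simp_all
    show "a1 * \<beta> + b1 * \<delta> = 0" "a2 * \<alpha> + b2 * \<gamma> = 0"
      by (simp_all add: \<alpha>_def \<beta>_def \<gamma>_def \<delta>_def)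
  qed
  have det: "\<alpha> * \<delta> - \<beta> * \<gamma> \<noteq> 0"
  proof
    assume "\<alpha> * \<delta> - \<beta> * \<gamma> = 0"
    then have "(a1 * b2 - b1 * a2) * (\<alpha> * \<delta> - \<beta> * \<gamma>) = 0" by simp
    moreover have "(a1 * b2 - b1 * a2) * (\<alpha> * \<delta> - \<beta> * \<gamma>) =
        (a1 * \<alpha> + b1 * \<gamma>) * (a2 * \<beta> + b2 * \<delta>) - (a1 * \<beta> + b1 * \<delta>) * (a2 * \<alpha> + b2 * \<gamma>)"
      by (simp add: algebra_simps)
    ultimately show False unfolding 1 by simp
  qed
  let ?J = "pull 3 (linmap \<alpha> \<beta> \<gamma> \<delta>) ` I"
  have q: "c * \<alpha>\<^sup>2 + d * \<alpha> * \<gamma> + e * \<gamma>\<^sup>2 = 0"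
    "2 * c * \<alpha> * \<beta> + d * (\<alpha> * \<delta> + \<beta> * \<gamma>) + 2 * e * \<gamma> * \<delta> = 1"
    "c * \<beta>\<^sup>2 + d * \<beta> * \<delta> + e * \<delta>\<^sup>2 = 0"
  proof -
    have "c * \<alpha>\<^sup>2 + d * \<alpha> * \<gamma> + e * \<gamma>\<^sup>2 = (a1 * \<alpha> + b1 * \<gamma>) * (a2 * \<alpha> + b2 * \<gamma>)"
      "2 * c * \<alpha> * \<beta> + d * (\<alpha> * \<delta> + \<beta> * \<gamma>) + 2 * e * \<gamma> * \<delta> =
        (a1 * \<alpha> + b1 * \<gamma>) * (a2 * \<beta> + b2 * \<delta>) + (a1 * \<beta> + b1 * \<delta>) * (a2 * \<alpha> + b2 * \<gamma>)"
      "c * \<beta>\<^sup>2 + d * \<beta> * \<delta> + e * \<delta>\<^sup>2 = (a1 * \<beta> + b1 * \<delta>) * (a2 * \<beta> + b2 * \<delta>)"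
      unfolding F by (simp_all add: power2_eq_square algebra_simps)
    then show "c * \<alpha>\<^sup>2 + d * \<alpha> * \<gamma> + e * \<gamma>\<^sup>2 = 0"
      "2 * c * \<alpha> * \<beta> + d * (\<alpha> * \<delta> + \<beta> * \<gamma>) + 2 * e * \<gamma> * \<delta> = 1"
      "c * \<beta>\<^sup>2 + d * \<beta> * \<delta> + e * \<delta>\<^sup>2 = 0" unfolding 1 by simp_all
  qed
  have J: "lin_eqv ?J" by (rule lin_eqv_linmap[OF lin_eqv_I det])
  have N: "no_linear_part ?J" by (rule no_linear_part_linmap[OF lin_eqv_eqv[OF lin_eqv_I] L])
  have "pull 3 (linmap \<alpha> \<beta> \<gamma> \<delta>) (J3 0 0 c d e f g h i) \<in> ?J" using p by (rule imageI)
  then obtain f g h i where "J3 0 0 0 1 0 f g h i \<in> ?J" unfolding pull_linmap_J3 q by auto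
  then show ?thesis by (rule listed_xy[OF J N])
qed

section \<open>Ideals whose quadratic parts are multiples of one square\<close>

lemma discriminant_nonneg:
  assumes "eqv J" "J3 0 0 c d e f g h i \<in> J"
  shows "d\<^sup>2 - 4 * c * e \<ge> 0"
proof (rule ccontr)
  assume "\<not> ?thesis"
  then have "d\<^sup>2 - 4 * c * e < 0" by simp
  then show False
    using not_all_forbidden[OF assms(1)] forbidden_J3_2[OF assms(2)] definite_quadratic_nonzero by blast
qed

lemma pull_image_eq_jset:
  assumes E: "eqv J" and E': "eqv (pull 3 \<phi> ` J)"
    and V: "\<And>a b c d e f g h i. J3 a b c d e f g h i \<in> J \<longleftrightarrow> V a b c d e f g h i"
    and fwd: "\<And>a b c d e f g h i. V a b c d e f g h i \<Longrightarrow> pull 3 \<phi> (J3 a b c d e f g h i) \<in> jset V'"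
    and bwd: "\<And>a b c d e f g h i. V' a b c d e f g h i \<Longrightarrow> J3 a b c d e f g h i \<in> pull 3 \<phi> ` J"
  shows "pull 3 \<phi> ` J = jset V'"
proof (rule eqv_eq_jset[OF E'])
  fix a b c d e f g h i
  show "J3 a b c d e f g h i \<in> pull 3 \<phi> ` J \<longleftrightarrow> V' a b c d e f g h i"
  proof
    assume "J3 a b c d e f g h i \<in> pull 3 \<phi> ` J"
    then show "V' a b c d e f g h i"
    proof (rule image_J3_cases[OF E])
      fix a' b' c' d' e' f' g' h' i'
      assume "J3 a' b' c' d' e' f' g' h' i' \<in> J" "J3 a b c d e f g h i = pull 3 \<phi> (J3 a' b' c' d' e' f' g' h' i')"
      then have "J3 a b c d e f g h i \<in> jset V'" using V fwd by metis
      then show ?thesis by simp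
    qed
  qed (rule bwd)
qed

text \<open>Because x^3 and x^2 y belong to \<open>J\<close>, each element reduces to a multiple of
  x^2 + h x y^2 + i y^3 plus a multiple of x y^2; a y^3-term beyond that would forbid all
  directions. Whether x y^2 belongs to \<open>J\<close> and whether i = 0 decides between four
  ideals of the list.\<close>

lemma listed_square:
  assumes E: "eqv J" and L: "no_linear_part J" and p: "J3 0 0 1 0 0 f g h i \<in> J"
    and sq: "\<And>c d e f g h i. J3 0 0 c d e f g h i \<in> J \<Longrightarrow> d = 0 \<and> e = 0"
  shows listed
proof -
  note x3 = mulX[OF E p] and x2y = mulY[OF E p]
  have red: "J3 0 0 c 0 0 0 0 h i \<in> J" if "J3 0 0 c 0 0 f g h i \<in> J" for c f g h i
  proof -
    from comb[OF E that x3, of _ 1 "- f"] have "J3 0 0 c 0 0 0 g h i \<in> J" by simp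
    from comb[OF E this x2y, of _ 1 "- g"] show ?thesis by simp
  qed
  note p0 = red[OF p]
  have red2: "J3 0 0 0 0 0 0 0 (h' - c * h) (i' - c * i) \<in> J" if "J3 0 0 c 0 0 f' g' h' i' \<in> J" for c f' g' h' i'
    by (rule comb[OF E red[OF that] p0, of _ 1 "- c"]) simp_all
  have i0: "i' = 0" if r: "J3 0 0 0 0 0 0 0 h' i' \<in> J" for h' i'
  proof (rule ccontr)
    assume i': "i' \<noteq> 0"
    show False
    proof (rule not_all_forbidden[OF E])
      fix u v :: real assume uv: "(u, v) \<noteq> (0, 0)"
      show "forbidden_direction 3 J (u, v)"
      proof (cases "u = 0")
        case True
        then show ?thesis using uv i' by (intro forbidden_J3_3[OF r]) auto
      next
        case False
        then show ?thesis by (intro forbidden_J3_2[OF p]) auto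
      qed
    qed
  qed
  have str: "a = 0 \<and> b = 0 \<and> d = 0 \<and> e = 0 \<and> i' = c * i" "J3 0 0 0 0 0 0 0 (h' - c * h) 0 \<in> J"
    if r: "J3 a b c d e f' g' h' i' \<in> J" for a b c d e f' g' h' i'
  proof -
    have ab: "a = 0" "b = 0" using no_linear_partD[OF L r] by simp_all
    then have de: "d = 0" "e = 0" using sq r by blast+
    have m: "J3 0 0 0 0 0 0 0 (h' - c * h) (i' - c * i) \<in> J" using red2[of c f' g' h' i'] r ab de by simp
    from i0[OF m] have i': "i' - c * i = 0" .
    then show "J3 0 0 0 0 0 0 0 (h' - c * h) 0 \<in> J" using m by simp
    show "a = 0 \<and> b = 0 \<and> d = 0 \<and> e = 0 \<and> i' = c * i" using ab de i' by simp
  qed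
  have mem: "J3 0 0 c 0 0 f' g' (c * h) (c * i) \<in> J" for c f' g'
  proof -
    from comb[OF E p0 x3, of _ c f'] have "J3 0 0 c 0 0 f' 0 (c * h) (c * i) \<in> J" by simp
    from comb[OF E this x2y, of _ 1 g'] show ?thesis by simp
  qed
  \<comment> \<open>Scaling y by \<delta> turns i y^3 into -y^3. The cube root exists for either
    sign of i, so both orientations of the cusp are equivalent.\<close>
  define \<delta> where "\<delta> = root 3 (- 1 / i)"
  have scale: "i * \<delta> ^ 3 = - 1" "\<delta> \<noteq> 0" if "i \<noteq> 0"
  proof -
    have "\<delta> ^ 3 = - 1 / i" by (simp add: \<delta>_def odd_real_root_pow)
    then show "i * \<delta> ^ 3 = - 1" using that by simp
    then show "\<delta> \<noteq> 0" by auto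
  qed
  show ?thesis
  proof (cases "\<exists>h'. h' \<noteq> 0 \<and> J3 0 0 0 0 0 0 0 h' 0 \<in> J")
    case True
    then obtain h' where "h' \<noteq> 0" "J3 0 0 0 0 0 0 0 h' 0 \<in> J" by blast
    then have xy2: "J3 0 0 0 0 0 0 0 1 0 \<in> J" using scl[OF E, of 0 0 0 0 0 0 0 h' 0 "1 / h'"] by simp
    have V: "J3 a b c d e f g h' i' \<in> J \<longleftrightarrow> a = 0 \<and> b = 0 \<and> d = 0 \<and> e = 0 \<and> i' = c * i" for a b c d e f g h' i'
    proof
      assume *: "a = 0 \<and> b = 0 \<and> d = 0 \<and> e = 0 \<and> i' = c * i"
      from comb[OF E mem[of c f g] xy2, of _ 1 "h' - c * h"] show "J3 a b c d e f g h' i' \<in> J" using * by simp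
    qed (rule str)
    show ?thesis
    proof (cases "i = 0")
      case True
      have "J = jset (\<lambda>a b c d e f g h i. a = 0 \<and> b = 0 \<and> d = 0 \<and> e = 0 \<and> i = 0)"
        by (rule eqv_eq_jset[OF E]) (use V True in auto)
      then show ?thesis by (rule listedI[OF E]) (simp add: ideal_list_jset)
    next
      case False
      let ?L = "linmap 1 0 0 \<delta>"
      have s3: "c * i * \<delta> ^ 3 = - c" for c using scale(1)[OF False] by (simp add: mult.assoc)
      have E': "eqv (pull 3 ?L ` J)" using scale[OF False] by (intro eqv_linmap[OF E]) simp
      have "pull 3 ?L ` J = jset (\<lambda>a b c d e f g h i. a = 0 \<and> b = 0 \<and> d = 0 \<and> e = 0 \<and> i = - c)"
      proof (rule pull_image_eq_jset[OF E E' V])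
        show "pull 3 ?L (J3 a b c d e f g h' i') \<in> jset (\<lambda>a b c d e f g h i. a = 0 \<and> b = 0 \<and> d = 0 \<and> e = 0 \<and> i = - c)"
          if "a = 0 \<and> b = 0 \<and> d = 0 \<and> e = 0 \<and> i' = c * i" for a b c d e f g h' i'
          using that by (simp add: pull_linmap_J3 s3)
        show "J3 a b c d e f g h' i' \<in> pull 3 ?L ` J"
          if "a = 0 \<and> b = 0 \<and> d = 0 \<and> e = 0 \<and> i' = - c" for a b c d e f g h' i'
          by (rule image_eqI[of _ _ "J3 0 0 c 0 0 f (g / \<delta>) (h' / \<delta>\<^sup>2) (c * i)"]) (use that scale(2)[OF False] in \<open>simp_all add: pull_linmap_J3 s3 V\<close>)
      qed
      then show ?thesis by (rule listedI[OF E']) (simp add: ideal_list_jset)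
    qed
  next
    case False
    have V: "J3 a b c d e f g h' i' \<in> J \<longleftrightarrow> a = 0 \<and> b = 0 \<and> d = 0 \<and> e = 0 \<and> h' = c * h \<and> i' = c * i" for a b c d e f g h' i'
    proof
      assume *: "a = 0 \<and> b = 0 \<and> d = 0 \<and> e = 0 \<and> h' = c * h \<and> i' = c * i"
      show "J3 a b c d e f g h' i' \<in> J" using * mem[of c f g] by simp
    next
      assume r: "J3 a b c d e f g h' i' \<in> J"
      have "h' - c * h = 0" using str(2)[OF r] False by blast
      then show "a = 0 \<and> b = 0 \<and> d = 0 \<and> e = 0 \<and> h' = c * h \<and> i' = c * i" using str(1)[OF r] by simp
    qed
    \<comment> \<open>The shear completes the square: putting x - h y^2 / 2 for x in x^2 + h x y^2
      leaves x^2 up to terms of degree 4.\<close>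
    define J' where "J' = pull 3 (shear (- h / 2) 0) ` J"
    have E': "eqv J'" unfolding J'_def by (rule eqv_shear[OF E])
    have J': "J' = jset (\<lambda>a b c d e f g h' i'. a = 0 \<and> b = 0 \<and> d = 0 \<and> e = 0 \<and> h' = 0 \<and> i' = c * i)"
      unfolding J'_def
    proof (rule pull_image_eq_jset[OF E E'[unfolded J'_def] V])
      show "J3 a b c d e f g h' i' \<in> pull 3 (shear (- h / 2) 0) ` J"
        if "a = 0 \<and> b = 0 \<and> d = 0 \<and> e = 0 \<and> h' = 0 \<and> i' = c * i" for a b c d e f g h' i'
        by (rule image_eqI[of _ _ "J3 0 0 c 0 0 f g (c * h) (c * i)"]) (use that in \<open>simp_all add: pull_shear_J3 V\<close>)
    qed (simp add: pull_shear_J3)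
    show ?thesis
    proof (cases "i = 0")
      case True
      then have "J' = jset (\<lambda>a b c d e f g h i. a = 0 \<and> b = 0 \<and> d = 0 \<and> e = 0 \<and> h = 0 \<and> i = 0)" using J' by simp
      then show ?thesis by (rule listedI[OF E']) (simp add: ideal_list_jset)
    next
      case False
      let ?L = "linmap 1 0 0 \<delta>"
      have s3: "c * i * \<delta> ^ 3 = - c" for c using scale(1)[OF False] by (simp add: mult.assoc)
      have E'': "eqv (pull 3 ?L ` J')" using scale[OF False] by (intro eqv_linmap[OF E']) simp
      have V: "J3 a b c d e f g h' i' \<in> J' \<longleftrightarrow> a = 0 \<and> b = 0 \<and> d = 0 \<and> e = 0 \<and> h' = 0 \<and> i' = c * i" for a b c d e f g h' i'
        unfolding J' by simp
      have "pull 3 ?L ` J' = jset (\<lambda>a b c d e f g h i. a = 0 \<and> b = 0 \<and> d = 0 \<and> e = 0 \<and> h = 0 \<and> i = - c)"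
      proof (rule pull_image_eq_jset[OF E' E'' V])
        show "pull 3 ?L (J3 a b c d e f g h' i') \<in> jset (\<lambda>a b c d e f g h i. a = 0 \<and> b = 0 \<and> d = 0 \<and> e = 0 \<and> h = 0 \<and> i = - c)"
          if "a = 0 \<and> b = 0 \<and> d = 0 \<and> e = 0 \<and> h' = 0 \<and> i' = c * i" for a b c d e f g h' i'
          using that by (simp add: pull_linmap_J3 s3)
        show "J3 a b c d e f g h' i' \<in> pull 3 ?L ` J'"
          if "a = 0 \<and> b = 0 \<and> d = 0 \<and> e = 0 \<and> h' = 0 \<and> i' = - c" for a b c d e f g h' i'
          by (rule image_eqI[of _ _ "J3 0 0 c 0 0 f (g / \<delta>) 0 (c * i)"]) (use that scale(2)[OF False] in \<open>simp_all add: pull_linmap_J3 s3 V\<close>)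
      qed
      then show ?thesis by (rule listedI[OF E'']) (simp add: ideal_list_jset)
    qed
  qed
qed

text \<open>If no quadratic part is indefinite, none is definite either, since that would forbid all
  directions. All discriminants then vanish, and a linear space of degenerate forms is spanned by a
  single square.\<close>

lemma listed_quadratic_part:
  assumes L: "no_linear_part I" and p: "J3 0 0 c d e f g h i \<in> I" and cde: "(c, d, e) \<noteq> (0, 0, 0)"
  shows listed
proof (cases "\<exists>c d e f g h i. J3 0 0 c d e f g h i \<in> I \<and> d\<^sup>2 - 4 * c * e > 0")
  case True
  then show ?thesis using listed_positive_discriminant[OF L] by blast
next
  case False
  have EI: "eqv I" by (rule lin_eqv_eqv[OF lin_eqv_I])
  have disc: "d\<^sup>2 = 4 * c * e" if "J3 0 0 c d e f g h i \<in> I" for c d e f g h i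
  proof -
    have "d\<^sup>2 - 4 * c * e \<le> 0" using False that by (metis not_le)
    then show ?thesis using discriminant_nonneg[OF EI that] by linarith
  qed
  \<comment> \<open>the new \<open>y\<close>-axis is the double root of the quadratic form\<close>
  have "\<exists>\<alpha> \<beta> \<gamma> \<delta>. \<alpha> * \<delta> - \<beta> * \<gamma> \<noteq> 0 \<and> c * \<alpha>\<^sup>2 + d * \<alpha> * \<gamma> + e * \<gamma>\<^sup>2 \<noteq> 0 \<and>
      2 * c * \<alpha> * \<beta> + d * (\<alpha> * \<delta> + \<beta> * \<gamma>) + 2 * e * \<gamma> * \<delta> = 0 \<and> c * \<beta>\<^sup>2 + d * \<beta> * \<delta> + e * \<delta>\<^sup>2 = 0"
  proof (cases "c = 0")
    case True
    then have "d = 0" using disc[OF p] by simp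
    then show ?thesis using True cde by (intro exI[of _ 0] exI[of _ 1] exI[of _ 1] exI[of _ 0]) simp
  next
    case False
    have "c * (- d / (2 * c))\<^sup>2 + d * (- d / (2 * c)) + e = (4 * c * e - d\<^sup>2) / (4 * c)"
      using False by (simp add: field_simps power2_eq_square)
    then have "c * (- d / (2 * c))\<^sup>2 + d * (- d / (2 * c)) + e = 0" using disc[OF p] by simp
    then show ?thesis using False
      by (intro exI[of _ 1] exI[of _ "- d / (2 * c)"] exI[of _ 0] exI[of _ 1]) simp
  qed
  then obtain \<alpha> \<beta> \<gamma> \<delta> where det: "\<alpha> * \<delta> - \<beta> * \<gamma> \<noteq> 0" and c': "c * \<alpha>\<^sup>2 + d * \<alpha> * \<gamma> + e * \<gamma>\<^sup>2 \<noteq> 0"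
    and q: "2 * c * \<alpha> * \<beta> + d * (\<alpha> * \<delta> + \<beta> * \<gamma>) + 2 * e * \<gamma> * \<delta> = 0" "c * \<beta>\<^sup>2 + d * \<beta> * \<delta> + e * \<delta>\<^sup>2 = 0"
    by blast
  define J where "J = pull 3 (linmap \<alpha> \<beta> \<gamma> \<delta>) ` I"
  have E: "eqv J" unfolding J_def by (rule eqv_linmap[OF EI det])
  have N: "no_linear_part J" unfolding J_def by (rule no_linear_part_linmap[OF EI L])
  have "pull 3 (linmap \<alpha> \<beta> \<gamma> \<delta>) (J3 0 0 c d e f g h i) \<in> J" unfolding J_def using p by (rule imageI)
  then obtain f g h i where "J3 0 0 (c * \<alpha>\<^sup>2 + d * \<alpha> * \<gamma> + e * \<gamma>\<^sup>2) 0 0 f g h i \<in> J"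
    unfolding pull_linmap_J3 q by auto
  from scl[OF E this, of "1 / (c * \<alpha>\<^sup>2 + d * \<alpha> * \<gamma> + e * \<gamma>\<^sup>2)"] obtain f g h i where
    p2: "J3 0 0 1 0 0 f g h i \<in> J" using c' by auto
  have discJ: "d\<^sup>2 = 4 * c * e" if r: "J3 0 0 c d e f g h i \<in> J" for c d e f g h i
    using r[unfolded J_def]
  proof (rule image_J3_cases[OF EI])
    fix a1 b1 c1 d1 e1 f1 g1 h1 i1
    assume *: "J3 a1 b1 c1 d1 e1 f1 g1 h1 i1 \<in> I"
      and eq: "J3 0 0 c d e f g h i = pull 3 (linmap \<alpha> \<beta> \<gamma> \<delta>) (J3 a1 b1 c1 d1 e1 f1 g1 h1 i1)"
    have "a1 = 0" "b1 = 0" using no_linear_partD[OF L *] by simp_all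
    then have D: "d1\<^sup>2 - 4 * c1 * e1 = 0" using disc * by auto
    have cde: "c = c1 * \<alpha>\<^sup>2 + d1 * \<alpha> * \<gamma> + e1 * \<gamma>\<^sup>2"
      "d = 2 * c1 * \<alpha> * \<beta> + d1 * (\<alpha> * \<delta> + \<beta> * \<gamma>) + 2 * e1 * \<gamma> * \<delta>"
      "e = c1 * \<beta>\<^sup>2 + d1 * \<beta> * \<delta> + e1 * \<delta>\<^sup>2"
      using eq unfolding pull_linmap_J3 J3_eq_iff by blast+
    \<comment> \<open>A linear substitution multiplies the discriminant by the square of the
      determinant.\<close>
    have "d\<^sup>2 - 4 * c * e = (\<alpha> * \<delta> - \<beta> * \<gamma>)\<^sup>2 * (d1\<^sup>2 - 4 * c1 * e1)"
      unfolding cde by (simp add: power2_eq_square algebra_simps)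
    then show "d\<^sup>2 = 4 * c * e" unfolding D by simp
  qed
  show ?thesis
  proof (rule listed_square[OF E N p2])
    fix c d e f' g' h' i' assume r: "J3 0 0 c d e f' g' h' i' \<in> J"
    \<comment> \<open>Adding x^2 changes the discriminant by -4e; both discriminants vanish, so e =
      0 and then d = 0.\<close>
    have "J3 0 0 (c + 1) d e (f' + f) (g' + g) (h' + h) (i' + i) \<in> J"
      by (rule comb[OF E r p2, of _ 1 1]) simp_all
    from discJ[OF this] discJ[OF r] show "d = 0 \<and> e = 0" by (simp add: algebra_simps)
  qed
qed

section \<open>Ideals consisting of cubic forms\<close>

definition cubic :: "poly2 set \<Rightarrow> bool" where
  "cubic J \<longleftrightarrow> (\<forall>a b c d e f g h i. J3 a b c d e f g h i \<in> J \<longrightarrow> a = 0 \<and> b = 0 \<and> c = 0 \<and> d = 0 \<and> e = 0)"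

lemma cubicD:
  "cubic J \<Longrightarrow> J3 a b c d e f g h i \<in> J \<Longrightarrow> a = 0 \<and> b = 0 \<and> c = 0 \<and> d = 0 \<and> e = 0"
  unfolding cubic_def by blast

lemma cubic_linmap:
  assumes "eqv J" "cubic J"
  shows "cubic (pull 3 (linmap \<alpha> \<beta> \<gamma> \<delta>) ` J)"
  unfolding cubic_def
proof (intro allI impI)
  fix a b c d e f g h i assume "J3 a b c d e f g h i \<in> pull 3 (linmap \<alpha> \<beta> \<gamma> \<delta>) ` J"
  then show "a = 0 \<and> b = 0 \<and> c = 0 \<and> d = 0 \<and> e = 0"
  proof (rule image_J3_cases[OF assms(1)])
    fix a' b' c' d' e' f' g' h' i'
    assume "J3 a' b' c' d' e' f' g' h' i' \<in> J"
    note * = cubicD[OF assms(2) this]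
    show "J3 a b c d e f g h i = pull 3 (linmap \<alpha> \<beta> \<gamma> \<delta>) (J3 a' b' c' d' e' f' g' h' i') \<Longrightarrow>
        a = 0 \<and> b = 0 \<and> c = 0 \<and> d = 0 \<and> e = 0"
      unfolding pull_linmap_J3 J3_eq_iff using * by simp
  qed
qed

lemma listed_zero:
  assumes E: "eqv J" "cubic J" and z: "\<And>f g h i. J3 0 0 0 0 0 f g h i \<in> J \<Longrightarrow> f = 0 \<and> g = 0 \<and> h = 0 \<and> i = 0"
  shows listed
proof -
  have "J3 0 0 0 0 0 0 0 0 0 \<in> J" using ideal_jet_zero[OF eqv_ideal[OF E(1)]] by (simp add: J3_zero)
  then have "J3 a b c d e f g h i \<in> J \<longleftrightarrow> a = 0 \<and> b = 0 \<and> c = 0 \<and> d = 0 \<and> e = 0 \<and> f = 0 \<and> g = 0 \<and> h = 0 \<and> i = 0"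
    for a b c d e f g h i
    using cubicD[OF E(2), of a b c d e f g h i] z[of f g h i] by auto
  from eqv_eq_jset[OF E(1) this] show ?thesis by (rule listedI[OF E(1)]) (simp add: ideal_list_jset)
qed

text \<open>Every cubic is x^2 times a linear form, and these forms are a subspace of the plane. A
  one-dimensional one is spanned by x or can be moved to y while x stays fixed.\<close>

lemma listed_x2:
  assumes E: "eqv J" and C: "cubic J" and hi: "\<And>f g h i. J3 0 0 0 0 0 f g h i \<in> J \<Longrightarrow> h = 0 \<and> i = 0"
  shows listed
proof -
  have V: "J3 a b c d e f g h i \<in> J \<longleftrightarrow>
      a = 0 \<and> b = 0 \<and> c = 0 \<and> d = 0 \<and> e = 0 \<and> h = 0 \<and> i = 0 \<and> J3 0 0 0 0 0 f g 0 0 \<in> J" for a b c d e f g h i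
    using cubicD[OF C, of a b c d e f g h i] hi[of f g h i] by auto
  have sub: "J3 0 0 0 0 0 (s * f + t * f') (s * g + t * g') 0 0 \<in> J"
    if "J3 0 0 0 0 0 f g 0 0 \<in> J" "J3 0 0 0 0 0 f' g' 0 0 \<in> J" for s t f f' g g'
    by (rule comb[OF E that, of _ s t]) simp_all
  show ?thesis
  proof (rule plane_subspace_cases[of "\<lambda>f g. J3 0 0 0 0 0 f g 0 0 \<in> J", OF sub])
    assume z: "\<And>f g. J3 0 0 0 0 0 f g 0 0 \<in> J \<Longrightarrow> f = 0 \<and> g = 0"
    show ?thesis
    proof (rule listed_zero[OF E C])
      fix f g h i assume r: "J3 0 0 0 0 0 f g h i \<in> J"
      then have "h = 0" "i = 0" using hi by blast+
      then show "f = 0 \<and> g = 0 \<and> h = 0 \<and> i = 0" using z r by simp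
    qed
  next
    assume all: "\<And>f g. J3 0 0 0 0 0 f g 0 0 \<in> J"
    have "J = jset (\<lambda>a b c d e f g h i. a = 0 \<and> b = 0 \<and> c = 0 \<and> d = 0 \<and> e = 0 \<and> h = 0 \<and> i = 0)"
      by (rule eqv_eq_jset[OF E]) (use V all in blast)
    then show ?thesis by (rule listedI[OF E]) (simp add: ideal_list_jset)
  next
    fix f0 g0 assume m: "J3 0 0 0 0 0 f0 g0 0 0 \<in> J" and nz: "(f0, g0) \<noteq> (0, 0)"
      and pr: "\<And>f g. J3 0 0 0 0 0 f g 0 0 \<in> J \<Longrightarrow> \<exists>s. f = s * f0 \<and> g = s * g0"
    have V': "J3 0 0 0 0 0 f g 0 0 \<in> J \<longleftrightarrow> (\<exists>s. f = s * f0 \<and> g = s * g0)" for f g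
      using pr scl[OF E m] by auto
    show ?thesis
    proof (cases "g0 = 0")
      case True
      have "f0 \<noteq> 0" using nz True by simp
      then have "(\<exists>s. f = s * f0 \<and> g = s * g0) \<longleftrightarrow> g = 0" for f g
        using True by (auto intro: exI[of _ "f / f0"])
      then have "J3 a b c d e f g h i \<in> J \<longleftrightarrow>
        a = 0 \<and> b = 0 \<and> c = 0 \<and> d = 0 \<and> e = 0 \<and> g = 0 \<and> h = 0 \<and> i = 0" for a b c d e f g h i
        using V[of a b c d e f g h i] V' by auto
      from eqv_eq_jset[OF E this] show ?thesis by (rule listedI[OF E]) (simp add: ideal_list_jset)
    next
      case False
      \<comment> \<open>This substitution fixes x and sends f0 x + g0 y to y.\<close>
      let ?L = "linmap 1 0 (- f0 / g0) (1 / g0)"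
      have E': "eqv (pull 3 ?L ` J)" by (rule eqv_linmap[OF E]) (use False in simp)
      have W: "J3 a b c d e f g h i \<in> J \<longleftrightarrow>
        a = 0 \<and> b = 0 \<and> c = 0 \<and> d = 0 \<and> e = 0 \<and> h = 0 \<and> i = 0 \<and> (\<exists>s. f = s * f0 \<and> g = s * g0)" for a b c d e f g h i
        using V[of a b c d e f g h i] V' by auto
      have "pull 3 ?L ` J = jset (\<lambda>a b c d e f g h i. a = 0 \<and> b = 0 \<and> c = 0 \<and> d = 0 \<and> e = 0 \<and> f = 0 \<and> h = 0 \<and> i = 0)"
      proof (rule pull_image_eq_jset[OF E E' W])
        show "pull 3 ?L (J3 a b c d e f g h i) \<in>
            jset (\<lambda>a b c d e f g h i. a = 0 \<and> b = 0 \<and> c = 0 \<and> d = 0 \<and> e = 0 \<and> f = 0 \<and> h = 0 \<and> i = 0)"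
          if "a = 0 \<and> b = 0 \<and> c = 0 \<and> d = 0 \<and> e = 0 \<and> h = 0 \<and> i = 0 \<and> (\<exists>s. f = s * f0 \<and> g = s * g0)"
          for a b c d e f g h i
          using that False by (auto simp: pull_linmap_J3)
        show "J3 a b c d e f g h i \<in> pull 3 ?L ` J"
          if "a = 0 \<and> b = 0 \<and> c = 0 \<and> d = 0 \<and> e = 0 \<and> f = 0 \<and> h = 0 \<and> i = 0" for a b c d e f g h i
          by (rule image_eqI[of _ _ "J3 0 0 0 0 0 (g * f0) (g * g0) 0 0"]) (use that False in \<open>auto simp: pull_linmap_J3 W intro!: exI[of _ g]\<close>)
      qed
      then show ?thesis by (rule listedI[OF E']) (simp add: ideal_list_jset)
    qed
  qed
qed

text \<open>Every cubic is xy times a linear form. A single spanning form g0 x + h0 y is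
  proportional to a coordinate, or both coefficients are nonzero and scaling the axes makes it
  proportional to x + y.\<close>

lemma listed_xy_factor:
  assumes E: "eqv J" and C: "cubic J" and fi: "\<And>f g h i. J3 0 0 0 0 0 f g h i \<in> J \<Longrightarrow> f = 0 \<and> i = 0"
  shows listed
proof -
  have V: "J3 a b c d e f g h i \<in> J \<longleftrightarrow>
      a = 0 \<and> b = 0 \<and> c = 0 \<and> d = 0 \<and> e = 0 \<and> f = 0 \<and> i = 0 \<and> J3 0 0 0 0 0 0 g h 0 \<in> J" for a b c d e f g h i
    using cubicD[OF C, of a b c d e f g h i] fi[of f g h i] by auto
  have sub: "J3 0 0 0 0 0 0 (s * g + t * g') (s * h + t * h') 0 \<in> J"
    if "J3 0 0 0 0 0 0 g h 0 \<in> J" "J3 0 0 0 0 0 0 g' h' 0 \<in> J" for s t h h' g g'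
    by (rule comb[OF E that, of _ s t]) simp_all
  show ?thesis
  proof (rule plane_subspace_cases[of "\<lambda>g h. J3 0 0 0 0 0 0 g h 0 \<in> J", OF sub])
    assume z: "\<And>g h. J3 0 0 0 0 0 0 g h 0 \<in> J \<Longrightarrow> g = 0 \<and> h = 0"
    show ?thesis
    proof (rule listed_zero[OF E C])
      fix f g h i assume r: "J3 0 0 0 0 0 f g h i \<in> J"
      then have "f = 0" "i = 0" using fi by blast+
      then show "f = 0 \<and> g = 0 \<and> h = 0 \<and> i = 0" using z r by simp
    qed
  next
    assume all: "\<And>g h. J3 0 0 0 0 0 0 g h 0 \<in> J"
    have "J = jset (\<lambda>a b c d e f g h i. a = 0 \<and> b = 0 \<and> c = 0 \<and> d = 0 \<and> e = 0 \<and> f = 0 \<and> i = 0)"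
      by (rule eqv_eq_jset[OF E]) (use V all in blast)
    then show ?thesis by (rule listedI[OF E]) (simp add: ideal_list_jset)
  next
    fix g0 h0 assume m: "J3 0 0 0 0 0 0 g0 h0 0 \<in> J" and nz: "(g0, h0) \<noteq> (0, 0)"
      and pr: "\<And>g h. J3 0 0 0 0 0 0 g h 0 \<in> J \<Longrightarrow> \<exists>s. g = s * g0 \<and> h = s * h0"
    have V': "J3 0 0 0 0 0 0 g h 0 \<in> J \<longleftrightarrow> (\<exists>s. g = s * g0 \<and> h = s * h0)" for g h
      using pr scl[OF E m] by auto
    have W: "J3 a b c d e f g h i \<in> J \<longleftrightarrow>
      a = 0 \<and> b = 0 \<and> c = 0 \<and> d = 0 \<and> e = 0 \<and> f = 0 \<and> i = 0 \<and> (\<exists>s. g = s * g0 \<and> h = s * h0)" for a b c d e f g h i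
      using V[of a b c d e f g h i] V' by auto
    consider "h0 = 0" "g0 \<noteq> 0" | "g0 = 0" "h0 \<noteq> 0" | "g0 \<noteq> 0" "h0 \<noteq> 0" using nz by auto
    then show ?thesis
    proof cases
      case 1
      have "(\<exists>s. g = s * g0 \<and> h = s * h0) \<longleftrightarrow> h = 0" for g h
        using 1 by (auto intro: exI[of _ "g / g0"])
      then have "J3 a b c d e f g h i \<in> J \<longleftrightarrow>
        a = 0 \<and> b = 0 \<and> c = 0 \<and> d = 0 \<and> e = 0 \<and> f = 0 \<and> h = 0 \<and> i = 0" for a b c d e f g h i
        using W[of a b c d e f g h i] by auto
      from eqv_eq_jset[OF E this] show ?thesis by (rule listedI[OF E]) (simp add: ideal_list_jset)
    next
      case 2
      let ?L = "linmap 0 1 1 0"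
      have E': "eqv (pull 3 ?L ` J)" by (rule eqv_linmap[OF E]) simp
      have "pull 3 ?L ` J = jset (\<lambda>a b c d e f g h i. a = 0 \<and> b = 0 \<and> c = 0 \<and> d = 0 \<and> e = 0 \<and> f = 0 \<and> h = 0 \<and> i = 0)"
      proof (rule pull_image_eq_jset[OF E E' W])
        show "pull 3 ?L (J3 a b c d e f g h i) \<in>
            jset (\<lambda>a b c d e f g h i. a = 0 \<and> b = 0 \<and> c = 0 \<and> d = 0 \<and> e = 0 \<and> f = 0 \<and> h = 0 \<and> i = 0)"
          if "a = 0 \<and> b = 0 \<and> c = 0 \<and> d = 0 \<and> e = 0 \<and> f = 0 \<and> i = 0 \<and> (\<exists>s. g = s * g0 \<and> h = s * h0)"
          for a b c d e f g h i
          using that 2 by (auto simp: pull_swap_J3)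
        show "J3 a b c d e f g h i \<in> pull 3 ?L ` J"
          if "a = 0 \<and> b = 0 \<and> c = 0 \<and> d = 0 \<and> e = 0 \<and> f = 0 \<and> h = 0 \<and> i = 0" for a b c d e f g h i
          by (rule image_eqI[of _ _ "J3 0 0 0 0 0 0 0 g 0"]) (use that 2 in \<open>auto simp: pull_swap_J3 W intro!: exI[of _ "g / h0"]\<close>)
      qed
      then show ?thesis by (rule listedI[OF E']) (simp add: ideal_list_jset)
    next
      case 3
      \<comment> \<open>Substituting h0 x and g0 y gives both x^2 y and x y^2 the coefficient g0^2
        h0^2.\<close>
      let ?L = "linmap h0 0 0 g0"
      have E': "eqv (pull 3 ?L ` J)" by (rule eqv_linmap[OF E]) (use 3 in simp)
      have "pull 3 ?L ` J = jset (\<lambda>a b c d e f g h i. a = 0 \<and> b = 0 \<and> c = 0 \<and> d = 0 \<and> e = 0 \<and> f = 0 \<and> g = h \<and> i = 0)"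
      proof (rule pull_image_eq_jset[OF E E' W])
        show "pull 3 ?L (J3 a b c d e f g h i) \<in>
            jset (\<lambda>a b c d e f g h i. a = 0 \<and> b = 0 \<and> c = 0 \<and> d = 0 \<and> e = 0 \<and> f = 0 \<and> g = h \<and> i = 0)"
          if "a = 0 \<and> b = 0 \<and> c = 0 \<and> d = 0 \<and> e = 0 \<and> f = 0 \<and> i = 0 \<and> (\<exists>s. g = s * g0 \<and> h = s * h0)"
          for a b c d e f g h i
          using that by (auto simp: pull_linmap_J3 power2_eq_square)
        show "J3 a b c d e f g h i \<in> pull 3 ?L ` J"
          if "a = 0 \<and> b = 0 \<and> c = 0 \<and> d = 0 \<and> e = 0 \<and> f = 0 \<and> g = h \<and> i = 0" for a b c d e f g h i
          by (rule image_eqI[of _ _ "J3 0 0 0 0 0 0 (g / (g0 * h0\<^sup>2)) (g / (g0\<^sup>2 * h0)) 0"]) (use that 3 in \<open>auto simp: pull_linmap_J3 W field_simps power2_eq_square intro!: exI[of _ "g / (g0\<^sup>2 * h0\<^sup>2)"]\<close>)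
      qed
      then show ?thesis by (rule listedI[OF E']) (simp add: ideal_list_jset)
    qed
  qed
qed

text \<open>Every cubic is x times a quadratic cofactor. If the cofactors have a common real zero,
  they share a linear factor, which is x or can be moved to y, and a preceding case applies. If not,
  closedness exchanges one cofactor for any quadratic form, so x times everything belongs to
  \<open>J\<close>.\<close>

lemma listed_x_factor:
  assumes lin: "lin_eqv J" and C: "cubic J" and i0: "\<And>f g h i. J3 0 0 0 0 0 f g h i \<in> J \<Longrightarrow> i = 0"
  shows listed
proof -
  have E: "eqv J" by (rule lin_eqv_eqv[OF lin])
  show ?thesis
  proof (cases "\<exists>x y. (x, y) \<noteq> (0, 0) \<and> (\<forall>f g h. J3 0 0 0 0 0 f g h 0 \<in> J \<longrightarrow> f * x\<^sup>2 + g * x * y + h * y\<^sup>2 = 0)")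
    case False
    then have nc: "\<exists>f g h. J3 0 0 0 0 0 f g h 0 \<in> J \<and> f * x\<^sup>2 + g * x * y + h * y\<^sup>2 \<noteq> 0" if "(x, y) \<noteq> (0, 0)" for x y
      using that by blast
    \<comment> \<open>A cofactor with h0 nonzero has no zero on the y-axis. At its zeros x is
      therefore nonzero, and another cofactor supplies a cubic that does not vanish there.\<close>
    from nc[of 0 1] obtain f0 g0 h0 where P: "J3 0 0 0 0 0 f0 g0 h0 0 \<in> J" and h0: "h0 \<noteq> 0" by auto
    have all: "J3 0 0 0 0 0 f g h 0 \<in> J" for f g h
    proof (rule quotient[OF lin P, where w = "peval (J3 0 0 f0 g0 h0 0 0 0 0)" and h = "peval (J3 0 0 f g h 0 0 0 0)"
          and k = 2 and u = fst])
      fix x y :: real assume xy: "(x, y) \<noteq> 0" and w0: "peval (J3 0 0 f0 g0 h0 0 0 0 0) (x, y) = 0"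
      have x: "x \<noteq> 0"
      proof
        assume "x = 0"
        then have "y = 0" using w0 h0 by (simp add: peval_J3)
        then show False using xy \<open>x = 0\<close> by (simp add: zero_prod_def)
      qed
      obtain f g h where m: "J3 0 0 0 0 0 f g h 0 \<in> J" "f * x\<^sup>2 + g * x * y + h * y\<^sup>2 \<noteq> 0"
        using nc[of x y] xy by (auto simp: zero_prod_def)
      have "f * x ^ 3 + g * x\<^sup>2 * y + h * x * y\<^sup>2 + 0 * y ^ 3 = x * (f * x\<^sup>2 + g * x * y + h * y\<^sup>2)"
        by (simp add: power2_eq_square power3_eq_cube algebra_simps)
      then have "f * x ^ 3 + g * x\<^sup>2 * y + h * x * y\<^sup>2 + 0 * y ^ 3 \<noteq> 0" using m(2) x by simp
      then show "\<exists>e f g i. J3 0 0 0 0 0 e f g i \<in> J \<and> e * x ^ 3 + f * x\<^sup>2 * y + g * x * y\<^sup>2 + i * y ^ 3 \<noteq> 0"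
        using m(1) by blast
    next
      show "peval (J3 0 0 0 0 0 f0 g0 h0 0) z = peval (J3 0 0 f0 g0 h0 0 0 0 0) z * fst z"
        "peval (J3 0 0 0 0 0 f g h 0) z = peval (J3 0 0 f g h 0 0 0 0) z * fst z" for z
        by (cases z, simp add: peval_J3 power2_eq_square power3_eq_cube algebra_simps)+
    qed (simp_all add: Ck_on_peval homogeneous_J3_2)
    have "J3 a b c d e f g h i \<in> J \<longleftrightarrow> a = 0 \<and> b = 0 \<and> c = 0 \<and> d = 0 \<and> e = 0 \<and> i = 0" for a b c d e f g h i
      using cubicD[OF C, of a b c d e f g h i] i0[of f g h i] all by auto
    from eqv_eq_jset[OF E this] show ?thesis by (rule listedI[OF E]) (simp add: ideal_list_jset)
  next
    case True
    then obtain s t where st: "(s, t) \<noteq> (0, 0)"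
      and z: "\<And>f g h. J3 0 0 0 0 0 f g h 0 \<in> J \<Longrightarrow> f * s\<^sup>2 + g * s * t + h * t\<^sup>2 = 0" by blast
    show ?thesis
    proof (cases "s = 0")
      case True
      have "h = 0 \<and> i = 0" if r: "J3 0 0 0 0 0 f g h i \<in> J" for f g h i
      proof -
        have "i = 0" by (rule i0[OF r])
        then show ?thesis using z[of f g h] r True st by simp
      qed
      then show ?thesis by (rule listed_x2[OF E C])
    next
      case False
      \<comment> \<open>The map takes (1, 0) to (s, t), so in the new coordinates all cofactors
        vanish on the x-axis.\<close>
      let ?J = "pull 3 (linmap s 0 t 1) ` J"
      have E': "eqv ?J" by (rule eqv_linmap[OF E]) (use False in simp)
      show ?thesis
      proof (rule listed_xy_factor[OF E' cubic_linmap[OF E C]])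
        fix f g h i assume "J3 0 0 0 0 0 f g h i \<in> ?J"
        then show "f = 0 \<and> i = 0"
        proof (rule image_J3_cases[OF E])
          fix a' b' c' d' e' f' g' h' i'
          assume m: "J3 a' b' c' d' e' f' g' h' i' \<in> J"
            and eq: "J3 0 0 0 0 0 f g h i = pull 3 (linmap s 0 t 1) (J3 a' b' c' d' e' f' g' h' i')"
          have c: "a' = 0" "b' = 0" "c' = 0" "d' = 0" "e' = 0" using cubicD[OF C m] by simp_all
          then have i': "i' = 0" using i0 m by blast
          have f: "f = f' * s ^ 3 + g' * s\<^sup>2 * t + h' * s * t\<^sup>2 + i' * t ^ 3" and i: "i = i'"
            using eq unfolding pull_linmap_J3 J3_eq_iff by simp_all
          have "f = s * (f' * s\<^sup>2 + g' * s * t + h' * t\<^sup>2)"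
            unfolding f i' by (simp add: power2_eq_square power3_eq_cube algebra_simps)
          then show "f = 0 \<and> i = 0" using z[of f' g' h'] m c i i' by simp
        qed
      qed
    qed
  qed
qed

text \<open>Some direction is allowed, and every cubic form of \<open>I\<close> vanishes in it.
  Turning it into the y-axis makes x a common factor.\<close>

lemma listed_cubic:
  assumes C: "cubic I"
  shows listed
proof -
  have EI: "eqv I" by (rule lin_eqv_eqv[OF lin_eqv_I])
  obtain u v where uv: "(u, v) \<noteq> (0, 0)" "\<not> forbidden_direction 3 I (u, v)"
    using not_all_forbidden[OF EI] by blast
  let ?L = "linmap v u (- u) v"
  have det: "v * v - u * (- u) \<noteq> 0" using uv(1) by (auto simp: sum_squares_eq_zero_iff)
  show ?thesis
  proof (rule listed_x_factor[OF lin_eqv_linmap[OF lin_eqv_I det] cubic_linmap[OF EI C]])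
    fix f g h i assume "J3 0 0 0 0 0 f g h i \<in> pull 3 ?L ` I"
    then show "i = 0"
    proof (rule image_J3_cases[OF EI])
      fix a' b' c' d' e' f' g' h' i'
      assume m: "J3 a' b' c' d' e' f' g' h' i' \<in> I"
        and eq: "J3 0 0 0 0 0 f g h i = pull 3 ?L (J3 a' b' c' d' e' f' g' h' i')"
      have "J3 0 0 0 0 0 f' g' h' i' \<in> I" using m cubicD[OF C m] by simp
      then have "f' * u ^ 3 + g' * u\<^sup>2 * v + h' * u * v\<^sup>2 + i' * v ^ 3 = 0"
        using forbidden_J3_3 uv(2) by blast
      then show "i = 0" using eq unfolding pull_linmap_J3 J3_eq_iff by simp
    qed
  qed
qed

theorem equivalent_to_listed: "\<exists>J\<in>set ideal_list. equivalent_ideals 3 I J"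
proof -
  have listed
  proof (cases "no_linear_part I")
    case False
    then show ?thesis unfolding no_linear_part_def using listed_linear_part by fastforce
  next
    case L: True
    show ?thesis
    proof (cases "cubic I")
      case True
      then show ?thesis by (rule listed_cubic)
    next
      case False
      then obtain a b c d e f g h i where m: "J3 a b c d e f g h i \<in> I"
        and nz: "\<not> (a = 0 \<and> b = 0 \<and> c = 0 \<and> d = 0 \<and> e = 0)" unfolding cubic_def by blast
      have "a = 0" "b = 0" using no_linear_partD[OF L m] by simp_all
      then show ?thesis using listed_quadratic_part[OF L, of c d e f g h i] m nz by auto
    qed
  qed
  then show ?thesis unfolding listed_def eqv_def .
qed

end

theorem closed_ideal_equivalent_to_listed:
  assumes "closed_ideal 3 I"
  shows "\<exists>J\<in>set ideal_list. equivalent_ideals 3 I J"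
proof (cases "I = jets0 3")
  case True
  have "jets0 3 \<in> set ideal_list" by (simp add: ideal_list_def)
  moreover have "equivalent_ideals 3 I I"
    by (rule equivalent_ideals_refl) (auto simp: True jets0_iff)
  ultimately show ?thesis using True by blast
next
  case False
  then interpret nontrivial_closed_ideal I using assms by unfold_locales
  show ?thesis by (rule equivalent_to_listed)
qed

section \<open>Functions vanishing on curves\<close>

text \<open>Along a branch of size O(t^k) the error o(|z|^m) is o(t^(km)). For a cusp, k = 2 and m =
  3 give conditions up to t^6.\<close>

lemma curve_coeff_zero:
  assumes "flat m (\<lambda>z. F z - peval p z)" "r > 0"
    and on: "\<And>t. 0 < t \<Longrightarrow> t < r \<Longrightarrow> F (\<alpha> t, \<beta> t) = 0"
    and bound: "\<And>t. 0 < t \<Longrightarrow> t < r \<Longrightarrow> \<bar>\<alpha> t\<bar> \<le> t ^ k \<and> \<bar>\<beta> t\<bar> \<le> t ^ k"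
    and k: "k > 0"
    and q: "\<And>t. peval p (\<alpha> t, \<beta> t) = poly q t" and j: "j \<le> k * m"
  shows "coeff q j = 0"
proof (rule poly_little_o_imp_coeff_zero[OF _ j])
  fix e :: real assume e: "e > 0"
  then have "e / 2 ^ m > 0" by simp
  from flatD[OF assms(1) this] obtain d where
    d: "d > 0" "\<And>z. norm z < d \<Longrightarrow> \<bar>F z - peval p z\<bar> \<le> e / 2 ^ m * norm z ^ m" by blast
  have "\<bar>poly q t\<bar> \<le> e * t ^ (k * m)" if t: "0 < t" "t < min (min r 1) (d / 2)" for t
  proof -
    have n: "norm (\<alpha> t, \<beta> t) \<le> 2 * t ^ k"
      using norm_Pair_le[of "\<alpha> t" "\<beta> t"] bound[of t] t by simp
    have "t ^ k \<le> t ^ 1" using t k by (intro power_decreasing) auto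
    then have "norm (\<alpha> t, \<beta> t) < d" using n t by simp
    then have "\<bar>poly q t\<bar> \<le> e / 2 ^ m * norm (\<alpha> t, \<beta> t) ^ m"
      using d(2)[of "(\<alpha> t, \<beta> t)"] on[of t] t q[of t] by simp
    also have "\<dots> \<le> e / 2 ^ m * (2 * t ^ k) ^ m" using e n by (intro mult_left_mono power_mono) auto
    also have "\<dots> = e * t ^ (k * m)" by (simp add: power_mult_distrib power_mult)
    finally show ?thesis .
  qed
  then show "\<exists>d>0. \<forall>t. 0 < t \<and> t < d \<longrightarrow> \<bar>poly q t\<bar> \<le> e * t ^ (k * m)"
    using d(1) assms(2) by (intro exI[of _ "min (min r 1) (d / 2)"]) auto
qed

lemma Dx_J3:
  "Dx (peval (J3 a b c d e f g h i)) z =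
    a + 2 * c * fst z + d * snd z + 3 * f * (fst z)\<^sup>2 + 2 * g * fst z * snd z + h * (snd z)\<^sup>2"
proof -
  have p: "peval (J3 a b c d e f g h i) = (\<lambda>z. a * fst z + b * snd z + c * (fst z)\<^sup>2 + d * fst z * snd z + e * (snd z)\<^sup>2
      + f * fst z ^ 3 + g * (fst z)\<^sup>2 * snd z + h * fst z * (snd z)\<^sup>2 + i * snd z ^ 3)"
    by (rule ext) (metis peval_J3 prod.collapse)
  have "(peval (J3 a b c d e f g h i) has_derivative (\<lambda>v. a * fst v + b * snd v + 2 * c * fst z * fst v
      + d * (fst v * snd z + fst z * snd v) + 2 * e * snd z * snd v + 3 * f * (fst z)\<^sup>2 * fst v
      + g * (2 * fst z * fst v * snd z + (fst z)\<^sup>2 * snd v) + h * (fst v * (snd z)\<^sup>2 + 2 * fst z * snd z * snd v)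
      + 3 * i * (snd z)\<^sup>2 * snd v)) (at z)"
    unfolding p by (auto intro!: derivative_eq_intros simp: algebra_simps power2_eq_square power3_eq_cube)
  from dir_deriv_eqI[OF this] show ?thesis by (simp add: algebra_simps)
qed

lemma Dx_diff_peval:
  assumes "Ck_on (Suc k) UNIV F"
  shows "Dx (\<lambda>z. F z - peval p z) z = Dx F z - Dx (peval p) z"
  using dir_deriv_cmult_add[OF Ck_on_peval assms, of "(1, 0)" "-1" p] by simp

text \<open>The intermediate point is also located strictly between distinct abscissas, so that two
  such points differ and the theorem can be applied once more to them.\<close>

lemma mvt_horizontal:
  assumes "\<And>z. F differentiable (at z)"
  obtains \<theta> where "\<bar>\<theta>\<bar> \<le> max \<bar>x1\<bar> \<bar>x2\<bar>" "F (x2, y) - F (x1, y) = (x2 - x1) * Dx F (\<theta>, y)"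
    "min x1 x2 \<le> \<theta>" "\<theta> \<le> max x1 x2" "x1 \<noteq> x2 \<longrightarrow> min x1 x2 < \<theta> \<and> \<theta> < max x1 x2"
proof -
  obtain t where t: "t \<in> {0<..<1}"
    "F ((x1, y) + (x2 - x1, 0)) - F (x1, y) = dir_deriv (x2 - x1, 0) F ((x1, y) + t *\<^sub>R (x2 - x1, 0))"
    using mvt_dir[of F "(x1, y)" "(x2 - x1, 0)"] assms by blast
  define \<theta> where "\<theta> = x1 + t * (x2 - x1)"
  have "dir_deriv (x2 - x1, 0) F z = (x2 - x1) * Dx F z" for z
    using dir_deriv_scaleR[OF assms, of "x2 - x1" "(1, 0)"] by simp
  then have eq: "F (x2, y) - F (x1, y) = (x2 - x1) * Dx F (\<theta>, y)" using t(2) by (simp add: \<theta>_def)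
  have str: "min x1 x2 < \<theta> \<and> \<theta> < max x1 x2" if "x1 \<noteq> x2"
  proof (cases "x1 < x2")
    case True
    then have "0 < t * (x2 - x1)" "t * (x2 - x1) < 1 * (x2 - x1)"
      using t(1) by (simp_all add: mult_strict_right_mono del: mult_1)
    then have "x1 + t * (x2 - x1) < x1 + 1 * (x2 - x1)" "x1 + 0 < x1 + t * (x2 - x1)"
      by (simp_all only: add_less_cancel_left)
    then show ?thesis using True by (simp add: \<theta>_def)
  next
    case False
    then have lt: "x2 < x1" using that by simp
    then have "0 < t * (x1 - x2)" "t * (x1 - x2) < 1 * (x1 - x2)"
      using t(1) by (simp_all add: mult_strict_right_mono del: mult_1)
    then have "x1 - 1 * (x1 - x2) < x1 - t * (x1 - x2)" "x1 - t * (x1 - x2) < x1 - 0"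
      by (blast intro: diff_strict_left_mono)+
    moreover have "\<theta> = x1 - t * (x1 - x2)" by (simp add: \<theta>_def algebra_simps)
    ultimately show ?thesis using lt by simp
  qed
  then have w: "min x1 x2 \<le> \<theta>" "\<theta> \<le> max x1 x2" by (cases "x1 = x2"; force simp: \<theta>_def)+
  then have "\<bar>\<theta>\<bar> \<le> max \<bar>x1\<bar> \<bar>x2\<bar>" by linarith
  then show ?thesis using that eq w str by blast
qed

text \<open>If \<open>F\<close> vanishes at two points \<open>(\<xi>, y)\<close> of the same height, then the divided difference
  of its jet in \<open>x\<close> is \<open>o(y\<^sup>2)\<close>. Here \<open>y = \<sigma> t\<^sup>2\<close> and the abscissas are \<open>O(t\<^sup>3)\<close> with
  sum \<open>s t\<^sup>4 + O(t\<^sup>5)\<close>.\<close>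

lemma two_branches_coeffs:
  assumes F: "Ck_on 3 UNIV F" and fl: "flat 3 (\<lambda>z. F z - peval (J3 a b c d e f g h i) z)"
    and \<sigma>: "\<bar>\<sigma>\<bar> = 1" and r: "r > 0"
    and on: "\<And>t. 0 < t \<Longrightarrow> t < r \<Longrightarrow> F (\<xi> t, \<sigma> * t\<^sup>2) = 0 \<and> F (\<eta> t, \<sigma> * t\<^sup>2) = 0 \<and> \<xi> t \<noteq> \<eta> t \<and>
      \<bar>\<xi> t\<bar> \<le> t ^ 3 \<and> \<bar>\<eta> t\<bar> \<le> t ^ 3 \<and> \<bar>\<xi> t + \<eta> t - s * t ^ 4\<bar> \<le> t ^ 5"
  shows "a = 0" "d = 0" "h + c * s = 0"
proof -
  let ?P = "peval (J3 a b c d e f g h i)" and ?R = "\<lambda>z. F z - peval (J3 a b c d e f g h i) z"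
  \<comment> \<open>\<open>?q\<close> collects the divided difference up to t^4: the terms in y and
    y^2, and c (x1 + x2), which is c s t^4 up to O(t^5). What is left is at most K t^5.\<close>
  let ?q = "[:a, 0, d * \<sigma>, 0, h + c * s:]"
  have CR: "Ck_on (Suc 2) UNIV ?R" using Ck_on_diff[OF open_UNIV F Ck_on_peval] by (simp add: numeral_3_eq_3)
  have fD: "flat 2 (Dx ?R)" by (rule flat_Dx[OF CR]) (use fl in \<open>simp add: numeral_3_eq_3\<close>)
  define K where "K = 3 * \<bar>f\<bar> + 2 * \<bar>g\<bar> + \<bar>c\<bar>"
  have K: "K \<ge> 0" by (simp add: K_def)
  have "coeff ?q j = 0" if "j \<le> 4" for j
  proof (rule poly_little_o_imp_coeff_zero[OF _ that])
    fix e :: real assume e: "e > 0"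
    then have "e / 8 > 0" by simp
    from flatD[OF fD this] obtain \<delta> where
      \<delta>: "\<delta> > 0" "\<And>z. norm z < \<delta> \<Longrightarrow> \<bar>Dx ?R z\<bar> \<le> e / 8 * norm z ^ 2" by blast
    have "\<bar>poly ?q t\<bar> \<le> e * t ^ 4" if t: "0 < t" "t < min (min r 1) (min (\<delta> / 2) (e / (2 * (K + 1))))" for t
    proof -
      have tr: "t < r" and t1: "t < 1" and td: "2 * t < \<delta>" and te: "t * (K + 1) \<le> e / 2"
        using t K by (auto simp: field_simps)
      define x1 x2 y where "x1 = \<xi> t" and "x2 = \<eta> t" and "y = \<sigma> * t\<^sup>2"
      have o: "F (x1, y) = 0" "F (x2, y) = 0" "x1 \<noteq> x2" "\<bar>x1\<bar> \<le> t ^ 3" "\<bar>x2\<bar> \<le> t ^ 3" "\<bar>x1 + x2 - s * t ^ 4\<bar> \<le> t ^ 5"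
        using on[OF t(1) tr] by (simp_all add: x1_def x2_def y_def)
      have ay: "\<bar>y\<bar> = t\<^sup>2" using \<sigma> by (simp add: y_def abs_mult)
      have y2: "y\<^sup>2 = t ^ 4"
      proof -
        have "y\<^sup>2 = \<bar>y\<bar>\<^sup>2" by simp
        then show ?thesis unfolding ay by (simp add: power_mult[symmetric])
      qed
      obtain \<theta> where \<theta>: "\<bar>\<theta>\<bar> \<le> max \<bar>x1\<bar> \<bar>x2\<bar>" "?R (x2, y) - ?R (x1, y) = (x2 - x1) * Dx ?R (\<theta>, y)"
        by (rule mvt_horizontal[of ?R x1 x2 y, OF Ck_on_Suc_differentiable[OF CR UNIV_I]])
      \<comment> \<open>The divided difference of the cubic between x1 and x2 at height y; the pure
        y-terms cancel.\<close>
      let ?A = "a + d * y + h * y\<^sup>2 + c * (x1 + x2) + f * (x1\<^sup>2 + x1 * x2 + x2\<^sup>2) + g * y * (x1 + x2)"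
      have "?R (x2, y) - ?R (x1, y) = (x2 - x1) * (- ?A)"
        using o(1,2) by (simp add: peval_J3 power2_eq_square power3_eq_cube algebra_simps)
      then have A: "?A = - Dx ?R (\<theta>, y)" using \<theta>(2) o(3) by simp
      have p32: "t ^ 3 \<le> t\<^sup>2" using t(1) t1 by (intro power_decreasing) auto
      have "norm (\<theta>, y) \<le> 2 * t\<^sup>2" using norm_Pair_le[of \<theta> y] \<theta>(1) o(4,5) ay p32 by simp
      moreover have "t\<^sup>2 \<le> t ^ 1" using t(1) t1 by (intro power_decreasing) auto
      ultimately have n: "norm (\<theta>, y) \<le> 2 * t\<^sup>2" "norm (\<theta>, y) < \<delta>" using td by simp_all
      have "\<bar>?A\<bar> \<le> e / 8 * norm (\<theta>, y) ^ 2" using \<delta>(2)[OF n(2)] A by simp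
      also have "\<dots> \<le> e / 8 * (2 * t\<^sup>2) ^ 2" using e n(1) by (intro mult_left_mono power_mono) auto
      also have "\<dots> = e / 2 * t ^ 4" by (simp add: power_mult_distrib power_mult[symmetric])
      finally have A1: "\<bar>?A\<bar> \<le> e / 2 * t ^ 4" .
      have p65: "t ^ 6 \<le> t ^ 5" using t(1) t1 by (intro power_decreasing) auto
      have xx: "\<bar>u * v\<bar> \<le> t ^ 5" if "\<bar>u\<bar> \<le> t ^ 3" "\<bar>v\<bar> \<le> t ^ 3" for u v :: real
      proof -
        have "\<bar>u * v\<bar> \<le> t ^ 3 * t ^ 3" unfolding abs_mult using that t(1) by (intro mult_mono) auto
        also have "\<dots> = t ^ 6" by (simp add: power_add[symmetric])
        finally show ?thesis using p65 by simp
      qed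
      have 1: "\<bar>f * (x1\<^sup>2 + x1 * x2 + x2\<^sup>2)\<bar> \<le> \<bar>f\<bar> * (3 * t ^ 5)"
        unfolding abs_mult[of f] power2_eq_square using xx[OF o(4,4)] xx[OF o(4,5)] xx[OF o(5,5)]
        by (intro mult_left_mono abs_ge_zero) linarith
      have 2: "\<bar>g * y * (x1 + x2)\<bar> \<le> \<bar>g\<bar> * (2 * t ^ 5)"
      proof -
        have "\<bar>y * (x1 + x2)\<bar> \<le> t\<^sup>2 * (2 * t ^ 3)"
          unfolding abs_mult ay using o(4,5) by (intro mult_left_mono) auto
        also have "\<dots> = 2 * t ^ 5" by (simp add: power_add[symmetric])
        finally show ?thesis unfolding mult.assoc abs_mult[of g] by (intro mult_left_mono) auto
      qed
      have 3: "\<bar>c * (x1 + x2 - s * t ^ 4)\<bar> \<le> \<bar>c\<bar> * t ^ 5"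
        unfolding abs_mult using o(6) by (intro mult_left_mono) auto
      have pq: "poly ?q t = a + d * y + h * y\<^sup>2 + c * (s * t ^ 4)"
        unfolding y2 by (simp add: y_def algebra_simps power2_eq_square eval_nat_numeral)
      have "poly ?q t = ?A - f * (x1\<^sup>2 + x1 * x2 + x2\<^sup>2) - g * y * (x1 + x2) - c * (x1 + x2 - s * t ^ 4)"
        unfolding pq by (simp add: algebra_simps)
      then have "\<bar>poly ?q t\<bar> \<le> e / 2 * t ^ 4 + (\<bar>f\<bar> * (3 * t ^ 5) + \<bar>g\<bar> * (2 * t ^ 5) + \<bar>c\<bar> * t ^ 5)"
        using A1 1 2 3 by linarith
      also have "\<bar>f\<bar> * (3 * t ^ 5) + \<bar>g\<bar> * (2 * t ^ 5) + \<bar>c\<bar> * t ^ 5 = (t * K) * t ^ 4"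
        by (simp add: K_def algebra_simps eval_nat_numeral)
      also have "e / 2 * t ^ 4 + (t * K) * t ^ 4 \<le> e / 2 * t ^ 4 + e / 2 * t ^ 4"
        using te t(1) by (intro add_left_mono mult_right_mono) (auto simp: algebra_simps)
      finally show ?thesis by simp
    qed
    then show "\<exists>d>0. \<forall>t. 0 < t \<and> t < d \<longrightarrow> \<bar>poly ?q t\<bar> \<le> e * t ^ 4"
      using r \<delta>(1) e K by (intro exI[of _ "min (min r 1) (min (\<delta> / 2) (e / (2 * (K + 1))))"]) auto
  qed
  from this[of 0] this[of 2] this[of 4] show "a = 0" "d = 0" "h + c * s = 0"
    using \<sigma> by (auto simp: eval_nat_numeral)
qed

lemma dir_deriv_add_const:
  fixes F :: "'a::real_normed_vector \<Rightarrow> real"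
  assumes "Ck_on (Suc 0) UNIV F"
  shows "dir_deriv v (\<lambda>z. a + F z) z = dir_deriv v F z"
proof -
  have "((\<lambda>z. a + F z) has_derivative (\<lambda>v. 0 + frechet_derivative F (at z) v)) (at z)"
    by (rule has_derivative_add[OF has_derivative_const Ck_on_SucD[OF assms UNIV_I]])
  from dir_deriv_eqI[OF this] show ?thesis by (simp add: dir_deriv_def)
qed

text \<open>Rolle's theorem used twice on three zeros of equal height gives a zero of the second
  x-derivative. Hence its jet 2c + 6f x + 2g y is o(t) at a point with y = t and x = O(t^2), which
  forces c = g = 0.\<close>

lemma three_branches_coeffs:
  assumes F: "Ck_on 3 UNIV F" and fl: "flat 3 (\<lambda>z. F z - peval (J3 a b c d e f g h i) z)"
    and on: "\<And>y. 0 < y \<Longrightarrow> F (- (y ^ 3), y) = 0 \<and> F (0, y) = 0 \<and> F (y ^ 3, y) = 0"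
  shows "c = 0" "g = 0"
proof -
  let ?P = "peval (J3 a b c d e f g h i)" and ?R = "\<lambda>z. F z - peval (J3 a b c d e f g h i) z"
  let ?q = "[:2 * c, 2 * g:]"
  have CF: "Ck_on (Suc 2) UNIV F" using F by (simp add: numeral_3_eq_3)
  have CR: "Ck_on (Suc 2) UNIV ?R" using Ck_on_diff[OF open_UNIV F Ck_on_peval] by (simp add: numeral_3_eq_3)
  have fD: "flat 2 (Dx ?R)" by (rule flat_Dx[OF CR]) (use fl in \<open>simp add: numeral_3_eq_3\<close>)
  have CDF: "Ck_on (Suc 1) UNIV (Dx F)" using Ck_on_dir_deriv[OF CF] by (simp add: numeral_2_eq_2)
  \<comment> \<open>The x-derivative of the cubic is written as a constant plus another
    \<open>J3\<close>, so that \<open>Dx_J3\<close> applies a second time.\<close>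
  have DR: "Dx ?R = (\<lambda>z. Dx F z - peval (const2 a + J3 (2 * c) d (3 * f) (2 * g) h 0 0 0 0) z)"
  proof
    fix z
    show "Dx ?R z = Dx F z - peval (const2 a + J3 (2 * c) d (3 * f) (2 * g) h 0 0 0 0) z"
      unfolding Dx_diff_peval[OF CF] Dx_J3
      by (cases z) (simp add: peval_add peval_single peval_J3)
  qed
  have DDR: "Dx (Dx ?R) z = Dx (Dx F) z - (2 * c + 6 * f * fst z + 2 * g * snd z)" for z
  proof -
    have "peval (const2 a + J3 (2 * c) d (3 * f) (2 * g) h 0 0 0 0) = (\<lambda>z. a + peval (J3 (2 * c) d (3 * f) (2 * g) h 0 0 0 0) z)"
      by (rule ext) (simp add: peval_add peval_single)
    moreover have "Dx (\<lambda>z. a + peval (J3 (2 * c) d (3 * f) (2 * g) h 0 0 0 0) z) z = Dx (peval (J3 (2 * c) d (3 * f) (2 * g) h 0 0 0 0)) z"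
      by (rule dir_deriv_add_const[OF Ck_on_peval])
    ultimately show ?thesis unfolding DR Dx_diff_peval[OF CDF] by (simp add: Dx_J3)
  qed
  have fDD: "flat 1 (Dx (Dx ?R))"
    by (rule flat_Dx) (use Ck_on_dir_deriv[OF CR] fD in \<open>simp_all add: numeral_2_eq_2\<close>)
  have "coeff ?q j = 0" if "j \<le> 1" for j
  proof (rule poly_little_o_imp_coeff_zero[OF _ that])
    fix e :: real assume e: "e > 0"
    then have "e / 4 > 0" by simp
    from flatD[OF fDD this] obtain \<delta> where
      \<delta>: "\<delta> > 0" "\<And>z. norm z < \<delta> \<Longrightarrow> \<bar>Dx (Dx ?R) z\<bar> \<le> e / 4 * norm z ^ 1" by blast
    have "\<bar>poly ?q t\<bar> \<le> e * t ^ 1" if t: "0 < t" "t < min 1 (min (\<delta> / 2) (e / (12 * (\<bar>f\<bar> + 1))))" for t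
    proof -
      have t1: "t < 1" and td: "2 * t < \<delta>" and te: "6 * \<bar>f\<bar> * t \<le> e / 2"
        using t by (auto simp: field_simps)
      have t3: "t ^ 3 > 0" "t ^ 3 \<le> t\<^sup>2" "t\<^sup>2 \<le> t" using t(1) t1 power_decreasing[of 2 3 t] power_decreasing[of 1 2 t] by auto
      have z: "F (- (t ^ 3), t) = 0" "F (0, t) = 0" "F (t ^ 3, t) = 0" using on[OF t(1)] by simp_all
      note df = Ck_on_Suc_differentiable[OF CF UNIV_I] Ck_on_Suc_differentiable[OF CDF UNIV_I]
      obtain \<theta>1 where \<theta>1: "F (0, t) - F (- (t ^ 3), t) = (0 - - (t ^ 3)) * Dx F (\<theta>1, t)"
        "- (t ^ 3) \<noteq> 0 \<longrightarrow> min (- (t ^ 3)) 0 < \<theta>1 \<and> \<theta>1 < max (- (t ^ 3)) 0"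
        by (rule mvt_horizontal[of F "- (t ^ 3)" 0 t, OF df(1)])
      obtain \<theta>2 where \<theta>2: "F (t ^ 3, t) - F (0, t) = (t ^ 3 - 0) * Dx F (\<theta>2, t)"
        "0 \<noteq> t ^ 3 \<longrightarrow> min 0 (t ^ 3) < \<theta>2 \<and> \<theta>2 < max 0 (t ^ 3)"
        by (rule mvt_horizontal[of F 0 "t ^ 3" t, OF df(1)])
      have D0: "Dx F (\<theta>1, t) = 0" "Dx F (\<theta>2, t) = 0" using \<theta>1(1) \<theta>2(1) z t3(1) by simp_all
      have b: "- (t ^ 3) < \<theta>1" "\<theta>1 < 0" "0 < \<theta>2" "\<theta>2 < t ^ 3" using \<theta>1(2) \<theta>2(2) t3(1) by auto
      obtain \<theta> where \<theta>: "\<bar>\<theta>\<bar> \<le> max \<bar>\<theta>1\<bar> \<bar>\<theta>2\<bar>" "Dx F (\<theta>2, t) - Dx F (\<theta>1, t) = (\<theta>2 - \<theta>1) * Dx (Dx F) (\<theta>, t)"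
        by (rule mvt_horizontal[of "Dx F" \<theta>1 \<theta>2 t, OF df(2)])
      have DD: "Dx (Dx F) (\<theta>, t) = 0" using \<theta>(2) D0 b by simp
      have a\<theta>: "\<bar>\<theta>\<bar> \<le> t\<^sup>2" using \<theta>(1) b t3 by linarith
      have n: "norm (\<theta>, t) \<le> 2 * t" using norm_Pair_le[of \<theta> t] a\<theta> t3 t(1) by simp
      then have "\<bar>Dx (Dx ?R) (\<theta>, t)\<bar> \<le> e / 4 * norm (\<theta>, t) ^ 1" using td by (intro \<delta>(2)) simp
      also have "\<dots> \<le> e / 4 * (2 * t)" using n e by (simp add: mult_left_mono)
      finally have "\<bar>0 - (2 * c + 6 * f * \<theta> + 2 * g * t)\<bar> \<le> e / 2 * t" unfolding DDR DD by simp
      then have 1: "\<bar>2 * c + 6 * f * \<theta> + 2 * g * t\<bar> \<le> e / 2 * t" by linarith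
      have "\<bar>6 * f * \<theta>\<bar> \<le> 6 * \<bar>f\<bar> * t\<^sup>2" using a\<theta> by (simp add: abs_mult mult_left_mono)
      also have "\<dots> = (6 * \<bar>f\<bar> * t) * t" by (simp add: power2_eq_square)
      also have "\<dots> \<le> e / 2 * t" using te t(1) by (intro mult_right_mono) auto
      finally have 2: "\<bar>6 * f * \<theta>\<bar> \<le> e / 2 * t" .
      have q: "poly ?q t = 2 * c + 2 * g * t" by simp
      have "\<bar>2 * c + 2 * g * t\<bar> \<le> e / 2 * t + e / 2 * t" using 1 2 by linarith
      then show ?thesis unfolding q by simp
    qed
    then show "\<exists>d>0. \<forall>t. 0 < t \<and> t < d \<longrightarrow> \<bar>poly ?q t\<bar> \<le> e * t ^ 1"
      using \<delta>(1) e by (intro exI[of _ "min 1 (min (\<delta> / 2) (e / (12 * (\<bar>f\<bar> + 1))))"]) auto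
  qed
  from this[of 0] this[of 1] show "c = 0" "g = 0" by simp_all
qed

section \<open>Some functions of class \<open>C\<^sup>3\<close>\<close>

text \<open>This is t^3 |t|, a C^3 function that is o(|t|^3). Written with \<open>pos_powr\<close>
  it inherits its differentiability.\<close>

definition signed_power4 :: "real \<Rightarrow> real" where
  "signed_power4 t = pos_powr 4 t - pos_powr 4 (- t)"

lemma Ck_on_pos_powr_of:
  assumes "Ck_on 3 UNIV f" "a > 3"
  shows "Ck_on 3 UNIV (\<lambda>z::real \<times> real. pos_powr a (f z))"
  using assms by (intro Ck_on_pos_powr_comp) auto

lemma Ck_on_signed_power4: "Ck_on 3 UNIV f \<Longrightarrow> Ck_on 3 UNIV (\<lambda>z::real \<times> real. signed_power4 (f z))"
  unfolding signed_power4_def by (intro Ck_on_diff Ck_on_pos_powr_of Ck_on_uminus open_UNIV) auto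

lemma signed_power4_eq: "signed_power4 t = t ^ 3 * \<bar>t\<bar>"
proof (cases t "0::real" rule: linorder_cases)
  case greater
  then show ?thesis by (simp add: signed_power4_def pos_powr_def powr_numeral eval_nat_numeral)
next
  case less
  then have "pos_powr 4 (- t) = (- t) ^ 4" by (simp add: pos_powr_def powr_numeral)
  then show ?thesis using less by (simp add: signed_power4_def pos_powr_def eval_nat_numeral)
qed (simp add: signed_power4_def)

text \<open>On the cusp branch (t^3, t^2) this identifies half-integral powers of y with powers of
  t, and thus with monomials in x and y.\<close>

lemma pos_powr_square:
  assumes "t \<ge> 0" "n > 0"
  shows "pos_powr (real n / 2) (t\<^sup>2) = t ^ n"
proof (cases "t = 0")
  case True
  then show ?thesis using assms by (simp add: pos_powr_def)
next
  case False
  then have t: "t > 0" using assms by simp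
  have "t\<^sup>2 = t powr 2" using t by (simp add: powr_numeral)
  then have "(t\<^sup>2) powr (real n / 2) = t powr (2 * (real n / 2))" by (simp only: powr_powr)
  also have "\<dots> = t ^ n" using t by (simp add: powr_realpow)
  finally show ?thesis by (simp only: pos_powr_def max_absorb2 zero_le_power2)
qed

lemma flat_signed_power4_snd: "flat 3 (\<lambda>z. signed_power4 (snd z))"
  and flat_signed_power4_fst: "flat 3 (\<lambda>z. signed_power4 (fst z))"
proof -
  have "\<bar>signed_power4 x\<bar> = \<bar>x\<bar> ^ 4" for x by (simp add: signed_power4_eq abs_mult power_abs eval_nat_numeral)
  moreover have "\<bar>snd z\<bar> ^ 4 \<le> 1 * norm z ^ Suc 3" "\<bar>fst z\<bar> ^ 4 \<le> 1 * norm z ^ Suc 3" for z :: "real \<times> real"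
    using power_mono[of "\<bar>snd z\<bar>" "norm z" 4] power_mono[of "\<bar>fst z\<bar>" "norm z" 4]
      abs_le_norm_pair(1)[of "fst z" "snd z"] abs_le_norm_pair(2)[of "snd z" "fst z"]
    by (simp_all add: eval_nat_numeral)
  ultimately show "flat 3 (\<lambda>z. signed_power4 (snd z))" "flat 3 (\<lambda>z. signed_power4 (fst z))"
    by (intro flat_Suc_bound[of 1 _ 1]; simp)+
qed

text \<open>For 0 < s < 1 the power is at most s^3 sqrt(s), and sqrt(s) <= e as soon as s <= e^2;
  hence the radius \<open>min 1 (e\<^sup>2)\<close>.\<close>

lemma flat_pos_powr_snd:
  assumes "a \<ge> 7 / 2" "\<bar>\<sigma>\<bar> = 1"
  shows "flat 3 (\<lambda>z. pos_powr a (\<sigma> * snd z))"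
  unfolding flat_def
proof (intro allI impI)
  fix e :: real assume e: "e > 0"
  have bd: "\<bar>pos_powr a (\<sigma> * snd z)\<bar> \<le> e * norm z ^ 3" if z: "norm z < min 1 (e\<^sup>2)" for z :: "real \<times> real"
  proof (cases "\<sigma> * snd z \<le> 0")
    case True
    then have "pos_powr a (\<sigma> * snd z) = 0" by (simp add: pos_powr_eq_0_iff)
    then show ?thesis using e by simp
  next
    case False
    define s where "s = \<sigma> * snd z"
    have s: "s > 0" using False s_def by simp
    have "\<bar>s\<bar> = \<bar>snd z\<bar>" using assms(2) by (simp add: s_def abs_mult)
    then have sn: "s \<le> norm z" using s abs_le_norm_pair(2)[of "snd z" "fst z"] by simp
    have "pos_powr a s = s powr a" using s by (simp add: pos_powr_def)
    also have "\<dots> \<le> s powr (7 / 2)" using s sn z assms(1) by (intro powr_mono') auto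
    also have "\<dots> = s powr 3 * s powr (1 / 2)" by (simp add: powr_add[symmetric])
    also have "\<dots> = s ^ 3 * sqrt s" using s by (simp add: powr_numeral powr_half_sqrt)
    also have "\<dots> \<le> norm z ^ 3 * e"
    proof (intro mult_mono power_mono sn)
      have "sqrt s \<le> sqrt (e\<^sup>2)" by (rule real_sqrt_le_mono) (use sn z in simp)
      then show "sqrt s \<le> e" using e by simp
    qed (use s in auto)
    finally show ?thesis using pos_powr_nonneg[of a s] by (simp add: s_def mult.commute)
  qed
  have "min 1 (e\<^sup>2) > 0" using e by simp
  then show "\<exists>d>0. \<forall>z::real \<times> real. norm z < d \<longrightarrow> \<bar>pos_powr a (\<sigma> * snd z)\<bar> \<le> e * norm z ^ 3"
    by (intro exI[of _ "min 1 (e\<^sup>2)"] conjI allI impI bd)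
qed

text \<open>This is x^i y^j |z|^(2s), homogeneous of degree i + j + 2s. Its derivatives are
  combinations of such functions of degree one less, so the family supports an induction on the
  order of differentiability.\<close>

definition mono_powr :: "nat \<Rightarrow> nat \<Rightarrow> real \<Rightarrow> real \<times> real \<Rightarrow> real" where
  "mono_powr i j s z = fst z ^ i * snd z ^ j * ((fst z)\<^sup>2 + (snd z)\<^sup>2) powr s"

lemma norm_square_pair: "(norm z)\<^sup>2 = (fst z)\<^sup>2 + (snd z)\<^sup>2" for z :: "real \<times> real"
  by (cases z) (simp add: norm_Pair)

lemma mono_powr_bound: "\<bar>mono_powr i j s z\<bar> \<le> norm z powr (real i + real j + 2 * s)"
proof (cases "z = 0")
  case True
  then show ?thesis by (simp add: mono_powr_def)
next
  case False
  have a: "\<bar>fst z\<bar> \<le> norm z" "\<bar>snd z\<bar> \<le> norm z"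
    using abs_le_norm_pair(1)[of "fst z" "snd z"] abs_le_norm_pair(2)[of "snd z" "fst z"] by simp_all
  have "\<bar>mono_powr i j s z\<bar> \<le> norm z ^ i * norm z ^ j * ((norm z)\<^sup>2) powr s"
    unfolding mono_powr_def norm_square_pair abs_mult power_abs
    using a by (intro mult_mono power_mono) auto
  also have "\<dots> = norm z powr (real i + real j + 2 * s)"
    using False by (simp add: powr_add powr_realpow powr_powr[symmetric] powr_numeral)
  finally show ?thesis .
qed

lemma Ck_on_mono_powr:
  "real i + real j + 2 * s > real n \<Longrightarrow> Ck_on n UNIV (mono_powr i j s)"
proof (induction n arbitrary: i j s)
  case 0
  have "continuous (at z) (mono_powr i j s)" for z
  proof (cases "z = 0")
    case True
    have "((\<lambda>z::real\<times>real. norm z powr (real i + real j + 2 * s)) \<longlongrightarrow> norm (0::real\<times>real) powr (real i + real j + 2 * s)) (at 0)"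
      using 0 by (intro tendsto_powr' tendsto_intros) auto
    then have lim: "((\<lambda>z::real\<times>real. norm z powr (real i + real j + 2 * s)) \<longlongrightarrow> 0) (at 0)" by simp
    have "\<forall>z. norm (mono_powr i j s z) \<le> norm z powr (real i + real j + 2 * s)"
      unfolding real_norm_def by (intro allI mono_powr_bound)
    then have "(mono_powr i j s \<longlongrightarrow> 0) (at 0)"
      by (intro Lim_null_comparison[OF always_eventually lim])
    moreover have "mono_powr i j s 0 = 0" by (simp add: mono_powr_def)
    ultimately show ?thesis using True by (simp add: continuous_at)
  next
    case False
    then have "(norm z)\<^sup>2 \<noteq> 0" by simp
    then have "(fst z)\<^sup>2 + (snd z)\<^sup>2 \<noteq> 0" unfolding norm_square_pair .
    then show ?thesis unfolding mono_powr_def[abs_def] by (intro continuous_intros) auto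
  qed
  then show ?case by (simp add: continuous_at_imp_continuous_on)
next
  case (Suc n)
  \<comment> \<open>For i = 0 or j = 0 the index \<open>i - 1\<close> or \<open>j - 1\<close> is
    truncated to 0, and the factor \<open>real i\<close> or \<open>real j\<close> removes the
    term.\<close>
  define Dm where "Dm z v = fst v * (real i * mono_powr (i - 1) j s z + 2 * s * mono_powr (i + 1) j (s - 1) z) +
    snd v * (real j * mono_powr i (j - 1) s z + 2 * s * mono_powr i (j + 1) (s - 1) z)" for z v
  have der: "(mono_powr i j s has_derivative Dm z) (at z)" for z
  proof (cases "z = 0")
    case True
    \<comment> \<open>\<open>0 powr s\<close> is 0 for every s, so each \<open>mono_powr\<close>
      vanishes at the origin, whatever its degree.\<close>
    have D0: "Dm 0 = (\<lambda>v. 0)" by (rule ext) (simp add: Dm_def mono_powr_def)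
    have m0: "mono_powr i j s 0 = 0" by (simp add: mono_powr_def)
    have "((\<lambda>h. norm (mono_powr i j s h) / norm h) \<longlongrightarrow> 0) (at 0)"
    proof (rule Lim_null_comparison)
      have "norm (norm (mono_powr i j s h) / norm h) \<le> norm h powr (real i + real j + 2 * s - 1)" if "h \<noteq> 0" for h
        using mono_powr_bound[of i j s h] that by (simp add: powr_diff divide_right_mono)
      then show "\<forall>\<^sub>F h in at 0. norm (norm (mono_powr i j s h) / norm h) \<le> norm h powr (real i + real j + 2 * s - 1)"
        by (auto simp: eventually_at_filter)
      have "((\<lambda>h::real\<times>real. norm h powr (real i + real j + 2 * s - 1)) \<longlongrightarrow> norm (0::real\<times>real) powr (real i + real j + 2 * s - 1)) (at 0)"
        using Suc.prems by (intro tendsto_powr' tendsto_intros) auto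
      then show "((\<lambda>h::real\<times>real. norm h powr (real i + real j + 2 * s - 1)) \<longlongrightarrow> 0) (at 0)" by simp
    qed
    then show ?thesis unfolding True D0 has_derivative_at by (simp add: m0)
  next
    case False
    then have "(norm z)\<^sup>2 > 0" by simp
    then have q: "(fst z)\<^sup>2 + (snd z)\<^sup>2 > 0" unfolding norm_square_pair .
    have d1: "((\<lambda>z. (fst z)\<^sup>2 + (snd z)\<^sup>2) has_derivative (\<lambda>v. 2 * fst z * fst v + 2 * snd z * snd v)) (at z)"
      by (auto intro!: derivative_eq_intros)
    have d2: "((\<lambda>t. t powr s) has_derivative (\<lambda>h. s * ((fst z)\<^sup>2 + (snd z)\<^sup>2) powr (s - 1) * h)) (at ((fst z)\<^sup>2 + (snd z)\<^sup>2))"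
      using has_real_derivative_powr[OF q, of s] by (simp add: has_field_derivative_def)
    have "(mono_powr i j s has_derivative (\<lambda>v. fst z ^ i * snd z ^ j * (s * ((fst z)\<^sup>2 + (snd z)\<^sup>2) powr (s - 1) * (2 * fst z * fst v + 2 * snd z * snd v)) +
       (fst v * (real i * (fst z ^ (i - 1) * snd z ^ j)) + snd v * (real j * (fst z ^ i * snd z ^ (j - 1)))) * ((fst z)\<^sup>2 + (snd z)\<^sup>2) powr s)) (at z)"
      unfolding mono_powr_def[abs_def]
      by (rule has_derivative_mult[OF has_derivative_monomial has_derivative_compose[OF d1 d2]])
    then show ?thesis
      by (rule has_derivative_eq_rhs) (rule ext, simp add: Dm_def mono_powr_def algebra_simps)
  qed
  have c1: "Ck_on n UNIV (\<lambda>z. real i * mono_powr (i - 1) j s z)"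
  proof (cases i)
    case (Suc i')
    then show ?thesis using Suc.IH[of i' j s] Suc.prems by (simp add: Ck_on_cmult)
  qed simp
  have c2: "Ck_on n UNIV (\<lambda>z. real j * mono_powr i (j - 1) s z)"
  proof (cases j)
    case (Suc j')
    then show ?thesis using Suc.IH[of i j' s] Suc.prems by (simp add: Ck_on_cmult)
  qed simp
  have c3: "Ck_on n UNIV (mono_powr (i + 1) j (s - 1))" "Ck_on n UNIV (mono_powr i (j + 1) (s - 1))"
    using Suc.prems by (intro Suc.IH; simp)+
  show ?case
    by (rule Ck_on_SucI[OF open_UNIV der])
       (unfold Dm_def, intro Ck_on_add Ck_on_mult Ck_on_const c1 c2 c3 open_UNIV)
qed

lemma flat_monomial: "i + j \<ge> 4 \<Longrightarrow> flat 3 (\<lambda>z. fst z ^ i * snd z ^ j)"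
  using flat_peval_high[of 3 "single2 i j 1"] by (auto simp: lookup_single when_def peval_single[abs_def])

section \<open>Realization by semi-algebraic sets\<close>

text \<open>Sets can so be described by ordinary expressions in \<open>fst\<close> and
  \<open>snd\<close>, the polynomial being found by structural rules.\<close>

definition polyfun :: "(real \<times> real \<Rightarrow> real) \<Rightarrow> bool" where
  "polyfun f \<longleftrightarrow> (\<exists>p. \<forall>z. f z = peval p z)"

lemma polyfunI: "(\<And>z. f z = peval p z) \<Longrightarrow> polyfun f"
  unfolding polyfun_def by blast

lemma polyfun_const: "polyfun (\<lambda>z. c)"
  by (rule polyfunI[of _ "const2 c"]) (simp add: peval_single)

lemma polyfun_fst: "polyfun fst" and polyfun_snd: "polyfun snd"
  by (rule polyfunI[of _ "single2 1 0 1"], simp add: peval_single)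
     (rule polyfunI[of _ "single2 0 1 1"], simp add: peval_single)

lemma polyfun_add: "polyfun f \<Longrightarrow> polyfun g \<Longrightarrow> polyfun (\<lambda>z. f z + g z)"
  unfolding polyfun_def by (metis peval_add)

lemma polyfun_diff: "polyfun f \<Longrightarrow> polyfun g \<Longrightarrow> polyfun (\<lambda>z. f z - g z)"
  unfolding polyfun_def by (metis peval_diff)

lemma polyfun_uminus: "polyfun f \<Longrightarrow> polyfun (\<lambda>z. - f z)"
  unfolding polyfun_def by (metis peval_uminus)

lemma polyfun_mult: "polyfun f \<Longrightarrow> polyfun g \<Longrightarrow> polyfun (\<lambda>z. f z * g z)"
  unfolding polyfun_def by (metis peval_mult)

lemma polyfun_power: "polyfun f \<Longrightarrow> polyfun (\<lambda>z. f z ^ n)"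
  unfolding polyfun_def by (metis peval_power)

lemmas polyfun_intros = polyfun_const polyfun_fst polyfun_snd polyfun_add polyfun_diff polyfun_uminus
  polyfun_mult polyfun_power

lemma semialgebraic_zero:
  assumes "polyfun f"
  shows "semialgebraic {z. f z = 0}"
proof -
  obtain p where "f = peval p" using assms unfolding polyfun_def by blast
  then show ?thesis by (simp add: semialgebraic.zero_set)
qed

lemma semialgebraic_nonneg:
  assumes "polyfun f"
  shows "semialgebraic {z. f z \<ge> 0}"
proof -
  obtain p where p: "\<And>z. f z = peval p z" using assms unfolding polyfun_def by blast
  have "{z. f z \<ge> 0} = - {z. peval (- p) z > 0}" by (auto simp: p peval_uminus)
  then show ?thesis using semialgebraic.Compl[OF semialgebraic.pos_set[of "- p"]] by simp
qed

text \<open>The two inclusions become two tasks: \<open>ex\<close> asks for a function vanishing on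
  E with a prescribed jet, and \<open>un\<close> asks for the conditions that vanishing on E imposes
  on a jet.\<close>

lemma jset_eq_vanishing_ideal:
  assumes "(0, 0) \<in> E"
    and ex: "\<And>a b c d e f g h i. V a b c d e f g h i \<Longrightarrow>
      \<exists>F. Ck_on 3 UNIV F \<and> (\<forall>z\<in>E. F z = 0) \<and> flat 3 (\<lambda>z. F z - peval (J3 a b c d e f g h i) z)"
    and un: "\<And>F a b c d e f g h i. Ck_on 3 UNIV F \<Longrightarrow> (\<And>z. z \<in> E \<Longrightarrow> F z = 0) \<Longrightarrow>
      flat 3 (\<lambda>z. F z - peval (J3 a b c d e f g h i) z) \<Longrightarrow> V a b c d e f g h i"
  shows "jset V = vanishing_ideal 3 E"
proof
  show "jset V \<subseteq> vanishing_ideal 3 E"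
  proof
    fix p assume "p \<in> jset V"
    then obtain a b c d e f g h i where p: "p = J3 a b c d e f g h i" "V a b c d e f g h i"
      unfolding jset_def by blast
    from ex[OF p(2)] obtain F where F: "Ck_on 3 UNIV F" "\<forall>z\<in>E. F z = 0"
      "flat 3 (\<lambda>z. F z - peval (J3 a b c d e f g h i) z)" by blast
    have "taylor 3 F = p" unfolding p by (rule taylor_eqI[OF F(1) _ F(3)]) simp
    then show "p \<in> vanishing_ideal 3 E" unfolding vanishing_ideal_def using F(1,2) by blast
  qed
  show "vanishing_ideal 3 E \<subseteq> jset V"
  proof
    fix p assume "p \<in> vanishing_ideal 3 E"
    then obtain F where F: "p = taylor 3 F" "Ck_on 3 UNIV F" "\<forall>z\<in>E. F z = 0"
      unfolding vanishing_ideal_def by blast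
    have "cf p (0, 0) = 0" using F(3) assms(1) by (simp add: F(1) lookup_taylor partial_def)
    then have "p \<in> jets0 3" using taylor_in_jets F(1) by (simp add: jets0_iff)
    then obtain a b c d e f g h i where p: "p = J3 a b c d e f g h i" using jets0_3_eq by blast
    have "V a b c d e f g h i"
      by (rule un[OF F(2)]) (use F(3) taylor_flat[OF F(2)] F(1) p in auto)
    then show "p \<in> jset V" using p by simp
  qed
qed

lemma flat_cong: "flat m g \<Longrightarrow> (\<And>x y. f (x, y) = g (x, y)) \<Longrightarrow> flat m f"
  by (metis ext surj_pair)

lemma flat_mult_fst: "flat m f \<Longrightarrow> flat m (\<lambda>z. fst z * f z)"
  using flat_bounded_mult[of m f 1 fst 1] abs_le_norm_pair(1) by (metis less_eq_real_def order_trans prod.collapse zero_less_one)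

lemma flat_mult_snd: "flat m f \<Longrightarrow> flat m (\<lambda>z. snd z * f z)"
  using flat_bounded_mult[of m f 1 snd 1] abs_le_norm_pair(2) by (metis less_eq_real_def order_trans prod.collapse zero_less_one)

lemmas flat_intros = flat_add flat_diff flat_uminus flat_cmult flat_monomial flat_signed_power4_fst
  flat_signed_power4_snd flat_mult_fst flat_mult_snd

lemma small_powers:
  fixes t :: real
  assumes "0 < t" "t < 1"
  shows "t\<^sup>2 \<le> t" "t ^ 3 \<le> t" "t ^ 3 \<le> t\<^sup>2" "t ^ 6 \<le> t ^ 3" "t ^ 4 \<le> t ^ 3" "t ^ 6 \<le> t ^ 5"
  using power_decreasing[of 1 2 t] power_decreasing[of 1 3 t] power_decreasing[of 2 3 t] power_decreasing[of 3 6 t]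
    power_decreasing[of 3 4 t] power_decreasing[of 5 6 t] assms by simp_all

section \<open>Conditions imposed by an axis or by one half of a cusp\<close>

lemma y_axis_coeffs:
  assumes "flat 3 (\<lambda>z. F z - peval (J3 a b c d e f g h i) z)" "\<And>t. F (0, t) = 0"
  shows "b = 0" "e = 0" "i = 0"
proof -
  have "coeff [:0, b, e, i:] j = 0" if "j \<le> 1 * 3" for j
    by (rule curve_coeff_zero[OF assms(1), where r = 1 and \<alpha> = "\<lambda>t. 0" and \<beta> = "\<lambda>t. t" and k = 1])
       (use assms(2) that in \<open>auto simp: peval_J3 power2_eq_square power3_eq_cube algebra_simps\<close>)
  from this[of 1] this[of 2] this[of 3] show "b = 0" "e = 0" "i = 0" by (simp_all add: eval_nat_numeral)
qed

lemma x_axis_coeffs: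
  assumes "flat 3 (\<lambda>z. F z - peval (J3 a b c d e f g h i) z)" "\<And>t. F (t, 0) = 0"
  shows "a = 0" "c = 0" "f = 0"
proof -
  have "coeff [:0, a, c, f:] j = 0" if "j \<le> 1 * 3" for j
    by (rule curve_coeff_zero[OF assms(1), where r = 1 and \<alpha> = "\<lambda>t. t" and \<beta> = "\<lambda>t. 0" and k = 1])
       (use assms(2) that in \<open>auto simp: peval_J3 power2_eq_square power3_eq_cube algebra_simps\<close>)
  from this[of 1] this[of 2] this[of 3] show "a = 0" "c = 0" "f = 0" by (simp_all add: eval_nat_numeral)
qed

text \<open>On (t^3, \<sigma> t^2) the monomial x^i y^j has weight 3i + 2j. Up to weight 6 only x^2
  and y^3 coincide, whence the single combined condition.\<close>

lemma cusp_branch_coeffs: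
  assumes "flat 3 (\<lambda>z. F z - peval (J3 a b c d e f g h i) z)" "\<bar>\<sigma>\<bar> = 1" "\<And>t. 0 < t \<Longrightarrow> F (t ^ 3, \<sigma> * t\<^sup>2) = 0"
  shows "a = 0" "b = 0" "d = 0" "e = 0" "c + i * \<sigma> = 0"
proof -
  have s: "\<sigma> * \<sigma> = 1" using assms(2) by (metis abs_mult_self_eq mult_1)
  have "coeff [:0, 0, b * \<sigma>, a, e, d * \<sigma>, c + i * \<sigma>, h, g * \<sigma>, f:] j = 0" if "j \<le> 2 * 3" for j
  proof (rule curve_coeff_zero[OF assms(1), where r = 1 and \<alpha> = "\<lambda>t. t ^ 3" and \<beta> = "\<lambda>t. \<sigma> * t\<^sup>2" and k = 2])
    show "peval (J3 a b c d e f g h i) (t ^ 3, \<sigma> * t\<^sup>2) = poly [:0, 0, b * \<sigma>, a, e, d * \<sigma>, c + i * \<sigma>, h, g * \<sigma>, f:] t" for t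
    proof -
      have "peval (J3 a b c d e f g h i) (t ^ 3, \<sigma> * t\<^sup>2) = a * t ^ 3 + b * \<sigma> * t\<^sup>2 + c * t ^ 6 + d * \<sigma> * t ^ 5
          + e * (\<sigma> * \<sigma>) * t ^ 4 + f * t ^ 9 + g * \<sigma> * t ^ 8 + h * (\<sigma> * \<sigma>) * t ^ 7 + i * (\<sigma> * \<sigma>) * \<sigma> * t ^ 6"
        by (simp add: peval_J3 power2_eq_square power3_eq_cube algebra_simps eval_nat_numeral)
      then show ?thesis unfolding s by (simp add: algebra_simps eval_nat_numeral)
    qed
  qed (use assms(2,3) that small_powers in \<open>auto simp: abs_mult\<close>)
  from this[of 2] this[of 3] this[of 4] this[of 5] this[of 6] show "a = 0" "b = 0" "d = 0" "e = 0" "c + i * \<sigma> = 0"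
    using s by (auto simp: eval_nat_numeral)
qed

section \<open>A semi-algebraic set for each ideal of the list\<close>

lemma realize_zero:
  "\<exists>E. semialgebraic E \<and> (0, 0) \<in> E \<and>
    jset (\<lambda>a b c d e f g h i. a = 0 \<and> b = 0 \<and> c = 0 \<and> d = 0 \<and> e = 0 \<and> f = 0 \<and> g = 0 \<and> h = 0 \<and> i = 0) = vanishing_ideal 3 E"
proof (intro exI[of _ UNIV] conjI)
  show "semialgebraic (UNIV :: (real \<times> real) set)"
    using semialgebraic_zero[OF polyfun_const[of 0]] by simp
  show "jset (\<lambda>a b c d e f g h i. a = 0 \<and> b = 0 \<and> c = 0 \<and> d = 0 \<and> e = 0 \<and> f = 0 \<and> g = 0 \<and> h = 0 \<and> i = 0) = vanishing_ideal 3 UNIV"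
  proof (rule jset_eq_vanishing_ideal)
    fix F and a b c d e f g h i :: real
    assume F: "\<And>z. z \<in> UNIV \<Longrightarrow> F z = 0" and fl: "flat 3 (\<lambda>z. F z - peval (J3 a b c d e f g h i) z)"
    have "flat 3 (peval (J3 a b c d e f g h i))" using flat_uminus[OF fl] F by simp
    then have "J3 a b c d e f g h i = J3 0 0 0 0 0 0 0 0 0"
      unfolding J3_zero by (intro flat_jet_eq_zero) simp_all
    then show "a = 0 \<and> b = 0 \<and> c = 0 \<and> d = 0 \<and> e = 0 \<and> f = 0 \<and> g = 0 \<and> h = 0 \<and> i = 0" by simp
  qed (auto simp: J3_zero intro!: exI[of _ "\<lambda>_. 0"])
qed simp

lemma realize_x:
  "\<exists>E. semialgebraic E \<and> (0, 0) \<in> E \<and> jset (\<lambda>a b c d e f g h i. b = 0 \<and> e = 0 \<and> i = 0) = vanishing_ideal 3 E"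
proof (intro exI[of _ "{z. fst z = 0}"] conjI)
  show "semialgebraic {z::real\<times>real. fst z = 0}" by (intro semialgebraic_zero polyfun_intros)
  show "jset (\<lambda>a b c d e f g h i. b = 0 \<and> e = 0 \<and> i = 0) = vanishing_ideal 3 {z. fst z = 0}"
  proof (rule jset_eq_vanishing_ideal)
    fix a b c d e f g h i :: real assume "b = 0 \<and> e = 0 \<and> i = 0"
    then show "\<exists>F. Ck_on 3 UNIV F \<and> (\<forall>z\<in>{z. fst z = 0}. F z = 0) \<and> flat 3 (\<lambda>z. F z - peval (J3 a b c d e f g h i) z)"
      by (intro exI[of _ "peval (J3 a b c d e f g h i)"]) (auto simp: Ck_on_peval peval_J3)
  next
    fix F and a b c d e f g h i :: real
    assume F: "\<And>z. z \<in> {z. fst z = 0} \<Longrightarrow> F z = 0" and fl: "flat 3 (\<lambda>z. F z - peval (J3 a b c d e f g h i) z)"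
    show "b = 0 \<and> e = 0 \<and> i = 0" using y_axis_coeffs[OF fl] F by simp
  qed simp
qed simp

text \<open>The branches x = 0 and x = y^3 touch so closely that x (x - y^3) has the jet x^2;
  Rolle's theorem between them supplies the conditions beyond those of the y-axis.\<close>

lemma realize_x2:
  "\<exists>E. semialgebraic E \<and> (0, 0) \<in> E \<and>
    jset (\<lambda>a b c d e f g h i. a = 0 \<and> b = 0 \<and> d = 0 \<and> e = 0 \<and> h = 0 \<and> i = 0) = vanishing_ideal 3 E"
proof -
  let ?E = "{z::real\<times>real. fst z * (fst z - snd z ^ 3) = 0}"
  have "semialgebraic ?E" by (intro semialgebraic_zero polyfun_intros)
  moreover have "jset (\<lambda>a b c d e f g h i. a = 0 \<and> b = 0 \<and> d = 0 \<and> e = 0 \<and> h = 0 \<and> i = 0) = vanishing_ideal 3 ?E"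
  proof (rule jset_eq_vanishing_ideal)
    fix a b c d e f g h i :: real assume V: "a = 0 \<and> b = 0 \<and> d = 0 \<and> e = 0 \<and> h = 0 \<and> i = 0"
    let ?F = "\<lambda>z. (c + f * fst z + g * snd z) * (fst z * (fst z - snd z ^ 3))"
    have "Ck_on 3 UNIV ?F" by (intro Ck_on_intros open_UNIV)
    moreover have "flat 3 (\<lambda>z. - (c * (fst z ^ 1 * snd z ^ 3) + f * (fst z ^ 2 * snd z ^ 3) + g * (fst z ^ 1 * snd z ^ 4)))"
      by (intro flat_intros) simp_all
    then have "flat 3 (\<lambda>z. ?F z - peval (J3 a b c d e f g h i) z)"
      by (rule flat_cong) (use V in \<open>simp add: peval_J3 algebra_simps eval_nat_numeral\<close>)
    ultimately show "\<exists>F. Ck_on 3 UNIV F \<and> (\<forall>z\<in>?E. F z = 0) \<and> flat 3 (\<lambda>z. F z - peval (J3 a b c d e f g h i) z)"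
      by (intro exI[of _ ?F]) auto
  next
    fix F and a b c d e f g h i :: real
    assume C: "Ck_on 3 UNIV F" and F: "\<And>z. z \<in> ?E \<Longrightarrow> F z = 0" and fl: "flat 3 (\<lambda>z. F z - peval (J3 a b c d e f g h i) z)"
    have "b = 0" "e = 0" "i = 0" using y_axis_coeffs[OF fl] F by simp_all
    \<comment> \<open>At height y = t^2 the abscissas are 0 and t^6, and their sum is at most t^5;
      thus s = 0.\<close>
    moreover have "a = 0" "d = 0" "h + c * 0 = 0"
      by (rule two_branches_coeffs[OF C fl, where \<sigma> = 1 and r = 1 and \<xi> = "\<lambda>t. 0" and \<eta> = "\<lambda>t. t ^ 6" and s = 0];
        use small_powers in \<open>auto intro!: F simp: power_mult[symmetric]\<close>)+
    ultimately show "a = 0 \<and> b = 0 \<and> d = 0 \<and> e = 0 \<and> h = 0 \<and> i = 0" by simp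
  qed simp
  ultimately show ?thesis by (intro exI[of _ ?E]) simp
qed

text \<open>The branches are x = 0, x = y^3 and x = -y^3. The third one allows Rolle's theorem to be
  used twice, which excludes x^2 and x^2 y.\<close>

lemma realize_x3:
  "\<exists>E. semialgebraic E \<and> (0, 0) \<in> E \<and>
    jset (\<lambda>a b c d e f g h i. a = 0 \<and> b = 0 \<and> c = 0 \<and> d = 0 \<and> e = 0 \<and> g = 0 \<and> h = 0 \<and> i = 0) = vanishing_ideal 3 E"
proof -
  let ?E = "{z::real\<times>real. fst z * (fst z ^ 2 - snd z ^ 6) = 0}"
  have "semialgebraic ?E" by (intro semialgebraic_zero polyfun_intros)
  moreover have "jset (\<lambda>a b c d e f g h i. a = 0 \<and> b = 0 \<and> c = 0 \<and> d = 0 \<and> e = 0 \<and> g = 0 \<and> h = 0 \<and> i = 0) = vanishing_ideal 3 ?E"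
  proof (rule jset_eq_vanishing_ideal)
    fix a b c d e f g h i :: real assume V: "a = 0 \<and> b = 0 \<and> c = 0 \<and> d = 0 \<and> e = 0 \<and> g = 0 \<and> h = 0 \<and> i = 0"
    let ?F = "\<lambda>z. f * (fst z * (fst z ^ 2 - snd z ^ 6))"
    have "Ck_on 3 UNIV ?F" by (intro Ck_on_intros open_UNIV)
    moreover have "flat 3 (\<lambda>z. - (f * (fst z ^ 1 * snd z ^ 6)))"
      by (intro flat_intros) simp_all
    then have "flat 3 (\<lambda>z. ?F z - peval (J3 a b c d e f g h i) z)"
      by (rule flat_cong) (use V in \<open>simp add: peval_J3 algebra_simps eval_nat_numeral\<close>)
    ultimately show "\<exists>F. Ck_on 3 UNIV F \<and> (\<forall>z\<in>?E. F z = 0) \<and> flat 3 (\<lambda>z. F z - peval (J3 a b c d e f g h i) z)"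
      by (intro exI[of _ ?F]) auto
  next
    fix F and a b c d e f g h i :: real
    assume C: "Ck_on 3 UNIV F" and F: "\<And>z. z \<in> ?E \<Longrightarrow> F z = 0" and fl: "flat 3 (\<lambda>z. F z - peval (J3 a b c d e f g h i) z)"
    have "b = 0" "e = 0" "i = 0" using y_axis_coeffs[OF fl] F by simp_all
    moreover have "a = 0" "d = 0" "h + c * 0 = 0"
      by (rule two_branches_coeffs[OF C fl, where \<sigma> = 1 and r = 1 and \<xi> = "\<lambda>t. 0" and \<eta> = "\<lambda>t. t ^ 6" and s = 0];
        use small_powers in \<open>auto intro!: F simp: power_mult[symmetric]\<close>)+
    moreover have "c = 0" "g = 0"
      by (rule three_branches_coeffs[OF C fl]; auto intro!: F simp: power_mult[symmetric])+
    ultimately show "a = 0 \<and> b = 0 \<and> c = 0 \<and> d = 0 \<and> e = 0 \<and> g = 0 \<and> h = 0 \<and> i = 0" by simp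
  qed simp
  ultimately show ?thesis by (intro exI[of _ ?E]) simp
qed

lemma realize_xy:
  "\<exists>E. semialgebraic E \<and> (0, 0) \<in> E \<and>
    jset (\<lambda>a b c d e f g h i. a = 0 \<and> b = 0 \<and> c = 0 \<and> e = 0 \<and> f = 0 \<and> i = 0) = vanishing_ideal 3 E"
proof -
  let ?E = "{z::real\<times>real. fst z * snd z = 0}"
  have "semialgebraic ?E" by (intro semialgebraic_zero polyfun_intros)
  moreover have "jset (\<lambda>a b c d e f g h i. a = 0 \<and> b = 0 \<and> c = 0 \<and> e = 0 \<and> f = 0 \<and> i = 0) = vanishing_ideal 3 ?E"
  proof (rule jset_eq_vanishing_ideal)
    fix a b c d e f g h i :: real assume "a = 0 \<and> b = 0 \<and> c = 0 \<and> e = 0 \<and> f = 0 \<and> i = 0"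
    then show "\<exists>F. Ck_on 3 UNIV F \<and> (\<forall>z\<in>?E. F z = 0) \<and> flat 3 (\<lambda>z. F z - peval (J3 a b c d e f g h i) z)"
      by (intro exI[of _ "peval (J3 a b c d e f g h i)"]) (auto simp: Ck_on_peval peval_J3)
  next
    fix F and a b c d e f g h i :: real
    assume F: "\<And>z. z \<in> ?E \<Longrightarrow> F z = 0" and fl: "flat 3 (\<lambda>z. F z - peval (J3 a b c d e f g h i) z)"
    show "a = 0 \<and> b = 0 \<and> c = 0 \<and> e = 0 \<and> f = 0 \<and> i = 0" using y_axis_coeffs[OF fl] x_axis_coeffs[OF fl] F by simp
  qed simp
  ultimately show ?thesis by (intro exI[of _ ?E]) simp
qed

text \<open>The close branches x = 0 and x = y^3 account for x^2, and the x-axis accounts for the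
  factor y.\<close>

lemma realize_yx2:
  "\<exists>E. semialgebraic E \<and> (0, 0) \<in> E \<and>
    jset (\<lambda>a b c d e f g h i. a = 0 \<and> b = 0 \<and> c = 0 \<and> d = 0 \<and> e = 0 \<and> f = 0 \<and> h = 0 \<and> i = 0) = vanishing_ideal 3 E"
proof -
  let ?E = "{z::real\<times>real. fst z * snd z * (fst z - snd z ^ 3) = 0}"
  have "semialgebraic ?E" by (intro semialgebraic_zero polyfun_intros)
  moreover have "jset (\<lambda>a b c d e f g h i. a = 0 \<and> b = 0 \<and> c = 0 \<and> d = 0 \<and> e = 0 \<and> f = 0 \<and> h = 0 \<and> i = 0) = vanishing_ideal 3 ?E"
  proof (rule jset_eq_vanishing_ideal)
    fix a b c d e f g h i :: real assume V: "a = 0 \<and> b = 0 \<and> c = 0 \<and> d = 0 \<and> e = 0 \<and> f = 0 \<and> h = 0 \<and> i = 0"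
    let ?F = "\<lambda>z. g * (fst z * snd z * (fst z - snd z ^ 3))"
    have "Ck_on 3 UNIV ?F" by (intro Ck_on_intros open_UNIV)
    moreover have "flat 3 (\<lambda>z. - (g * (fst z ^ 1 * snd z ^ 4)))"
      by (intro flat_intros) simp_all
    then have "flat 3 (\<lambda>z. ?F z - peval (J3 a b c d e f g h i) z)"
      by (rule flat_cong) (use V in \<open>simp add: peval_J3 algebra_simps eval_nat_numeral\<close>)
    ultimately show "\<exists>F. Ck_on 3 UNIV F \<and> (\<forall>z\<in>?E. F z = 0) \<and> flat 3 (\<lambda>z. F z - peval (J3 a b c d e f g h i) z)"
      by (intro exI[of _ ?F]) auto
  next
    fix F and a b c d e f g h i :: real
    assume C: "Ck_on 3 UNIV F" and F: "\<And>z. z \<in> ?E \<Longrightarrow> F z = 0" and fl: "flat 3 (\<lambda>z. F z - peval (J3 a b c d e f g h i) z)"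
    have "b = 0" "e = 0" "i = 0" "a = 0" "c = 0" "f = 0"
      using y_axis_coeffs[OF fl] x_axis_coeffs[OF fl] F by simp_all
    moreover have "a = 0" "d = 0" "h + c * 0 = 0"
      by (rule two_branches_coeffs[OF C fl, where \<sigma> = 1 and r = 1 and \<xi> = "\<lambda>t. 0" and \<eta> = "\<lambda>t. t ^ 6" and s = 0];
        use small_powers in \<open>auto intro!: F simp: power_mult[symmetric]\<close>)+
    ultimately show "a = 0 \<and> b = 0 \<and> c = 0 \<and> d = 0 \<and> e = 0 \<and> f = 0 \<and> h = 0 \<and> i = 0" by simp
  qed simp
  ultimately show ?thesis by (intro exI[of _ ?E]) simp
qed

lemma realize_xyxy:
  "\<exists>E. semialgebraic E \<and> (0, 0) \<in> E \<and>
    jset (\<lambda>a b c d e f g h i. a = 0 \<and> b = 0 \<and> c = 0 \<and> d = 0 \<and> e = 0 \<and> f = 0 \<and> g = h \<and> i = 0) = vanishing_ideal 3 E"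
proof -
  let ?E = "{z::real\<times>real. fst z * snd z * (fst z + snd z) = 0}"
  have "semialgebraic ?E" by (intro semialgebraic_zero polyfun_intros)
  moreover have "jset (\<lambda>a b c d e f g h i. a = 0 \<and> b = 0 \<and> c = 0 \<and> d = 0 \<and> e = 0 \<and> f = 0 \<and> g = h \<and> i = 0) = vanishing_ideal 3 ?E"
  proof (rule jset_eq_vanishing_ideal)
    fix a b c d e f g h i :: real assume "a = 0 \<and> b = 0 \<and> c = 0 \<and> d = 0 \<and> e = 0 \<and> f = 0 \<and> g = h \<and> i = 0"
    then have "peval (J3 a b c d e f g h i) (x, y) = g * (x * y * (x + y))" for x y
      by (simp add: peval_J3 algebra_simps power2_eq_square)
    then show "\<exists>F. Ck_on 3 UNIV F \<and> (\<forall>z\<in>?E. F z = 0) \<and> flat 3 (\<lambda>z. F z - peval (J3 a b c d e f g h i) z)"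
      by (intro exI[of _ "peval (J3 a b c d e f g h i)"]) (auto simp: Ck_on_peval)
  next
    fix F and a b c d e f g h i :: real
    assume F: "\<And>z. z \<in> ?E \<Longrightarrow> F z = 0" and fl: "flat 3 (\<lambda>z. F z - peval (J3 a b c d e f g h i) z)"
    have 1: "b = 0" "e = 0" "i = 0" "a = 0" "c = 0" "f = 0"
      using y_axis_coeffs[OF fl] x_axis_coeffs[OF fl] F by simp_all
    have "coeff [:0, a - b, c - d + e, f - g + h - i:] j = 0" if "j \<le> 1 * 3" for j
      by (rule curve_coeff_zero[OF fl, where r = 1 and \<alpha> = "\<lambda>t. t" and \<beta> = "\<lambda>t. - t" and k = 1])
         (use F that in \<open>auto simp: peval_J3 power2_eq_square power3_eq_cube algebra_simps\<close>)
    from this[of 2] this[of 3] show "a = 0 \<and> b = 0 \<and> c = 0 \<and> d = 0 \<and> e = 0 \<and> f = 0 \<and> g = h \<and> i = 0"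
      using 1 by (simp add: eval_nat_numeral)
  qed simp
  ultimately show ?thesis by (intro exI[of _ ?E]) simp
qed

text \<open>The halves of the cusp have opposite abscissas at equal height, so s = 0 and the
  two-branch condition reads h = 0. The other conditions come from one half.\<close>

lemma realize_cusp:
  "\<exists>E. semialgebraic E \<and> (0, 0) \<in> E \<and>
    jset (\<lambda>a b c d e f g h i. a = 0 \<and> b = 0 \<and> d = 0 \<and> e = 0 \<and> h = 0 \<and> i = - c) = vanishing_ideal 3 E"
proof -
  let ?E = "{z::real\<times>real. fst z ^ 2 - snd z ^ 3 = 0}"
  have "semialgebraic ?E" by (intro semialgebraic_zero polyfun_intros)
  moreover have "jset (\<lambda>a b c d e f g h i. a = 0 \<and> b = 0 \<and> d = 0 \<and> e = 0 \<and> h = 0 \<and> i = - c) = vanishing_ideal 3 ?E"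
  proof (rule jset_eq_vanishing_ideal)
    fix a b c d e f g h i :: real assume V: "a = 0 \<and> b = 0 \<and> d = 0 \<and> e = 0 \<and> h = 0 \<and> i = - c"
    let ?F = "\<lambda>z. (c + f * fst z + g * snd z) * (fst z ^ 2 - snd z ^ 3)"
    have "Ck_on 3 UNIV ?F" by (intro Ck_on_intros open_UNIV)
    moreover have "flat 3 (\<lambda>z. - (f * (fst z ^ 1 * snd z ^ 3) + g * (fst z ^ 0 * snd z ^ 4)))"
      by (intro flat_intros) simp_all
    then have "flat 3 (\<lambda>z. ?F z - peval (J3 a b c d e f g h i) z)"
      by (rule flat_cong) (use V in \<open>simp add: peval_J3 algebra_simps eval_nat_numeral\<close>)
    ultimately show "\<exists>F. Ck_on 3 UNIV F \<and> (\<forall>z\<in>?E. F z = 0) \<and> flat 3 (\<lambda>z. F z - peval (J3 a b c d e f g h i) z)"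
      by (intro exI[of _ ?F]) auto
  next
    fix F and a b c d e f g h i :: real
    assume C: "Ck_on 3 UNIV F" and F: "\<And>z. z \<in> ?E \<Longrightarrow> F z = 0" and fl: "flat 3 (\<lambda>z. F z - peval (J3 a b c d e f g h i) z)"
    have m: "F (t ^ 3, 1 * t\<^sup>2) = 0" "F (- (t ^ 3), 1 * t\<^sup>2) = 0" for t
      by (rule F, simp add: power_mult[symmetric])+
    have "a = 0" "b = 0" "d = 0" "e = 0" "c + i * 1 = 0"
      using cusp_branch_coeffs[OF fl, of 1] m(1) by simp_all
    moreover have "h + c * 0 = 0"
      by (rule two_branches_coeffs(3)[OF C fl, where \<sigma> = 1 and r = 1 and \<xi> = "\<lambda>t. - (t ^ 3)" and \<eta> = "\<lambda>t. t ^ 3" and s = 0])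
        (use m in auto)
    ultimately show "a = 0 \<and> b = 0 \<and> d = 0 \<and> e = 0 \<and> h = 0 \<and> i = - c" by simp
  qed simp
  ultimately show ?thesis by (intro exI[of _ ?E]) simp
qed

text \<open>On x = |y|^3 one has x^2 = y^6 and xy = y^3 |y|, both C^3 and o(|z|^3). The two halves
  give a + i = 0 and a - i = 0.\<close>

lemma realize_x2_xy:
  "\<exists>E. semialgebraic E \<and> (0, 0) \<in> E \<and>
    jset (\<lambda>a b c d e f g h i. a = 0 \<and> b = 0 \<and> e = 0 \<and> i = 0) = vanishing_ideal 3 E"
proof -
  let ?E = "{z::real\<times>real. fst z ^ 2 - snd z ^ 6 = 0} \<inter> {z. fst z \<ge> 0}"
  have mem: "fst z = \<bar>snd z\<bar> ^ 3" if "z \<in> ?E" for z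
  proof -
    have "(fst z)\<^sup>2 = (\<bar>snd z\<bar> ^ 3)\<^sup>2" using that by (simp add: power_mult[symmetric] power_even_abs)
    then show ?thesis by (rule power2_eq_imp_eq) (use that in auto)
  qed
  have "semialgebraic ?E" by (intro semialgebraic.Int semialgebraic_zero semialgebraic_nonneg polyfun_intros)
  moreover have "jset (\<lambda>a b c d e f g h i. a = 0 \<and> b = 0 \<and> e = 0 \<and> i = 0) = vanishing_ideal 3 ?E"
  proof (rule jset_eq_vanishing_ideal)
    fix a b c d e f g h i :: real assume V: "a = 0 \<and> b = 0 \<and> e = 0 \<and> i = 0"
    let ?F = "\<lambda>z. (c + f * fst z + g * snd z) * (fst z ^ 2 - snd z ^ 6) + (d + h * snd z) * (fst z * snd z - signed_power4 (snd z))"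
    have "Ck_on 3 UNIV ?F" by (intro Ck_on_intros Ck_on_signed_power4 open_UNIV)
    moreover have "flat 3 (\<lambda>z. - (c * (fst z ^ 0 * snd z ^ 6) + f * (fst z ^ 1 * snd z ^ 6) + g * (fst z ^ 0 * snd z ^ 7))
        - (d * signed_power4 (snd z) + h * (snd z * signed_power4 (snd z))))"
      by (intro flat_intros) simp_all
    then have "flat 3 (\<lambda>z. ?F z - peval (J3 a b c d e f g h i) z)"
      by (rule flat_cong) (use V in \<open>simp add: peval_J3 algebra_simps eval_nat_numeral\<close>)
    moreover have "?F z = 0" if "z \<in> ?E" for z
    proof -
      have "fst z * snd z = signed_power4 (snd z)"
        using mem[OF that] by (auto simp: signed_power4_eq eval_nat_numeral abs_if)
      then show ?thesis using that by simp
    qed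
    ultimately show "\<exists>F. Ck_on 3 UNIV F \<and> (\<forall>z\<in>?E. F z = 0) \<and> flat 3 (\<lambda>z. F z - peval (J3 a b c d e f g h i) z)"
      by blast
  next
    fix F and a b c d e f g h i :: real
    assume F: "\<And>z. z \<in> ?E \<Longrightarrow> F z = 0" and fl: "flat 3 (\<lambda>z. F z - peval (J3 a b c d e f g h i) z)"
    have m: "F (t ^ 3, t) = 0" "F (t ^ 3, - t) = 0" if "t > 0" for t
      by (rule F, use that in \<open>simp add: power_mult[symmetric]\<close>)+
    have 1: "coeff [:0, b, e, a + i, d, h, c, g, 0, f:] j = 0" if "j \<le> 1 * 3" for j
      by (rule curve_coeff_zero[OF fl, where r = 1 and \<alpha> = "\<lambda>t. t ^ 3" and \<beta> = "\<lambda>t. t" and k = 1])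
         (use m that small_powers in \<open>auto simp: peval_J3 algebra_simps eval_nat_numeral\<close>)
    have 2: "coeff [:0, - b, e, a - i, - d, h, c, - g, 0, f:] j = 0" if "j \<le> 1 * 3" for j
      by (rule curve_coeff_zero[OF fl, where r = 1 and \<alpha> = "\<lambda>t. t ^ 3" and \<beta> = "\<lambda>t. - t" and k = 1])
         (use m that small_powers in \<open>auto simp: peval_J3 algebra_simps eval_nat_numeral\<close>)
    from 1[of 1] 1[of 2] 1[of 3] 2[of 3] show "a = 0 \<and> b = 0 \<and> e = 0 \<and> i = 0" by (simp add: eval_nat_numeral)
  qed simp
  ultimately show ?thesis by (intro exI[of _ ?E]) simp
qed

text \<open>On x = y |y| one has x^2 = y^4 and x y^2 = y^3 |y|. Comparing the two halves separates a
  from e and d from i.\<close>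

lemma realize_x2_xy2:
  "\<exists>E. semialgebraic E \<and> (0, 0) \<in> E \<and>
    jset (\<lambda>a b c d e f g h i. a = 0 \<and> b = 0 \<and> d = 0 \<and> e = 0 \<and> i = 0) = vanishing_ideal 3 E"
proof -
  let ?E = "({z::real\<times>real. fst z - snd z ^ 2 = 0} \<inter> {z. snd z \<ge> 0}) \<union> ({z. fst z + snd z ^ 2 = 0} \<inter> {z. - snd z \<ge> 0})"
  have "semialgebraic ?E" by (intro semialgebraic.Un semialgebraic.Int semialgebraic_zero semialgebraic_nonneg polyfun_intros)
  moreover have "jset (\<lambda>a b c d e f g h i. a = 0 \<and> b = 0 \<and> d = 0 \<and> e = 0 \<and> i = 0) = vanishing_ideal 3 ?E"
  proof (rule jset_eq_vanishing_ideal)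
    fix a b c d e f g h i :: real assume V: "a = 0 \<and> b = 0 \<and> d = 0 \<and> e = 0 \<and> i = 0"
    let ?F = "\<lambda>z. (c + f * fst z + g * snd z) * (fst z ^ 2 - snd z ^ 4) + h * (fst z * snd z ^ 2 - signed_power4 (snd z))"
    have "Ck_on 3 UNIV ?F" by (intro Ck_on_intros Ck_on_signed_power4 open_UNIV)
    moreover have "flat 3 (\<lambda>z. - (c * (fst z ^ 0 * snd z ^ 4) + f * (fst z ^ 1 * snd z ^ 4) + g * (fst z ^ 0 * snd z ^ 5))
        - h * signed_power4 (snd z))"
      by (intro flat_intros) simp_all
    then have "flat 3 (\<lambda>z. ?F z - peval (J3 a b c d e f g h i) z)"
      by (rule flat_cong) (use V in \<open>simp add: peval_J3 algebra_simps eval_nat_numeral\<close>)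
    moreover have "?F z = 0" if "z \<in> ?E" for z
    proof -
      have "fst z = snd z ^ 2 \<and> snd z \<ge> 0 \<or> fst z = - (snd z ^ 2) \<and> snd z \<le> 0" using that by auto
      then have "fst z * snd z ^ 2 = signed_power4 (snd z)" "fst z ^ 2 = snd z ^ 4"
        by (auto simp: signed_power4_eq eval_nat_numeral)
      then show ?thesis by simp
    qed
    ultimately show "\<exists>F. Ck_on 3 UNIV F \<and> (\<forall>z\<in>?E. F z = 0) \<and> flat 3 (\<lambda>z. F z - peval (J3 a b c d e f g h i) z)"
      by blast
  next
    fix F and a b c d e f g h i :: real
    assume F: "\<And>z. z \<in> ?E \<Longrightarrow> F z = 0" and fl: "flat 3 (\<lambda>z. F z - peval (J3 a b c d e f g h i) z)"
    have m: "F (t ^ 2, t) = 0" "F (- (t ^ 2), - t) = 0" if "t > 0" for t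
      by (rule F, use that in simp)+
    have 1: "coeff [:0, b, a + e, d + i, c + h, g, f:] j = 0" if "j \<le> 1 * 3" for j
      by (rule curve_coeff_zero[OF fl, where r = 1 and \<alpha> = "\<lambda>t. t ^ 2" and \<beta> = "\<lambda>t. t" and k = 1])
         (use m that small_powers in \<open>auto simp: peval_J3 algebra_simps eval_nat_numeral\<close>)
    have 2: "coeff [:0, - b, - a + e, d - i, c - h, - g, - f:] j = 0" if "j \<le> 1 * 3" for j
      by (rule curve_coeff_zero[OF fl, where r = 1 and \<alpha> = "\<lambda>t. - (t ^ 2)" and \<beta> = "\<lambda>t. - t" and k = 1])
         (use m that small_powers in \<open>auto simp: peval_J3 algebra_simps eval_nat_numeral\<close>)
    from 1[of 1] 1[of 2] 1[of 3] 2[of 2] 2[of 3] show "a = 0 \<and> b = 0 \<and> d = 0 \<and> e = 0 \<and> i = 0"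
      by (simp add: eval_nat_numeral)
  qed simp
  ultimately show ?thesis by (intro exI[of _ ?E]) simp
qed

text \<open>On y = x |x| one has x^2 y = x^3 |x| and x y^2 = x^5, and these identities also hold on
  the y-axis. The two halves separate d from f.\<close>

lemma realize_x2y_xy2:
  "\<exists>E. semialgebraic E \<and> (0, 0) \<in> E \<and>
    jset (\<lambda>a b c d e f g h i. a = 0 \<and> b = 0 \<and> c = 0 \<and> d = 0 \<and> e = 0 \<and> f = 0 \<and> i = 0) = vanishing_ideal 3 E"
proof -
  let ?E = "{z::real\<times>real. fst z = 0} \<union> (({z. snd z - fst z ^ 2 = 0} \<inter> {z. fst z \<ge> 0}) \<union> ({z. snd z + fst z ^ 2 = 0} \<inter> {z. - fst z \<ge> 0}))"
  have "semialgebraic ?E" by (intro semialgebraic.Un semialgebraic.Int semialgebraic_zero semialgebraic_nonneg polyfun_intros)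
  moreover have "jset (\<lambda>a b c d e f g h i. a = 0 \<and> b = 0 \<and> c = 0 \<and> d = 0 \<and> e = 0 \<and> f = 0 \<and> i = 0) = vanishing_ideal 3 ?E"
  proof (rule jset_eq_vanishing_ideal)
    fix a b c d e f g h i :: real assume V: "a = 0 \<and> b = 0 \<and> c = 0 \<and> d = 0 \<and> e = 0 \<and> f = 0 \<and> i = 0"
    let ?F = "\<lambda>z. g * (fst z ^ 2 * snd z - signed_power4 (fst z)) + h * (fst z * snd z ^ 2 - fst z ^ 5)"
    have "Ck_on 3 UNIV ?F" by (intro Ck_on_intros Ck_on_signed_power4 open_UNIV)
    moreover have "flat 3 (\<lambda>z. - (g * signed_power4 (fst z)) - h * (fst z ^ 5 * snd z ^ 0))"
      by (intro flat_intros) simp_all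
    then have "flat 3 (\<lambda>z. ?F z - peval (J3 a b c d e f g h i) z)"
      by (rule flat_cong) (use V in \<open>simp add: peval_J3 algebra_simps\<close>)
    moreover have "?F z = 0" if "z \<in> ?E" for z
    proof -
      have "fst z = 0 \<or> snd z = fst z ^ 2 \<and> fst z \<ge> 0 \<or> snd z = - (fst z ^ 2) \<and> fst z \<le> 0" using that by auto
      then have "fst z ^ 2 * snd z = signed_power4 (fst z)" "fst z * snd z ^ 2 = fst z ^ 5"
        by (auto simp: signed_power4_eq eval_nat_numeral)
      then show ?thesis by simp
    qed
    ultimately show "\<exists>F. Ck_on 3 UNIV F \<and> (\<forall>z\<in>?E. F z = 0) \<and> flat 3 (\<lambda>z. F z - peval (J3 a b c d e f g h i) z)"
      by blast
  next
    fix F and a b c d e f g h i :: real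
    assume F: "\<And>z. z \<in> ?E \<Longrightarrow> F z = 0" and fl: "flat 3 (\<lambda>z. F z - peval (J3 a b c d e f g h i) z)"
    have 0: "b = 0" "e = 0" "i = 0" using y_axis_coeffs[OF fl] F by simp_all
    have m: "F (t, t ^ 2) = 0" "F (- t, - (t ^ 2)) = 0" if "t > 0" for t
      by (rule F, use that in simp)+
    have 1: "coeff [:0, a, b + c, d + f, e + g, h, i:] j = 0" if "j \<le> 1 * 3" for j
      by (rule curve_coeff_zero[OF fl, where r = 1 and \<alpha> = "\<lambda>t. t" and \<beta> = "\<lambda>t. t ^ 2" and k = 1])
         (use m that small_powers in \<open>auto simp: peval_J3 algebra_simps eval_nat_numeral\<close>)
    have 2: "coeff [:0, - a, - b + c, d - f, e - g, - h, - i:] j = 0" if "j \<le> 1 * 3" for j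
      by (rule curve_coeff_zero[OF fl, where r = 1 and \<alpha> = "\<lambda>t. - t" and \<beta> = "\<lambda>t. - (t ^ 2)" and k = 1])
         (use m that small_powers in \<open>auto simp: peval_J3 algebra_simps eval_nat_numeral\<close>)
    from 0 1[of 1] 1[of 2] 1[of 3] 2[of 3]
    show "a = 0 \<and> b = 0 \<and> c = 0 \<and> d = 0 \<and> e = 0 \<and> f = 0 \<and> i = 0" by (simp add: eval_nat_numeral)
  qed simp
  ultimately show ?thesis by (intro exI[of _ ?E]) simp
qed

text \<open>Here \<open>x = y \<bar>z\<bar>\<close> rather than \<open>x = y \<bar>y\<bar>\<close> is used because \<open>x y\<^sup>2 \<bar>z\<bar>\<close> is of class \<open>C\<^sup>3\<close>
  on the whole plane, while \<open>x \<bar>y\<bar>\<^sup>3\<close> is not.\<close>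

lemma realize_x3_x2y:
  "\<exists>E. semialgebraic E \<and> (0, 0) \<in> E \<and>
    jset (\<lambda>a b c d e f g h i. a = 0 \<and> b = 0 \<and> c = 0 \<and> d = 0 \<and> e = 0 \<and> h = 0 \<and> i = 0) = vanishing_ideal 3 E"
proof -
  let ?E = "{z::real\<times>real. fst z = 0} \<union> ({z. fst z ^ 2 - snd z ^ 2 * (fst z ^ 2 + snd z ^ 2) = 0} \<inter> {z. fst z * snd z \<ge> 0})"
  have "semialgebraic ?E" by (intro semialgebraic.Un semialgebraic.Int semialgebraic_zero semialgebraic_nonneg polyfun_intros)
  moreover have "jset (\<lambda>a b c d e f g h i. a = 0 \<and> b = 0 \<and> c = 0 \<and> d = 0 \<and> e = 0 \<and> h = 0 \<and> i = 0) = vanishing_ideal 3 ?E"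
  proof (rule jset_eq_vanishing_ideal)
    fix a b c d e f g h i :: real assume V: "a = 0 \<and> b = 0 \<and> c = 0 \<and> d = 0 \<and> e = 0 \<and> h = 0 \<and> i = 0"
    let ?F = "\<lambda>z. f * (fst z ^ 3 - fst z * snd z ^ 2 * (fst z ^ 2 + snd z ^ 2)) + g * (fst z ^ 2 * snd z - mono_powr 1 2 (1 / 2) z)"
    have "Ck_on 3 UNIV (mono_powr 1 2 (1 / 2))" by (rule Ck_on_mono_powr) simp
    then have "Ck_on 3 UNIV ?F" by (intro Ck_on_intros open_UNIV) auto
    moreover have "flat 3 (mono_powr 1 2 (1 / 2))"
    proof (rule flat_Suc_bound[of 1 _ 1])
      fix z :: "real \<times> real"
      have "norm z powr 4 = norm z ^ 4" by (cases "z = 0") (simp_all add: powr_numeral)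
      then show "\<bar>mono_powr 1 2 (1 / 2) z\<bar> \<le> 1 * norm z ^ Suc 3"
        using mono_powr_bound[of 1 2 "1 / 2" z] by (simp add: eval_nat_numeral)
    qed simp
    then have "flat 3 (\<lambda>z. - (f * (fst z ^ 3 * snd z ^ 2) + f * (fst z ^ 1 * snd z ^ 4)) - g * mono_powr 1 2 (1 / 2) z)"
      by (intro flat_intros) simp_all
    then have "flat 3 (\<lambda>z. ?F z - peval (J3 a b c d e f g h i) z)"
      by (rule flat_cong) (use V in \<open>simp add: peval_J3 algebra_simps eval_nat_numeral\<close>)
    moreover have "?F z = 0" if "z \<in> ?E" for z
    proof (cases "fst z = 0")
      case True
      then show ?thesis by (simp add: mono_powr_def)
    next
      case False
      then have q: "fst z ^ 2 = snd z ^ 2 * (fst z ^ 2 + snd z ^ 2)" and s: "fst z * snd z \<ge> 0" using that by auto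
      define r where "r = sqrt (fst z ^ 2 + snd z ^ 2)"
      have r2: "r ^ 2 = fst z ^ 2 + snd z ^ 2" and r0: "r \<ge> 0" by (simp_all add: r_def)
      have "(fst z - snd z * r) * (fst z + snd z * r) = 0"
        using q unfolding r2[symmetric] by (simp add: algebra_simps power2_eq_square)
      then consider "fst z = snd z * r" | "fst z = - (snd z * r)" by (auto simp: eq_neg_iff_add_eq_0)
      \<comment> \<open>The sign condition on xy selects x = y |z| from the two roots.\<close>
      then have x: "fst z = snd z * r"
      proof cases
        case 2
        then have "- (snd z * snd z * r) \<ge> 0" using s by (simp add: ac_simps)
        moreover have "snd z * snd z * r \<ge> 0" using r0 by simp
        ultimately have "snd z * snd z * r = 0" by linarith
        then show ?thesis using 2 False by auto
      qed
      have "mono_powr 1 2 (1 / 2) z = fst z * snd z ^ 2 * r" by (simp add: mono_powr_def r_def powr_half_sqrt)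
      moreover have "fst z ^ 2 * snd z = fst z * snd z ^ 2 * r" using x by (simp add: power2_eq_square)
      moreover have "fst z ^ 3 = fst z * snd z ^ 2 * (fst z ^ 2 + snd z ^ 2)"
        using q by (simp add: power3_eq_cube power2_eq_square)
      ultimately show ?thesis by simp
    qed
    ultimately show "\<exists>F. Ck_on 3 UNIV F \<and> (\<forall>z\<in>?E. F z = 0) \<and> flat 3 (\<lambda>z. F z - peval (J3 a b c d e f g h i) z)"
      by blast
  next
    fix F and a b c d e f g h i :: real
    assume C: "Ck_on 3 UNIV F" and F: "\<And>z. z \<in> ?E \<Longrightarrow> F z = 0" and fl: "flat 3 (\<lambda>z. F z - peval (J3 a b c d e f g h i) z)"
    have 0: "b = 0" "e = 0" "i = 0" using y_axis_coeffs[OF fl] F by simp_all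
    have 1: "a = 0 \<and> d = 0 \<and> h + c * \<sigma> = 0" if \<sigma>: "\<sigma> = 1 \<or> \<sigma> = -1" for \<sigma>
    proof -
      have s: "\<bar>\<sigma>\<bar> = 1" "\<sigma> * \<sigma> = 1" using \<sigma> by auto
      \<comment> \<open>Solving x^2 = y^2 (x^2 + y^2) at y = \<sigma> t^2 gives x^2 (1 - t^4) = t^8,
        that is x = \<sigma> t^4 w(t) with w(t) = 1 + O(t^4). Together with the branch x = 0 this
        means s = \<sigma>.\<close>
      define w where "w t = 1 / sqrt (1 - t ^ 4)" for t :: real
      have "F (0, \<sigma> * t\<^sup>2) = 0 \<and> F (\<sigma> * t ^ 4 * w t, \<sigma> * t\<^sup>2) = 0 \<and> 0 \<noteq> \<sigma> * t ^ 4 * w t \<and>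
          \<bar>0\<bar> \<le> t ^ 3 \<and> \<bar>\<sigma> * t ^ 4 * w t\<bar> \<le> t ^ 3 \<and> \<bar>0 + \<sigma> * t ^ 4 * w t - \<sigma> * t ^ 4\<bar> \<le> t ^ 5"
        if t: "0 < t" "t < 1 / 2" for t
      proof -
        have "t ^ 3 \<le> (1 / 2) ^ 3" using t by (intro power_mono) auto
        then have "t ^ 3 \<le> 1 / 8" by (simp add: power3_eq_cube)
        then have "t ^ 3 * t \<le> 1 / 8 * t" using t by (intro mult_right_mono) auto
        then have "t ^ 4 \<le> 1 / 8 * t" by (simp add: eval_nat_numeral)
        then have t4: "2 * t ^ 4 \<le> t" "t ^ 4 \<le> 1 / 2" using t by linarith+
        let ?u = "1 - t ^ 4"
        have u: "?u > 0" "?u \<le> 1" "?u \<ge> 1 / 2" using t4 t by auto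
        have w2: "w t ^ 2 * ?u = 1" and w0: "w t > 0" using u by (simp_all add: w_def power_divide)
        have "?u\<^sup>2 \<le> ?u" using u by (simp add: power2_eq_square mult_left_le)
        then have su: "sqrt ?u \<ge> ?u" using u by (intro real_le_rsqrt)
        have w1: "w t \<ge> 1" using u by (simp add: w_def)
        have "w t \<le> 1 / ?u" unfolding w_def using su u by (intro divide_left_mono) auto
        also have "\<dots> \<le> 1 + 2 * t ^ 4"
        proof -
          have "1 \<le> (1 + 2 * t ^ 4) * ?u"
          proof -
            have "(1 + 2 * t ^ 4) * ?u = 1 + t ^ 4 * (1 - 2 * t ^ 4)" by (simp add: algebra_simps)
            moreover have "t ^ 4 * (1 - 2 * t ^ 4) \<ge> 0" using t4 t by (intro mult_nonneg_nonneg) auto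
            ultimately show ?thesis by simp
          qed
          then show ?thesis using u(1) by (simp add: pos_divide_le_eq)
        qed
        finally have "w t \<le> 1 + 2 * t ^ 4" .
        then have wt: "w t - 1 \<le> t" "w t \<le> 2" using t4 t by linarith+
        have "\<bar>\<sigma> * t ^ 4 * w t\<bar> = t ^ 4 * w t" using s(1) w0 by (simp add: abs_mult)
        also have "\<dots> \<le> t ^ 4 * 2" using wt by (intro mult_left_mono) auto
        also have "\<dots> = t ^ 3 * (2 * t)" by (simp add: eval_nat_numeral)
        also have "\<dots> \<le> t ^ 3 * 1" using t by (intro mult_left_mono) auto
        finally have 3: "\<bar>\<sigma> * t ^ 4 * w t\<bar> \<le> t ^ 3" by simp
        have "\<sigma> * t ^ 4 * w t - \<sigma> * t ^ 4 = \<sigma> * (t ^ 4 * (w t - 1))" by (simp add: algebra_simps)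
        then have "\<bar>\<sigma> * t ^ 4 * w t - \<sigma> * t ^ 4\<bar> = t ^ 4 * (w t - 1)" using s(1) w1 by (simp add: abs_mult)
        also have "\<dots> \<le> t ^ 4 * t" using wt by (intro mult_left_mono) auto
        also have "\<dots> = t ^ 5" by (simp add: eval_nat_numeral)
        finally have 4: "\<bar>\<sigma> * t ^ 4 * w t - \<sigma> * t ^ 4\<bar> \<le> t ^ 5" .
        have 5: "F (\<sigma> * t ^ 4 * w t, \<sigma> * t\<^sup>2) = 0"
        proof (rule F)
          have y2: "(\<sigma> * t\<^sup>2) ^ 2 = t ^ 4" using s(2) by (simp add: power2_eq_square eval_nat_numeral algebra_simps)
          have x2: "(\<sigma> * t ^ 4 * w t) ^ 2 = t ^ 8 * w t ^ 2"
          proof -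
            have "(\<sigma> * t ^ 4 * w t) ^ 2 = (\<sigma> * \<sigma>) * (t ^ 4 * t ^ 4) * w t ^ 2" by (simp add: power2_eq_square algebra_simps)
            then show ?thesis unfolding s(2) by (simp add: power_add[symmetric])
          qed
          have "t ^ 4 * (t ^ 8 * w t ^ 2 + t ^ 4) = t ^ 8 * (t ^ 4 * w t ^ 2 + 1)" by (simp add: algebra_simps power_add[symmetric])
          also have "t ^ 4 * w t ^ 2 + 1 = w t ^ 2" using w2 by (simp add: algebra_simps)
          finally have "(\<sigma> * t ^ 4 * w t) ^ 2 - (\<sigma> * t\<^sup>2) ^ 2 * ((\<sigma> * t ^ 4 * w t) ^ 2 + (\<sigma> * t\<^sup>2) ^ 2) = 0"
            unfolding x2 y2 by simp
          moreover have "(\<sigma> * t ^ 4 * w t) * (\<sigma> * t\<^sup>2) = (\<sigma> * \<sigma>) * (t ^ 6 * w t)" by (simp add: eval_nat_numeral)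
          then have "(\<sigma> * t ^ 4 * w t) * (\<sigma> * t\<^sup>2) = t ^ 6 * w t" by (simp only: s(2) mult_1)
          then have "(\<sigma> * t ^ 4 * w t) * (\<sigma> * t\<^sup>2) \<ge> 0" using t w0 by (simp only: mult_nonneg_nonneg zero_le_power less_imp_le)
          ultimately show "(\<sigma> * t ^ 4 * w t, \<sigma> * t\<^sup>2) \<in> ?E" by simp
        qed
        have 6: "F (0, \<sigma> * t\<^sup>2) = 0" by (rule F) simp
        have 7: "0 \<noteq> \<sigma> * t ^ 4 * w t" using s(1) t w0 by auto
        show ?thesis using 3 4 5 6 7 t by simp
      qed
      note * = two_branches_coeffs[OF C fl s(1), where r = "1 / 2" and \<xi> = "\<lambda>t. 0" and \<eta> = "\<lambda>t. \<sigma> * t ^ 4 * w t" and s = \<sigma>, OF _ this]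
      show ?thesis using * by simp
    qed
    \<comment> \<open>The upper and the lower half give h + c = 0 and h - c = 0.\<close>
    from 0 1[of 1] 1[of "-1"] show "a = 0 \<and> b = 0 \<and> c = 0 \<and> d = 0 \<and> e = 0 \<and> h = 0 \<and> i = 0" by simp
  qed simp
  ultimately show ?thesis by (intro exI[of _ ?E]) simp
qed

lemma cusp_parametrization:
  fixes x y :: real
  assumes "x\<^sup>2 = y ^ 3" "x \<ge> 0"
  obtains t where "t \<ge> 0" "x = t ^ 3" "y = t\<^sup>2"
proof
  have "y ^ 3 \<ge> 0" using assms(1) zero_le_power2[of x] by simp
  then have y: "y \<ge> 0" by (simp add: zero_le_odd_power)
  show "sqrt y \<ge> 0" "y = (sqrt y)\<^sup>2" using y by simp_all
  have "(sqrt y ^ 3)\<^sup>2 = ((sqrt y)\<^sup>2) ^ 3" by (simp add: power_mult[symmetric])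
  then have "x\<^sup>2 = (sqrt y ^ 3)\<^sup>2" using y assms(1) by simp
  then show "x = sqrt y ^ 3" by (rule power2_eq_imp_eq) (use assms(2) y in auto)
qed

text \<open>On one half of the cusp x = y^(3/2) and x y^2 = y^(7/2), which is C^3 and o(|z|^3).
  Dropping the other half releases the condition h = 0.\<close>

lemma realize_cusp_xy2:
  "\<exists>E. semialgebraic E \<and> (0, 0) \<in> E \<and>
    jset (\<lambda>a b c d e f g h i. a = 0 \<and> b = 0 \<and> d = 0 \<and> e = 0 \<and> i = - c) = vanishing_ideal 3 E"
proof -
  let ?E = "{z::real\<times>real. fst z ^ 2 - snd z ^ 3 = 0} \<inter> {z. fst z \<ge> 0}"
  have "semialgebraic ?E" by (intro semialgebraic.Int semialgebraic_zero semialgebraic_nonneg polyfun_intros)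
  moreover have "jset (\<lambda>a b c d e f g h i. a = 0 \<and> b = 0 \<and> d = 0 \<and> e = 0 \<and> i = - c) = vanishing_ideal 3 ?E"
  proof (rule jset_eq_vanishing_ideal)
    fix a b c d e f g h i :: real assume V: "a = 0 \<and> b = 0 \<and> d = 0 \<and> e = 0 \<and> i = - c"
    let ?F = "\<lambda>z. (c + f * fst z + g * snd z) * (fst z ^ 2 - snd z ^ 3) + h * (fst z * snd z ^ 2 - pos_powr (7 / 2) (1 * snd z))"
    have "Ck_on 3 UNIV ?F" by (intro Ck_on_intros Ck_on_pos_powr_of open_UNIV) simp
    moreover have "flat 3 (\<lambda>z. - (f * (fst z ^ 1 * snd z ^ 3) + g * (fst z ^ 0 * snd z ^ 4)) - h * pos_powr (7 / 2) (1 * snd z))"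
      by (intro flat_intros flat_pos_powr_snd) simp_all
    then have "flat 3 (\<lambda>z. ?F z - peval (J3 a b c d e f g h i) z)"
      by (rule flat_cong) (use V in \<open>simp add: peval_J3 algebra_simps eval_nat_numeral\<close>)
    moreover have "?F z = 0" if "z \<in> ?E" for z
    proof -
      have "(fst z)\<^sup>2 = snd z ^ 3" "fst z \<ge> 0" using that by auto
      then obtain t where t: "t \<ge> 0" "fst z = t ^ 3" "snd z = t\<^sup>2" by (rule cusp_parametrization)
      have "pos_powr (7 / 2) (t\<^sup>2) = t ^ 7" using pos_powr_square[OF t(1), of 7] by simp
      then show ?thesis using t by (simp add: power_mult[symmetric] power_add[symmetric])
    qed
    ultimately show "\<exists>F. Ck_on 3 UNIV F \<and> (\<forall>z\<in>?E. F z = 0) \<and> flat 3 (\<lambda>z. F z - peval (J3 a b c d e f g h i) z)"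
      by blast
  next
    fix F and a b c d e f g h i :: real
    assume F: "\<And>z. z \<in> ?E \<Longrightarrow> F z = 0" and fl: "flat 3 (\<lambda>z. F z - peval (J3 a b c d e f g h i) z)"
    have m: "F (t ^ 3, 1 * t\<^sup>2) = 0" if "t > 0" for t
      by (rule F) (use that in \<open>simp add: power_mult[symmetric]\<close>)
    show "a = 0 \<and> b = 0 \<and> d = 0 \<and> e = 0 \<and> i = - c"
      using cusp_branch_coeffs[OF fl, of 1] m by simp
  qed simp
  ultimately show ?thesis by (intro exI[of _ ?E]) simp
qed

text \<open>On x = |y|^(3/2) the generators become |y|^(9/2), y^3 |y| and |y|^(7/2). The two halves
  give c + i = 0 and c - i = 0.\<close>

lemma realize_x3_x2y_xy2:
  "\<exists>E. semialgebraic E \<and> (0, 0) \<in> E \<and>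
    jset (\<lambda>a b c d e f g h i. a = 0 \<and> b = 0 \<and> c = 0 \<and> d = 0 \<and> e = 0 \<and> i = 0) = vanishing_ideal 3 E"
proof -
  let ?E = "({z::real\<times>real. fst z ^ 2 - snd z ^ 3 = 0} \<union> {z. fst z ^ 2 + snd z ^ 3 = 0}) \<inter> {z. fst z \<ge> 0}"
  have "semialgebraic ?E" by (intro semialgebraic.Un semialgebraic.Int semialgebraic_zero semialgebraic_nonneg polyfun_intros)
  moreover have "jset (\<lambda>a b c d e f g h i. a = 0 \<and> b = 0 \<and> c = 0 \<and> d = 0 \<and> e = 0 \<and> i = 0) = vanishing_ideal 3 ?E"
  proof (rule jset_eq_vanishing_ideal)
    fix a b c d e f g h i :: real assume V: "a = 0 \<and> b = 0 \<and> c = 0 \<and> d = 0 \<and> e = 0 \<and> i = 0"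
    let ?p = "\<lambda>r z. pos_powr r (1 * snd z) + pos_powr r (- 1 * snd z)"
    let ?F = "\<lambda>z. f * (fst z ^ 3 - ?p (9 / 2) z) + g * (fst z ^ 2 * snd z - signed_power4 (snd z)) + h * (fst z * snd z ^ 2 - ?p (7 / 2) z)"
    have "Ck_on 3 UNIV ?F" by (intro Ck_on_intros Ck_on_pos_powr_of Ck_on_signed_power4 open_UNIV) simp_all
    moreover have "flat 3 (\<lambda>z. - (f * ?p (9 / 2) z) - g * signed_power4 (snd z) - h * ?p (7 / 2) z)"
      by (intro flat_intros flat_pos_powr_snd) simp_all
    then have "flat 3 (\<lambda>z. ?F z - peval (J3 a b c d e f g h i) z)"
      by (rule flat_cong) (use V in \<open>simp add: peval_J3 algebra_simps\<close>)
    moreover have "?F z = 0" if "z \<in> ?E" for z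
    proof -
      have "\<exists>\<sigma> t. (\<sigma> = 1 \<or> \<sigma> = - 1) \<and> t \<ge> 0 \<and> fst z = t ^ 3 \<and> snd z = \<sigma> * t\<^sup>2"
      proof (cases "(fst z)\<^sup>2 = snd z ^ 3")
        case True
        then obtain t where "t \<ge> 0" "fst z = t ^ 3" "snd z = t\<^sup>2" using cusp_parametrization[of "fst z" "snd z"] \<open>z \<in> ?E\<close> by auto
        then show ?thesis by (intro exI[of _ 1] exI[of _ t]) simp
      next
        case False
        then have "(fst z)\<^sup>2 = (- snd z) ^ 3" "fst z \<ge> 0" using that by (auto simp: power3_eq_cube)
        then obtain t where "t \<ge> 0" "fst z = t ^ 3" "- snd z = t\<^sup>2" by (rule cusp_parametrization)
        then show ?thesis by (intro exI[of _ "- 1"] exI[of _ t]) simp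
      qed
      then obtain \<sigma> t where \<sigma>: "\<sigma> = 1 \<or> \<sigma> = - 1" and t: "t \<ge> 0" "fst z = t ^ 3" "snd z = \<sigma> * t\<^sup>2" by blast
      have n: "pos_powr r (- (t\<^sup>2)) = 0" for r by (simp add: pos_powr_eq_0_iff)
      have p: "?p (7 / 2) z = t ^ 7" "?p (9 / 2) z = t ^ 9"
        using \<sigma> t n pos_powr_square[OF t(1), of 7] pos_powr_square[OF t(1), of 9] by auto
      have "signed_power4 (snd z) = \<sigma> * t ^ 8"
        using \<sigma> t(3) by (auto simp: signed_power4_eq power_mult[symmetric] power_add[symmetric] abs_mult)
      moreover have "fst z ^ 2 * snd z = \<sigma> * t ^ 8" "fst z ^ 3 = t ^ 9" "fst z * snd z ^ 2 = t ^ 7"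
        using \<sigma> t by (auto simp: power_mult[symmetric] power_add[symmetric])
      ultimately show ?thesis using p by simp
    qed
    ultimately show "\<exists>F. Ck_on 3 UNIV F \<and> (\<forall>z\<in>?E. F z = 0) \<and> flat 3 (\<lambda>z. F z - peval (J3 a b c d e f g h i) z)"
      by blast
  next
    fix F and a b c d e f g h i :: real
    assume F: "\<And>z. z \<in> ?E \<Longrightarrow> F z = 0" and fl: "flat 3 (\<lambda>z. F z - peval (J3 a b c d e f g h i) z)"
    have m: "F (t ^ 3, 1 * t\<^sup>2) = 0" "F (t ^ 3, - 1 * t\<^sup>2) = 0" if "t > 0" for t
      by (rule F, use that in \<open>simp add: power_mult[symmetric]\<close>)+
    show "a = 0 \<and> b = 0 \<and> c = 0 \<and> d = 0 \<and> e = 0 \<and> i = 0"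
      using cusp_branch_coeffs[OF fl, of 1] cusp_branch_coeffs[OF fl, of "- 1"] m by simp
  qed simp
  ultimately show ?thesis by (intro exI[of _ ?E]) simp
qed

lemma realize_all:
  "\<exists>E. semialgebraic E \<and> (0, 0) \<in> E \<and> jset (\<lambda>a b c d e f g h i. True) = vanishing_ideal 3 E"
proof -
  let ?E = "{z::real\<times>real. fst z ^ 2 + snd z ^ 2 = 0}"
  have "semialgebraic ?E" by (intro semialgebraic_zero polyfun_intros)
  moreover have "jset (\<lambda>a b c d e f g h i. True) = vanishing_ideal 3 ?E"
  proof (rule jset_eq_vanishing_ideal)
    fix a b c d e f g h i :: real
    show "\<exists>F. Ck_on 3 UNIV F \<and> (\<forall>z\<in>?E. F z = 0) \<and> flat 3 (\<lambda>z. F z - peval (J3 a b c d e f g h i) z)"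
      by (intro exI[of _ "peval (J3 a b c d e f g h i)"]) (auto simp: Ck_on_peval peval_J3 sum_power2_eq_zero_iff)
  qed simp_all
  ultimately show ?thesis by (intro exI[of _ ?E]) simp
qed

theorem listed_ideal_realized:
  "\<forall>J\<in>set ideal_list. \<exists>E. semialgebraic E \<and> (0, 0) \<in> E \<and> J = vanishing_ideal 3 E"
  unfolding ideal_list_jset list.set ball_simps
  by (intro conjI TrueI realize_zero realize_x realize_x2 realize_x3 realize_xy realize_yx2 realize_xyxy
      realize_cusp realize_x2_xy realize_x2_xy2 realize_x2y_xy2 realize_x3_x2y realize_cusp_xy2
      realize_all realize_x3_x2y_xy2)

section \<open>Pairwise inequivalence\<close>

text \<open>For a jet \<open>s\<close> vanishing at the origin, \<open>s\<^sup>3 \<noteq> 0\<close> says that \<open>s\<close> has a nonzero linear part, and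
  \<open>coord_pair s t\<close> that the linear parts of \<open>s\<close> and \<open>t\<close> are linearly independent; in this form both
  are visibly preserved by automorphisms of the ring of jets.\<close>

definition cube :: "poly2 \<Rightarrow> poly2" where
  "cube s = jmult 3 s (jmult 3 s s)"

definition coord :: "poly2 \<Rightarrow> bool" where
  "coord s \<longleftrightarrow> s \<in> jets0 3 \<and> cube s \<noteq> 0"

definition coord_pair :: "poly2 \<Rightarrow> poly2 \<Rightarrow> bool" where
  "coord_pair s t \<longleftrightarrow> coord t \<and> (\<forall>c. coord (s + const2 c * t))"

definition has_linear :: "poly2 set \<Rightarrow> bool" where
  "has_linear J \<longleftrightarrow> (\<exists>s\<in>J. coord s)"

text \<open>For p vanishing at the origin, a nonzero product with a jet from \<open>jets0 3\<close>
  says that p is not purely cubic.\<close>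

definition has_quadratic :: "poly2 set \<Rightarrow> bool" where
  "has_quadratic J \<longleftrightarrow> (\<exists>p\<in>J. \<exists>s\<in>jets0 3. jmult 3 p s \<noteq> 0)"

definition has_square :: "poly2 set \<Rightarrow> bool" where
  "has_square J \<longleftrightarrow> (\<exists>s. coord s \<and> jmult 3 s s \<in> J)"

definition has_cube :: "poly2 set \<Rightarrow> bool" where
  "has_cube J \<longleftrightarrow> (\<exists>s. coord s \<and> cube s \<in> J)"

definition has_st :: "poly2 set \<Rightarrow> bool" where
  "has_st J \<longleftrightarrow> (\<exists>s t. coord_pair s t \<and> jmult 3 s t \<in> J)"

definition has_sst :: "poly2 set \<Rightarrow> bool" where
  "has_sst J \<longleftrightarrow> (\<exists>s t. coord_pair s t \<and> jmult 3 s (jmult 3 s t) \<in> J)"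

definition has_sst_stt :: "poly2 set \<Rightarrow> bool" where
  "has_sst_stt J \<longleftrightarrow> (\<exists>s t. coord_pair s t \<and> jmult 3 s (jmult 3 s t) \<in> J \<and> jmult 3 s (jmult 3 t t) \<in> J)"

lemma coord_J3: "coord (J3 a b c d e f g h i) \<longleftrightarrow> (a, b) \<noteq> (0, 0)"
  unfolding coord_def cube_def jmult_J3 J3_zero[symmetric] by auto

lemma coord_pair_J3:
  "coord_pair (J3 a b c d e f g h i) (J3 a' b' c' d' e' f' g' h' i') \<longleftrightarrow> a * b' \<noteq> b * a'"
  unfolding coord_pair_def J3_cmult J3_add coord_J3
proof
  assume *: "(a', b') \<noteq> (0, 0) \<and> (\<forall>k. (a + k * a', b + k * b') \<noteq> (0, 0))"
  show "a * b' \<noteq> b * a'"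
  proof
    assume eq: "a * b' = b * a'"
    show False
    proof (cases "a' = 0")
      case True
      then have "b' \<noteq> 0" "a = 0" using * eq by auto
      then have "a + (- b / b') * a' = 0" "b + (- b / b') * b' = 0" using True by simp_all
      then show False using * by blast
    next
      case False
      then have "a + (- a / a') * a' = 0" "b + (- a / a') * b' = 0" using eq by (simp_all add: field_simps)
      then show False using * by blast
    qed
  qed
next
  assume ne: "a * b' \<noteq> b * a'"
  have "(a + k * a', b + k * b') \<noteq> (0, 0)" for k
  proof
    assume "(a + k * a', b + k * b') = (0, 0)"
    then have "a = - k * a'" "b = - k * b'" by (simp_all add: algebra_simps add_eq_0_iff)
    then show False using ne by simp
  qed
  moreover have "(a', b') \<noteq> (0, 0)" using ne by auto
  ultimately show "(a', b') \<noteq> (0, 0) \<and> (\<forall>k. (a + k * a', b + k * b') \<noteq> (0, 0))" by blast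
qed

lemma coord_jets0: "coord s \<Longrightarrow> s \<in> jets0 3"
  by (simp add: coord_def)

lemma coord_pair_jets0: "coord_pair s t \<Longrightarrow> s \<in> jets0 3 \<and> t \<in> jets0 3"
proof
  assume *: "coord_pair s t"
  then have "coord (s + const2 0 * t)" unfolding coord_pair_def by blast
  then show "s \<in> jets0 3" using coord_jets0[of s] by simp
  show "t \<in> jets0 3" using * coord_jets0[of t] unfolding coord_pair_def by simp
qed

lemma coordE:
  assumes "coord s"
  obtains a b c d e f g h i where "s = J3 a b c d e f g h i" "(a, b) \<noteq> (0, 0)"
proof -
  obtain a b c d e f g h i where s: "s = J3 a b c d e f g h i" using coord_jets0[OF assms] jets0_3_eq by blast
  then show ?thesis using that assms coord_J3 by metis
qed

lemma coord_pairE: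
  assumes "coord_pair s t"
  obtains a b c d e f g h i a' b' c' d' e' f' g' h' i' where "s = J3 a b c d e f g h i"
    "t = J3 a' b' c' d' e' f' g' h' i'" "a * b' \<noteq> b * a'"
proof -
  obtain a b c d e f g h i where s: "s = J3 a b c d e f g h i" using coord_pair_jets0[OF assms] jets0_3_eq by blast
  obtain a' b' c' d' e' f' g' h' i' where t: "t = J3 a' b' c' d' e' f' g' h' i'"
    using coord_pair_jets0[OF assms] jets0_3_eq by blast
  have "a * b' \<noteq> b * a'" using assms unfolding s t coord_pair_J3 .
  then show ?thesis by (rule that[OF s t])
qed

section \<open>Invariance of these properties under pullback\<close>

context
  fixes \<phi> I J
  assumes \<phi>: "diffeo0 3 \<phi>" and I: "I \<subseteq> jets0 3" and J: "J = pull 3 \<phi> ` I"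
begin

interpretation origin_map 3 \<phi>
  using diffeo0_origin_map[OF \<phi>] by simp

lemma pull_inj: "p \<in> jets 3 \<Longrightarrow> q \<in> jets 3 \<Longrightarrow> pull 3 \<phi> p = pull 3 \<phi> q \<Longrightarrow> p = q"
  using pull_inv_pull(1)[OF \<phi>] by (metis one_le_numeral)

lemma pull_zero: "pull 3 \<phi> 0 = 0"
  using pull_add[of 0 0] by simp

lemma pull_eq_0_iff: "p \<in> jets 3 \<Longrightarrow> pull 3 \<phi> p = 0 \<longleftrightarrow> p = 0"
  using pull_inj[of p 0] pull_zero by auto

lemma coord_pull: "coord s \<Longrightarrow> coord (pull 3 \<phi> s)"
  unfolding coord_def cube_def
  using pull_jets0 pull_eq_0_iff[OF jmult_in_jets, of s "jmult 3 s s"] by (simp add: pull_jmult)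

lemma coord_pair_pull: "coord_pair s t \<Longrightarrow> coord_pair (pull 3 \<phi> s) (pull 3 \<phi> t)"
  unfolding coord_pair_def using coord_pull by (metis pull_add pull_cmult)

text \<open>One implication for each property is enough: the converse is the same statement for the
  inverse diffeomorphism.\<close>

lemma features_pull:
  shows "has_linear I \<Longrightarrow> has_linear J" "has_quadratic I \<Longrightarrow> has_quadratic J" "has_square I \<Longrightarrow> has_square J"
    "has_cube I \<Longrightarrow> has_cube J" "has_st I \<Longrightarrow> has_st J" "has_sst I \<Longrightarrow> has_sst J" "has_sst_stt I \<Longrightarrow> has_sst_stt J"
proof -
  show "has_linear I \<Longrightarrow> has_linear J" unfolding has_linear_def J using coord_pull by blast
  show "has_quadratic J" if "has_quadratic I"
  proof -
    obtain p s where "p \<in> I" "s \<in> jets0 3" "jmult 3 p s \<noteq> 0" using \<open>has_quadratic I\<close> unfolding has_quadratic_def by blast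
    then have "pull 3 \<phi> p \<in> J" "pull 3 \<phi> s \<in> jets0 3" "jmult 3 (pull 3 \<phi> p) (pull 3 \<phi> s) \<noteq> 0"
      using J pull_jets0 pull_eq_0_iff[OF jmult_in_jets, of p s] by (auto simp: pull_jmult)
    then show ?thesis unfolding has_quadratic_def by blast
  qed
  show "has_square I \<Longrightarrow> has_square J" unfolding has_square_def J using coord_pull pull_jmult by (metis imageI)
  show "has_cube I \<Longrightarrow> has_cube J" unfolding has_cube_def cube_def J using coord_pull pull_jmult by (metis imageI)
  show "has_st I \<Longrightarrow> has_st J" unfolding has_st_def J using coord_pair_pull pull_jmult by (metis imageI)
  show "has_sst I \<Longrightarrow> has_sst J" unfolding has_sst_def J using coord_pair_pull pull_jmult by (metis imageI)
  show "has_sst_stt I \<Longrightarrow> has_sst_stt J" unfolding has_sst_stt_def J using coord_pair_pull pull_jmult by (metis imageI)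
qed

lemma zero_pull: "I = {0} \<Longrightarrow> J = {0}"
  unfolding J using pull_zero by simp

lemma all_pull: "I = jets0 3 \<Longrightarrow> J = jets0 3"
proof
  assume "I = jets0 3"
  then show "J \<subseteq> jets0 3" unfolding J using pull_jets0 by blast
  show "jets0 3 \<subseteq> J"
  proof
    fix p :: poly2 assume p: "p \<in> jets0 3"
    have "pull 3 (inv_into UNIV \<phi>) p \<in> jets0 3"
      by (rule origin_map.pull_jets0[OF diffeo0_origin_map[OF diffeo0_inv[OF \<phi>]] p]) simp
    moreover have "pull 3 \<phi> (pull 3 (inv_into UNIV \<phi>) p) = p"
      by (rule pull_inv_pull(2)[OF \<phi>]) (use p in \<open>simp_all add: jets0_iff\<close>)
    ultimately show "p \<in> J" unfolding J \<open>I = jets0 3\<close> by (metis imageI)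
  qed
qed

end

text \<open>A decision tree on invariants whose leaves are the positions in
  \<open>ideal_list\<close>, so that different positions mean inequivalent ideals.\<close>

definition signature :: "poly2 set \<Rightarrow> nat" where
  "signature J =
    (if has_quadratic J then
       if has_linear J then if J = jets0 3 then 13 else 1
       else if has_square J then if has_st J then 8 else if has_sst_stt J then 9 else 2
       else if has_st J then 4 else if has_sst_stt J then 12 else 7
     else if J = {0} then 0
     else if has_cube J then if \<not> has_sst J then 3 else if has_sst_stt J then 14 else 11
     else if \<not> has_sst J then 6 else if has_sst_stt J then 10 else 5)"

lemma signature_equivalent:
  assumes "equivalent_ideals 3 I J" "I \<subseteq> jets0 3" "J \<subseteq> jets0 3"
  shows "signature I = signature J"
proof -
  obtain \<phi> where \<phi>: "diffeo0 3 \<phi>" "J = pull 3 \<phi> ` I" using assms(1) unfolding equivalent_ideals_pull by blast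
  have "equivalent_ideals 3 J I"
    by (rule equivalent_ideals_sym[OF assms(1)]) (use assms(2) in \<open>auto simp: jets0_iff\<close>)
  then obtain \<psi> where \<psi>: "diffeo0 3 \<psi>" "I = pull 3 \<psi> ` J" unfolding equivalent_ideals_pull by blast
  note f = features_pull[OF \<phi>(1) assms(2) \<phi>(2)] zero_pull[OF \<phi>(1) assms(2) \<phi>(2)] all_pull[OF \<phi>(1) assms(2) \<phi>(2)]
  note g = features_pull[OF \<psi>(1) assms(3) \<psi>(2)] zero_pull[OF \<psi>(1) assms(3) \<psi>(2)] all_pull[OF \<psi>(1) assms(3) \<psi>(2)]
  have "has_linear I = has_linear J" "has_quadratic I = has_quadratic J" "has_square I = has_square J"
    "has_cube I = has_cube J" "has_st I = has_st J" "has_sst I = has_sst J" "has_sst_stt I = has_sst_stt J"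
    "(I = {0}) = (J = {0})" "(I = jets0 3) = (J = jets0 3)"
    by (rule iffI, erule f, erule g)+
  then show ?thesis unfolding signature_def by simp
qed

section \<open>The invariants read off from coefficients\<close>

lemma has_quadratic_jset:
  "has_quadratic (jset V) \<longleftrightarrow> (\<exists>a b c d e f g h i. V a b c d e f g h i \<and> \<not> (a = 0 \<and> b = 0 \<and> c = 0 \<and> d = 0 \<and> e = 0))"
proof
  assume "has_quadratic (jset V)"
  then obtain p s where p: "p \<in> jset V" and s: "s \<in> jets0 3" and ne: "jmult 3 p s \<noteq> 0" unfolding has_quadratic_def by blast
  obtain a b c d e f g h i where p': "p = J3 a b c d e f g h i" "V a b c d e f g h i" using p unfolding jset_def by blast
  obtain a' b' c' d' e' f' g' h' i' where s': "s = J3 a' b' c' d' e' f' g' h' i'" using s jets0_3_eq by blast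
  have "\<not> (a = 0 \<and> b = 0 \<and> c = 0 \<and> d = 0 \<and> e = 0)"
    using ne unfolding p' s' jmult_J3 J3_zero[symmetric] J3_eq_iff by auto
  then show "\<exists>a b c d e f g h i. V a b c d e f g h i \<and> \<not> (a = 0 \<and> b = 0 \<and> c = 0 \<and> d = 0 \<and> e = 0)" using p'(2) by blast
next
  assume "\<exists>a b c d e f g h i. V a b c d e f g h i \<and> \<not> (a = 0 \<and> b = 0 \<and> c = 0 \<and> d = 0 \<and> e = 0)"
  then obtain a b c d e f g h i where V: "V a b c d e f g h i" and ne: "\<not> (a = 0 \<and> b = 0 \<and> c = 0 \<and> d = 0 \<and> e = 0)" by blast
  let ?p = "J3 a b c d e f g h i"
  have "jmult 3 ?p (J3 1 0 0 0 0 0 0 0 0) \<noteq> 0 \<or> jmult 3 ?p (J3 0 1 0 0 0 0 0 0 0) \<noteq> 0"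
    using ne unfolding jmult_J3 J3_zero[symmetric] J3_eq_iff by auto
  then show "has_quadratic (jset V)" unfolding has_quadratic_def using V J3_in_jset[of a b c d e f g h i V] J3_in_jets0 by blast
qed

lemma has_linear_jset:
  "has_linear (jset V) \<longleftrightarrow> (\<exists>a b c d e f g h i. V a b c d e f g h i \<and> (a, b) \<noteq> (0, 0))"
  unfolding has_linear_def jset_def by (auto simp: coord_J3 Bex_def simp del: J3_eq_iff) (metis coord_J3 Pair_inject)+

text \<open>The cubic coefficients of s^2 involve the quadratic part of s and have to be kept: the
  y^3-coefficient 2be is what tells the cusp from x^2.\<close>

lemma has_squareD:
  assumes "has_square (jset V)"
  shows "\<exists>a b c d e f g h. (a, b) \<noteq> (0, 0) \<and> V 0 0 (a * a) (2 * a * b) (b * b) (2 * a * c) (2 * (a * d + b * c)) (2 * (a * e + b * d)) (2 * b * e)"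
proof -
  obtain s where s: "coord s" "jmult 3 s s \<in> jset V" using assms unfolding has_square_def by blast
  from s(1) show ?thesis
  proof (rule coordE)
    fix a b c d e f g h i assume J: "s = J3 a b c d e f g h i" "(a, b) \<noteq> (0, 0)"
    have "V 0 0 (a * a) (a * b + b * a) (b * b) (a * c + c * a) (a * d + d * a + b * c + c * b) (a * e + e * a + b * d + d * b) (b * e + e * b)"
      using s(2) unfolding J(1) jmult_J3 J3_in_jset .
    moreover have "a * b + b * a = 2 * a * b" "a * c + c * a = 2 * a * c" "a * d + d * a + b * c + c * b = 2 * (a * d + b * c)"
      "a * e + e * a + b * d + d * b = 2 * (a * e + b * d)" "b * e + e * b = 2 * b * e" by simp_all
    ultimately have "V 0 0 (a * a) (2 * a * b) (b * b) (2 * a * c) (2 * (a * d + b * c)) (2 * (a * e + b * d)) (2 * b * e)" by metis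
    then show ?thesis using J(2) by blast
  qed
qed

lemma has_squareI: "V 0 0 1 0 0 0 0 0 0 \<Longrightarrow> has_square (jset V)"
  unfolding has_square_def
  by (intro exI[of _ "J3 1 0 0 0 0 0 0 0 0"]) (simp add: coord_J3 jmult_J3)

lemma has_cubeD:
  assumes "has_cube (jset V)"
  shows "\<exists>a b. (a, b) \<noteq> (0, 0) \<and> V 0 0 0 0 0 (a ^ 3) (3 * a\<^sup>2 * b) (3 * a * b\<^sup>2) (b ^ 3)"
proof -
  obtain s where s: "coord s" "cube s \<in> jset V" using assms unfolding has_cube_def by blast
  from s(1) show ?thesis
  proof (rule coordE)
    fix a b c d e f g h i assume J: "s = J3 a b c d e f g h i" "(a, b) \<noteq> (0, 0)"
    have "cube s = J3 0 0 0 0 0 (a ^ 3) (3 * a\<^sup>2 * b) (3 * a * b\<^sup>2) (b ^ 3)"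
      unfolding J(1) cube_def jmult_J3 J3_eq_iff by (simp add: power2_eq_square power3_eq_cube)
    then show ?thesis using s(2) J(2) by auto
  qed
qed

lemma has_cubeI: "V 0 0 0 0 0 1 0 0 0 \<Longrightarrow> has_cube (jset V)"
  unfolding has_cube_def cube_def
  by (intro exI[of _ "J3 1 0 0 0 0 0 0 0 0"]) (simp add: coord_J3 jmult_J3)

lemma has_stD:
  assumes "has_st (jset V)"
  shows "\<exists>a b a' b' f g h i. a * b' \<noteq> b * a' \<and> V 0 0 (a * a') (a * b' + b * a') (b * b') f g h i"
proof -
  obtain s t where s: "coord_pair s t" "jmult 3 s t \<in> jset V" using assms unfolding has_st_def by blast
  from s(1) show ?thesis
  proof (rule coord_pairE)
    fix a b c d e f g h i a' b' c' d' e' f' g' h' i'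
    assume J: "s = J3 a b c d e f g h i" "t = J3 a' b' c' d' e' f' g' h' i'" and ne: "a * b' \<noteq> b * a'"
    show ?thesis using s(2) ne unfolding J jmult_J3 J3_in_jset by blast
  qed
qed

lemma has_stI: "V 0 0 0 1 0 0 0 0 0 \<Longrightarrow> has_st (jset V)"
  unfolding has_st_def
  by (intro exI[of _ "J3 1 0 0 0 0 0 0 0 0"] exI[of _ "J3 0 1 0 0 0 0 0 0 0"]) (simp add: coord_pair_J3 jmult_J3)

lemma sst_J3:
  "jmult 3 (J3 a b c d e f g h i) (jmult 3 (J3 a b c d e f g h i) (J3 a' b' c' d' e' f' g' h' i')) =
    J3 0 0 0 0 0 (a\<^sup>2 * a') (a\<^sup>2 * b' + 2 * a * b * a') (2 * a * b * b' + b\<^sup>2 * a') (b\<^sup>2 * b')"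
  "jmult 3 (J3 a b c d e f g h i) (jmult 3 (J3 a' b' c' d' e' f' g' h' i') (J3 a' b' c' d' e' f' g' h' i')) =
    J3 0 0 0 0 0 (a * a'\<^sup>2) (2 * a * a' * b' + b * a'\<^sup>2) (a * b'\<^sup>2 + 2 * b * a' * b') (b * b'\<^sup>2)"
  unfolding jmult_J3 J3_eq_iff by (simp_all add: power2_eq_square algebra_simps)

lemma has_sstD:
  assumes "has_sst (jset V)"
  shows "\<exists>a b a' b'. a * b' \<noteq> b * a' \<and>
    V 0 0 0 0 0 (a\<^sup>2 * a') (a\<^sup>2 * b' + 2 * a * b * a') (2 * a * b * b' + b\<^sup>2 * a') (b\<^sup>2 * b')"
proof -
  obtain s t where s: "coord_pair s t" "jmult 3 s (jmult 3 s t) \<in> jset V" using assms unfolding has_sst_def by blast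
  from s(1) show ?thesis
  proof (rule coord_pairE)
    fix a b c d e f g h i a' b' c' d' e' f' g' h' i'
    assume J: "s = J3 a b c d e f g h i" "t = J3 a' b' c' d' e' f' g' h' i'" and ne: "a * b' \<noteq> b * a'"
    show ?thesis using s(2) ne unfolding J sst_J3 J3_in_jset by blast
  qed
qed

lemma has_sstI: "V 0 0 0 0 0 0 1 0 0 \<Longrightarrow> has_sst (jset V)"
  unfolding has_sst_def
  by (intro exI[of _ "J3 1 0 0 0 0 0 0 0 0"] exI[of _ "J3 0 1 0 0 0 0 0 0 0"]) (simp add: coord_pair_J3 sst_J3)

lemma has_sst_sttD:
  assumes "has_sst_stt (jset V)"
  shows "\<exists>a b a' b'. a * b' \<noteq> b * a' \<and>
    V 0 0 0 0 0 (a\<^sup>2 * a') (a\<^sup>2 * b' + 2 * a * b * a') (2 * a * b * b' + b\<^sup>2 * a') (b\<^sup>2 * b') \<and>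
    V 0 0 0 0 0 (a * a'\<^sup>2) (2 * a * a' * b' + b * a'\<^sup>2) (a * b'\<^sup>2 + 2 * b * a' * b') (b * b'\<^sup>2)"
proof -
  obtain s t where s: "coord_pair s t" "jmult 3 s (jmult 3 s t) \<in> jset V" "jmult 3 s (jmult 3 t t) \<in> jset V"
    using assms unfolding has_sst_stt_def by blast
  from s(1) show ?thesis
  proof (rule coord_pairE)
    fix a b c d e f g h i a' b' c' d' e' f' g' h' i'
    assume J: "s = J3 a b c d e f g h i" "t = J3 a' b' c' d' e' f' g' h' i'" and ne: "a * b' \<noteq> b * a'"
    show ?thesis using s(2,3) ne unfolding J sst_J3 J3_in_jset by blast
  qed
qed

lemma has_sst_sttI: "V 0 0 0 0 0 0 1 0 0 \<Longrightarrow> V 0 0 0 0 0 0 0 1 0 \<Longrightarrow> has_sst_stt (jset V)"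
  unfolding has_sst_stt_def
  by (intro exI[of _ "J3 1 0 0 0 0 0 0 0 0"] exI[of _ "J3 0 1 0 0 0 0 0 0 0"]) (simp add: coord_pair_J3 sst_J3)

text \<open>Under the hypothesis x^2 divides all cubic forms in question. For independent s and t
  the greatest common divisor of s^2 t and s t^2 is s t, which has no repeated factor.\<close>

lemma no_sst_stt_without_xy2:
  assumes "\<And>f g h i. V 0 0 0 0 0 f g h i \<Longrightarrow> h = 0 \<and> i = 0"
  shows "\<not> has_sst_stt (jset V)"
proof
  assume "has_sst_stt (jset V)"
  then obtain a b a' b' :: real where ne: "a * b' \<noteq> b * a'"
    and 1: "2 * a * b * b' + b\<^sup>2 * a' = 0" "b\<^sup>2 * b' = 0"
    and 2: "a * b'\<^sup>2 + 2 * b * a' * b' = 0" "b * b'\<^sup>2 = 0"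
    using has_sst_sttD[of V] assms by blast
  show False
  proof (cases "b = 0")
    case True
    then show False using ne 2(1) by auto
  next
    case False
    then have "b' = 0" using 1(2) by simp
    then show False using ne 1(1) False by auto
  qed
qed

lemma signature_ideal_list:
  assumes "i < length ideal_list"
  shows "signature (ideal_list ! i) = i"
proof -
  have ne0: "jset V \<noteq> {0}" if "V a b c d e f g h i" "\<not> (a = 0 \<and> b = 0 \<and> c = 0 \<and> d = 0 \<and> e = 0 \<and> f = 0 \<and> g = 0 \<and> h = 0 \<and> i = 0)"
    for V a b c d e f g h i
  proof
    assume "jset V = {0}"
    then have "J3 a b c d e f g h i = J3 0 0 0 0 0 0 0 0 0" using that(1) J3_in_jset[of a b c d e f g h i V] by (simp add: J3_zero)
    then show False using that(2) by simp
  qed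
  have neall: "jset V \<noteq> jets0 3" if "\<not> V a b c d e f g h i" for V a b c d e f g h i
    using that J3_in_jset[of a b c d e f g h i V] J3_in_jets0[of a b c d e f g h i] by metis
  have "i < 15" using assms by (simp add: ideal_list_def)
  then consider "i = 0" | "i = 1" | "i = 2" | "i = 3" | "i = 4" | "i = 5" | "i = 6" | "i = 7" | "i = 8" | "i = 9"
    | "i = 10" | "i = 11" | "i = 12" | "i = 13" | "i = 14" by (fastforce simp: numeral_eq_Suc less_Suc_eq)
  then show ?thesis
  proof cases
    case 1
    have "\<not> has_quadratic {0}" unfolding jset_zero[symmetric] has_quadratic_jset by simp
    then show ?thesis unfolding 1 ideal_list_jset by (simp add: signature_def jset_zero)
  next
    case 2
    let ?V = "\<lambda>a b c d e f g h (i::real). b = (0::real) \<and> e = (0::real) \<and> i = 0"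
    have "has_quadratic (jset ?V)" "has_linear (jset ?V)"
      unfolding has_quadratic_jset has_linear_jset by (rule exI[of _ 1], auto)+
    moreover have "jset ?V \<noteq> jets0 3" by (rule neall[of _ 0 1 0 0 0 0 0 0 0]) simp
    ultimately show ?thesis unfolding 2 ideal_list_jset by (simp add: signature_def)
  next
    case 3
    let ?V = "\<lambda>a b c d e f g h i::real. a = (0::real) \<and> b = (0::real) \<and> d = (0::real) \<and> e = (0::real) \<and> h = (0::real) \<and> i = 0"
    have "has_quadratic (jset ?V)" unfolding has_quadratic_jset by (intro exI[of _ "0::real"] exI[of _ "1::real"]) (auto intro: exI[of _ "1::real"])
    moreover have "\<not> has_linear (jset ?V)" unfolding has_linear_jset by auto
    moreover have "has_square (jset ?V)" by (rule has_squareI) simp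
    moreover have "\<not> has_st (jset ?V)" using has_stD[of ?V] by auto
    moreover have "\<not> has_sst_stt (jset ?V)" by (rule no_sst_stt_without_xy2) simp
    ultimately show ?thesis unfolding 3 ideal_list_jset by (simp add: signature_def)
  next
    case 4
    let ?V = "\<lambda>a b c d e f g h i. a = (0::real) \<and> b = (0::real) \<and> c = (0::real) \<and> d = (0::real) \<and> e = (0::real) \<and> g = (0::real) \<and> h = (0::real) \<and> i = (0::real)"
    have "\<not> has_quadratic (jset ?V)" unfolding has_quadratic_jset by auto
    moreover have "jset ?V \<noteq> {0}" by (rule ne0[of _ 0 0 0 0 0 1 0 0 0]) simp_all
    moreover have "has_cube (jset ?V)" by (rule has_cubeI) simp
    \<comment> \<open>By unique factorization s^2 t with independent s and t is no multiple of a
      cube.\<close>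
    moreover have "\<not> has_sst (jset ?V)"
    proof
      assume "has_sst (jset ?V)"
      from has_sstD[OF this] obtain a b a' b' :: real where "a * b' \<noteq> b * a'" "a\<^sup>2 * b' + 2 * a * b * a' = 0"
        "2 * a * b * b' + b\<^sup>2 * a' = 0" "b\<^sup>2 * b' = 0" by auto
      then show False by (cases "b = 0") auto
    qed
    ultimately show ?thesis unfolding 4 ideal_list_jset by (simp add: signature_def)
  next
    case 5
    let ?V = "\<lambda>a b c d e f g h i. a = (0::real) \<and> b = (0::real) \<and> c = (0::real) \<and> e = (0::real) \<and> f = (0::real) \<and> i = (0::real)"
    have "has_quadratic (jset ?V)" unfolding has_quadratic_jset by (rule exI[of _ 0], rule exI[of _ 0], rule exI[of _ 0], rule exI[of _ 1]) auto
    moreover have "\<not> has_linear (jset ?V)" unfolding has_linear_jset by auto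
    moreover have "\<not> has_square (jset ?V)" using has_squareD[of ?V] by auto
    moreover have "has_st (jset ?V)" by (rule has_stI) simp
    ultimately show ?thesis unfolding 5 ideal_list_jset by (simp add: signature_def)
  next
    case 6
    let ?V = "\<lambda>a b c d e f g h i. a = (0::real) \<and> b = (0::real) \<and> c = (0::real) \<and> d = (0::real) \<and> e = (0::real) \<and> f = (0::real) \<and> h = (0::real) \<and> i = (0::real)"
    have "\<not> has_quadratic (jset ?V)" unfolding has_quadratic_jset by auto
    moreover have "jset ?V \<noteq> {0}" by (rule ne0[of _ 0 0 0 0 0 0 1 0 0]) simp_all
    moreover have "\<not> has_cube (jset ?V)" using has_cubeD[of ?V] by auto
    moreover have "has_sst (jset ?V)" by (rule has_sstI) simp
    moreover have "\<not> has_sst_stt (jset ?V)" by (rule no_sst_stt_without_xy2) simp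
    ultimately show ?thesis unfolding 6 ideal_list_jset by (simp add: signature_def)
  next
    case 7
    let ?V = "\<lambda>a b c d e f g h i. a = (0::real) \<and> b = (0::real) \<and> c = (0::real) \<and> d = (0::real) \<and> e = (0::real) \<and> f = (0::real) \<and> g = (h::real) \<and> i = (0::real)"
    have "\<not> has_quadratic (jset ?V)" unfolding has_quadratic_jset by auto
    moreover have "jset ?V \<noteq> {0}" by (rule ne0[of _ 0 0 0 0 0 0 1 1 0]) simp_all
    moreover have "\<not> has_cube (jset ?V)" using has_cubeD[of ?V] by auto
    \<comment> \<open>s^2 t has a repeated factor, and xy (x + y) has none.\<close>
    moreover have "\<not> has_sst (jset ?V)"
    proof
      assume "has_sst (jset ?V)"
      from has_sstD[OF this] obtain a b a' b' :: real where ne: "a * b' \<noteq> b * a'" and "a\<^sup>2 * a' = 0" "b\<^sup>2 * b' = 0"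
        and e: "a\<^sup>2 * b' + 2 * a * b * a' = 2 * a * b * b' + b\<^sup>2 * a'" by auto
      then have "a = 0 \<or> a' = 0" "b = 0 \<or> b' = 0" by simp_all
      then show False using ne e by auto
    qed
    ultimately show ?thesis unfolding 7 ideal_list_jset by (simp add: signature_def)
  next
    case 8
    let ?V = "\<lambda>a b c d e f g h i. a = (0::real) \<and> b = (0::real) \<and> d = (0::real) \<and> e = (0::real) \<and> h = (0::real) \<and> i = - (c::real)"
    have "has_quadratic (jset ?V)" unfolding has_quadratic_jset by (rule exI[of _ 0], rule exI[of _ 0], rule exI[of _ 1]) auto
    moreover have "\<not> has_linear (jset ?V)" unfolding has_linear_jset by auto
    \<comment> \<open>A square without y^2-term has b = 0, so its y^3-coefficient 2be is 0, while
      membership demands -a^2.\<close>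
    moreover have "\<not> has_square (jset ?V)" using has_squareD[of ?V] by auto
    moreover have "\<not> has_st (jset ?V)" using has_stD[of ?V] by auto
    moreover have "\<not> has_sst_stt (jset ?V)" by (rule no_sst_stt_without_xy2) simp
    ultimately show ?thesis unfolding 8 ideal_list_jset by (simp add: signature_def)
  next
    case 9
    let ?V = "\<lambda>a b c d e f g h i. a = (0::real) \<and> b = (0::real) \<and> e = (0::real) \<and> i = (0::real)"
    have "has_quadratic (jset ?V)" unfolding has_quadratic_jset by (rule exI[of _ 0], rule exI[of _ 0], rule exI[of _ 1]) auto
    moreover have "\<not> has_linear (jset ?V)" unfolding has_linear_jset by auto
    moreover have "has_square (jset ?V)" by (rule has_squareI) simp
    moreover have "has_st (jset ?V)" by (rule has_stI) simp
    ultimately show ?thesis unfolding 9 ideal_list_jset by (simp add: signature_def)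
  next
    case 10
    let ?V = "\<lambda>a b c d e f g h i. a = (0::real) \<and> b = (0::real) \<and> d = (0::real) \<and> e = (0::real) \<and> i = (0::real)"
    have "has_quadratic (jset ?V)" unfolding has_quadratic_jset by (rule exI[of _ 0], rule exI[of _ 0], rule exI[of _ 1]) auto
    moreover have "\<not> has_linear (jset ?V)" unfolding has_linear_jset by auto
    moreover have "has_square (jset ?V)" by (rule has_squareI) simp
    moreover have "\<not> has_st (jset ?V)" using has_stD[of ?V] by auto
    moreover have "has_sst_stt (jset ?V)" by (rule has_sst_sttI) simp_all
    ultimately show ?thesis unfolding 10 ideal_list_jset by (simp add: signature_def)
  next
    case 11
    let ?V = "\<lambda>a b c d e f g h i. a = (0::real) \<and> b = (0::real) \<and> c = (0::real) \<and> d = (0::real) \<and> e = (0::real) \<and> f = (0::real) \<and> i = (0::real)"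
    have "\<not> has_quadratic (jset ?V)" unfolding has_quadratic_jset by auto
    moreover have "jset ?V \<noteq> {0}" by (rule ne0[of _ 0 0 0 0 0 0 1 0 0]) simp_all
    moreover have "\<not> has_cube (jset ?V)" using has_cubeD[of ?V] by auto
    moreover have "has_sst (jset ?V)" by (rule has_sstI) simp
    moreover have "has_sst_stt (jset ?V)" by (rule has_sst_sttI) simp_all
    ultimately show ?thesis unfolding 11 ideal_list_jset by (simp add: signature_def)
  next
    case 12
    let ?V = "\<lambda>a b c d e f g h i. a = (0::real) \<and> b = (0::real) \<and> c = (0::real) \<and> d = (0::real) \<and> e = (0::real) \<and> h = (0::real) \<and> i = (0::real)"
    have "\<not> has_quadratic (jset ?V)" unfolding has_quadratic_jset by auto
    moreover have "jset ?V \<noteq> {0}" by (rule ne0[of _ 0 0 0 0 0 0 1 0 0]) simp_all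
    moreover have "has_cube (jset ?V)" by (rule has_cubeI) simp
    moreover have "has_sst (jset ?V)" by (rule has_sstI) simp
    moreover have "\<not> has_sst_stt (jset ?V)" by (rule no_sst_stt_without_xy2) simp
    ultimately show ?thesis unfolding 12 ideal_list_jset by (simp add: signature_def)
  next
    case 13
    let ?V = "\<lambda>a b c d e f g h i. a = (0::real) \<and> b = (0::real) \<and> d = (0::real) \<and> e = (0::real) \<and> i = - (c::real)"
    have "has_quadratic (jset ?V)" unfolding has_quadratic_jset by (rule exI[of _ 0], rule exI[of _ 0], rule exI[of _ 1]) auto
    moreover have "\<not> has_linear (jset ?V)" unfolding has_linear_jset by auto
    moreover have "\<not> has_square (jset ?V)" using has_squareD[of ?V] by auto
    moreover have "\<not> has_st (jset ?V)" using has_stD[of ?V] by auto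
    moreover have "has_sst_stt (jset ?V)" by (rule has_sst_sttI) simp_all
    ultimately show ?thesis unfolding 13 ideal_list_jset by (simp add: signature_def)
  next
    case 14
    have "has_quadratic (jset (\<lambda>a b c d e f g h i. True))" "has_linear (jset (\<lambda>a b c d e f g h i. True))"
      unfolding has_quadratic_jset has_linear_jset by (rule exI[of _ 1], auto)+
    then show ?thesis unfolding 14 ideal_list_jset by (simp add: signature_def jset_all)
  next
    case 15
    let ?V = "\<lambda>a b c d e f g h i. a = (0::real) \<and> b = (0::real) \<and> c = (0::real) \<and> d = (0::real) \<and> e = (0::real) \<and> i = (0::real)"
    have "\<not> has_quadratic (jset ?V)" unfolding has_quadratic_jset by auto
    moreover have "jset ?V \<noteq> {0}" by (rule ne0[of _ 0 0 0 0 0 0 1 0 0]) simp_all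
    moreover have "has_cube (jset ?V)" by (rule has_cubeI) simp
    moreover have "has_sst (jset ?V)" by (rule has_sstI) simp
    moreover have "has_sst_stt (jset ?V)" by (rule has_sst_sttI) simp_all
    ultimately show ?thesis unfolding 15 ideal_list_jset by (simp add: signature_def)
  qed
qed

lemma ideal_list_subset: "J \<in> set ideal_list \<Longrightarrow> J \<subseteq> jets0 3"
  unfolding ideal_list_jset by (auto simp: jset_def)

theorem theorem1p4:
  shows "(\<forall>I. closed_ideal 3 I \<longrightarrow> (\<exists>J \<in> set ideal_list. equivalent_ideals 3 I J)) \<and>
         (\<forall>J \<in> set ideal_list.
            \<exists>E. semialgebraic E \<and> (0, 0) \<in> E \<and> J = vanishing_ideal 3 E) \<and>
         (\<forall>i < length ideal_list. \<forall>j < length ideal_list.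
            i \<noteq> j \<longrightarrow> \<not> equivalent_ideals 3 (ideal_list ! i) (ideal_list ! j))"
proof (intro conjI allI impI)
  show "\<exists>J \<in> set ideal_list. equivalent_ideals 3 I J" if "closed_ideal 3 I" for I
    by (rule closed_ideal_equivalent_to_listed[OF that])
  show "\<forall>J \<in> set ideal_list. \<exists>E. semialgebraic E \<and> (0, 0) \<in> E \<and> J = vanishing_ideal 3 E"
    by (rule listed_ideal_realized)
  fix i j assume ij: "i < length ideal_list" "j < length ideal_list" "i \<noteq> j"
  show "\<not> equivalent_ideals 3 (ideal_list ! i) (ideal_list ! j)"
    using signature_equivalent[OF _ ideal_list_subset ideal_list_subset, OF _ nth_mem nth_mem, OF _ ij(1,2)]
      signature_ideal_list ij by auto
qed

end
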